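(* For any $0<s<1/2$, the Birkhoff map $\Phi:L^2_{r,0}\to h^{1/2}_+$ admits an extension, also denoted by $\Phi$, $$\Phi:H^{-s}_{r,0}\to h^{1/2-s}_+,\qquad u\mapsto\Phi(u):=(\zeta_n(u))_{n\ge1},$$ so that the following holds: (i) $\Phi$ is a homeomorphism. (ii) There exists an increasing function $F_s:\mathbb{R}_{\ge0}\to\mathbb{R}_{\ge0}$ so that $$\|u\|_{-s}\le F_s(\|\Phi(u)\|_{1/2-s}),\qquad\forall u\in H^{-s}_{r,0}.$$ (iii) $\Phi$ and its inverse map bounded subsets to bounded subsets.
   Context: Let $\mathbb{T}=\mathbb{R}/2\pi\mathbb{Z}$, $\widehat f(n)=\frac1{2\pi}\int_0^{2\pi}f(x)e^{-inx}dx$ (extended to distributions), $\langle n\rangle=\max\{1,|n|\}$. For $\sigma\in\mathbb{R}$, $H^\sigma=H^\sigma(\mathbb{T},\mathbb{C})$ has norm $\|v\|_\sigma=(\sum_{n\in\mathbb{Z}}\langle n\rangle^{2\sigma}|\widehat v(n)|^2)^{1/2}$; $H^\sigma_{r,0}$ is the real subspace of real valued $u \in H^\sigma$ with $\widehat u(0)=0$; $L^2_{r,0}=H^0_{r,0}$. $h^\sigma_+$ is the space of complex sequences $(z_n)_{n\ge1}$ with $\|(z_n)\|_\sigma=(\sum_{n\ge1}n^{2\sigma}|z_n|^2)^{1/2}<\infty$. $\langle f|g\rangle=\frac1{2\pi}\int_0^{2\pi}f\overline g\,dx$. $H_+=\{f\in L^2(\mathbb{T},\mathbb{C}):\widehat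 f(n)=0\ \forall n<0\}$ is the Hardy space, $H^1_+=H^1\cap H_+$, and $\Pi:L^2\to H_+$ is the orthogonal projector. The Birkhoff map $\Phi:L^2_{r,0}\to h^{1/2}_+$ is defined as follows. For $u\in L^2_{r,0}$, $L_u:=-i\partial_x-T_u$, $T_uf:=\Pi(uf)$, is a self-adjoint operator on $H_+$ with domain $H^1_+$, with discrete spectrum consisting of eigenvalues $\lambda_0<\lambda_1<\lambda_2<\cdots$ (all simple) satisfying $\gamma_n:=\lambda_n-\lambda_{n-1}-1\ge0$ for $n\ge1$. Let $(f_n)_{n\ge0}$ be the orthonormal basis of $H_+$ of eigenfunctions, $L_uf_n=\lambda_nf_n$, normalized by $\|f_n\|_0=1$, $\langle1|f_0\rangle>0$ and $\langle f_n|e^{ix}f_{n-1}\rangle>0$ for $n\ge1$. Then $$\zeta_n(u):=\frac1{\sqrt{\kappa_n}}\langle1|f_n\rangle,\qquad\kappa_n:=\frac1{\lambda_n-\lambda_0}\prod_{p\ge1,\,p\ne n}\Big(1-\frac{\gamma_p}{\lambda_p-\lambda_n}\Big)>0,\qquad n\ge1,$$ and $\Phi(u):=(\zeta_n(u))_{n\ge1}$. It is known (Gérard-Kappeler) that $\Phi:L^2_{r,0}\to h^{1/2}_+$ is a homeomorphism. *)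

theory Defs
  imports "HOL-Analysis.Analysis"
begin

text \<open>
  Functions on the torus $\mathbb{R}/2\pi\mathbb{Z}$ of class $L^2$ are represented by functions on the
  real line of which only the restriction to $[0,2\pi]$ matters, up to null sets.
  Distributions on the torus are genuine continuous linear functionals on smooth
  $2\pi$-periodic functions; they are set to 0 outside the test functions, so that
  equality of distributions is equality of functionals.
\<close>

section \<open>Distributions on the torus and Sobolev spaces\<close>

definition torus :: "real measure" where
  "torus = lebesgue_on {0..2 * pi}"

definition vderiv :: "(real \<Rightarrow> complex) \<Rightarrow> real \<Rightarrow> complex" where
  "vderiv \<phi> = (\<lambda>x. vector_derivative \<phi> (at x))"

definition test_fun :: "(real \<Rightarrow> complex) set" where
  "test_fun = {\<phi>. (\<forall>x. \<phi> (x + 2 * pi) = \<phi> x) \<and>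
                  (\<forall>k x. (vderiv ^^ k) \<phi> differentiable (at x))}"

definition distribution :: "((real \<Rightarrow> complex) \<Rightarrow> complex) set" where
  "distribution = {u.
     (\<forall>\<phi>. \<phi> \<notin> test_fun \<longrightarrow> u \<phi> = 0) \<and>
     (\<forall>\<phi>\<in>test_fun. \<forall>\<psi>\<in>test_fun. u (\<lambda>x. \<phi> x + \<psi> x) = u \<phi> + u \<psi>) \<and>
     (\<forall>c. \<forall>\<phi>\<in>test_fun. u (\<lambda>x. c * \<phi> x) = c * u \<phi>) \<and>
     (\<exists>C N. \<forall>\<phi>\<in>test_fun. cmod (u \<phi>) \<le> C * (\<Sum>k\<le>N. SUP x. cmod ((vderiv ^^ k) \<phi> x)))}"

definition distr_of :: "(real \<Rightarrow> complex) \<Rightarrow> (real \<Rightarrow> complex) \<Rightarrow> complex" where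
  "distr_of f \<phi> = (if \<phi> \<in> test_fun then (LINT x|torus. f x * \<phi> x) else 0)"

definition distr_deriv :: "((real \<Rightarrow> complex) \<Rightarrow> complex) \<Rightarrow> (real \<Rightarrow> complex) \<Rightarrow> complex" where
  "distr_deriv u \<phi> = (if \<phi> \<in> test_fun then - u (vderiv \<phi>) else 0)"

definition fourier :: "((real \<Rightarrow> complex) \<Rightarrow> complex) \<Rightarrow> int \<Rightarrow> complex" where
  "fourier u n = u (\<lambda>x. exp (- \<i> * of_int n * of_real x)) / (2 * of_real pi)"

definition jap :: "int \<Rightarrow> real" where
  "jap n = max 1 \<bar>of_int n\<bar>"

definition sobolev :: "real \<Rightarrow> ((real \<Rightarrow> complex) \<Rightarrow> complex) set" where
  "sobolev \<sigma> = {u \<in> distribution.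
     (\<lambda>n. jap n powr (2 * \<sigma>) * (cmod (fourier u n))\<^sup>2) summable_on UNIV}"

definition sobolev_norm :: "real \<Rightarrow> ((real \<Rightarrow> complex) \<Rightarrow> complex) \<Rightarrow> real" where
  "sobolev_norm \<sigma> u = sqrt (\<Sum>\<^sub>\<infinity>n. jap n powr (2 * \<sigma>) * (cmod (fourier u n))\<^sup>2)"

definition sobolev_dist ::
  "real \<Rightarrow> ((real \<Rightarrow> complex) \<Rightarrow> complex) \<Rightarrow> ((real \<Rightarrow> complex) \<Rightarrow> complex) \<Rightarrow> real" where
  "sobolev_dist \<sigma> u v = sobolev_norm \<sigma> (\<lambda>\<phi>. u \<phi> - v \<phi>)"

definition real_valued :: "((real \<Rightarrow> complex) \<Rightarrow> complex) \<Rightarrow> bool" where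
  "real_valued u \<longleftrightarrow> (\<forall>\<phi>\<in>test_fun. u (\<lambda>x. cnj (\<phi> x)) = cnj (u \<phi>))"

definition sobolev_r0 :: "real \<Rightarrow> ((real \<Rightarrow> complex) \<Rightarrow> complex) set" where
  "sobolev_r0 \<sigma> = {u \<in> sobolev \<sigma>. real_valued u \<and> fourier u 0 = 0}"

section \<open>Weighted sequence spaces\<close>

text \<open>A sequence indexed by $n \ge 1$ is a function on the naturals with value 0 at 0.\<close>

definition hplus :: "real \<Rightarrow> (nat \<Rightarrow> complex) set" where
  "hplus \<sigma> = {z. z 0 = 0 \<and> (\<lambda>n. real n powr (2 * \<sigma>) * (cmod (z n))\<^sup>2) summable_on {1..}}"

definition hplus_norm :: "real \<Rightarrow> (nat \<Rightarrow> complex) \<Rightarrow> real" where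
  "hplus_norm \<sigma> z = sqrt (\<Sum>\<^sub>\<infinity>n\<in>{1..}. real n powr (2 * \<sigma>) * (cmod (z n))\<^sup>2)"

definition hplus_dist :: "real \<Rightarrow> (nat \<Rightarrow> complex) \<Rightarrow> (nat \<Rightarrow> complex) \<Rightarrow> real" where
  "hplus_dist \<sigma> z w = hplus_norm \<sigma> (\<lambda>n. z n - w n)"

section \<open>The Lax operator\<close>

definition L2 :: "(real \<Rightarrow> complex) set" where
  "L2 = {f \<in> borel_measurable torus. integrable torus (\<lambda>x. (cmod (f x))\<^sup>2)}"

definition L2_r0 :: "(real \<Rightarrow> real) set" where
  "L2_r0 = {u. (\<lambda>x. complex_of_real (u x)) \<in> L2 \<and> (LINT x|torus. u x) = 0}"

definition inner2 :: "(real \<Rightarrow> complex) \<Rightarrow> (real \<Rightarrow> complex) \<Rightarrow> complex" where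
  "inner2 f g = (LINT x|torus. f x * cnj (g x)) / (2 * of_real pi)"

definition hardy :: "(real \<Rightarrow> complex) set" where
  "hardy = {f \<in> L2. \<forall>n<0. fourier (distr_of f) n = 0}"

definition hardy1 :: "(real \<Rightarrow> complex) set" where
  "hardy1 = {f \<in> hardy. distr_of f \<in> sobolev 1}"

text \<open>
  The following operators choose a representative of a function that is determined
  almost everywhere: the orthogonal projection onto the Hardy space, and the weak
  derivative.
\<close>

definition szego :: "(real \<Rightarrow> complex) \<Rightarrow> real \<Rightarrow> complex" where
  "szego h = (SOME g. g \<in> hardy \<and> (\<forall>k\<in>hardy. inner2 (\<lambda>x. h x - g x) k = 0))"

definition weak_deriv :: "(real \<Rightarrow> complex) \<Rightarrow> real \<Rightarrow> complex" where
  "weak_deriv f = (SOME h. h \<in> L2 \<and> distr_of h = distr_deriv (distr_of f))"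

definition toeplitz :: "(real \<Rightarrow> real) \<Rightarrow> (real \<Rightarrow> complex) \<Rightarrow> real \<Rightarrow> complex" where
  "toeplitz u f = szego (\<lambda>x. of_real (u x) * f x)"

definition lax :: "(real \<Rightarrow> real) \<Rightarrow> (real \<Rightarrow> complex) \<Rightarrow> real \<Rightarrow> complex" where
  "lax u f = (\<lambda>x. - \<i> * weak_deriv f x - toeplitz u f x)"

definition eigenfun :: "(real \<Rightarrow> real) \<Rightarrow> real \<Rightarrow> (real \<Rightarrow> complex) \<Rightarrow> bool" where
  "eigenfun u \<mu> f \<longleftrightarrow> f \<in> hardy1 \<and> \<not> (AE x in torus. f x = 0) \<and>
     (AE x in torus. lax u f x = of_real \<mu> * f x)"

section \<open>The Birkhoff map on square integrable potentials\<close>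

text \<open>The eigenvalues in increasing order, enumerated from 0.\<close>

definition lam :: "(real \<Rightarrow> real) \<Rightarrow> nat \<Rightarrow> real" where
  "lam u = (THE l. strict_mono l \<and> range l = {\<mu>. \<exists>f. eigenfun u \<mu> f})"

definition gam :: "(real \<Rightarrow> real) \<Rightarrow> nat \<Rightarrow> real" where
  "gam u n = lam u n - lam u (n - 1) - 1"

definition pos_complex :: "complex \<Rightarrow> bool" where
  "pos_complex z \<longleftrightarrow> z \<in> \<real> \<and> Re z > 0"

definition normalized_eigenbasis :: "(real \<Rightarrow> real) \<Rightarrow> (nat \<Rightarrow> real \<Rightarrow> complex) \<Rightarrow> bool" where
  "normalized_eigenbasis u f \<longleftrightarrow>
     (\<forall>n. eigenfun u (lam u n) (f n)) \<and>
     (\<forall>m n. inner2 (f m) (f n) = (if m = n then 1 else 0)) \<and>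
     (\<forall>h\<in>hardy. (\<forall>n. inner2 h (f n) = 0) \<longrightarrow> (AE x in torus. h x = 0)) \<and>
     pos_complex (inner2 (\<lambda>x. 1) (f 0)) \<and>
     (\<forall>n\<ge>1. pos_complex (inner2 (f n) (\<lambda>x. exp (\<i> * of_real x) * f (n - 1) x)))"

text \<open>Determined up to null sets, hence harmless in the inner products below.\<close>

definition efun :: "(real \<Rightarrow> real) \<Rightarrow> nat \<Rightarrow> real \<Rightarrow> complex" where
  "efun u = (SOME f. normalized_eigenbasis u f)"

definition kap :: "(real \<Rightarrow> real) \<Rightarrow> nat \<Rightarrow> real" where
  "kap u n = 1 / (lam u n - lam u 0) *
     (\<Prod>p. if p = 0 \<or> p = n then 1 else 1 - gam u p / (lam u p - lam u n))"

definition zeta :: "(real \<Rightarrow> real) \<Rightarrow> nat \<Rightarrow> complex" where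
  "zeta u n = 1 / of_real (sqrt (kap u n)) * inner2 (\<lambda>x. 1) (efun u n)"

definition birkhoff :: "(real \<Rightarrow> real) \<Rightarrow> nat \<Rightarrow> complex" where
  "birkhoff u = (\<lambda>n. if n = 0 then 0 else zeta u n)"

end

theory Submission
 imports Defs "HOL-Real_Asymp.Real_Asymp" "HOL-Complex_Analysis.Complex_Analysis"
begin

text \<open>
 A potential is represented by its Fourier coefficients \<open>v\<close>, and the Lax operator by the Toeplitz form \<open>qf v\<close> on sequences,
 which for \<open>v\<close> in \<open>h\<^sup>-\<^sup>s\<close>, \<open>s < 1/2\<close>, is a small perturbation of the diagonal form. The minimax principle gives an eigenbasis,
 and the shift shows that the gaps are nonnegative. In the eigenbasis the shift has Cauchy matrix entries, so the spectral
 weights \<open>|\<langle>1|f n\<rangle>|\<^sup>2\<close> are products of the eigenvalues; this extends the Birkhoff map and shows that it is injective.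
 Testing the form against resolvent type vectors, at all dyadic energies \<open>2\<^sup>i\<close>, bounds the tails of \<open>v\<close> by those of its
 coordinates and conversely. Hence the map is proper, and weak continuity becomes norm continuity in both directions.
 It is onto since its range is closed and contains all finitely supported sequences, which are reached by
 reconstructing \<open>v\<close> from the matrix of the shift.
\<close>

text \<open>For a distribution \<open>v\<close> the product of the potential with an eigenfunction
  need not be square integrable, so everything is phrased through a form whose domain is common to
  all potentials. What keeps the constants uniform is the trace formula \<open>gap_sum\<close>: the
  gaps add up to \<open>- mu 0\<close>, and \<open>mu 0\<close> is controlled by coercivity on
  bounded sets of potentials and by the gaps on bounded sets of coordinates. The a priori bound is
  the delicate point: the test identity contains a term cubic in \<open>v\<close>, and it closes
  only because that term costs the first power of the norm of \<open>v\<close> while the left side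
  is its square. A single energy \<open>L\<close> sees only the weight 1/(k + L); superposing the
  energies 2^i with coefficients 2^(i(1-2s)) rebuilds the weight k^(-2s) on both sides of the
  comparison. The definition of the coordinates is met through a polar form: the phase is that of
  <1|f_n>, the modulus is the square root of the gap, so the phase can jump only where the modulus
  vanishes.\<close>

abbreviation sqn :: "complex => real" where "sqn z == (cmod z)^2"

abbreviation hw where "hw sg z n == real n powr (2 * sg) * sqn (z n)"

abbreviation lim_to :: "(nat => 'a::topological_space) => 'a => bool" (infixr "---->" 60)
 where "f ----> l == filterlim f (nhds l) sequentially"

abbreviation (input) iff_ascii (infixr "<->" 25) where "A <-> B == A = B"

text \<open>The weight \<open>dw s\<close> at the dyadic energy 2^k.\<close>

abbreviation "tp s k == 2 powr (- (2 * s)*real k)"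

abbreviation "dw s k == real k powr (- (2 * s))"

abbreviation ev_seq (binder "EV " 10) where "ev_seq P == eventually P sequentially"

type_synonym cseq = "nat => complex"

section \<open>Square summable families\<close>

lemma infsum_le_bound:
 fixes f :: "'a => real"
 assumes "!!x. x:A ==> f x >= 0" "!!F. finite F ==> F \<subseteq> A ==> sum f F <= C"
 shows "f summable_on A" "infsum f A <= C"
proof -
 show 1: "f summable_on A"
  by (rule nonneg_bdd_above_summable_on) (use assms in "auto intro!: bdd_aboveI2")
 show "infsum f A <= C"
  by (rule infsum_le_finite_sums[OF 1]) (use assms in auto)
qed

lemma infsum_ge_sum:
 fixes f :: "'a => real"
 assumes "f summable_on A" "!!x. x:A ==> f x >= 0" "finite F" "F \<subseteq> A"
 shows "sum f F <= infsum f A"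
 using finite_sum_le_infsum[of f A F] assms by auto

lemma summable_on_le:
 fixes f :: "'a => real"
 assumes "g summable_on A" "!!x. x:A ==> 0 <= f x" "!!x. x:A ==> f x <= g x"
 shows "f summable_on A"
 using summable_on_comparison_test[of g A f] assms by auto

lemma cauchy_schwarz_infsum:
 fixes a b :: "'a => real"
 assumes "!!x. x:A ==> a x >= 0" "!!x. x:A ==> b x >= 0"
  and "(%x. (a x)^2) summable_on A" "(%x. (b x)^2) summable_on A"
 shows "(%x. a x*b x) summable_on A"
  "(INFSUM x:A. a x*b x) <= sqrt (INFSUM x:A. (a x)^2) * sqrt (INFSUM x:A. (b x)^2)"
proof -
 have "sum (%x. a x*b x) F <= sqrt (INFSUM x:A. (a x)^2) * sqrt (INFSUM x:A. (b x)^2)"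
  if F: "finite F" "F \<subseteq> A" for F
 proof -
  have "(sum (%x. a x*b x) F)^2 <= (SUM x:F. (a x)^2)*(SUM x:F. (b x)^2)"
   by (rule Cauchy_Schwarz_ineq_sum)
  also have "... <= (INFSUM x:A. (a x)^2)*(INFSUM x:A. (b x)^2)"
   by (intro mult_mono infsum_ge_sum assms F sum_nonneg infsum_nonneg) auto
  finally show ?thesis
   by (metis real_le_rsqrt real_sqrt_mult)
 qed
 thus "(%x. a x*b x) summable_on A"
  "(INFSUM x:A. a x*b x) <= sqrt (INFSUM x:A. (a x)^2) * sqrt (INFSUM x:A. (b x)^2)"
  using infsum_le_bound[of A "%x. a x*b x"] assms(1,2) by (auto simp: subset_iff)
qed

section \<open>Square summable families: norm, inner product, Bessel and Parseval\<close>

definition ell2 :: "('a => complex) => bool" where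
 "ell2 f <-> (%k. sqn (f k)) summable_on UNIV"

definition nsq :: "('a => complex) => real" where
 "nsq f = (INFSUM k. sqn (f k))"

text \<open>Linear in the first argument, as \<open>inner2\<close>. An unconditional sum has the
  default value 0 when it diverges, which lets scaling and symmetry rules hold for all
  families.\<close>

definition ip :: "('a => complex) => ('a => complex) => complex" where
 "ip f g = (INFSUM k. f k*cnj (g k))"

lemma nsq_nonneg [simp]: "nsq f >= 0"
 by (simp add: nsq_def infsum_nonneg)

lemma ell2I_bound:
 assumes "!!F. finite F ==> (SUM k:F. sqn (f k)) <= C"
 shows "ell2 f" "nsq f <= C"
 using infsum_le_bound[of UNIV "%k. sqn (f k)" C] assms by (auto simp: ell2_def nsq_def)

lemma sum_le_nsq: "ell2 f ==> finite F ==> (SUM k:F. sqn (f k)) <= nsq f"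
 unfolding nsq_def by (intro infsum_ge_sum) (auto simp: ell2_def)

lemma coord_le_nsq: "ell2 f ==> sqn (f k) <= nsq f"
 using sum_le_nsq[of f "{k}"] by simp

lemma coord_le_sqrt_nsq: "ell2 f ==> cmod (f k) <= sqrt (nsq f)"
 using coord_le_nsq[of f k] by (simp add: real_le_rsqrt)

lemma ell2_le:
 assumes "ell2 g" "!!k. cmod (f k) <= cmod (g k)"
 shows "ell2 f" "nsq f <= nsq g"
proof -
 have "(SUM k:F. sqn (f k)) <= nsq g" if "finite F" for F
  by (rule order_trans[OF sum_mono sum_le_nsq[OF assms(1) that]])
   (use assms(2) in "simp add: power_mono")
 thus "ell2 f" "nsq f <= nsq g" using ell2I_bound by blast+
qed

lemma ell2_scale: "ell2 f ==> ell2 (%k. c*f k)"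
 unfolding ell2_def norm_mult power_mult_distrib by (rule summable_on_cmult_right)

lemma nsq_scale: "nsq (%k. c*f k) = sqn c*nsq f"
 unfolding nsq_def norm_mult power_mult_distrib by (rule infsum_cmult_right')

lemma cmod_add_sq_le: "sqn (a + b) <= 2 * sqn a + 2 * sqn b"
proof -
 have "sqn (a + b) <= (cmod a + cmod b)^2" by (simp add: norm_triangle_ineq power_mono)
 also have "... <= 2 * sqn a + 2 * sqn b"
  using sum_squares_bound[of "cmod a" "cmod b"] by (simp add: power2_sum)
 finally show ?thesis .
qed

lemma ell2_add: assumes "ell2 f" "ell2 g" shows "ell2 (%k. f k + g k)" "nsq (%k. f k + g k) <= 2*nsq f + 2*nsq g"
proof -
 have "(SUM k:F. sqn (f k + g k)) <= 2*nsq f + 2*nsq g" if "finite F" for F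
 proof -
  have "(SUM k:F. sqn (f k + g k)) <= (SUM k:F. 2 * sqn (f k) + 2 * sqn (g k))"
   by (intro sum_mono cmod_add_sq_le)
  also have "... <= 2*nsq f + 2*nsq g"
   unfolding sum.distrib sum_distrib_left[symmetric]
   using sum_le_nsq[OF assms(1) that] sum_le_nsq[OF assms(2) that] by simp
  finally show ?thesis .
 qed
 thus "ell2 (%k. f k + g k)" "nsq (%k. f k + g k) <= 2*nsq f + 2*nsq g"
  using ell2I_bound[of "%k. f k + g k"] by blast+
qed

lemma ell2_uminus [simp]: "ell2 (%k. - f k) <-> ell2 f"
 by (simp add: ell2_def)

lemma ell2_diff: assumes "ell2 f" "ell2 g" shows "ell2 (%k. f k - g k)" "nsq (%k. f k - g k) <= 2*nsq f + 2*nsq g"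
 using ell2_add[of f "%k. - g k"] assms by (auto simp: nsq_def)

lemma ell2_zero [simp]: "ell2 (%k. 0)" "nsq (%k. 0) = 0"
 by (auto simp: ell2_def nsq_def)

lemma ell2_sum: "finite I ==> (!!i. i:I ==> ell2 (f i)) ==> ell2 (%k. SUM i:I. f i k)"
 by (induction I rule: finite_induct) (auto intro!: ell2_add)

lemma ell2_finite_support:
 assumes "finite {k. f k ~= 0}" shows "ell2 f"
 unfolding ell2_def by (rule finite_nonzero_values_imp_summable_on) (use assms in "auto elim: finite_subset[rotated]")

lemma ell2_mult:
 assumes "ell2 f" "ell2 g"
 shows "(%k. cmod (f k)*cmod (g k)) summable_on UNIV"
  "(INFSUM k. cmod (f k)*cmod (g k)) <= sqrt (nsq f) * sqrt (nsq g)"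
 using cauchy_schwarz_infsum[of UNIV "%k. cmod (f k)" "%k. cmod (g k)"] assms
 by (auto simp: ell2_def nsq_def)

lemma ip_abs_summable:
 assumes "ell2 f" "ell2 g" shows "(%k. cmod (f k*cnj (g k))) summable_on UNIV"
 using ell2_mult[OF assms] by (simp add: norm_mult)

lemma ip_summable:
 assumes "ell2 f" "ell2 g" shows "(%k. f k*cnj (g k)) summable_on UNIV"
 using ip_abs_summable[OF assms] by (rule abs_summable_summable)

lemma ip_has_sum:
 assumes "ell2 f" "ell2 g" shows "((%k. f k*cnj (g k)) has_sum ip f g) UNIV"
 unfolding ip_def using ip_summable[OF assms] by simp

lemma ip_sums:
 assumes "ell2 f" "ell2 g" shows "(%k::nat. f k*cnj (g k)) sums ip f g"
 by (rule has_sum_imp_sums[OF ip_has_sum[OF assms]])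

lemma ip_bound:
 assumes "ell2 f" "ell2 g" shows "cmod (ip f g) <= sqrt (nsq f) * sqrt (nsq g)"
proof -
 have "cmod (ip f g) <= (INFSUM k. cmod (f k*cnj (g k)))"
  unfolding ip_def by (rule norm_infsum_bound[OF ip_abs_summable[OF assms]])
 also have "... <= sqrt (nsq f) * sqrt (nsq g)" using ell2_mult[OF assms] by (simp add: norm_mult)
 finally show ?thesis .
qed

lemma ip_self: "ip f f = of_real (nsq f)"
proof -
 have "ip f f = (INFSUM k. complex_of_real (sqn (f k)))"
  unfolding ip_def by (intro infsum_cong) (simp only: complex_norm_square)
 also have "... = of_real (nsq f)"
 proof (cases "ell2 f")
  case True
  thus ?thesis unfolding ell2_def nsq_def
   by (intro infsumI has_sum_of_real has_sum_infsum)
 next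
  \<comment> \<open>Both sums diverge here, and both infinite sums take the default value 0.\<close>
  case False
  hence "\<not> (%k. complex_of_real (sqn (f k))) summable_on UNIV"
   unfolding ell2_def using summable_on_Re[of "%k. complex_of_real (sqn (f k))" UNIV] by auto
  with False show ?thesis by (simp add: infsum_not_exists nsq_def ell2_def)
 qed
 finally show ?thesis .
qed

lemma ip_commute: "ip g f = cnj (ip f g)"
 unfolding ip_def infsum_cnj[symmetric] by (simp add: mult.commute)

lemma ip_add_left:
 "ell2 f ==> ell2 f' ==> ell2 g ==> ip (%k. f k + f' k) g = ip f g + ip f' g"
 unfolding ip_def distrib_right by (intro infsum_add ip_summable)

lemma ip_scale_left: "ip (%k. c*f k) g = c*ip f g"
 unfolding ip_def by (simp add: mult.assoc infsum_cmult_right')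

lemma ip_diff_left:
 "ell2 f ==> ell2 f' ==> ell2 g ==> ip (%k. f k - f' k) g = ip f g - ip f' g"
 using ip_add_left[of f "%k. (-1)*f' k" g] ip_scale_left[of "-1" f' g] ell2_scale[of f' "-1"] by simp

lemma ip_add_right:
 "ell2 f ==> ell2 f' ==> ell2 g ==> ip g (%k. f k + f' k) = ip g f + ip g f'"
 using ip_add_left[of f f' g] by (simp add: ip_commute[where g=g])

lemma ip_scale_right: "ip g (%k. c*f k) = cnj c*ip g f"
 using ip_scale_left[of c f g] by (simp add: ip_commute[of g])

lemma ip_diff_right:
 "ell2 f ==> ell2 f' ==> ell2 g ==> ip g (%k. f k - f' k) = ip g f - ip g f'"
 using ip_diff_left[of f f' g] by (simp add: ip_commute[where g=g])

lemma ip_zero [simp]: "ip (%k. 0) g = 0" "ip g (%k. 0) = 0"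
 by (auto simp: ip_def)

lemma ip_sum_left:
 assumes "finite I" "!!i. i:I ==> ell2 (f i)" "ell2 g"
 shows "ip (%k. SUM i:I. f i k) g = (SUM i:I. ip (f i) g)"
 using assms(1,2)
proof (induction I rule: finite_induct)
 case (insert x F)
 thus ?case by (simp add: ip_add_left ell2_sum assms(3))
qed simp

lemma ip_sum_right:
 assumes "finite I" "!!i. i:I ==> ell2 (f i)" "ell2 g"
 shows "ip g (%k. SUM i:I. f i k) = (SUM i:I. ip g (f i))"
 using ip_sum_left[of I f g, OF assms] by (simp add: ip_commute[of g])

lemma nsq_add: assumes "ell2 f" "ell2 g"
 shows "nsq (%k. f k + g k) = nsq f + 2*Re (ip f g) + nsq g"
proof -
 have "of_real (nsq (%k. f k + g k)) = ip f f + ip f g + (ip g f + ip g g)"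
  unfolding ip_self[symmetric] using assms by (simp add: ip_add_left ip_add_right ell2_add)
 also have "... = of_real (nsq f + 2*Re (ip f g) + nsq g)"
  unfolding ip_self ip_commute[of g f] by (simp add: complex_eq_iff)
 finally show ?thesis using of_real_eq_iff by blast
qed

lemma nsq_diff: assumes "ell2 f" "ell2 g"
 shows "nsq (%k. f k - g k) = nsq f - 2*Re (ip f g) + nsq g"
 using nsq_add[of f "%k. (-1)*g k"] assms ell2_scale[of g "-1"] nsq_scale[of "-1" g]
  ip_scale_right[of f "-1" g] by simp

lemma nsq_eq_0: assumes "ell2 f" "nsq f = 0" shows "f k = 0"
 using coord_le_nsq[OF assms(1), of k] assms(2) by simp

lemma sqrt_nsq_add: assumes "ell2 f" "ell2 g"
 shows "sqrt (nsq (%k. f k + g k)) <= sqrt (nsq f) + sqrt (nsq g)"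
proof (rule real_le_lsqrt)
 have "Re (ip f g) <= sqrt (nsq f) * sqrt (nsq g)"
  using ip_bound[OF assms] complex_Re_le_cmod order_trans by blast
 thus "nsq (%k. f k + g k) <= (sqrt (nsq f) + sqrt (nsq g))^2"
  unfolding nsq_add[OF assms] power2_sum by simp
qed (auto intro!: add_nonneg_nonneg)

text \<open>Pythagoras: the pairing of \<open>f\<close> with its projection and the squared norm of
  the projection are the same sum.\<close>

lemma bessel_identity:
 assumes F: "!!n. n:I ==> ell2 (F n)" and fin: "finite I"
  and on: "!!n m. n:I ==> m:I ==> ip (F n) (F m) = (if n = m then 1 else 0)"
  and f: "ell2 f"
 shows "nsq (%k. f k - (SUM n:I. ip f (F n)*F n k)) = nsq f - (SUM n:I. sqn (ip f (F n)))"
proof -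
 let ?p = "%k. SUM n:I. ip f (F n)*F n k"
 have lp: "ell2 ?p" by (intro ell2_sum ell2_scale F fin)
 have 1: "ip f ?p = (SUM n:I. of_real (sqn (ip f (F n))))"
  by (subst ip_sum_right) (auto intro!: fin F f ell2_scale sum.cong simp: ip_scale_right complex_norm_square mult.commute[of "cnj _"] simp del: of_real_power)
 have 2: "ip ?p (F m) = ip f (F m)" if "m:I" for m
 proof -
  have "ip ?p (F m) = (SUM n:I. ip f (F n)*(if n = m then 1 else 0))"
   by (subst ip_sum_left) (use that in "auto intro!: fin F f ell2_scale sum.cong simp: ip_scale_left on")
  also have "... = ip f (F m)" using that fin by (simp add: if_distrib cong: if_cong)
  finally show ?thesis .
 qed
 have 3: "ip ?p ?p = (SUM n:I. of_real (sqn (ip f (F n))))"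
 proof -
  have "ip ?p ?p = (SUM n:I. ip ?p (%k. ip f (F n)*F n k))"
   by (rule ip_sum_right) (auto intro!: fin F f ell2_scale lp)
  also have "... = (SUM n:I. of_real (sqn (ip f (F n))))"
   by (intro sum.cong refl) (simp add: ip_scale_right 2 complex_norm_square mult.commute[of "cnj _"] del: of_real_power)
  finally show ?thesis .
 qed
 have "nsq ?p = (SUM n:I. sqn (ip f (F n)))"
  using 3 unfolding ip_self of_real_sum[symmetric] of_real_eq_iff .
 moreover have "Re (ip f ?p) = (SUM n:I. sqn (ip f (F n)))" unfolding 1 by simp
 ultimately show ?thesis unfolding nsq_diff[OF f lp] by simp
qed

lemma bessel:
 assumes F: "!!n. ell2 (F n)"
  and on: "!!n m. ip (F n) (F m) = (if n = m then 1 else 0)"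
  and f: "ell2 f"
 shows "ell2 (%n. ip f (F n))" "nsq (%n. ip f (F n)) <= nsq f"
proof -
 have "(SUM n:I. sqn (ip f (F n))) <= nsq f" if "finite I" for I
  using bessel_identity[of I F f, OF F that _ f] on nsq_nonneg[of "%k. f k - (SUM n:I. ip f (F n)*F n k)"] by simp
 thus "ell2 (%n. ip f (F n))" "nsq (%n. ip f (F n)) <= nsq f"
  using ell2I_bound[of "%n. ip f (F n)"] by auto
qed

text \<open>The residuals of \<open>f\<close> tend to 0 in norm, so pairing them with any
  \<open>g\<close> gives the polarised identity. Equality in Bessel is asked for the one vector
  \<open>f\<close> only, because for some families completeness is known on special vectors before
  it is known in general.\<close>

lemma parseval_of_bessel_eq:
 fixes F :: "nat => 'a => complex"
 assumes F: "!!n. ell2 (F n)"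
  and on: "!!n m. ip (F n) (F m) = (if n = m then 1 else 0)"
  and f: "ell2 f" and g: "ell2 g"
  and eq: "nsq (%n. ip f (F n)) = nsq f"
 shows "ip f g = ip (%n. ip f (F n)) (%n. ip g (F n))"
proof -
 define r where "r = (%N k. f k - (SUM n<N. ip f (F n)*F n k))"
 have lr: "ell2 (r N)" for N unfolding r_def by (intro ell2_diff f ell2_sum ell2_scale F) auto
 have nr: "nsq (r N) = nsq f - (SUM n<N. sqn (ip f (F n)))" for N
  unfolding r_def by (intro bessel_identity F f) (auto simp: on)
 have "(%n. sqn (ip f (F n))) sums nsq f"
  using bessel(1)[OF F on f] eq unfolding ell2_def nsq_def
  by (metis has_sum_imp_sums has_sum_infsum)
 hence "(%N. nsq f - (SUM n<N. sqn (ip f (F n)))) ----> nsq f - nsq f"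
  unfolding sums_def by (intro tendsto_intros)
 hence nr0: "(%N. nsq (r N)) ----> 0" by (simp add: nr)
 have "(%N. ip (r N) g) ----> 0"
 proof (rule Lim_null_comparison)
  show "EV N. norm (ip (r N) g) <= sqrt (nsq (r N)) * sqrt (nsq g)"
   using ip_bound[OF lr g] by simp
  show "(%N. sqrt (nsq (r N)) * sqrt (nsq g)) ----> 0"
   using tendsto_mult_right[OF tendsto_real_sqrt[OF nr0], of "sqrt (nsq g)"] by (simp add: mult.commute)
 qed
 moreover have "ip (r N) g = ip f g - (SUM n<N. ip f (F n)*cnj (ip g (F n)))" for N
 proof -
  have "ip (%k. SUM n<N. ip f (F n)*F n k) g = (SUM n<N. ip f (F n)*cnj (ip g (F n)))"
   by (subst ip_sum_left) (auto intro!: ell2_scale F g sum.cong simp: ip_scale_left ip_commute[of "F _" g])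
  thus ?thesis unfolding r_def
   by (subst ip_diff_left) (auto intro!: f g ell2_sum ell2_scale F)
 qed
 ultimately have "(%N. ip f g - (SUM n<N. ip f (F n)*cnj (ip g (F n)))) ----> 0" by simp
 hence "(%n. ip f (F n)*cnj (ip g (F n))) sums ip f g"
  unfolding sums_def using tendsto_diff[OF tendsto_const[of "ip f g"]] by fastforce
 moreover have "(%n. ip f (F n)*cnj (ip g (F n))) sums ip (%n. ip f (F n)) (%n. ip g (F n))"
  by (intro ip_sums bessel F on f g)
 ultimately show ?thesis by (rule sums_unique2)
qed

text \<open>Fatou's lemma for families: finite partial sums pass to the limit.\<close>

lemma nsq_fatou:
 assumes "!!j. ell2 (f j)" "!!j. nsq (f j) <= C" "!!k. (%j::nat. f j k) ----> g k"
 shows "ell2 g" "nsq g <= C"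
proof -
 have "(SUM k:F. sqn (g k)) <= C" if "finite F" for F
 proof (rule LIMSEQ_le_const2)
  show "(%j. SUM k:F. sqn (f j k)) ----> (SUM k:F. sqn (g k))"
   by (intro tendsto_intros assms)
  show "EX N. ALL j>=N. (SUM k:F. sqn (f j k)) <= C"
   using sum_le_nsq[OF assms(1) that] assms(2) by (meson order_trans)
 qed
 thus "ell2 g" "nsq g <= C" using ell2I_bound by blast+
qed

lemma ell2_tail:
 assumes "ell2 h" "eps > 0"
 obtains F where "finite F" "nsq (%k. if k:F then 0 else h k) < eps"
proof -
 have "(%k. sqn (h k)) summable_on UNIV" using assms by (simp add: ell2_def)
 then obtain F where F: "finite F" "dist (SUM k:F. sqn (h k)) (nsq h) < eps"
  using infsum_finite_approximation[of "%k. sqn (h k)" UNIV "eps/2"] assms(2)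
  unfolding nsq_def by (metis (no_types, lifting) field_sum_of_halves half_gt_zero less_add_same_cancel1 order.strict_trans1)
 have 1: "nsq h = (INFSUM k:F. sqn (h k)) + (INFSUM k:-F. sqn (h k))"
  unfolding nsq_def using assms(1) summable_on_subset_banach unfolding ell2_def
  by (subst infsum_Un_disjoint[symmetric]) (auto intro: summable_on_subset_banach)
 have 2: "nsq (%k. if k:F then 0 else h k) = (INFSUM k:-F. sqn (h k))"
  unfolding nsq_def by (rule infsum_cong_neutral) auto
 show ?thesis
  by (rule that[OF F(1)]) (use F 1 2 in "auto simp: dist_real_def")
qed

text \<open>A finite set carries almost all of \<open>h\<close>; on it coordinatewise convergence
  suffices, off it Cauchy-Schwarz gives smallness.\<close>

lemma weak_convergence_0:
 assumes f: "!!j. ell2 (f j)" and b: "!!j. nsq (f j) <= C" and c: "!!k. (%j::nat. f j k) ----> 0"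
  and h: "ell2 h"
 shows "(%j. INFSUM k. cmod (f j k)*cmod (h k)) ----> 0"
proof (rule LIMSEQ_I)
 fix r :: real assume "r > 0"
 have C: "C >= 0" using b[of 0] nsq_nonneg[of "f 0"] by linarith
 \<comment> \<open>Chosen so that \<open>sqrt C * sqrt eps\<close> is at most \<open>r/2\<close>;
   the summand 1 covers \<open>C = 0\<close>.\<close>
 define eps where "eps = (r/(2*(sqrt C + 1)))^2"
 have "eps > 0" unfolding eps_def using \<open>r > 0\<close> C
  by (intro zero_less_power divide_pos_pos) (auto intro!: add_nonneg_pos mult_pos_pos)
 obtain F where F: "finite F" "nsq (%k. if k:F then 0 else h k) < eps"
  using ell2_tail[OF h \<open>eps > 0\<close>] .
 let ?t = "%k. if k:F then 0 else h k"
 have lt: "ell2 ?t" by (rule ell2_le(1)[OF h]) auto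
 have "(%j. SUM k:F. cmod (f j k)*cmod (h k)) ----> (SUM k:F. 0*cmod (h k))"
  by (intro tendsto_intros) (use c tendsto_norm_zero in blast)
 hence "EV j. (SUM k:F. cmod (f j k)*cmod (h k)) < r/2"
  using \<open>r > 0\<close> order_tendstoD(2)[of _ 0 sequentially "r/2"] by simp
 then obtain N where N: "!!j. j >= N ==> (SUM k:F. cmod (f j k)*cmod (h k)) < r/2"
  unfolding eventually_sequentially by blast
 have "norm ((INFSUM k. cmod (f j k)*cmod (h k)) - 0) < r" if "j >= N" for j
 proof -
  have s: "(%k. cmod (f j k)*cmod (h k)) summable_on UNIV" by (rule ell2_mult(1)[OF f h])
  have "(INFSUM k. cmod (f j k)*cmod (h k)) =
   (INFSUM k:F. cmod (f j k)*cmod (h k)) + (INFSUM k:-F. cmod (f j k)*cmod (h k))"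
   by (subst infsum_Un_disjoint[symmetric]) (auto intro: summable_on_subset_banach[OF s])
  also have "(INFSUM k:-F. cmod (f j k)*cmod (h k)) = (INFSUM k. cmod (f j k)*cmod (?t k))"
   by (rule infsum_cong_neutral) auto
  also have "... <= sqrt (nsq (f j)) * sqrt (nsq ?t)" by (rule ell2_mult(2)[OF f lt])
  also have "... <= sqrt C * sqrt eps"
   using b[of j] F(2) by (intro mult_mono) (auto simp: C)
  also have "sqrt eps = r/(2*(sqrt C + 1))" unfolding eps_def using \<open>r > 0\<close> C by simp
  also have "sqrt C*(r/(2*(sqrt C + 1))) <= r/2"
  proof -
   have "sqrt C/(sqrt C + 1) <= 1" using C by (simp add: divide_le_eq add_nonneg_pos)
   hence "(r/2)*(sqrt C/(sqrt C + 1)) <= (r/2)*1" using \<open>r > 0\<close> by (intro mult_left_mono) auto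
   thus ?thesis by (simp add: algebra_simps)
  qed
  finally have "(INFSUM k. cmod (f j k)*cmod (h k)) < r" using N[OF that] F(1) by simp
  moreover have "(INFSUM k. cmod (f j k)*cmod (h k)) >= 0" by (intro infsum_nonneg) simp
  ultimately show ?thesis by simp
 qed
 thus "EX no. ALL j>=no. norm ((INFSUM k. cmod (f j k)*cmod (h k)) - 0) < r" by blast
qed

lemma weak_convergence:
 assumes f: "!!j. ell2 (f j)" and b: "!!j. nsq (f j) <= C" and c: "!!k. (%j::nat. f j k) ----> g k"
  and h: "ell2 h"
 shows "(%j. ip (f j) h) ----> ip g h"
proof -
 have g: "ell2 g" "nsq g <= C" using nsq_fatou[of f C g] f b c by auto
 have "nsq (%k. f j k - g k) <= 4*C" for j
  using ell2_diff(2)[OF f[of j] g(1)] b[of j] g(2) by linarith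
 hence 1: "(%j. INFSUM k. cmod (f j k - g k)*cmod (h k)) ----> 0"
  by (intro weak_convergence_0[of "%j k. f j k - g k" "4*C" h] ell2_diff f g h)
   (use c in "simp_all add: LIM_zero")
 have "(%j. ip (f j) h - ip g h) ----> 0"
 proof (rule Lim_null_comparison[OF _ 1], intro always_eventually allI)
  fix j
  have d: "ell2 (%k. f j k - g k)" by (intro ell2_diff f g)
  have "ip (f j) h - ip g h = ip (%k. f j k - g k) h" using f g h by (simp add: ip_diff_left)
  thus "norm (ip (f j) h - ip g h) <= (INFSUM k. cmod (f j k - g k)*cmod (h k))"
   unfolding ip_def using norm_infsum_bound[OF ip_abs_summable[OF d h]] by (simp add: norm_mult)
 qed
 thus ?thesis by (simp add: LIM_zero_iff)
qed

section \<open>The Toeplitz form of a potential\<close>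

definition wn :: "real => cseq => real" where
 "wn sg v = (INFSUM n:{1..}. hw sg v n)"

lemma hplus_norm_wn: "hplus_norm sg v = sqrt (wn sg v)"
 by (simp add: hplus_norm_def wn_def)

lemma wn_nonneg [simp]: "wn sg v >= 0"
 unfolding wn_def by (intro infsum_nonneg) auto

text \<open>All Fourier coefficients of the real potential of mean zero whose coefficients of
  positive index are \<open>v\<close>; \<open>tz v\<close> is the matrix of its Toeplitz
  operator.\<close>

definition uc :: "cseq => int => complex" where
 "uc v m = (if m > 0 then v (nat m) else if m < 0 then cnj (v (nat (- m))) else 0)"

abbreviation "tz v k l == uc v (int k - int l)"

lemma uc_uminus: "uc v (- m) = cnj (uc v m)"
 by (auto simp: uc_def)

lemma uc_0 [simp]: "uc v 0 = 0"
 by (simp add: uc_def)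

lemma uc_of_nat: "v 0 = 0 ==> uc v (int n) = v n"
 by (auto simp: uc_def)

lemma uc_diff: "uc (%n. v n - w n) m = uc v m - uc w m"
 by (auto simp: uc_def)

lemma wn_sum_le:
 assumes "v:hplus sg" "finite F" "F \<subseteq> {1..}"
 shows "(SUM n:F. hw sg v n) <= wn sg v"
 unfolding wn_def using assms by (intro infsum_ge_sum) (auto simp: hplus_def)

lemma uc_sum_le:
 assumes "v:hplus sg" "finite F"
 shows "(SUM m:F. \<bar>real_of_int m\<bar> powr (2 * sg) * sqn (uc v m)) <= 2*wn sg v"
proof -
 let ?b = "%m. \<bar>real_of_int m\<bar> powr (2 * sg) * sqn (uc v m)"
 let ?c = "%n. hw sg v n"
 have "sum ?b F <= sum ?b (F Int {0<..}) + sum ?b (F Int {..<0})"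
 proof -
  have "sum ?b F = sum ?b (F Int {0<..} Un F Int {..<0})"
   by (rule sum.mono_neutral_right) (use assms(2) in "auto simp: not_less")
  also have "... = sum ?b (F Int {0<..}) + sum ?b (F Int {..<0})"
   by (rule sum.union_disjoint) (use assms(2) in auto)
  finally show ?thesis by simp
 qed
 also have "sum ?b (F Int {0<..}) = sum ?c (nat ` (F Int {0<..}))"
  by (subst sum.reindex) (auto simp: inj_on_def uc_def intro!: sum.cong)
 also have "sum ?b (F Int {..<0}) = sum ?c ((%m. nat (- m)) ` (F Int {..<0}))"
  by (subst sum.reindex) (auto simp: inj_on_def uc_def intro!: sum.cong)
 also have "sum ?c (nat ` (F Int {0<..})) + sum ?c ((%m. nat (- m)) ` (F Int {..<0})) <= wn sg v + wn sg v"
  by (intro add_mono wn_sum_le assms) (use assms(2) in auto)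
 finally show ?thesis by simp
qed

text \<open>The Toeplitz matrix between two factors (D + L)^(-1/2), where D is the diagonal operator
  with entries k. It turns out to be Hilbert-Schmidt, with norm tending to 0 as \<open>L\<close>
  grows.\<close>

definition hk :: "real => cseq => nat \<times> nat => complex" where
 "hk L v p = tz v (fst p) (snd p)/of_real (sqrt ((real (fst p) + L)*(real (snd p) + L)))"

text \<open>The product is at most the full power of the smaller variable, and the sum replaces the
  case distinction.\<close>

lemma powr_max_bound:
 fixes X Y a b :: real
 assumes "X > 0" "Y > 0" "a >= 0" "b >= 0"
 shows "X powr (- a)*Y powr (- b) <= X powr (- (a + b)) + Y powr (- (a + b))"
proof (cases "X <= Y")
 case True
 have "X powr (- a)*Y powr (- b) <= X powr (- a)*X powr (- b)"
  using True assms by (intro mult_left_mono powr_mono2') auto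
 also have "... = X powr (- (a + b))" by (simp add: powr_add[symmetric])
 finally show ?thesis by (simp add: add_increasing2)
next
 case False
 have "X powr (- a)*Y powr (- b) <= Y powr (- a)*Y powr (- b)"
  using False assms by (intro mult_right_mono powr_mono2') auto
 also have "... = Y powr (- (a + b))" by (simp add: powr_add[symmetric])
 finally show ?thesis by (simp add: add_increasing)
qed

lemma summable_powr_shift: "a > 1 ==> (%k. real (Suc k) powr (- a)) summable_on UNIV"
 using summable_Suc_iff[of "%n. real n powr (- a)"]
 by (subst summable_on_UNIV_nonneg_real_iff) (auto simp: summable_real_powr_iff)

text \<open>Since \<open>|k - l|\<close> is at most \<open>X = k + L\<close> or at most \<open>Y = l + L\<close>, the growth of the coefficients is traded
 for the decay of one of the two weights.\<close>

lemma hk_entry_bound: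
 assumes "0 < s" "s < 1/2" "L >= 1"
 shows "sqn (hk L v (k, l)) <= \<bar>real_of_int (int k - int l)\<bar> powr (2*(- s)) * sqn (tz v k l)
  *((real k + L) powr (- (2 - 2 * s)) + (real l + L) powr (- (2 - 2 * s)))"
proof (cases "k = l")
 case True thus ?thesis by (simp add: hk_def)
next
 case False
 have core: "c/(X*Y) <= m powr (2*(- s))*c*(X powr (- (2 - 2 * s)) + Y powr (- (2 - 2 * s)))"
  if "0 < m" "m <= X" "0 < Y" "c >= 0" for c m X Y :: real
 proof -
  have X: "X > 0" using that by simp
  have "c/(X*Y) = m powr (2*(- s))*c*(m powr (2 * s)/(X*Y))" using that by (simp add: powr_minus field_simps)
  also have "... <= m powr (2*(- s))*c*(X powr (- (1 - 2 * s))*Y powr (- 1))"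
  proof (rule mult_left_mono)
   have "m powr (2 * s)/(X*Y) <= X powr (2 * s)/(X*Y)" using that X assms by (intro divide_right_mono powr_mono2) auto
   also have "... = X powr (- (1 - 2 * s))*Y powr (- 1)"
    using X that powr_diff[of X "2 * s" 1] by (simp add: powr_minus_divide)
   finally show "m powr (2 * s)/(X*Y) <= X powr (- (1 - 2 * s))*Y powr (- 1)" .
  qed (use that in simp)
  also have "... <= m powr (2*(- s))*c*(X powr (- (1 - 2 * s + 1)) + Y powr (- (1 - 2 * s + 1)))"
   by (intro mult_left_mono powr_max_bound) (use that X assms in auto)
  finally show ?thesis by simp
 qed
 let ?m = "\<bar>real_of_int (int k - int l)\<bar>" and ?X = "real k + L" and ?Y = "real l + L"
 have e: "sqn (hk L v (k, l)) = sqn (tz v k l)/(?X*?Y)" using assms by (simp add: hk_def norm_divide power_divide)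
 have p: "?m > 0" "?X > 0" "?Y > 0" using assms False by auto
 have "?m <= ?X \<or> ?m <= ?Y" using assms by auto
 thus ?thesis unfolding e
  using core[OF p(1) _ p(3), of ?X "sqn (tz v k l)"] core[OF p(1) _ p(2), of ?Y "sqn (tz v k l)"]
  by (simp only: mult.commute[of ?Y] add.commute[of "?Y powr _"]) auto
qed

text \<open>Of the available decay 2 - 2s, the part 3/2 - s is spent on summability, possible since
  s < 1/2, and 1/2 - s is left for \<open>L\<close>. The factor 4 counts the two signs of the
  frequency and the two weights of the entry bound.\<close>

definition KK :: "real => real" where
 "KK s = 4*(INFSUM k. real (Suc k) powr (- (3/2 - s)))"

lemma KK_nonneg: "KK s >= 0" by (simp add: KK_def infsum_nonneg)

lemma weight_tail:
 assumes "0 < s" "s < 1/2" "L >= 1" "finite F"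
 shows "(SUM k:F. (real k + L) powr (- (2 - 2 * s))) <= KK s/4*L powr (- (1/2 - s))"
proof -
 have "(SUM k:F. (real k + L) powr (- (2 - 2 * s))) <= (SUM k:F. real (Suc k) powr (- (3/2 - s))*L powr (- (1/2 - s)))"
 proof (rule sum_mono)
  fix k
  have "(real k + L) powr (- (2 - 2 * s)) = (real k + L) powr (- (3/2 - s))*(real k + L) powr (- (1/2 - s))"
   by (simp add: powr_add[symmetric])
  also have "... <= real (Suc k) powr (- (3/2 - s))*L powr (- (1/2 - s))"
   using assms by (intro mult_mono powr_mono2') auto
  finally show "(real k + L) powr (- (2 - 2 * s)) <= real (Suc k) powr (- (3/2 - s))*L powr (- (1/2 - s))" .
 qed
 also have "... = (SUM k:F. real (Suc k) powr (- (3/2 - s)))*L powr (- (1/2 - s))"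
  by (simp add: sum_distrib_right)
 also have "... <= (INFSUM k. real (Suc k) powr (- (3/2 - s)))*L powr (- (1/2 - s))"
  using assms by (intro mult_right_mono infsum_ge_sum summable_powr_shift) auto
 finally show ?thesis by (simp add: KK_def)
qed

text \<open>Along a row or a column the weighted coefficients sum to at most
  \<open>2 * wn (- s) v\<close>; the other index is summed with \<open>weight_tail\<close>, which
  produces the negative power of \<open>L\<close>.\<close>

lemma hk_bound:
 assumes s: "0 < s" "s < 1/2" and L: "L >= 1" and v: "v:hplus (- s)"
 shows "ell2 (hk L v)" "nsq (hk L v) <= KK s*wn (- s) v * L powr (- (1/2 - s))"
proof -
 let ?b = "%m. \<bar>real_of_int m\<bar> powr (2*(- s)) * sqn (uc v m)"
 let ?w = "%k. (real k + L) powr (- (2 - 2 * s))"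
 let ?T = "KK s/4*L powr (- (1/2 - s))"
 have "(SUM p:F. sqn (hk L v p)) <= KK s*wn (- s) v * L powr (- (1/2 - s))" if "finite F" for F
 proof -
  \<comment> \<open>Enlarging to a rectangle allows rows and columns to be summed
    separately.\<close>
  define A B where "A = fst ` F" and "B = snd ` F"
  have fin: "finite A" "finite B" using that by (auto simp: A_def B_def)
  have rc: "(SUM l:C. ?b (g l)) <= 2*wn (- s) v" if "finite C" "inj_on g C" for g and C :: "nat set"
   using uc_sum_le[OF v, of "g ` C"] that by (simp add: sum.reindex)
  have "(SUM p:F. sqn (hk L v p)) <= (SUM p:A\<times>B. sqn (hk L v p))"
   by (rule sum_mono2) (use fin in "auto simp: A_def B_def intro: rev_image_eqI")
  also have "... <= (SUM p:A\<times>B. ?b (int (fst p) - int (snd p))*(?w (fst p) + ?w (snd p)))"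
   using hk_entry_bound[OF s L, of v] by (intro sum_mono) (metis prod.collapse)
  also have "... = (SUM p:A\<times>B. ?b (int (fst p) - int (snd p))*?w (fst p)) + (SUM p:A\<times>B. ?b (int (fst p) - int (snd p))*?w (snd p))"
   by (simp add: sum.distrib sum_distrib_left algebra_simps)
  also have "(SUM p:A\<times>B. ?b (int (fst p) - int (snd p))*?w (fst p)) = (SUM k:A. (SUM l:B. ?b (int k - int l))*?w k)"
   unfolding sum_distrib_right sum.cartesian_product by (intro sum.cong) auto
  also have "(SUM p:A\<times>B. ?b (int (fst p) - int (snd p))*?w (snd p)) = (SUM l:B. (SUM k:A. ?b (int k - int l))*?w l)"
   unfolding sum_distrib_right by (subst sum.swap, unfold sum.cartesian_product) (intro sum.cong, auto)
  also have "(SUM k:A. (SUM l:B. ?b (int k - int l))*?w k) + (SUM l:B. (SUM k:A. ?b (int k - int l))*?w l)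
   <= (SUM k:A. 2*wn (- s) v * ?w k) + (SUM l:B. 2*wn (- s) v * ?w l)"
   by (intro add_mono sum_mono mult_right_mono rc fin) (auto simp: inj_on_def)
  also have "... = 2*wn (- s) v * ((SUM k:A. ?w k) + (SUM l:B. ?w l))"
   by (simp add: sum_distrib_left algebra_simps)
  also have "... <= 2*wn (- s) v * (?T + ?T)"
   by (intro mult_left_mono add_mono weight_tail s L fin) auto
  finally show ?thesis by (simp add: algebra_simps)
 qed
 thus "ell2 (hk L v)" "nsq (hk L v) <= KK s*wn (- s) v * L powr (- (1/2 - s))"
  using ell2I_bound by blast+
qed

section \<open>The form domain and the energy norms\<close>

definition wt :: "real => cseq => nat => complex" where
 "wt L f k = of_real (sqrt (real k + L))*f k"

text \<open>Sequences with half a derivative in ell2: the form domain. By \<open>hs_iff\<close>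
  every positive shift defines the same space.\<close>

definition hs :: "cseq => bool" where
 "hs f <-> ell2 (wt 1 f)"

definition en :: "real => cseq => real" where
 "en L f = nsq (wt L f)"

lemma en_nonneg [simp]: "en L f >= 0" by (simp add: en_def)

lemma wt_cmod_sq: "L >= 0 ==> sqn (wt L f k) = (real k + L) * sqn (f k)"
 by (simp add: wt_def norm_mult power_mult_distrib)

lemma hs_iff: "L > 0 ==> ell2 (wt L f) <-> hs f"
proof -
 have *: "ell2 (wt M f)" if "ell2 (wt L f)" "L > 0" "M > 0" for L M
 proof -
  have "ell2 (%k. of_real (sqrt (1 + M/L))*wt L f k)" using that by (intro ell2_scale)
  thus ?thesis
  proof (rule ell2_le(1))
   fix k
   have "real k + M <= (1 + M/L)*(real k + L)" using that by (simp add: field_simps)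
   hence "sqrt (real k + M) <= sqrt (1 + M/L) * sqrt (real k + L)"
    by (metis real_sqrt_le_iff real_sqrt_mult)
   thus "cmod (wt M f k) <= cmod (of_real (sqrt (1 + M/L))*wt L f k)"
    using that unfolding wt_def by (simp add: norm_mult mult.assoc[symmetric] mult_right_mono)
  qed
 qed
 assume "L > 0" thus ?thesis unfolding hs_def using *[of L 1] *[of 1 L] by auto
qed

lemma hs_ell2 [intro]: "hs f ==> ell2 f"
 unfolding hs_def by (erule ell2_le(1)) (auto simp: wt_def norm_mult intro!: mult_left_le_one_le mult_right_mono[of 1 "sqrt _", simplified])

lemma nsq_le_en: assumes "hs f" "L > 0" shows "L*nsq f <= en L f"
proof -
 have "nsq (%k. of_real (sqrt L)*f k) <= nsq (wt L f)"
  by (rule ell2_le(2)) (use assms hs_iff in "auto simp: wt_def norm_mult intro!: mult_right_mono")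
 thus ?thesis unfolding nsq_scale en_def using assms by simp
qed

lemma wt_add: "wt L (%k. f k + g k) = (%k. wt L f k + wt L g k)"
 and wt_diff: "wt L (%k. f k - g k) = (%k. wt L f k - wt L g k)"
 and wt_scale: "wt L (%k. c*f k) = (%k. c*wt L f k)"
 by (auto simp: wt_def algebra_simps)

lemma hs_add: "hs f ==> hs g ==> hs (%k. f k + g k)"
 and hs_diff: "hs f ==> hs g ==> hs (%k. f k - g k)"
 and hs_scale: "hs f ==> hs (%k. c*f k)"
 unfolding hs_def wt_add wt_diff wt_scale by (auto intro: ell2_add ell2_diff ell2_scale)

lemma hs_zero [simp]: "hs (%k. 0)" by (simp add: hs_def wt_def[abs_def])

lemma hs_sum: "finite I ==> (!!i. i:I ==> hs (f i)) ==> hs (%k. SUM i:I. f i k)"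
 by (induction I rule: finite_induct) (auto intro!: hs_add)

lemma hs_finite_support: "finite {k. f k ~= 0} ==> hs f"
 unfolding hs_def by (rule ell2_finite_support) (auto simp: wt_def elim: finite_subset[rotated])

lemma en_mono: assumes "hs f" "0 < L" "L <= M" shows "en L f <= en M f"
 unfolding en_def by (rule ell2_le(2)) (use assms hs_iff in "auto simp: wt_def norm_mult intro!: mult_right_mono")

definition dpart :: "cseq => cseq => complex" where
 "dpart f g = (INFSUM k. of_nat k*f k*cnj (g k))"

definition tf :: "cseq => cseq => cseq => complex" where
 "tf v f g = (INFSUM p. tz v (fst p) (snd p)*f (snd p)*cnj (g (fst p)))"

text \<open>The form of the Lax operator: the derivative part minus the Toeplitz part.\<close>

definition qf :: "cseq => cseq => cseq => complex" where
 "qf v f g = dpart f g - tf v f g"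

lemma dpart_ip: "hs f ==> hs g ==> L > 0 ==> dpart f g + of_real L*ip f g = ip (wt L f) (wt L g)"
 and dpart_summable: "hs f ==> hs g ==> (%k. of_nat k*f k*cnj (g k)) summable_on UNIV"
proof -
 assume f: "hs f" and g: "hs g"
 have eq: "wt L f k*cnj (wt L g k) = of_nat k*f k*cnj (g k) + of_real L*(f k*cnj (g k))" if "L > 0" for L k
 proof -
  have "wt L f k*cnj (wt L g k) = of_real (sqrt (real k + L) * sqrt (real k + L))*(f k*cnj (g k))"
   unfolding wt_def of_real_mult by (simp add: mult_ac)
  also have "sqrt (real k + L) * sqrt (real k + L) = real k + L" using that by simp
  finally show ?thesis by (simp add: algebra_simps)
 qed
 have s1: "(%k. wt L f k*cnj (wt L g k)) summable_on UNIV" if "L > 0" for L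
  by (rule ip_summable) (use f g hs_iff that in auto)
 have s2: "(%k. of_real L*(f k*cnj (g k))) summable_on UNIV" for L :: real
  by (intro summable_on_cmult_right ip_summable) (use f g in auto)
 show s3: "(%k. of_nat k*f k*cnj (g k)) summable_on UNIV"
  using summable_on_add[OF s1[of 1] summable_on_uminus[THEN iffD2, OF s2[of 1]]] eq[of 1] by simp
 assume L: "L > 0"
 show "dpart f g + of_real L*ip f g = ip (wt L f) (wt L g)"
  unfolding ip_def[of "wt L f"] eq[OF L] dpart_def ip_def
  by (subst infsum_add[OF s3 s2]) (simp add: infsum_cmult_right')
qed

text \<open>A rank one kernel whose weights cancel those of \<open>hk\<close>. The Toeplitz form
  becomes an inner product of two square summable kernels, so Cauchy-Schwarz and weak convergence
  apply to it.\<close>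

definition pr :: "real => cseq => cseq => nat \<times> nat => complex" where
 "pr L f g p = wt L g (fst p)*cnj (wt L f (snd p))"

lemma ell2_tensor:
 assumes "ell2 a" "ell2 b"
 shows "ell2 (%p. a (fst p)*cnj (b (snd p)))" "nsq (%p. a (fst p)*cnj (b (snd p))) <= nsq a*nsq b"
proof -
 have "(SUM p:F. sqn (a (fst p)*cnj (b (snd p)))) <= nsq a*nsq b" if "finite F" for F
 proof -
  have "(SUM p:F. sqn (a (fst p)*cnj (b (snd p)))) <= (SUM p:fst ` F \<times> snd ` F. sqn (a (fst p)) * sqn (b (snd p)))"
   unfolding norm_mult power_mult_distrib complex_mod_cnj
   by (rule sum_mono2) (use that in "auto intro: rev_image_eqI")
  also have "... = (SUM k:fst ` F. sqn (a k))*(SUM l:snd ` F. sqn (b l))"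
   unfolding sum_product sum.cartesian_product by (intro sum.cong) auto
  also have "... <= nsq a*nsq b"
   by (intro mult_mono sum_le_nsq assms sum_nonneg) (use that in auto)
  finally show ?thesis .
 qed
 thus "ell2 (%p. a (fst p)*cnj (b (snd p)))" "nsq (%p. a (fst p)*cnj (b (snd p))) <= nsq a*nsq b"
  using ell2I_bound[of "%p. a (fst p)*cnj (b (snd p))"] by blast+
qed

lemma pr_ell2: assumes "hs f" "hs g" "L > 0" shows "ell2 (pr L f g)" "nsq (pr L f g) <= en L f*en L g"
 using ell2_tensor[of "wt L g" "wt L f"] assms hs_iff
 unfolding pr_def[abs_def] en_def by (auto simp: mult.commute)

lemma hk_pr: "L > 0 ==> hk L v p*cnj (pr L f g p) = tz v (fst p) (snd p)*f (snd p)*cnj (g (fst p))"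
proof -
 assume L: "L > 0"
 have 0: "sqrt (real (fst p) + L) ~= 0" "sqrt (real (snd p) + L) ~= 0" using L by auto
 show ?thesis unfolding hk_def pr_def wt_def real_sqrt_mult of_real_mult
  using 0 by (simp add: field_simps)
qed

lemma tf_ip: "L > 0 ==> tf v f g = ip (hk L v) (pr L f g)"
 unfolding tf_def ip_def by (simp add: hk_pr)

definition pot :: "real => cseq => bool" where
 "pot s v <-> 0 < s \<and> s < 1/2 \<and> v:hplus (- s)"

lemma pot_hk: "pot s v ==> L >= 1 ==> ell2 (hk L v)"
 using hk_bound(1) by (auto simp: pot_def)

lemma tf_abs_summable:
 assumes "pot s v" "hs f" "hs g"
 shows "(%p. cmod (tz v (fst p) (snd p)*f (snd p)*cnj (g (fst p)))) summable_on UNIV"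
 using ip_abs_summable[OF pot_hk[OF assms(1), of 1] pr_ell2(1)[OF assms(2,3), of 1]] by (simp add: hk_pr)

lemma tf_summable:
 assumes "pot s v" "hs f" "hs g"
 shows "(%p. tz v (fst p) (snd p)*f (snd p)*cnj (g (fst p))) summable_on UNIV"
 using tf_abs_summable[OF assms] by (rule abs_summable_summable)

lemma tf_bound:
 assumes "pot s v" "hs f" "hs g" "L >= 1"
 shows "cmod (tf v f g) <= sqrt (nsq (hk L v)) * sqrt (en L f*en L g)"
proof -
 have "cmod (tf v f g) <= sqrt (nsq (hk L v)) * sqrt (nsq (pr L f g))"
  using tf_ip[of L v f g] ip_bound[OF pot_hk[OF assms(1,4)] pr_ell2(1)[OF assms(2,3)]] assms by simp
 also have "... <= sqrt (nsq (hk L v)) * sqrt (en L f*en L g)"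
  by (intro mult_left_mono real_sqrt_le_mono pr_ell2(2) assms) (use assms in auto)
 finally show ?thesis .
qed

lemma tf_add_left: "pot s v ==> hs f ==> hs f' ==> hs g ==> tf v (%k. f k + f' k) g = tf v f g + tf v f' g"
 unfolding tf_def distrib_left distrib_right by (intro infsum_add tf_summable)

lemma tf_scale_left: "tf v (%k. c*f k) g = c*tf v f g"
proof -
 have "tf v (%k. c*f k) g = (INFSUM p. c*(tz v (fst p) (snd p)*f (snd p)*cnj (g (fst p))))"
  unfolding tf_def by (simp add: mult_ac)
 thus ?thesis unfolding tf_def by (simp only: infsum_cmult_right')
qed

lemma tf_commute: "tf v g f = cnj (tf v f g)"
proof -
 have "tf v g f = (INFSUM p. tz v (snd p) (fst p)*g (fst p)*cnj (f (snd p)))"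
  unfolding tf_def
  by (rule infsum_reindex_bij_witness[of _ "%p. (snd p, fst p)" "%p. (snd p, fst p)"]) auto
 also have "... = (INFSUM p. cnj (tz v (fst p) (snd p)*f (snd p)*cnj (g (fst p))))"
  by (intro infsum_cong) (simp add: uc_uminus[symmetric] mult_ac)
 also have "... = cnj (tf v f g)" unfolding tf_def by (rule infsum_cnj)
 finally show ?thesis .
qed

lemma dpart_add_left: "hs f ==> hs f' ==> hs g ==> dpart (%k. f k + f' k) g = dpart f g + dpart f' g"
 unfolding dpart_def distrib_left distrib_right by (intro infsum_add dpart_summable)

lemma dpart_scale_left: "dpart (%k. c*f k) g = c*dpart f g"
proof -
 have "dpart (%k. c*f k) g = (INFSUM k. c*(of_nat k*f k*cnj (g k)))"
  unfolding dpart_def by (simp add: mult_ac)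
 thus ?thesis unfolding dpart_def by (simp only: infsum_cmult_right')
qed

lemma dpart_commute: "dpart g f = cnj (dpart f g)"
 unfolding dpart_def infsum_cnj[symmetric] by (simp add: mult_ac)

lemma qf_add_left: "pot s v ==> hs f ==> hs f' ==> hs g ==> qf v (%k. f k + f' k) g = qf v f g + qf v f' g"
 by (simp add: qf_def tf_add_left dpart_add_left)

lemma qf_scale_left: "qf v (%k. c*f k) g = c*qf v f g"
 by (simp add: qf_def tf_scale_left dpart_scale_left right_diff_distrib)

lemma qf_commute: "qf v g f = cnj (qf v f g)"
 by (simp add: qf_def tf_commute[of v g f] dpart_commute[of g f])

lemma qf_diff_left: "pot s v ==> hs f ==> hs f' ==> hs g ==> qf v (%k. f k - f' k) g = qf v f g - qf v f' g"
 using qf_add_left[of s v f "%k. (-1)*f' k" g] qf_scale_left[of v "-1" f' g] hs_scale[of f' "-1"] by simp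

lemma qf_add_right: "pot s v ==> hs f ==> hs f' ==> hs g ==> qf v g (%k. f k + f' k) = qf v g f + qf v g f'"
 using qf_add_left[of s v f f' g] by (simp add: qf_commute[where g=g])

lemma qf_diff_right: "pot s v ==> hs f ==> hs f' ==> hs g ==> qf v g (%k. f k - f' k) = qf v g f - qf v g f'"
 using qf_diff_left[of s v f f' g] by (simp add: qf_commute[where g=g])

lemma qf_scale_right: "qf v g (%k. c*f k) = cnj c*qf v g f"
 using qf_scale_left[of v c f g] by (simp add: qf_commute[where g=g])

lemma qf_zero_left [simp]: "qf v (%k. 0) g = 0"
 using qf_scale_left[of v 0 "%k. 0" g] by simp

lemma qf_sum_left:
 assumes "pot s v" "finite I" "!!i. i:I ==> hs (f i)" "hs g"
 shows "qf v (%k. SUM i:I. f i k) g = (SUM i:I. qf v (f i) g)"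
 using assms(2,3)
proof (induction I rule: finite_induct)
 case (insert x F)
 thus ?case by (simp add: qf_add_left[OF assms(1)] hs_sum assms(4))
qed simp

lemma qf_sum_right:
 assumes "pot s v" "finite I" "!!i. i:I ==> hs (f i)" "hs g"
 shows "qf v g (%k. SUM i:I. f i k) = (SUM i:I. qf v g (f i))"
 using qf_sum_left[of s v I f g, OF assms] by (simp add: qf_commute[where g=g])

lemma qf_self: "qf v f f = of_real (Re (qf v f f))"
 using qf_commute[of v f f] by (simp add: complex_eq_iff)

definition qd :: "cseq => cseq => real" where
 "qd v f = Re (qf v f f)"

lemma qf_qd: "qf v f f = of_real (qd v f)"
 unfolding qd_def by (rule qf_self)

lemma qd_eq: "hs f ==> L > 0 ==> qd v f + L*nsq f = en L f - Re (tf v f f)"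
proof -
 assume "hs f" "L > 0"
 hence "dpart f f + of_real L*ip f f = of_real (en L f)" unfolding en_def ip_self[symmetric] by (intro dpart_ip)
 hence "Re (dpart f f) + L*nsq f = en L f" by (simp add: ip_self complex_eq_iff)
 thus ?thesis unfolding qd_def qf_def by simp
qed

lemma qd_add: assumes "pot s v" "hs f" "hs g" shows "qd v (%k. f k + g k) = qd v f + 2*Re (qf v f g) + qd v g"
 unfolding qd_def using assms by (simp add: qf_add_left[OF assms(1)] qf_add_right[OF assms(1)] hs_add qf_commute[of v g f])

lemma qd_diff: assumes "pot s v" "hs f" "hs g" shows "qd v (%k. f k - g k) = qd v f - 2*Re (qf v f g) + qd v g"
 unfolding qd_def using assms by (simp add: qf_diff_left[OF assms(1)] qf_diff_right[OF assms(1)] hs_diff qf_commute[of v g f])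

lemma qd_scale: "qd v (%k. c*f k) = sqn c*qd v f"
proof -
 have "qf v (%k. c*f k) (%k. c*f k) = (c*cnj c)*qf v f f" by (simp add: qf_scale_left qf_scale_right mult_ac)
 also have "... = of_real (sqn c*qd v f)" unfolding complex_norm_square[symmetric] qf_qd by simp
 finally show ?thesis unfolding qf_qd of_real_eq_iff .
qed

text \<open>Hilbert-Schmidt norm at most 1/2: the Toeplitz form is then at most half of the energy
  at level \<open>L\<close>, which is coercivity.\<close>

definition small_at :: "cseq => real => bool" where
 "small_at v L <-> L >= 1 \<and> nsq (hk L v) <= 1/4"

text \<open>One threshold serves a whole ball of potentials; all later uniformity in the potential
  comes from here.\<close>

lemma small_at_exists:
 assumes s: "0 < s" "s < 1/2"
 obtains L0 where "L0 >= 1" "!!v L. v:hplus (- s) ==> wn (- s) v <= R ==> L >= L0 ==> small_at v L"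
proof -
 have "((%L. KK s*R*L powr (- (1/2 - s))) \<longlongrightarrow> KK s*R*0) at_top"
  by (intro tendsto_mult_left tendsto_neg_powr filterlim_ident) (use s in auto)
 hence "\<forall>\<^sub>F L in at_top. KK s*R*L powr (- (1/2 - s)) < 1/4"
  by (intro order_tendstoD) auto
 then obtain L0 where L0: "!!L. L >= L0 ==> KK s*R*L powr (- (1/2 - s)) < 1/4"
  unfolding eventually_at_top_linorder by blast
 show ?thesis
 proof (rule that[of "max 1 L0"])
  fix v L assume v: "v:hplus (- s)" "wn (- s) v <= R" and L: "max 1 L0 <= L"
  have "nsq (hk L v) <= KK s*wn (- s) v * L powr (- (1/2 - s))"
   using hk_bound(2)[OF s _ v(1)] L by simp
  also have "... <= KK s*R*L powr (- (1/2 - s))"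
   by (intro mult_right_mono mult_left_mono v KK_nonneg) auto
  also have "... <= 1/4" using L0[of L] L by simp
  finally show "small_at v L" using L by (simp add: small_at_def)
 qed auto
qed

lemma small_at_ex: assumes "pot s v" obtains L where "small_at v L"
 using small_at_exists[of s "wn (-s) v"] assms unfolding pot_def by (metis order_refl)

lemma qd_coercive:
 assumes "pot s v" "small_at v L" "hs f"
 shows "en L f/2 <= qd v f + L*nsq f" "qd v f + L*nsq f <= 3/2*en L f" "\<bar>Re (tf v f f)\<bar> <= en L f/2"
proof -
 have L: "L >= 1" using assms by (simp add: small_at_def)
 have "\<bar>Re (tf v f f)\<bar> <= cmod (tf v f f)" by (rule abs_Re_le_cmod)
 also have "... <= sqrt (nsq (hk L v)) * sqrt (en L f*en L f)" by (rule tf_bound[OF assms(1,3,3) L])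
 also have "... <= sqrt (1/4) * sqrt (en L f*en L f)"
  by (intro mult_right_mono) (use assms in "auto simp: small_at_def simp del: real_sqrt_le_iff intro: real_sqrt_le_mono")
 also have "... = en L f/2" by (simp add: real_sqrt_divide)
 finally show "\<bar>Re (tf v f f)\<bar> <= en L f/2" .
 thus "en L f/2 <= qd v f + L*nsq f" "qd v f + L*nsq f <= 3/2*en L f"
  using qd_eq[OF assms(3), of L v] L by linarith+
qed

section \<open>Unit vectors and the shift, which is multiplication by exp(ix), with its adjoint
  \<open>bs\<close>\<close>

definition ev :: "nat => nat => complex" where "ev k j = (if j = k then 1 else 0)"
definition sh :: "cseq => nat => complex" where "sh f k = (case k of 0 => 0 | Suc j => f j)"
definition bs :: "cseq => nat => complex" where "bs f k = f (Suc k)"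

lemma sh_simps [simp]: "sh f 0 = 0" "sh f (Suc j) = f j" by (auto simp: sh_def)

lemma hs_ev [simp]: "hs (ev k)" by (rule hs_finite_support) (simp add: ev_def)
lemma ell2_ev [simp]: "ell2 (ev k)" by (rule hs_ell2) simp

lemma infsum_single: "(INFSUM k. if k = a then f k else (0::'b::{comm_monoid_add,t2_space})) = f a"
proof -
 have "(INFSUM k. if k = a then f k else 0) = (INFSUM k:{a}. if k = a then f k else 0)"
  by (rule infsum_cong_neutral) auto
 thus ?thesis by simp
qed

lemma ip_ev_right: "ip f (ev k) = f k"
proof -
 have "ip f (ev k) = (INFSUM j. if j = k then f j else 0)" unfolding ip_def ev_def by (intro infsum_cong) auto
 thus ?thesis by (simp add: infsum_single)
qed

lemma ip_ev_left: "ip (ev k) f = cnj (f k)"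
 using ip_ev_right[of f k] by (simp add: ip_commute[of "ev k" f])

lemma nsq_ev [simp]: "nsq (ev k) = 1"
 using ip_self[of "ev k"] by (simp add: ip_ev_right, simp add: ev_def)

lemma sh_ev: "sh (ev k) = ev (Suc k)" by (auto simp: sh_def ev_def fun_eq_iff split: nat.splits)

lemma infsum_Suc_neutral:
 assumes "f 0 = (0::'b::{comm_monoid_add,t2_space})" shows "(INFSUM k. f k) = (INFSUM k. f (Suc k))"
proof -
 have "(INFSUM k. f k) = (INFSUM k:range Suc. f k)"
  by (rule infsum_cong_neutral) (use assms in "auto simp: image_iff, metis not0_implies_Suc")
 also have "... = (INFSUM k. f (Suc k))" by (subst infsum_reindex) (auto simp: o_def)
 finally show ?thesis .
qed

lemma ip_sh: "ip (sh f) (sh g) = ip f g" unfolding ip_def by (subst infsum_Suc_neutral) auto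
lemma ip_sh_bs: "ip (sh f) g = ip f (bs g)" unfolding ip_def bs_def by (subst infsum_Suc_neutral) auto
lemma nsq_sh: "nsq (sh f) = nsq f" using ip_sh[of f f] by (simp add: ip_self)

lemma ell2_sh: "ell2 f ==> ell2 (sh f)"
proof -
 assume "ell2 f"
 hence "(%k. sqn (sh f k)) summable_on range Suc"
  unfolding ell2_def by (subst summable_on_reindex) (auto simp: o_def)
 thus ?thesis unfolding ell2_def
  by (rule summable_on_cong_neutral[THEN iffD1, rotated 3]) (auto simp: sh_def split: nat.splits)
qed

lemma ell2_bs: "ell2 f ==> ell2 (bs f)"
proof -
 assume f: "ell2 f"
 have "(SUM k:F. sqn (bs f k)) <= nsq f" if "finite F" for F
 proof -
  have "(SUM k:F. sqn (bs f k)) = (SUM k:Suc ` F. sqn (f k))" by (subst sum.reindex) (auto simp: bs_def)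
  also have "... <= nsq f" by (rule sum_le_nsq[OF f]) (use that in auto)
  finally show ?thesis .
 qed
 thus ?thesis by (rule ell2I_bound)
qed

lemma hs_sh: "hs f ==> hs (sh f)"
proof -
 assume f: "hs f"
 have "sh (wt 2 f) = wt 1 (sh f)" by (auto simp: fun_eq_iff sh_def wt_def split: nat.splits)
 thus ?thesis unfolding hs_def using ell2_sh[of "wt 2 f"] hs_iff[of 2 f] f by simp
qed

lemma hs_bs: "hs f ==> hs (bs f)"
proof -
 assume f: "hs f"
 have "bs (wt 1 f) = wt 2 (bs f)" by (auto simp: fun_eq_iff bs_def wt_def)
 thus ?thesis using ell2_bs[of "wt 1 f"] hs_iff[of 2 "bs f"] f by (simp add: hs_def)
qed

lemma sh_bs: "f = (%k. sh (bs f) k + f 0*ev 0 k)"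
 by (auto simp: fun_eq_iff sh_def bs_def ev_def split: nat.splits)

text \<open>Entries depend on the difference of the indices only, and pairs outside the image of the
  double shift contribute 0.\<close>

lemma tf_sh: "tf v (sh f) (sh g) = tf v f g"
proof -
 let ?h = "%p. tz v (fst p) (snd p) * sh f (snd p)*cnj (sh g (fst p))"
 have "tf v (sh f) (sh g) = infsum ?h (range (map_prod Suc Suc))"
  unfolding tf_def
 proof (rule infsum_cong_neutral)
  fix p :: "nat \<times> nat" assume "p:UNIV - range (map_prod Suc Suc)"
  hence "fst p = 0 \<or> snd p = 0"
   by (cases p; cases "fst p"; cases "snd p") (auto simp: image_iff)
  thus "?h p = 0" by auto
 qed auto
 also have "... = (INFSUM p. ?h (map_prod Suc Suc p))"
  by (subst infsum_reindex) (auto simp: o_def inj_on_def)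
 also have "... = tf v f g" unfolding tf_def by (intro infsum_cong) simp
 finally show ?thesis .
qed

lemma dpart_sh: assumes "hs f" "hs g" shows "dpart (sh f) (sh g) = dpart f g + ip f g"
proof -
 have "dpart (sh f) (sh g) = (INFSUM k. of_nat k*f k*cnj (g k) + f k*cnj (g k))"
  unfolding dpart_def by (subst infsum_Suc_neutral) (auto simp: algebra_simps)
 also have "... = dpart f g + ip f g" unfolding dpart_def ip_def
  by (rule infsum_add) (use assms in "auto intro: dpart_summable ip_summable")
 finally show ?thesis .
qed

text \<open>Conjugating the Lax operator by the shift adds the identity: Toeplitz entries are
  unchanged while the diagonal entry k becomes k + 1.\<close>

lemma qf_sh: "hs f ==> hs g ==> qf v (sh f) (sh g) = qf v f g + ip f g"
 by (simp add: qf_def tf_sh dpart_sh)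

lemma qd_sh: "hs f ==> qd v (sh f) = qd v f + nsq f"
 by (simp add: qd_def qf_sh ip_self)

lemma tf_ev_left:
 shows "tf v (ev l) g = (INFSUM k. tz v k l*cnj (g k))"
proof -
 have "tf v (ev l) g = (INFSUM p:range (%k. (k, l)). tz v (fst p) (snd p)*ev l (snd p)*cnj (g (fst p)))"
  unfolding tf_def
 proof (rule infsum_cong_neutral)
  fix p :: "nat \<times> nat" assume "p:UNIV - range (%k. (k, l))"
  hence "snd p ~= l" by (cases p) auto
  thus "tz v (fst p) (snd p)*ev l (snd p)*cnj (g (fst p)) = 0" by (simp add: ev_def)
 qed auto
 also have "... = (INFSUM k. tz v k l*cnj (g k))"
  by (subst infsum_reindex) (auto simp: o_def inj_on_def ev_def)
 finally show ?thesis .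
qed

lemma tf_ev_ev: "tf v (ev l) (ev k) = tz v k l"
proof -
 have "tf v (ev l) (ev k) = (INFSUM j. if j = k then tz v j l else 0)"
  unfolding tf_ev_left by (intro infsum_cong) (auto simp: ev_def)
 thus ?thesis by (simp add: infsum_single)
qed

lemma dpart_ev_left: "dpart (ev l) g = of_nat l*cnj (g l)"
proof -
 have "dpart (ev l) g = (INFSUM j. if j = l then of_nat j*cnj (g j) else 0)"
  unfolding dpart_def by (intro infsum_cong) (auto simp: ev_def)
 thus ?thesis by (simp add: infsum_single)
qed

lemma qf_ev_ev: "qf v (ev l) (ev k) = (if k = l then of_nat l else 0) - tz v k l"
 by (simp add: qf_def tf_ev_ev dpart_ev_left) (simp add: ev_def)

section \<open>Spectral theory of the Toeplitz form\<close>

text \<open>Gaussian elimination: a nonzero coefficient at the pivot \<open>p\<close> removes one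
  equation and one unknown. This is the dimension count behind the minimax arguments.\<close>

lemma homogeneous_system:
 fixes a :: "'i => 'k => complex"
 assumes "finite I" "finite K" "card I < card K"
 shows "EX c. (EX k:K. c k ~= 0) \<and> (ALL i:I. (SUM k:K. c k*a i k) = 0)"
 using assms
proof (induction I arbitrary: K a rule: finite_induct)
 case empty
 hence "K ~= {}" by auto
 thus ?case by (intro exI[of _ "%_. 1"]) auto
next
 case (insert i I)
 show ?case
 proof (cases "ALL k:K. a i k = 0")
  case True
  have "card I < card K" using insert by auto
  from insert.IH[OF insert.prems(1) this, of a] obtain c where
   "EX k:K. c k ~= 0" "ALL i:I. (SUM k:K. c k*a i k) = 0" by blast
  thus ?thesis using True by (intro exI[of _ c]) auto
 next
  case False
  then obtain p where p: "p:K" "a i p ~= 0" by auto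
  define K' where "K' = K - {p}"
  have K': "finite K'" "card I < card K'" "p ~: K'" "K = insert p K'"
   using insert p by (auto simp: K'_def)
  define b where "b j k = a j k - a j p*a i k/a i p" for j k
  from insert.IH[OF K'(1,2), of b] obtain c where
   c: "EX k:K'. c k ~= 0" "!!j. j:I ==> (SUM k:K'. c k*b j k) = 0" by blast
  define d where "d = - (SUM k:K'. c k*a i k)/a i p"
  define c' where "c' = c(p := d)"
  have sum: "(SUM k:K. c' k*a j k) = d*a j p + (SUM k:K'. c k*a j k)" for j
  proof -
   have "(SUM k:K. c' k*a j k) = c' p*a j p + (SUM k:K'. c' k*a j k)"
    unfolding K'(4) by (rule sum.insert) (use K' in auto)
   also have "(SUM k:K'. c' k*a j k) = (SUM k:K'. c k*a j k)"
    by (rule sum.cong) (use K'(3) in "auto simp: c'_def")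
   finally show ?thesis by (simp add: c'_def)
  qed
  have "(SUM k:K. c' k*a j k) = 0" if "j:insert i I" for j
  proof (cases "j = i")
   case True thus ?thesis unfolding sum using p by (simp add: d_def)
  next
   case False
   hence "0 = (SUM k:K'. c k*a j k - c k*a i k*(a j p/a i p))"
    using c(2)[of j] that by (simp add: b_def algebra_simps)
   also have "... = (SUM k:K'. c k*a j k) - (SUM k:K'. c k*a i k)*(a j p/a i p)"
    by (simp add: sum_subtractf sum_distrib_right sum_divide_distrib)
   finally show ?thesis unfolding sum by (simp add: d_def algebra_simps)
  qed
  moreover have "EX k:K. c' k ~= 0" using c(1) K' by (auto simp: c'_def)
  ultimately show ?thesis by blast
 qed
qed

text \<open>The quantitative form of the compact embedding of the form domain into ell2.\<close>

lemma nsq_le_head_tail: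
 assumes "hs d" shows "nsq d <= (SUM k<K. sqn (d k)) + en 1 d/(real K + 1)"
proof -
 have "(SUM k:F. sqn (d k)) <= (SUM k<K. sqn (d k)) + en 1 d/(real K + 1)" if "finite F" for F
 proof -
  have "(SUM k:F. sqn (d k)) = (SUM k:F Int {..<K}. sqn (d k)) + (SUM k:F - {..<K}. sqn (d k))"
   using that by (simp add: sum.Int_Diff[of F _ "{..<K}"])
  also have "... <= (SUM k<K. sqn (d k)) + (SUM k:F - {..<K}. sqn (wt 1 d k)/(real K + 1))"
  proof (intro add_mono sum_mono)
   show "(SUM k:F Int {..<K}. sqn (d k)) <= (SUM k<K. sqn (d k))" by (rule sum_mono2) auto
   fix k assume "k:F - {..<K}"
   hence "(real K + 1) * sqn (d k) <= (real k + 1) * sqn (d k)" by (intro mult_right_mono) auto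
   thus "sqn (d k) <= sqn (wt 1 d k)/(real K + 1)"
    by (simp add: wt_cmod_sq field_simps)
  qed
  also have "(SUM k:F - {..<K}. sqn (wt 1 d k)/(real K + 1)) <= en 1 d/(real K + 1)"
   unfolding sum_divide_distrib[symmetric] en_def
   by (intro divide_right_mono sum_le_nsq) (use assms that in "auto simp: hs_def")
  finally show ?thesis by simp
 qed
 thus ?thesis by (rule ell2I_bound)
qed

text \<open>Rellich: bounded energy makes the tails uniformly small, so coordinatewise convergence
  becomes convergence in norm.\<close>

lemma hs_limit:
 assumes "!!j. hs (f j)" "!!j. en 1 (f j) <= C" "!!k. (%j::nat. f j k) ----> g k"
 shows "hs g" "en 1 g <= C" "(%j. nsq (%k. f j k - g k)) ----> 0"
proof -
 have w: "(%j. wt 1 (f j) k) ----> wt 1 g k" for k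
  unfolding wt_def by (intro tendsto_intros assms)
 show g: "hs g" "en 1 g <= C" using nsq_fatou[of "%j. wt 1 (f j)" C "wt 1 g"] assms w
  by (auto simp: hs_def en_def)
 have C: "C >= 0" using assms(2)[of 0] en_nonneg[of 1 "f 0"] by linarith
 have e: "en 1 (%k. f j k - g k) <= 4*C" for j
  using ell2_diff(2)[of "wt 1 (f j)" "wt 1 g"] assms(1)[of j] assms(2)[of j] g unfolding en_def wt_diff hs_def by simp
 show "(%j. nsq (%k. f j k - g k)) ----> 0"
 proof (rule LIMSEQ_I)
  fix r :: real assume r: "r > 0"
  obtain K :: nat where K: "4*C/(r/2) < real K" using reals_Archimedean2 by blast
  hence K2: "4*C/(real K + 1) < r/2"
   using r C by (simp add: field_simps)
  have "(%j. SUM k<K. sqn (f j k - g k)) ----> (SUM k<K. sqn (g k - g k))"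
   by (intro tendsto_intros assms)
  hence "EV j. (SUM k<K. sqn (f j k - g k)) < r/2"
   by (rule order_tendstoD) (use r in auto)
  then obtain N where N: "!!j. j >= N ==> (SUM k<K. sqn (f j k - g k)) < r/2"
   unfolding eventually_sequentially by blast
  have "norm (nsq (%k. f j k - g k) - 0) < r" if "j >= N" for j
  proof -
   have "nsq (%k. f j k - g k) <= (SUM k<K. sqn (f j k - g k)) + en 1 (%k. f j k - g k)/(real K + 1)"
    by (rule nsq_le_head_tail) (intro hs_diff assms g)
   also have "en 1 (%k. f j k - g k)/(real K + 1) <= 4*C/(real K + 1)"
    by (intro divide_right_mono e) auto
   finally show ?thesis using N[OF that] K2 by simp
  qed
  thus "EX no. ALL j>=no. norm (nsq (%k. f j k - g k) - 0) < r" by blast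
 qed
qed

text \<open>Diagonal argument; dividing by \<open>B x + 1\<close> turns the bounds into the uniform
  bound 1.\<close>

lemma pointwise_subsequence:
 fixes f :: "nat => 'a::countable => complex"
 assumes "!!j x. cmod (f j x) <= B x"
 obtains r g where "strict_mono (r :: nat => nat)" "!!x. (%j. f (r j) x) ----> g x"
proof -
 have B: "B x >= 0" for x using assms[of 0 x] norm_ge_zero order_trans by blast
 have n1: "cmod (f j x/of_real (B x + 1)) <= 1" for j x
  using assms[of j x] B[of x] by (simp add: norm_divide divide_le_eq del: of_real_add of_real_1)
 obtain r where r: "strict_mono r" "!!x. x:UNIV ==> EX l. (%j. f (r j) x/of_real (B x + 1)) ----> l"
  by (rule function_convergent_subsequence[of UNIV "%j x. f j x/of_real (B x + 1)" 1]) (use n1 in blast)+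
 have "ALL x. EX l. (%j. f (r j) x/of_real (B x + 1)) ----> l" using r(2) by blast
 from choice[OF this] obtain l where l: "!!x. (%j. f (r j) x/of_real (B x + 1)) ----> l x" by blast
 have lim: "(%j. f (r j) x) ----> l x * of_real (B x + 1)" for x
 proof -
  have "complex_of_real (B x + 1) ~= 0" using B[of x] by (simp only: of_real_eq_0_iff)
  thus ?thesis using tendsto_mult_right[OF l[of x], of "of_real (B x + 1)"] by simp
 qed
 show ?thesis by (rule that[OF r(1) lim])
qed

lemma hs_compact:
 assumes "!!j. hs (f j)" "!!j. en 1 (f j) <= C"
 obtains r g where "strict_mono (r :: nat => nat)" "!!k. (%j. f (r j) k) ----> g k"
proof -
 have "cmod (f j k) <= sqrt C" for j k
 proof -
  have "nsq (f j) <= C" using nsq_le_en[OF assms(1), of 1 j] assms(2)[of j] by simp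
  thus ?thesis
   using coord_le_sqrt_nsq[OF hs_ell2[OF assms(1)], of j k] real_sqrt_le_mono order_trans by blast
 qed
 thus ?thesis using pointwise_subsequence[of f "%_. sqrt C"] that by blast
qed

text \<open>The kernel \<open>hk 1 v\<close> is fixed and square summable, while the rank one
  kernels converge weakly; so both arguments may vary at once.\<close>

lemma tf_tendsto:
 assumes v: "pot s v"
  and f: "!!j. hs (f j)" "!!j. en 1 (f j) <= C" "!!k. (%j::nat. f j k) ----> f' k"
  and g: "!!j. hs (g j)" "!!j. en 1 (g j) <= C" "!!k. (%j::nat. g j k) ----> g' k"
 shows "(%j. tf v (f j) (g j)) ----> tf v f' g'"
proof -
 have C: "C >= 0" using f(2)[of 0] en_nonneg[of 1 "f 0"] by linarith
 have "(%j. ip (pr 1 (f j) (g j)) (hk 1 v)) ----> ip (pr 1 f' g') (hk 1 v)"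
 proof (rule weak_convergence)
  show "ell2 (pr 1 (f j) (g j))" for j by (intro pr_ell2 f g) simp
  show "nsq (pr 1 (f j) (g j)) <= C*C" for j
   by (rule order_trans[OF pr_ell2(2)]) (auto intro!: f g mult_mono C)
  show "ell2 (hk 1 v)" by (rule pot_hk[OF v]) simp
  show "(%j. pr 1 (f j) (g j) k) ----> pr 1 f' g' k" for k
   unfolding pr_def wt_def by (intro tendsto_intros f g)
 qed
 hence "(%j. cnj (ip (pr 1 (f j) (g j)) (hk 1 v))) ----> cnj (ip (pr 1 f' g') (hk 1 v))"
  by (rule tendsto_cnj)
 thus ?thesis by (simp add: ip_commute[symmetric] tf_ip[of 1, symmetric])
qed

lemma dpart_tendsto:
 assumes f: "!!j. hs (f j)" "!!j. en 1 (f j) <= C" "!!k. (%j::nat. f j k) ----> f' k" and g: "hs g"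
 shows "(%j. dpart (f j) g) ----> dpart f' g" "(%j. ip (f j) g) ----> ip f' g"
proof -
 have f': "hs f'" by (rule hs_limit[OF f])
 have n: "nsq (f j) <= C" for j using nsq_le_en[of "f j" 1] f(1,2)[of j] by simp
 have w: "(%j. wt 1 (f j) k) ----> wt 1 f' k" for k
  unfolding wt_def by (intro tendsto_intros f)
 have 1: "(%j. ip (wt 1 (f j)) (wt 1 g)) ----> ip (wt 1 f') (wt 1 g)"
  by (rule weak_convergence[of _ C]) (use f g w in "auto simp: hs_def en_def")
 show 2: "(%j. ip (f j) g) ----> ip f' g"
  by (rule weak_convergence[of _ C]) (use f g n in auto)
 have eq: "dpart h g = ip (wt 1 h) (wt 1 g) - ip h g" if "hs h" for h
  using dpart_ip[of h g 1] that g by (simp add: algebra_simps)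
 show "(%j. dpart (f j) g) ----> dpart f' g"
  using tendsto_diff[OF 1 2] by (simp add: eq f f')
qed

lemma qf_tendsto:
 assumes v: "pot s v"
  and f: "!!j. hs (f j)" "!!j. en 1 (f j) <= C" "!!k. (%j::nat. f j k) ----> f' k" and g: "hs g"
 shows "(%j. qf v (f j) g) ----> qf v f' g"
proof -
 have "(%j. tf v (f j) g) ----> tf v f' g"
  by (rule tf_tendsto[OF v, of f "max C (en 1 g)" f' "%_. g" g]) (use f g in "auto intro: max.coboundedI1")
 thus ?thesis unfolding qf_def by (intro tendsto_diff dpart_tendsto[OF f g])
qed

text \<open>The energy is lower semicontinuous by Fatou; the norm and the Toeplitz part are even
  continuous along the sequence.\<close>

lemma qd_lsc:
 assumes v: "pot s v"
  and f: "!!j. hs (f j)" "!!j. en 1 (f j) <= C" "!!k. (%j::nat. f j k) ----> f' k"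
  and c: "!!j. qd v (f j) <= c j" "c ----> c'"
 shows "qd v f' <= c'" "(%j. nsq (f j)) ----> nsq f'"
proof -
 note lim = hs_limit[OF f]
 show n: "(%j. nsq (f j)) ----> nsq f'"
 proof -
  have eq: "nsq (f j) = nsq (%k. f j k - f' k) + 2*Re (ip (f j) f') - nsq f'" for j
   using nsq_diff[OF hs_ell2 hs_ell2, OF f(1)[of j] lim(1)] by simp
  have "(%j. ip (f j) f') ----> ip f' f'"
   by (rule dpart_tendsto[OF f lim(1)])
  hence "(%j. nsq (%k. f j k - f' k) + 2*Re (ip (f j) f') - nsq f') ----> 0 + 2*Re (ip f' f') - nsq f'"
   by (intro tendsto_intros lim)
  thus ?thesis unfolding eq by (simp add: ip_self)
 qed
 have t: "(%j. Re (tf v (f j) (f j))) ----> Re (tf v f' f')"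
  by (intro tendsto_Re tf_tendsto[OF v f f])
 have e: "en 1 (f j) <= c j + nsq (f j) + Re (tf v (f j) (f j))" for j
  using qd_eq[of "f j" 1 v] f(1)[of j] c(1)[of j] by simp
 have l: "(%j. c j + nsq (f j) + Re (tf v (f j) (f j))) ----> c' + nsq f' + Re (tf v f' f')"
  by (intro tendsto_intros c n t)
 have "en 1 f' <= c' + nsq f' + Re (tf v f' f') + eps" if "eps > 0" for eps
 proof -
  have "EV j. c j + nsq (f j) + Re (tf v (f j) (f j)) < c' + nsq f' + Re (tf v f' f') + eps"
   by (rule order_tendstoD[OF l]) (use that in simp)
  then obtain N where "!!j. j >= N ==> c j + nsq (f j) + Re (tf v (f j) (f j)) < c' + nsq f' + Re (tf v f' f') + eps"
   unfolding eventually_sequentially by blast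
  hence "!!j. j >= N ==> en 1 (f j) <= c' + nsq f' + Re (tf v f' f') + eps" using e by (meson less_imp_le order_trans)
  thus ?thesis
   using hs_limit(2)[of "%j. f (j + N)" "c' + nsq f' + Re (tf v f' f') + eps" f'] f(1) f(3)
    LIMSEQ_ignore_initial_segment[of "%j. f j _"] by auto
 qed
 hence "en 1 f' <= c' + nsq f' + Re (tf v f' f')" by (rule field_le_epsilon)
 thus "qd v f' <= c'" using qd_eq[OF lim(1), of 1 v] by simp
qed

definition epair :: "cseq => real => cseq => bool" where
 "epair v mu f <-> hs f \<and> (ALL h. hs h --> qf v f h = of_real mu*ip f h)"

lemma quadratic_nonneg_linear_zero:
 fixes b c :: real assumes "!!t. 2*t*b + t^2*c >= 0" shows "b = 0"
proof (rule ccontr)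
 assume b: "b ~= 0"
 \<comment> \<open>The minimiser of the quadratic whose leading coefficient is replaced by the
   positive \<open>\<bar>c\<bar> + 1\<close>.\<close>
 define t where "t = - b/(\<bar>c\<bar> + 1)"
 have p: "\<bar>c\<bar> + 1 > 0" by simp
 have "2*t*b + t^2*c <= 2*t*b + t^2*(\<bar>c\<bar> + 1)" by (intro add_left_mono mult_left_mono) auto
 also have "... = - b\<^sup>2/(\<bar>c\<bar> + 1)"
 proof -
  have "t*(\<bar>c\<bar> + 1) = - b" using p by (simp add: t_def)
  hence "t^2*(\<bar>c\<bar> + 1) = - t*b" by (simp add: power2_eq_square mult.assoc)
  hence "2*t*b + t^2*(\<bar>c\<bar> + 1) = t*b" by simp
  thus ?thesis by (simp add: t_def power2_eq_square)
 qed
 also have "... < 0" using b p by (simp add: divide_neg_pos)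
 finally show False using assms[of t] by simp
qed

section \<open>Eigenvectors by successive minimisation\<close>

definition feas :: "nat => (nat => nat => complex) => cseq => bool" where
 "feas n G h <-> hs h \<and> (ALL i<n. ip h (G i) = 0)"

lemma feas_add: "(!!i. i < n ==> ell2 (G i)) ==> feas n G f ==> feas n G h ==> feas n G (%k. f k + h k)"
 and feas_scale: "feas n G h ==> feas n G (%k. c*h k)"
 by (auto simp: feas_def hs_add hs_scale ip_scale_left ip_add_left hs_ell2)

text \<open>There are \<open>n + 1\<close> unit vectors and only \<open>n\<close> conditions on
  their combinations.\<close>

lemma feas_nonzero:
 assumes "!!i. i < n ==> ell2 (G i)"
 obtains h where "feas n G h" "nsq h = 1"
proof -
 obtain c where c: "EX k:{..n}. c k ~= 0" "ALL i:{..<n}. (SUM k:{..n}. c k*ip (ev k) (G i)) = 0"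
  using homogeneous_system[of "{..<n}" "{..n}" "%i k. ip (ev k) (G i)"] by auto
 define h where "h = (%j. SUM k:{..n}. c k*ev k j)"
 have hs: "hs h" unfolding h_def by (intro hs_sum hs_scale) auto
 have f: "feas n G h"
  unfolding feas_def using hs c(2) unfolding h_def
  by (auto simp: ip_sum_left assms ell2_scale ip_scale_left)
 obtain k where k: "k <= n" "c k ~= 0" using c(1) by auto
 have "h k = c k" unfolding h_def ev_def using k by (simp add: if_distrib cong: if_cong)
 hence "nsq h ~= 0" using nsq_eq_0[of h k] hs k by auto
 hence p: "nsq h > 0" using nsq_nonneg[of h] by linarith
 show ?thesis
  by (rule that[OF feas_scale[OF f, of "of_real (1/sqrt (nsq h))"]]) (use p in "unfold nsq_scale, simp add: norm_divide power_divide")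
qed

text \<open>Direct method: coercivity bounds a minimising sequence in energy, compactness gives a
  limit of norm 1, and lower semicontinuity makes it a minimiser.\<close>

lemma min_exists:
 assumes v: "pot s v" and G: "!!i. i < n ==> ell2 (G i)"
 obtains f mu where "feas n G f" "nsq f = 1" "qd v f = mu" "!!h. feas n G h ==> qd v h >= mu*nsq h"
proof -
 obtain L where L: "small_at v L" using small_at_ex[OF v] .
 hence L1: "L >= 1" by (simp add: small_at_def)
 define A where "A = qd v ` {h. feas n G h \<and> nsq h = 1}"
 define m where "m = Inf A"
 have lower: "a >= - L" if "a:A" for a
 proof -
  from that obtain h where h: "feas n G h" "nsq h = 1" "a = qd v h" by (auto simp: A_def)
  hence "hs h" by (simp add: feas_def)
  from qd_coercive(1)[OF v L this] h(2) have "en L h/2 <= qd v h + L" by simp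
  thus ?thesis using en_nonneg[of L h] h(3) by linarith
 qed
 hence bdd: "bdd_below A" by (rule bdd_belowI)
 have ne: "A ~= {}" using feas_nonzero[of n G, OF G] by (auto simp: A_def)
 have "EX h. feas n G h \<and> nsq h = 1 \<and> qd v h < m + 1/real (Suc j)" for j
 proof -
  have "Inf A < m + 1/real (Suc j)" by (simp add: m_def)
  then obtain a where "a:A" "a < m + 1/real (Suc j)" using cInf_lessD[OF ne] by blast
  thus ?thesis by (auto simp: A_def)
 qed
 then obtain f where f: "!!j. feas n G (f j)" "!!j. nsq (f j) = 1" "!!j. qd v (f j) < m + 1/real (Suc j)" by metis
 have fh: "hs (f j)" for j using f(1)[of j] by (simp add: feas_def)
 have e: "en 1 (f j) <= 2*(m + 1 + L)" for j
 proof -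
  have "qd v (f j) < m + 1" by (rule less_le_trans[OF f(3)]) simp
  moreover have "en L (f j)/2 <= qd v (f j) + L" using qd_coercive(1)[OF v L fh[of j]] f(2)[of j] by simp
  ultimately have "en L (f j) <= 2*(m + 1 + L)" by argo
  thus ?thesis using en_mono[OF fh, of 1 L j] L1 by simp
 qed
 obtain r g where r: "strict_mono (r :: nat => nat)" "!!k. (%j. f (r j) k) ----> g k"
  using hs_compact[of f, OF fh e] by metis
 have c: "(%j. m + 1/real (Suc (r j))) ----> m + 0"
  using LIMSEQ_subseq_LIMSEQ[OF LIMSEQ_Suc[OF lim_inverse_n'] r(1)]
  by (intro tendsto_add tendsto_const) (simp add: o_def)
 have lsc: "qd v g <= m + 0" "(%j. nsq (f (r j))) ----> nsq g"
  using qd_lsc[OF v, of "%j. f (r j)" "2*(m + 1 + L)" g "%j. m + 1/real (Suc (r j))" "m + 0"] fh e r(2) c less_imp_le[OF f(3)] by blast+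
 have g: "hs g" using hs_limit(1)[of "%j. f (r j)" "2*(m + 1 + L)" g] fh e r(2) by blast
 have n1: "nsq g = 1" using lsc(2) f(2) by (simp add: LIMSEQ_const_iff)
 have fg: "feas n G g"
  unfolding feas_def
 proof (intro conjI allI impI g)
  fix i assume i: "i < n"
  have "(%j. ip (f (r j)) (G i)) ----> ip g (G i)"
   by (rule weak_convergence[of _ 1]) (use fh f(2) r(2) G[OF i] in auto)
  thus "ip g (G i) = 0" using f(1) i by (simp add: feas_def LIMSEQ_const_iff)
 qed
 have mle: "m <= qd v h" if "feas n G h" "nsq h = 1" for h
  unfolding m_def by (rule cInf_lower[OF _ bdd]) (use that in "auto simp: A_def")
 show ?thesis
 proof (rule that[OF fg n1])
  show "qd v g = m" using mle[OF fg n1] lsc(1) by simp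
  fix h assume h: "feas n G h"
  show "m*nsq h <= qd v h"
  proof (cases "nsq h = 0")
   case True
   hence "h = (%k. 0)" using nsq_eq_0[of h] h by (auto simp: feas_def)
   thus ?thesis by (simp add: qd_def)
  next
   case False
   hence p: "nsq h > 0" using nsq_nonneg[of h] by linarith
   let ?c = "complex_of_real (1/sqrt (nsq h))"
   have "m <= qd v (%k. ?c*h k)"
    by (rule mle[OF feas_scale[OF h]]) (use p in "unfold nsq_scale, simp add: norm_divide power_divide")
   hence "m <= qd v h/nsq h"
    unfolding qd_scale using p by (simp add: norm_divide power_divide)
   thus ?thesis using p by (simp add: field_simps)
  qed
 qed
qed

definition eigen_system :: "cseq => nat => (nat => real) => (nat => nat => complex) => bool" where
 "eigen_system v n mu G <-> (ALL i<n. epair v (mu i) (G i)) \<and> (ALL i<n. ALL j<n. ip (G i) (G j) = (if i = j then 1 else 0))"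

text \<open>The first variation at a minimiser vanishes on admissible directions; a general
  direction differs from an admissible one by a combination of earlier eigenvectors, where form and
  inner product with \<open>f\<close> both vanish.\<close>

lemma next_eigenvector:
 assumes v: "pot s v" and G: "eigen_system v n mu G"
 obtains f nu where "epair v nu f" "nsq f = 1" "!!i. i < n ==> ip f (G i) = 0"
  "!!h. feas n G h ==> qd v h >= nu*nsq h"
proof -
 have Gh: "hs (G i)" if "i < n" for i using G that by (auto simp: eigen_system_def epair_def)
 obtain f m where f: "feas n G f" "nsq f = 1" "qd v f = m" "!!h. feas n G h ==> qd v h >= m*nsq h"
  using min_exists[OF v, of n G] Gh by blast
 have fh: "hs f" using f(1) by (simp add: feas_def)
 have re: "Re (qf v f h - of_real m*ip f h) = 0" if h: "feas n G h" for h
 proof (rule quadratic_nonneg_linear_zero)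
  fix t :: real
  have hh: "hs h" using h by (simp add: feas_def)
  have "feas n G (%k. f k + of_real t*h k)"
   by (intro feas_add feas_scale f h) (use Gh in auto)
  hence "m*nsq (%k. f k + of_real t*h k) <= qd v (%k. f k + of_real t*h k)" by (rule f(4))
  moreover have "nsq (%k. f k + of_real t*h k) = 1 + 2*t*Re (ip f h) + t^2*nsq h"
   using fh hh f(2) by (subst nsq_add) (auto simp: nsq_scale ip_scale_right ell2_scale hs_ell2)
  moreover have "qd v (%k. f k + of_real t*h k) = m + 2*t*Re (qf v f h) + t^2*qd v h"
   using fh hh f(3) by (subst qd_add[OF v]) (auto simp: qd_scale qf_scale_right hs_scale)
  ultimately show "0 <= 2*t*Re (qf v f h - of_real m*ip f h) + t^2*(qd v h - m*nsq h)"
   by (simp add: algebra_simps)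
 qed
 have eq: "qf v f h = of_real m*ip f h" if h: "feas n G h" for h
 proof -
  \<comment> \<open>The direction \<open>h\<close> multiplied by the imaginary unit is admissible
    too.\<close>
  have "Im (qf v f h - of_real m*ip f h) = 0"
   using re[OF feas_scale[OF h, of \<i>]] by (simp add: qf_scale_right ip_scale_right algebra_simps)
  thus ?thesis using re[OF h] by (simp add: complex_eq_iff)
 qed
 show ?thesis
 proof (rule that[of m f])
  show "nsq f = 1" by (rule f(2))
  show "!!i. i < n ==> ip f (G i) = 0" using f(1) by (simp add: feas_def)
  show "!!h. feas n G h ==> qd v h >= m*nsq h" by (rule f(4))
  show "epair v m f"
   unfolding epair_def
  proof (intro conjI allI impI fh)
   fix h assume h: "hs h"
   define p where "p = (%k. SUM i<n. ip h (G i)*G i k)"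
   have ph: "hs p" unfolding p_def by (intro hs_sum hs_scale Gh) auto
   define d where "d = (%k. h k - p k)"
   have dh: "hs d" unfolding d_def by (intro hs_diff h ph)
   have ipp: "ip p (G j) = ip h (G j)" if "j < n" for j
   proof -
    have "ip p (G j) = (SUM i<n. ip h (G i)*ip (G i) (G j))"
     unfolding p_def using Gh that by (subst ip_sum_left) (auto simp: ip_scale_left intro!: ell2_scale)
    also have "... = (SUM i<n. if i = j then ip h (G i) else 0)"
     using G that by (intro sum.cong) (auto simp: eigen_system_def)
    also have "... = ip h (G j)" using that by (simp add: sum.delta)
    finally show ?thesis .
   qed
   have "feas n G d" unfolding feas_def using dh ipp Gh ph h
    by (auto simp: d_def ip_diff_left hs_ell2)
   hence 1: "qf v f d = of_real m*ip f d" by (rule eq)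
   have fG: "ip f (G i) = 0" "qf v f (G i) = 0" if "i < n" for i
   proof -
    show "ip f (G i) = 0" using f(1) that by (simp add: feas_def)
    hence "ip (G i) f = 0" using ip_commute[of "G i" f] by simp
    hence "qf v (G i) f = 0" using G that fh by (simp add: eigen_system_def epair_def)
    thus "qf v f (G i) = 0" using qf_commute[of v f "G i"] by simp
   qed
   have 2: "ip f p = 0" unfolding p_def using Gh fh fG(1)
    by (subst ip_sum_right) (auto simp: ip_scale_right intro!: ell2_scale sum.neutral)
   have 3: "qf v f p = 0" unfolding p_def using Gh fh fG(2)
    by (subst qf_sum_right[OF v]) (auto simp: qf_scale_right intro!: hs_scale sum.neutral)
   have hd: "h = (%k. d k + p k)" by (auto simp: d_def)
   show "qf v f h = of_real m*ip f h"
    unfolding hd using 1 2 3 fh dh ph by (simp add: qf_add_right[OF v] ip_add_right hs_ell2)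
  qed
 qed
qed

text \<open>Minimality of \<open>mu n\<close> on the orthogonal complement of the earlier vectors
  yields both the ordering of the eigenvalues and the completeness of the eigenvectors.\<close>

definition ebasis :: "cseq => (nat => real) => (nat => nat => complex) => bool" where
 "ebasis v mu F <-> (ALL n. eigen_system v n mu F) \<and> (ALL n h. feas n F h --> qd v h >= mu n*nsq h)"

lemma eigen_system_Suc:
 "eigen_system v (Suc n) mu G <-> eigen_system v n mu G \<and> epair v (mu n) (G n) \<and> nsq (G n) = 1 \<and> (ALL i<n. ip (G n) (G i) = 0)"
 (is "?L <-> ?R")
proof
 assume L: ?L
 have "ip (G n) (G n) = 1" using L by (auto simp: eigen_system_def)
 hence "nsq (G n) = 1" unfolding ip_self by simp
 thus ?R using L by (auto simp: eigen_system_def)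
next
 assume R: ?R
 have 1: "ip (G i) (G n) = 0" if "i < n" for i using R that ip_commute[of "G i" "G n"] by simp
 have 2: "ip (G n) (G n) = 1" using R by (simp add: ip_self)
 show ?L using R 1 2 unfolding eigen_system_def less_Suc_eq by auto
qed

lemma ebasis_exists:
 assumes v: "pot s v" obtains mu F where "ebasis v mu F"
proof -
 \<comment> \<open>\<open>P x n y\<close> reads \<open>x\<close> only below \<open>n\<close>, as the
   choice of a dependent sequence requires.\<close>
 define P :: "(nat => real \<times> cseq) => nat => real \<times> cseq => bool" where
  "P = (%x n y. epair v (fst y) (snd y) \<and> nsq (snd y) = 1 \<and> (ALL i<n. ip (snd y) (snd (x i)) = 0) \<and>
   (ALL h. feas n (%i. snd (x i)) h --> qd v h >= fst y*nsq h))"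
 have "EX x. ALL n. P x n (x n)"
 proof (rule dependent_wellorder_choice)
  fix r f g and x :: nat assume "!!y. y < x ==> (f y :: real \<times> cseq) = g y"
  thus "P f x r = P g x r" by (simp add: P_def feas_def)
 next
  fix n x assume IH: "!!y. y < n ==> P x y (x y)"
  have "eigen_system v k (%i. fst (x i)) (%i. snd (x i))" if "k <= n" for k
   using that
  proof (induction k)
   case 0 show ?case by (simp add: eigen_system_def)
  next
   case (Suc k) thus ?case using IH[of k] by (simp add: eigen_system_Suc P_def)
  qed
  from this[of n] obtain f nu where "epair v nu f" "nsq f = 1" "!!i. i < n ==> ip f (snd (x i)) = 0"
   "!!h. feas n (%i. snd (x i)) h ==> qd v h >= nu*nsq h"
   using next_eigenvector[OF v] by (metis order_refl)
  thus "EX r. P x n r" by (intro exI[of _ "(nu, f)"]) (auto simp: P_def)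
 qed
 then obtain x where x: "!!n. P x n (x n)" by blast
 have "eigen_system v k (%i. fst (x i)) (%i. snd (x i))" for k
 proof (induction k)
  case 0 show ?case by (simp add: eigen_system_def)
 next
  case (Suc k) thus ?case using x[of k] by (simp add: eigen_system_Suc P_def)
 qed
 hence "ebasis v (%i. fst (x i)) (%i. snd (x i))"
  using x unfolding ebasis_def P_def by auto
 thus ?thesis by (rule that)
qed

section \<open>Expansions in an eigenbasis\<close>

locale spectral =
 fixes s :: real and v :: cseq and mu :: "nat => real" and F :: "nat => nat => complex"
 assumes pot: "pot s v" and basis: "ebasis v mu F"
begin

lemma epF: "epair v (mu n) (F n)"
 using basis unfolding ebasis_def eigen_system_def by blast

lemma hsF [simp]: "hs (F n)" using epF by (simp add: epair_def)
lemma l2F [simp]: "ell2 (F n)" by (rule hs_ell2) simp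

lemma onF: "ip (F m) (F n) = (if m = n then 1 else 0)"
proof -
 have "eigen_system v (Suc (max m n)) mu F" using basis by (simp add: ebasis_def)
 thus ?thesis unfolding eigen_system_def by (auto simp: less_Suc_eq_le)
qed

lemma nsqF [simp]: "nsq (F n) = 1" using onF[of n n] by (simp add: ip_self)

lemma qfF: "hs h ==> qf v (F n) h = of_real (mu n)*ip (F n) h"
 using epF by (simp add: epair_def)

lemma qfF_right: "hs h ==> qf v h (F n) = of_real (mu n)*ip h (F n)"
 using qfF[of h n] qf_commute[of v h "F n"] ip_commute[of h "F n"] by simp

lemma qdF: "qd v (F n) = mu n" by (simp add: qd_def qfF ip_self)

lemma minF: "feas n F h ==> qd v h >= mu n*nsq h"
 using basis by (simp add: ebasis_def)

lemma mu_mono_Suc: "mu n <= mu (Suc n)"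
 using minF[of n "F (Suc n)"] by (simp add: feas_def onF qdF)

lemma mu_mono: "m <= n ==> mu m <= mu n"
 by (rule lift_Suc_mono_le[of mu]) (use mu_mono_Suc in auto)

lemma comb:
 assumes "finite I"
 shows "hs (%k. SUM n:I. c n*F n k)" "nsq (%k. SUM n:I. c n*F n k) = (SUM n:I. sqn (c n))"
  "qd v (%k. SUM n:I. c n*F n k) = (SUM n:I. mu n * sqn (c n))"
  "hs h ==> qf v h (%k. SUM n:I. c n*F n k) = (SUM n:I. of_real (mu n)*(cnj (c n)*ip h (F n)))"
  "ell2 h ==> ip h (%k. SUM n:I. c n*F n k) = (SUM n:I. cnj (c n)*ip h (F n))"
  "m:I ==> ip (%k. SUM n:I. c n*F n k) (F m) = c m"
proof -
 let ?p = "%k. SUM n:I. c n*F n k"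
 show hp: "hs ?p" by (intro hs_sum hs_scale assms) simp
 have q: "qf v h ?p = (SUM n:I. of_real (mu n)*(cnj (c n)*ip h (F n)))" if "hs h" for h
  using that by (subst qf_sum_right[OF pot assms]) (auto intro!: hs_scale sum.cong simp: qf_scale_right qfF_right)
 have i: "ip h ?p = (SUM n:I. cnj (c n)*ip h (F n))" if "ell2 h" for h
  using that by (subst ip_sum_right[OF assms]) (auto intro!: ell2_scale simp: ip_scale_right)
 have c: "ip ?p (F m) = c m" if "m:I" for m
 proof -
  have "ip ?p (F m) = (SUM n:I. if n = m then c n else 0)"
   by (subst ip_sum_left[OF assms]) (auto intro!: ell2_scale sum.cong simp: ip_scale_left onF)
  thus ?thesis using that assms by (simp add: sum.delta)
 qed
 show "hs h ==> qf v h ?p = (SUM n:I. of_real (mu n)*(cnj (c n)*ip h (F n)))" by (rule q)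
 show "ell2 h ==> ip h ?p = (SUM n:I. cnj (c n)*ip h (F n))" by (rule i)
 show "m:I ==> ip ?p (F m) = c m" by (rule c)
 have "complex_of_real (nsq ?p) = (SUM n:I. of_real (sqn (c n)))"
  unfolding ip_self[symmetric] i[OF hs_ell2[OF hp]]
  by (intro sum.cong refl) (simp add: c complex_norm_square mult.commute del: of_real_power)
 thus "nsq ?p = (SUM n:I. sqn (c n))" unfolding of_real_sum[symmetric] of_real_eq_iff .
 have "complex_of_real (qd v ?p) = (SUM n:I. of_real (mu n * sqn (c n)))"
  unfolding qf_qd[symmetric] q[OF hp]
  by (intro sum.cong refl) (simp only: c complex_norm_square of_real_mult mult.commute[of "cnj _"])
 thus "qd v ?p = (SUM n:I. mu n * sqn (c n))" unfolding of_real_sum[symmetric] of_real_eq_iff .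
qed

text \<open>Minimax: among \<open>n+2\<close> eigenfunctions some combination is orthogonal to the constant and has
  its backward shift orthogonal to the first \<open>n\<close> eigenfunctions.\<close>

lemma gap: "mu (Suc n) >= mu n + 1"
proof -
 define a where "a i k = (if i = n then ip (F k) (ev 0) else ip (bs (F k)) (F i))" for i k
 obtain c where c: "EX k:{..Suc n}. c k ~= 0" "ALL i:{..n}. (SUM k:{..Suc n}. c k*a i k) = 0"
  using homogeneous_system[of "{..n}" "{..Suc n}" a] by auto
 define f where "f = (%k. SUM j:{..Suc n}. c j*F j k)"
 have fh: "hs f" unfolding f_def by (rule comb) simp
 have cz: "(SUM k:{..Suc n}. c k*a i k) = 0" if "i <= n" for i using c(2) that by blast
 have f0: "f 0 = 0" using cz[of n] unfolding f_def a_def by (simp add: ip_ev_right del: sum.atMost_Suc)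
 have bf: "ip (bs f) (F i) = 0" if "i < n" for i
 proof -
  have "bs f = (%k. SUM j:{..Suc n}. c j*bs (F j) k)" by (simp add: f_def bs_def fun_eq_iff)
  hence "ip (bs f) (F i) = (SUM j:{..Suc n}. c j*ip (bs (F j)) (F i))"
   by (simp only:, subst ip_sum_left) (auto intro!: ell2_scale ell2_bs simp: ip_scale_left)
  also have "... = 0" using cz[of i] that unfolding a_def by (simp del: sum.atMost_Suc)
  finally show ?thesis .
 qed
 have fs: "f = sh (bs f)" using sh_bs[of f] f0 by simp
 have "(mu n + 1)*nsq f = mu n*nsq (bs f) + nsq (bs f)"
  by (subst fs) (simp add: nsq_sh algebra_simps)
 also have "... <= qd v (bs f) + nsq (bs f)"
  using minF[of n "bs f"] bf hs_bs[OF fh] by (simp add: feas_def)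
 also have "... = qd v f" by (subst (3) fs) (rule qd_sh[OF hs_bs[OF fh], symmetric])
 also have "... = (SUM j:{..Suc n}. mu j * sqn (c j))" unfolding f_def by (rule comb) simp
 also have "... <= (SUM j:{..Suc n}. mu (Suc n) * sqn (c j))"
  by (intro sum_mono mult_right_mono mu_mono) auto
 also have "... = mu (Suc n)*nsq f" unfolding f_def by (subst comb(2)) (simp_all add: sum_distrib_left del: sum.atMost_Suc)
 finally have 1: "(mu n + 1)*nsq f <= mu (Suc n)*nsq f" .
 have "nsq f > 0"
 proof -
  obtain k where "k:{..Suc n}" "c k ~= 0" using c(1) by blast
  thus ?thesis unfolding f_def
   by (subst comb(2)) (auto intro!: sum_pos2[of _ k] simp del: sum.atMost_Suc)
 qed
 with 1 show ?thesis by simp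
qed

lemma mu_ge: "m <= n ==> mu n >= mu m + real (n - m)"
proof (induction n)
 case (Suc n)
 thus ?case using gap[of n] by (cases "m = Suc n") (auto simp: Suc_diff_le)
qed simp

lemma mu_strict: "m < n ==> mu m + 1 <= mu n"
 using mu_ge[of "Suc m" n] gap[of m] by simp

lemma strict_mono_mu: "strict_mono mu"
 by (rule strict_monoI) (use mu_strict in fastforce)

lemma mu_inj: "mu m = mu n <-> m = n"
 using strict_mono_eq[OF strict_mono_mu] .

definition rm :: "cseq => nat => nat => complex" where
 "rm h N = (%k. h k - (SUM n<N. ip h (F n)*F n k))"

lemma rm_hs: "hs h ==> hs (rm h N)"
 unfolding rm_def by (intro hs_diff comb) auto

lemma rm_feas: "hs h ==> feas N F (rm h N)"
 unfolding feas_def using rm_hs[of h N]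
 by (auto simp: rm_def ip_diff_left comb hs_ell2)

lemma rm_nsq: "hs h ==> nsq (rm h N) = nsq h - (SUM n<N. sqn (ip h (F n)))"
 unfolding rm_def by (rule bessel_identity) (auto simp: onF)

lemma rm_qd: "hs h ==> qd v (rm h N) = qd v h - (SUM n<N. mu n * sqn (ip h (F n)))"
proof -
 assume h: "hs h"
 have 1: "qf v h (%k. SUM n<N. ip h (F n)*F n k) = (SUM n<N. of_real (mu n * sqn (ip h (F n))))"
  using h by (subst comb(4)) (auto intro!: sum.cong simp: complex_norm_square mult.commute[of "cnj _"] simp del: of_real_power)
 show ?thesis unfolding rm_def
  by (subst qd_diff[OF pot h comb(1)]) (auto simp: 1 comb(3) Re_sum simp del: of_real_mult)
qed

text \<open>What is missing on the left is the shifted form of the residual, nonnegative by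
  minimality.\<close>

lemma coord_energy:
 assumes h: "hs h" and L: "mu 0 + L >= 0"
 shows "(%n. (mu n + L) * sqn (ip h (F n))) summable_on UNIV"
  "(INFSUM n. (mu n + L) * sqn (ip h (F n))) <= qd v h + L*nsq h"
  "(SUM n<N. (mu n + L) * sqn (ip h (F n))) <= qd v h + L*nsq h"
proof -
 have pos: "mu n + L >= 0" for n using mu_mono[of 0 n] L by simp
 have main: "(SUM n<N. (mu n + L) * sqn (ip h (F n))) <= qd v h + L*nsq h" for N
 proof -
  have "qd v (rm h N) >= mu N*nsq (rm h N)" by (rule minF[OF rm_feas[OF h]])
  hence "qd v (rm h N) + L*nsq (rm h N) >= (mu N + L)*nsq (rm h N)" by (simp add: algebra_simps)
  moreover have "(mu N + L)*nsq (rm h N) >= 0" using pos by simp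
  ultimately have "0 <= qd v (rm h N) + L*nsq (rm h N)" by linarith
  thus ?thesis unfolding rm_qd[OF h] rm_nsq[OF h]
   by (simp add: algebra_simps sum.distrib sum_distrib_left)
 qed
 show "(SUM n<N. (mu n + L) * sqn (ip h (F n))) <= qd v h + L*nsq h" by (rule main)
 have "sum (%n. (mu n + L) * sqn (ip h (F n))) A <= qd v h + L*nsq h" if "finite A" for A
 proof -
  obtain N where "A \<subseteq> {..<N}" using finite_nat_bounded[OF \<open>finite A\<close>] by blast
  hence "sum (%n. (mu n + L) * sqn (ip h (F n))) A <= (SUM n<N. (mu n + L) * sqn (ip h (F n)))"
   by (intro sum_mono2) (auto simp: pos)
  thus ?thesis using main[of N] by linarith
 qed
 thus "(%n. (mu n + L) * sqn (ip h (F n))) summable_on UNIV"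
  "(INFSUM n. (mu n + L) * sqn (ip h (F n))) <= qd v h + L*nsq h"
  using infsum_le_bound[of UNIV "%n. (mu n + L) * sqn (ip h (F n))"] pos by auto
qed

text \<open>The gaps force \<open>mu N >= mu 0 + N\<close>, so the squared norm of the residual is
  O(1/N). This is the completeness of the eigenvectors.\<close>

lemma rm_small:
 assumes h: "hs h" and L: "mu 0 + L >= 0"
 shows "real N*nsq (rm h N) <= qd v h + L*nsq h"
proof -
 have "real N*nsq (rm h N) <= (mu N + L)*nsq (rm h N)"
  using mu_ge[of 0 N] L by (intro mult_right_mono) auto
 also have "... <= qd v (rm h N) + L*nsq (rm h N)"
  using minF[OF rm_feas[OF h, of N]] by (simp add: algebra_simps)
 also have "... = qd v h + L*nsq h - (SUM n<N. (mu n + L) * sqn (ip h (F n)))"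
  unfolding rm_qd[OF h] rm_nsq[OF h] by (simp add: algebra_simps sum.distrib sum_distrib_left)
 also have "... <= qd v h + L*nsq h"
  using L mu_mono[of 0] by (simp add: sum_nonneg) (intro sum_nonneg mult_nonneg_nonneg, auto intro: order_trans)
 finally show ?thesis .
qed

lemma rm_nsq_0: assumes h: "hs h" shows "(%N. nsq (rm h N)) ----> 0"
proof (rule Lim_null_comparison)
 define B where "B = qd v h + (- mu 0)*nsq h"
 show "(%N. B*(1/real N)) ----> 0"
  using tendsto_mult[OF tendsto_const[of B] lim_inverse_n'] by simp
 show "EV N. norm (nsq (rm h N)) <= B*(1/real N)"
  using eventually_gt_at_top[of 0]
 proof eventually_elim
  fix N :: nat assume "N > 0"
  thus "norm (nsq (rm h N)) <= B*(1/real N)"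
   using rm_small[OF h, of "- mu 0" N] by (simp add: B_def field_simps)
 qed
qed

lemma nsq_coord: assumes h: "hs h" shows "nsq (%n. ip h (F n)) = nsq h" "(%n. sqn (ip h (F n))) sums nsq h"
proof -
 have "(%N. nsq h - nsq (rm h N)) ----> nsq h - 0" by (intro tendsto_intros rm_nsq_0 h)
 thus 1: "(%n. sqn (ip h (F n))) sums nsq h" unfolding sums_def by (simp add: rm_nsq[OF h])
 have "ell2 (%n. ip h (F n))" using bessel(1)[of F h] h by (auto simp: onF)
 hence "(%n. sqn (ip h (F n))) sums nsq (%n. ip h (F n))"
  unfolding ell2_def nsq_def by (metis has_sum_imp_sums has_sum_infsum)
 thus "nsq (%n. ip h (F n)) = nsq h" using 1 sums_unique2 by blast
qed

lemma coord_ell2 [simp]: "ell2 h ==> ell2 (%n. ip h (F n))"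
 using bessel(1)[of F h] by (auto simp: onF)

lemma parseval: "hs h ==> ell2 g ==> ip h g = ip (%n. ip h (F n)) (%n. ip g (F n))"
 by (intro parseval_of_bessel_eq) (auto simp: onF nsq_coord)

lemma parseval_sums: "hs h ==> ell2 g ==> (%n. ip h (F n)*cnj (ip g (F n))) sums ip h g"
 using ip_sums[of "%n. ip h (F n)" "%n. ip g (F n)"] parseval[of h g] by (simp add: hs_ell2)

lemma complete: "ell2 g ==> (!!n. ip g (F n) = 0) ==> g k = 0"
 using parseval[of "ev k" g] by (simp add: ip_ev_left)

text \<open>The residuals of \<open>g\<close> stay bounded in energy and vanish in the limit, so the
  form, weakly continuous in one argument, tends to 0 on them.\<close>

lemma qf_sums:
 assumes h: "hs h" and g: "hs g"
 shows "(%n. of_real (mu n)*(ip h (F n)*cnj (ip g (F n)))) sums qf v h g"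
proof -
 obtain L where L: "small_at v L" using small_at_ex[OF pot] .
 hence L1: "L >= 1" by (simp add: small_at_def)
 have L0: "mu 0 + L >= 0"
 proof -
  have "en L (F 0)/2 <= mu 0 + L" using qd_coercive(1)[OF pot L hsF[of 0]] by (simp add: qdF)
  thus ?thesis using en_nonneg[of L "F 0"] by linarith
 qed
 have e: "en 1 (rm g N) <= 2*(qd v g + L*nsq g)" for N
 proof -
  have "en 1 (rm g N) <= en L (rm g N)" by (rule en_mono[OF rm_hs[OF g]]) (use L1 in auto)
  also have "... <= 2*(qd v (rm g N) + L*nsq (rm g N))" using qd_coercive(1)[OF pot L rm_hs[OF g], of N] by simp
  also have "qd v (rm g N) + L*nsq (rm g N) = qd v g + L*nsq g - (SUM n<N. (mu n + L) * sqn (ip g (F n)))"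
   unfolding rm_qd[OF g] rm_nsq[OF g] by (simp add: algebra_simps sum.distrib sum_distrib_left)
  also have "... <= qd v g + L*nsq g"
  proof -
   have "mu n + L >= 0" for n using mu_mono[of 0 n] L0 by linarith
   thus ?thesis by (simp add: sum_nonneg)
  qed
  finally show ?thesis by simp
 qed
 have p: "(%N. rm g N k) ----> 0" for k
 proof (rule Lim_null_comparison)
  show "(%N. sqrt (nsq (rm g N))) ----> 0" using tendsto_real_sqrt[OF rm_nsq_0[OF g]] by simp
  show "EV N. norm (rm g N k) <= sqrt (nsq (rm g N))"
   using coord_le_sqrt_nsq[OF hs_ell2[OF rm_hs[OF g]]] by simp
 qed
 have "(%N. qf v (rm g N) h) ----> qf v (%k. 0) h"
  by (rule qf_tendsto[OF pot rm_hs[OF g] e p h])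
 hence "(%N. cnj (qf v (rm g N) h)) ----> cnj 0" by (intro tendsto_cnj) simp
 hence "(%N. qf v h (rm g N)) ----> 0" by (simp add: qf_commute[symmetric])
 moreover have "qf v h (rm g N) = qf v h g - (SUM n<N. of_real (mu n)*(ip h (F n)*cnj (ip g (F n))))" for N
 proof -
  have "qf v h (%k. SUM n<N. ip g (F n)*F n k) = (SUM n<N. of_real (mu n)*(ip h (F n)*cnj (ip g (F n))))"
   using h by (subst comb(4)) (auto simp: mult_ac)
  thus ?thesis unfolding rm_def using h g comb(1)[of "{..<N}"]
   by (subst qf_diff_right[OF pot]) auto
 qed
 ultimately have "(%N. qf v h g - (SUM n<N. of_real (mu n)*(ip h (F n)*cnj (ip g (F n))))) ----> 0" by simp
 from tendsto_diff[OF tendsto_const[of "qf v h g"] this] show ?thesis unfolding sums_def by simp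
qed

lemma epair_unique:
 assumes f: "epair v nu f" "nsq f ~= 0"
 obtains n where "nu = mu n" "f = (%k. ip f (F n)*F n k)" "ip f (F n) ~= 0"
proof -
 have fh: "hs f" using f by (simp add: epair_def)
 have z: "ip f (F n) = 0 \<or> nu = mu n" for n
 proof -
  have "of_real nu*ip f (F n) = of_real (mu n)*ip f (F n)"
   using f(1) qfF_right[OF fh, of n] by (simp add: epair_def)
  thus ?thesis by auto
 qed
 have "EX n. ip f (F n) ~= 0"
 proof (rule ccontr)
  assume "\<not> ?thesis"
  thus False using nsq_coord(1)[OF fh] f(2) by simp
 qed
 then obtain n where n: "ip f (F n) ~= 0" by blast
 hence "nu = mu n" using z by blast
 have zm: "ip f (F m) = 0" if "m ~= n" for m using z[of m] z[of n] n that mu_inj by auto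
 define g where "g = (%k. f k - ip f (F n)*F n k)"
 have "ell2 g" unfolding g_def by (intro ell2_diff ell2_scale) (use fh in auto)
 moreover have "ip g (F m) = 0" for m
  unfolding g_def using fh by (subst ip_diff_left) (auto simp: ip_scale_left onF zm hs_ell2 ell2_scale)
 ultimately have "g k = 0" for k by (rule complete)
 hence "f = (%k. ip f (F n)*F n k)" by (auto simp: g_def fun_eq_iff)
 thus ?thesis using that n \<open>nu = mu n\<close> by blast
qed

subsection \<open>The shift in the eigenbasis\<close>

definition yv :: cseq where "yv n = ip (ev 0) (F n)"
definition sm :: "nat => nat => complex" where "sm n p = ip (sh (F p)) (F n)"
text \<open>The component along the constant of the Lax operator applied to a shifted eigenfunction:
  the rank one defect of the commutation relation.\<close>

definition cc :: cseq where "cc p = qf v (sh (F p)) (ev 0)"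
text \<open>The gap lengths for \<open>p >= 1\<close>; truncated subtraction gives
  \<open>ga 0\<close> the value -1.\<close>

definition ga :: "nat => real" where "ga p = mu p - mu (p - 1) - 1"

lemma ga_nonneg: "p >= 1 ==> ga p >= 0"
 using gap[of "p - 1"] by (simp add: ga_def)

lemma yv_eq: "yv n = cnj (F n 0)" by (simp add: yv_def ip_ev_left)

text \<open>Splitting \<open>F n\<close> into a shifted part and a multiple of the constant, the
  shifted part obeys \<open>qf_sh\<close> and the constant gives the rank one term. For open gaps
  the shift is thus a Cauchy matrix.\<close>

lemma sm_rel: "of_real (mu n - mu p - 1) * sm n p = cc p*yv n"
proof -
 have h: "hs (sh (F p))" "hs (bs (F n))" by (auto intro: hs_sh hs_bs)
 have "of_real (mu n) * sm n p = qf v (sh (F p)) (F n)" unfolding sm_def using qfF_right[OF h(1)] by simp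
 also have "... = qf v (sh (F p)) (%k. sh (bs (F n)) k + F n 0*ev 0 k)" using sh_bs[of "F n"] by simp
 also have "... = qf v (sh (F p)) (sh (bs (F n))) + cnj (F n 0)*cc p"
  by (subst qf_add_right[OF pot]) (auto intro!: hs_sh hs_bs hs_scale simp: qf_scale_right cc_def)
 also have "qf v (sh (F p)) (sh (bs (F n))) = (of_real (mu p) + 1)*ip (F p) (bs (F n))"
  using h by (simp add: qf_sh qfF distrib_right)
 also have "ip (F p) (bs (F n)) = sm n p" by (simp add: sm_def ip_sh_bs)
 finally show ?thesis by (simp add: yv_eq algebra_simps)
qed

text \<open>This and the next two facts say that the range of the shift is orthogonal to the
  constant, that the shift is isometric, and that shift times adjoint is the identity minus the
  projection onto the constant.\<close>

lemma sm_col_yv: "(%n. sm n p*cnj (yv n)) sums 0"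
 using parseval_sums[of "sh (F p)" "ev 0"] unfolding sm_def yv_def
 by (simp add: hs_sh ip_ev_right)

lemma sm_col: "(%n. sqn (sm n p)) sums 1"
 using nsq_coord(2)[of "sh (F p)"] by (simp add: sm_def hs_sh nsq_sh)

lemma sm_row: "(%q. sqn (sm n q)) sums (1 - sqn (yv n))"
proof -
 have "ip (bs (F n)) (F q) = cnj (sm n q)" for q
  using ip_commute[of "bs (F n)" "F q"] by (simp add: sm_def ip_sh_bs)
 hence "(%q. sqn (sm n q)) sums nsq (bs (F n))"
  using nsq_coord(2)[of "bs (F n)"] by (simp add: hs_bs)
 moreover have "nsq (F n) = nsq (sh (bs (F n))) + sqn (F n 0)"
 proof -
  have "nsq (F n) = nsq (%k. sh (bs (F n)) k + F n 0*ev 0 k)" using sh_bs[of "F n"] by simp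
  thus ?thesis
   by (subst (asm) nsq_add) (auto intro!: ell2_sh ell2_bs ell2_scale simp: ip_scale_right ip_ev_right nsq_scale)
 qed
 ultimately show ?thesis by (metis nsq_sh nsqF yv_eq complex_mod_cnj add_diff_cancel_right')
qed

lemma sums_single_eq: "f sums S ==> (!!n. n ~= m ==> f n = 0) ==> S = (f (m :: nat) :: 'b :: real_normed_vector)"
 using sums_finite[of "{m}" f] sums_unique2[of f S] by auto

text \<open>At a closed gap \<open>sm_rel\<close> reads \<open>cc p * yv (Suc p) = 0\<close>. If
  \<open>cc p\<close> vanishes, column \<open>p\<close> has a single nonzero entry, in row
  \<open>Suc p\<close>, and its orthogonality to \<open>yv\<close> concludes.\<close>

lemma yv_zero: assumes "ga (Suc p) = 0" shows "yv (Suc p) = 0"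
proof -
 have mu: "mu (Suc p) = mu p + 1" using assms by (simp add: ga_def)
 have "cc p*yv (Suc p) = 0" using sm_rel[of "Suc p" p] mu by simp
 moreover have "yv (Suc p) = 0" if "cc p = 0"
 proof -
  have z: "sm n p = 0" if "n ~= Suc p" for n
  proof -
   have "mu n - mu p - 1 ~= 0" using mu mu_inj[of n "Suc p"] that by auto
   thus ?thesis using sm_rel[of n p] \<open>cc p = 0\<close> by (simp del: of_real_diff)
  qed
  have "1 = sqn (sm (Suc p) p)" by (rule sums_single_eq[OF sm_col]) (simp add: z)
  moreover have "0 = sm (Suc p) p*cnj (yv (Suc p))" by (rule sums_single_eq[OF sm_col_yv]) (simp add: z)
  ultimately show ?thesis by auto
 qed
 ultimately show ?thesis by auto
qed

text \<open>Row \<open>Suc p\<close> is concentrated at \<open>p\<close> and has norm 1 since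
  \<open>yv (Suc p) = 0\<close>; the unit column \<open>p\<close> then has no room for other
  entries.\<close>

lemma sm_trivial:
 assumes "ga (Suc p) = 0" shows "cmod (sm (Suc p) p) = 1" "!!n. n ~= Suc p ==> sm n p = 0"
proof -
 have mu: "mu (Suc p) = mu p + 1" using assms by (simp add: ga_def)
 have z: "sm (Suc p) q = 0" if "q ~= p" for q
 proof -
  have "mu (Suc p) - mu q - 1 ~= 0" using mu mu_inj[of p q] that by auto
  thus ?thesis using sm_rel[of "Suc p" q] yv_zero[OF assms] by (simp del: of_real_diff)
 qed
 have "1 - sqn (yv (Suc p)) = sqn (sm (Suc p) p)" by (rule sums_single_eq[OF sm_row]) (simp add: z)
 hence 1: "sqn (sm (Suc p) p) = 1" using yv_zero[OF assms] by simp
 thus "cmod (sm (Suc p) p) = 1" by (simp add: power2_eq_1_iff) (smt (verit) norm_ge_zero)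
 fix n assume n: "n ~= Suc p"
 have "(SUM k:{n, Suc p}. sqn (sm k p)) <= 1"
  using sum_le_suminf[OF sums_summable[OF sm_col[of p]], of "{n, Suc p}"] sums_unique[OF sm_col[of p]] by auto
 thus "sm n p = 0" using n 1 by simp
qed

text \<open>For an open gap, \<open>mu p + 1\<close> lies strictly between consecutive eigenvalues;
  this keeps the Cauchy denominators away from 0.\<close>

lemma mu_avoid: "ga (Suc p) ~= 0 ==> mu n ~= mu p + 1"
proof
 assume g: "ga (Suc p) ~= 0" and n: "mu n = mu p + 1"
 show False
 proof (cases "n <= p")
  case True thus ?thesis using mu_mono[OF True] n by simp
 next
  case False
  hence "mu (Suc p) <= mu n" by (intro mu_mono) simp
  thus ?thesis using ga_nonneg[of "Suc p"] g n by (simp add: ga_def)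
 qed
qed

lemma cc_nonzero: assumes "ga (Suc p) ~= 0" shows "cc p ~= 0"
proof
 assume c: "cc p = 0"
 have "sm n p = 0" for n
  using sm_rel[of n p] mu_avoid[OF assms, of n] c by (auto simp del: of_real_diff)
 thus False using sm_col[of p] sums_unique[of "%n. sqn (sm n p)" 1] by simp
qed

lemma sm_eq: assumes "ga (Suc p) ~= 0" shows "sm n p = cc p*yv n/of_real (mu n - (mu p + 1))"
proof -
 have "complex_of_real (mu n - (mu p + 1)) ~= 0" using mu_avoid[OF assms, of n] by (metis of_real_eq_0_iff right_minus_eq)
 moreover have "complex_of_real (mu n - (mu p + 1)) * sm n p = cc p*yv n"
  using sm_rel[of n p] by (simp add: algebra_simps)
 ultimately show ?thesis by (metis mult.commute nonzero_eq_divide_eq)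
qed

definition w :: "nat => real" where "w n = sqn (yv n)"

lemma w_nonneg [simp]: "w n >= 0" by (simp add: w_def)

lemma w_sums: "w sums 1"
 using nsq_coord(2)[of "ev 0"] by (simp add: w_def[abs_def] yv_def)

text \<open>The form at the constant is minus the mean of the potential, which is 0.\<close>

lemma mu_w_sums: "(%n. mu n*w n) sums 0"
proof -
 have "(%n. of_real (mu n)*(yv n*cnj (yv n))) sums complex_of_real 0"
  using qf_sums[of "ev 0" "ev 0"] by (simp add: yv_def qf_ev_ev)
 hence "(%n. complex_of_real (mu n*w n)) sums complex_of_real 0"
  by (simp only: w_def complex_norm_square of_real_mult)
 thus ?thesis by (simp only: sums_of_real_iff)
qed

text \<open>Orthogonality of column \<open>p\<close> to the constant, with the Cauchy formula for
  its entries.\<close>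

lemma w_cauchy: assumes "ga (Suc p) ~= 0" shows "(%n. w n/(mu n - (mu p + 1))) sums 0"
proof -
 have "(%n. cc p * of_real (w n/(mu n - (mu p + 1)))) sums (cc p*complex_of_real 0)"
  using sm_col_yv[of p] unfolding sm_eq[OF assms] w_def of_real_divide complex_norm_square
  by (simp add: mult_ac)
 hence "(%n. complex_of_real (w n/(mu n - (mu p + 1)))) sums complex_of_real 0"
  by (rule sums_mult_iff[OF cc_nonzero[OF assms], THEN iffD1])
 thus ?thesis by (simp only: sums_of_real_iff)
qed

lemma w_zero: "ga (Suc p) = 0 ==> w (Suc p) = 0" by (simp add: w_def yv_zero)

end

section \<open>Product formulas for the spectral weights\<close>

text \<open>Induction over the factors, each equal to 1 + b/(z - m q). The first conclusion compares
  the coefficients of 1/z at infinity.\<close>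

lemma partial_fractions:
 fixes m nu :: "nat => real"
 assumes "finite A" "inj_on m A"
 shows "EX a. (SUM p:A. a p) = (SUM p:A. m p - nu p) \<and>
  (ALL z. (ALL p:A. z ~= m p) --> (PROD p:A. (z - nu p)/(z - m p)) = 1 + (SUM p:A. a p/(z - m p)))"
 using assms
proof (induction A rule: finite_induct)
 case empty thus ?case by auto
next
 case (insert q A)
 then obtain a where a: "(SUM p:A. a p) = (SUM p:A. m p - nu p)"
  "!!z. (ALL p:A. z ~= m p) ==> (PROD p:A. (z - nu p)/(z - m p)) = 1 + (SUM p:A. a p/(z - m p))"
  by auto
 have ne: "m p ~= m q" if "p:A" for p using insert that by (auto simp: inj_on_def)
 define b where "b = m q - nu q"
 \<comment> \<open>Splitting 1/((z - m p)(z - m q)) into simple fractions moves part of every old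
   coefficient to the new pole \<open>m q\<close>.\<close>
 define a' where "a' p = (if p = q then b - (SUM r:A. a r*b/(m r - m q)) else a p + a p*b/(m p - m q))" for p
 have sumA: "(SUM p:A. f (a' p) p) = (SUM p:A. f (a p + a p*b/(m p - m q)) p)" for f :: "real => nat => real"
  by (rule sum.cong) (use insert in "auto simp: a'_def")
 show ?case
 proof (intro exI[of _ a'] conjI allI impI)
  show "(SUM p:insert q A. a' p) = (SUM p:insert q A. m p - nu p)"
   using insert sumA[of "%x p. x"] by (simp add: a(1) sum.distrib) (simp add: a'_def b_def)
  fix z assume z: "ALL p:insert q A. z ~= m p"
  hence zq: "z - m q ~= 0" and zA: "!!p. p:A ==> z - m p ~= 0" by auto
  have "(PROD p:insert q A. (z - nu p)/(z - m p)) = (z - nu q)/(z - m q)*(1 + (SUM p:A. a p/(z - m p)))"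
   using insert z by (simp add: a(2))
  also have "(z - nu q)/(z - m q) = 1 + b/(z - m q)" using zq by (simp add: b_def field_simps)
  also have "(1 + b/(z - m q))*(1 + (SUM p:A. a p/(z - m p)))
   = 1 + b/(z - m q) + (SUM p:A. a p/(z - m p) + a p*b/((z - m p)*(z - m q)))"
   by (simp add: algebra_simps sum_distrib_left sum.distrib sum_divide_distrib)
  also have "(SUM p:A. a p/(z - m p) + a p*b/((z - m p)*(z - m q)))
   = (SUM p:A. (a p + a p*b/(m p - m q))/(z - m p) - a p*b/(m p - m q)/(z - m q))"
  proof (rule sum.cong[OF refl])
   fix p assume p: "p:A"
   have d: "m p - m q ~= 0" using ne[OF p] by simp
   have "1/((z - m p)*(z - m q)) = (1/(z - m p) - 1/(z - m q))/(m p - m q)"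
    using zA[OF p] zq d by (simp add: diff_frac_eq)
   hence "a p*b*(1/((z - m p)*(z - m q))) = a p*b*((1/(z - m p) - 1/(z - m q))/(m p - m q))"
    by (rule arg_cong)
   thus "a p/(z - m p) + a p*b/((z - m p)*(z - m q)) =
    (a p + a p*b/(m p - m q))/(z - m p) - a p*b/(m p - m q)/(z - m q)"
    by (simp add: add_divide_distrib diff_divide_distrib right_diff_distrib mult_ac)
  qed
  also have "... = (SUM p:A. a' p/(z - m p)) - (SUM r:A. a r*b/(m r - m q))/(z - m q)"
   unfolding sumA[of "%x p. x/(z - m p)"] by (simp add: sum_subtractf sum_divide_distrib)
  also have "1 + b/(z - m q) + ... = 1 + (SUM p:insert q A. a' p/(z - m p))"
   using insert by (simp add: a'_def diff_divide_distrib)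
  finally show "(PROD p:insert q A. (z - nu p)/(z - m p)) = 1 + (SUM p:insert q A. a' p/(z - m p))" .
 qed
qed

text \<open>Made for test functions that vanish at all eigenvalues up to \<open>N\<close> but one:
  the surviving term is the whole sum up to a tail.\<close>

lemma sums_tail_bound:
 fixes f h :: "nat => real"
 assumes f: "f sums S" and z: "!!k. k <= N ==> k ~= n ==> f k = 0" and n: "n <= N"
  and b: "!!k. k > N ==> \<bar>f k\<bar> <= h k" and h: "summable h"
 shows "\<bar>S - f n\<bar> <= (\<Sum>k. h (k + Suc N))"
proof -
 have sf: "summable f" using f by (rule sums_summable)
 have "(SUM k<Suc N. f k) = (SUM k<Suc N. if k = n then f k else 0)"
  by (rule sum.cong) (use z in auto)
 also have "... = f n" using n by (subst sum.delta) auto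
 finally have eq: "S - f n = (\<Sum>k. f (k + Suc N))"
  using suminf_split_initial_segment[OF sf, of "Suc N"] sums_unique[OF f] by simp
 have sh: "summable (%k. h (k + Suc N))" using h by (rule summable_ignore_initial_segment)
 have sa: "summable (%k. \<bar>f (k + Suc N)\<bar>)"
  by (rule summable_comparison_test'[OF sh, of 0]) (use b in auto)
 have "\<bar>\<Sum>k. f (k + Suc N)\<bar> <= (\<Sum>k. \<bar>f (k + Suc N)\<bar>)" by (rule summable_rabs[OF sa])
 also have "... <= (\<Sum>k. h (k + Suc N))" by (rule suminf_le[OF _ sa sh]) (use b in auto)
 finally show ?thesis using eq by simp
qed

lemma suminf_tail_0:
 fixes h :: "nat => real"
 assumes "summable h" shows "(%N. \<Sum>k. h (k + Suc N)) ----> 0"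
proof -
 have "(%N. suminf h - (SUM k<Suc N. h k)) ----> suminf h - suminf h"
  using LIMSEQ_Suc[OF summable_LIMSEQ[OF assms]] by (intro tendsto_intros)
 thus ?thesis unfolding suminf_minus_initial_segment[OF assms] by simp
qed

section \<open>Products over the gaps\<close>

locale gapped =
 fixes mu :: "nat => real"
 assumes gap: "mu (Suc n) >= mu n + 1"
begin

definition g :: "nat => real" where "g p = mu p - mu (p - 1) - 1"
text \<open>The truncation at \<open>N\<close> of \<open>K n\<close>, the infinite product occurring
  in \<open>kap\<close>.\<close>

definition KN :: "nat => nat => real" where "KN n N = (PROD p:{1..N} - {n}. 1 - g p/(mu p - mu n))"
definition K :: "nat => real" where "K n = (\<Prod>p. if p = 0 \<or> p = n then 1 else 1 - g p/(mu p - mu n))"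

lemma dist: "m < n ==> mu m + real (n - m) <= mu n"
proof (induction n)
 case (Suc n)
 thus ?case using gap[of n] by (cases "m = n") (auto simp: Suc_diff_le)
qed simp

lemma dist1: "m < n ==> mu m + 1 <= mu n" using dist[of m n] by linarith

lemma mono: "m <= n ==> mu m <= mu n" using dist[of m n] by (cases "m = n") auto

lemma g_nonneg: "p >= 1 ==> g p >= 0" using gap[of "p - 1"] by (simp add: g_def)

text \<open>For \<open>p > n\<close> the distance \<open>mu p - mu n\<close> is at least
  \<open>1 + g p\<close>; for \<open>p < n\<close> the factor exceeds 1. Hence all factors are
  positive, and products are bounded through the sum of the gaps alone.\<close>

lemma factor:
 assumes "p >= 1" "p ~= n"
 shows "1 - g p/(mu p - mu n) = (mu n - (mu (p - 1) + 1))/(mu n - mu p)"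
  "exp (- g p) <= 1 - g p/(mu p - mu n)" "1 - g p/(mu p - mu n) <= exp (g p)"
  "\<bar>g p/(mu p - mu n)\<bar> <= g p"
proof -
 have g0: "g p >= 0" by (rule g_nonneg[OF assms(1)])
 have d: "\<bar>mu p - mu n\<bar> >= 1" using dist1[of p n] dist1[of n p] assms(2) by (cases "p < n") auto
 hence d0: "mu p - mu n ~= 0" by auto
 thus "1 - g p/(mu p - mu n) = (mu n - (mu (p - 1) + 1))/(mu n - mu p)"
  by (simp add: g_def field_simps)
 show a: "\<bar>g p/(mu p - mu n)\<bar> <= g p"
  using d g0 by (simp add: abs_divide divide_le_eq mult_left_mono[of 1 _ "g p", simplified])
 have "1 - g p/(mu p - mu n) <= 1 + g p" using a by linarith
 also have "... <= exp (g p)" by (rule exp_ge_add_one_self)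
 finally show "1 - g p/(mu p - mu n) <= exp (g p)" .
 show "exp (- g p) <= 1 - g p/(mu p - mu n)"
 proof (cases "p < n")
  case True
  hence "g p/(mu p - mu n) <= 0" using dist1[of p n] g0 by (simp add: divide_nonneg_neg)
  moreover have "exp (- g p) <= 1" using g0 by simp
  ultimately show ?thesis by linarith
 next
  case False
  hence np: "n < p" using assms by simp
  have "mu n <= mu (p - 1)" using np by (intro mono) auto
  hence x: "mu p - mu n >= 1 + g p" by (simp add: g_def)
  have "exp (- g p) = 1/exp (g p)" by (simp add: exp_minus field_simps)
  also have "... <= 1/(1 + g p)" using g0 exp_ge_add_one_self[of "g p"] by (intro divide_left_mono) auto
  also have "... = 1 - g p/(1 + g p)" using g0 by (simp add: field_simps)
  also have "... <= 1 - g p/(mu p - mu n)"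
   using x g0 by (intro diff_left_mono divide_left_mono) auto
  finally show ?thesis .
 qed
qed

lemma KN_bounds:
 assumes "(SUM p=1..N. g p) <= G"
 shows "exp (- G) <= KN n N" "KN n N <= exp G"
proof -
 have s: "sum g ({1..N} - {n}) <= G"
  by (rule order_trans[OF sum_mono2 assms]) (auto intro: g_nonneg)
 have "exp (- G) <= exp (- sum g ({1..N} - {n}))" using s by simp
 also have "... = (PROD p:{1..N} - {n}. exp (- g p))" by (simp add: exp_sum sum_negf[symmetric])
 also have "... <= KN n N" unfolding KN_def by (rule prod_mono) (use factor in auto)
 finally show "exp (- G) <= KN n N" .
 have "KN n N <= (PROD p:{1..N} - {n}. exp (g p))" unfolding KN_def
  by (intro prod_mono conjI factor order_trans[OF _ factor(2)]) auto
 also have "... = exp (sum g ({1..N} - {n}))" by (simp add: exp_sum)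
 also have "... <= exp G" using s by simp
 finally show "KN n N <= exp G" .
qed

lemma K_limit:
 assumes "summable (%p. g (Suc p))"
 shows "(%N. KN n N) ----> K n"
proof -
 let ?f = "%p. if p = 0 \<or> p = n then 1 else 1 - g p/(mu p - mu n)"
 have "summable (%p. norm (?f (Suc p) - 1))"
  by (rule summable_comparison_test'[OF assms, of 0]) (use factor(4)[of "Suc _" n] in \<open>auto simp: g_nonneg\<close>)
 hence "summable (%p. norm (?f p - 1))" by (rule summable_Suc_iff[THEN iffD1])
 hence "convergent_prod ?f"
  by (intro abs_convergent_prod_imp_convergent_prod) (simp add: abs_convergent_prod_conv_summable)
 hence "(%N. PROD i<=N. ?f i) ----> K n" unfolding K_def by (rule convergent_prod_LIMSEQ)
 moreover have "(PROD i<=N. ?f i) = KN n N" for N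
  unfolding KN_def by (rule prod.mono_neutral_cong_right) auto
 ultimately show ?thesis by simp
qed

lemma K_bounds:
 assumes "(%p. g (Suc p)) sums G"
 shows "exp (- G) <= K n" "K n <= exp G"
proof -
 have s: "(SUM p=1..N. g p) <= G" for N
 proof -
  have "(SUM p=1..N. g p) = (SUM p<N. g (Suc p))" by (rule sum.reindex_bij_witness[of _ Suc "%p. p - 1"]) auto
  also have "... <= G" using sum_le_suminf[OF sums_summable[OF assms], of "{..<N}"] sums_unique[OF assms]
   by (auto simp: g_nonneg)
  finally show ?thesis .
 qed
 note lim = K_limit[OF sums_summable[OF assms], of n]
 show "exp (- G) <= K n" by (rule LIMSEQ_le_const[OF lim]) (use KN_bounds(1)[OF s] in auto)
 show "K n <= exp G" by (rule LIMSEQ_le_const2[OF lim]) (use KN_bounds(2)[OF s] in auto)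
qed

end

text \<open>The function \<open>\<Sum> w n / (mu n - z)\<close> vanishes at the points \<open>mu p + 1\<close>. Testing it against
  truncated products \<open>\<Prod> (z - mu p) / (z - mu (p - 1) - 1)\<close>, expanded in partial fractions,
  determines all its residues \<open>w n\<close>.\<close>

locale cauchy_data = gapped +
 fixes w :: "nat => real"
 assumes w_abs: "summable (%n. \<bar>w n\<bar>)" and w_one: "w sums 1"
  and mw_abs: "summable (%n. (mu n - mu 0)*\<bar>w n\<bar>)" and mw: "(%n. (mu n - mu 0)*w n) sums (- mu 0)"
  and w_pole: "g (Suc p) ~= 0 ==> (%n. w n/(mu n - (mu p + 1))) sums 0"
  and w_null: "g (Suc p) = 0 ==> w (Suc p) = 0"
begin

text \<open>Open gaps only. \<open>m p\<close> is the left end of gap \<open>p\<close>, a zero of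
  the Cauchy sum; for a closed gap it would coincide with \<open>mu p\<close>.\<close>

definition A :: "nat => nat set" where "A N = {p:{1..N}. g p ~= 0}"
definition m :: "nat => real" where "m p = mu (p - 1) + 1"

lemma finA: "finite (A N)" by (simp add: A_def)

lemma m_strict: assumes "p >= 1" "g p ~= 0" shows "mu (p - 1) + 1 <= m p" "m p < mu p"
 using g_nonneg[OF assms(1)] assms(2) by (auto simp: m_def g_def)

lemma m_inj: "inj_on m (A N)"
proof (rule inj_onI)
 fix p q assume "p:A N" "q:A N" "m p = m q"
 hence *: "mu (p - 1) = mu (q - 1)" "p >= 1" "q >= 1" by (auto simp: m_def A_def)
 hence "p - 1 = q - 1"
  using dist1[of "p - 1" "q - 1"] dist1[of "q - 1" "p - 1"] by (metis add_le_same_cancel1 linorder_neqE_nat not_one_le_zero)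
 thus "p = q" using * by simp
qed

lemma mu_ne_m: assumes "p:A N" shows "mu k ~= m p"
proof (cases "k <= p - 1")
 case True thus ?thesis using mono[OF True] by (simp add: m_def)
next
 case False
 hence "mu p <= mu k" by (intro mono) auto
 thus ?thesis using m_strict[of p] assms by (auto simp: A_def)
qed

lemma w_pole': "p:A N ==> (%n. w n/(mu n - m p)) sums 0"
 using w_pole[of "p - 1"] by (auto simp: A_def m_def)

lemma w_null': "1 <= k ==> k <= N ==> k ~: A N ==> w k = 0"
 using w_null[of "k - 1"] by (auto simp: A_def)

text \<open>In the partial fraction expansion every pole term sums to 0 by \<open>w_pole'\<close>,
  so only the constant term 1 survives. The numerators \<open>nu\<close> stay free for the choices
  made later.\<close>

lemma prod_sums:
 obtains a where "(SUM p:A N. a p) = (SUM p:A N. m p - nu p)"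
  "!!k. (PROD p:A N. (mu k - nu p)/(mu k - m p)) = 1 + (SUM p:A N. a p/(mu k - m p))"
  "(%k. w k*(PROD p:A N. (mu k - nu p)/(mu k - m p))) sums 1"
proof -
 obtain a where a: "(SUM p:A N. a p) = (SUM p:A N. m p - nu p)"
  "!!z. (ALL p:A N. z ~= m p) ==> (PROD p:A N. (z - nu p)/(z - m p)) = 1 + (SUM p:A N. a p/(z - m p))"
  using partial_fractions[OF finA m_inj] by metis
 have b: "(PROD p:A N. (mu k - nu p)/(mu k - m p)) = 1 + (SUM p:A N. a p/(mu k - m p))" for k
  by (rule a(2)) (use mu_ne_m in auto)
 have "(%k. w k + (SUM p:A N. a p*(w k/(mu k - m p)))) sums (1 + (SUM p:A N. a p*0))"
  by (intro sums_add w_one sums_sum sums_mult w_pole')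
 hence "(%k. w k*(PROD p:A N. (mu k - nu p)/(mu k - m p))) sums 1"
  unfolding b by (simp add: distrib_left sum_distrib_left mult_ac)
 thus ?thesis using that[OF a(1) b] by blast
qed

lemma ratio_le_1:
 assumes "k > N" "p:A N" shows "0 <= (mu k - mu p)/(mu k - m p)" "(mu k - mu p)/(mu k - m p) <= 1"
proof -
 have p: "p >= 1" "p <= N" "g p ~= 0" using assms by (auto simp: A_def)
 hence "mu p + 1 <= mu k" "m p < mu p" using dist1[of p k] assms m_strict by auto
 thus "0 <= (mu k - mu p)/(mu k - m p)" "(mu k - mu p)/(mu k - m p) <= 1"
  by (auto simp: divide_le_eq)
qed

lemma prod_ratio_le_1:
 assumes "k > N" "B \<subseteq> A N" shows "0 <= (PROD p:B. (mu k - mu p)/(mu k - m p))" "(PROD p:B. (mu k - mu p)/(mu k - m p)) <= 1"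
 using ratio_le_1[OF assms(1)] assms(2) by (auto intro!: prod_nonneg prod_le_1 simp: subset_iff)

text \<open>Trace formula. With zeros at the eigenvalues and the extra factor
  \<open>mu k - mu 0\<close>, the test function kills all terms up to \<open>N\<close>; the first
  moment of \<open>w\<close> and the 1/z coefficient then give \<open>- mu 0\<close> minus the
  partial sum of the gaps, which must be a tail.\<close>

theorem gap_sum: "(%p. g (Suc p)) sums (- mu 0)"
proof -
 have b: "\<bar>(- mu 0 - (SUM p<N. g (Suc p))) - 0\<bar> <= (\<Sum>k. (mu (k + Suc N) - mu 0)*\<bar>w (k + Suc N)\<bar>)" for N
 proof -
  obtain a where a: "(SUM p:A N. a p) = (SUM p:A N. m p - mu p)"
   "!!k. (PROD p:A N. (mu k - mu p)/(mu k - m p)) = 1 + (SUM p:A N. a p/(mu k - m p))"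
   using prod_sums[of N mu] by blast
  let ?f = "%k. (mu k - mu 0)*w k*(PROD p:A N. (mu k - mu p)/(mu k - m p))"
  have f: "?f = (%k. (mu k - mu 0)*w k + ((SUM p:A N. a p)*w k + (SUM p:A N. a p*(m p - mu 0)*(w k/(mu k - m p)))))"
  proof
   fix k
   have "(mu k - mu 0)*(SUM p:A N. a p/(mu k - m p)) = (SUM p:A N. a p + a p*(m p - mu 0)/(mu k - m p))"
    unfolding sum_distrib_left
   proof (rule sum.cong[OF refl])
    fix p assume "p:A N"
    hence "mu k - m p ~= 0" using mu_ne_m by auto
    thus "(mu k - mu 0)*(a p/(mu k - m p)) = a p + a p*(m p - mu 0)/(mu k - m p)"
     by (simp add: field_simps)
   qed
   hence "?f k = w k*((mu k - mu 0) + (SUM p:A N. a p + a p*(m p - mu 0)/(mu k - m p)))"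
    unfolding a(2) by (simp add: distrib_left mult_ac)
   thus "?f k = (mu k - mu 0)*w k + ((SUM p:A N. a p)*w k + (SUM p:A N. a p*(m p - mu 0)*(w k/(mu k - m p))))"
    by (simp add: distrib_left sum.distrib sum_distrib_left mult_ac)
  qed
  have "?f sums (- mu 0 + ((SUM p:A N. a p)*1 + (SUM p:A N. a p*(m p - mu 0)*0)))"
   unfolding f by (intro sums_add mw sums_mult w_one sums_sum w_pole')
  moreover have "(SUM p:A N. m p - mu p) = - (SUM p<N. g (Suc p))"
  proof -
   have "(SUM p:A N. m p - mu p) = (SUM p:{1..N}. - g p)"
    by (rule sum.mono_neutral_cong_left) (auto simp: A_def m_def g_def)
   also have "... = (SUM p<N. - g (Suc p))" by (rule sum.reindex_bij_witness[of _ Suc "%p. p - 1"]) auto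
   finally show ?thesis by (simp add: sum_negf)
  qed
  ultimately have s: "?f sums (- mu 0 - (SUM p<N. g (Suc p)))" by (simp add: a(1))
  have "\<bar>(- mu 0 - (SUM p<N. g (Suc p))) - ?f 0\<bar> <= (\<Sum>k. (mu (k + Suc N) - mu 0)*\<bar>w (k + Suc N)\<bar>)"
  proof (rule sums_tail_bound[OF s])
   show "?f k = 0" if "k <= N" "k ~= 0" for k
   proof (cases "k:A N")
    case True hence "(PROD p:A N. (mu k - mu p)/(mu k - m p)) = 0" using finA by (auto intro!: prod_zero)
    thus ?thesis by simp
   next
    case False thus ?thesis using w_null' that by auto
   qed
   show "\<bar>?f k\<bar> <= (mu k - mu 0)*\<bar>w k\<bar>" if "k > N" for k
   proof -
    have "mu k - mu 0 >= 0" using mono[of 0 k] by simp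
    thus ?thesis using prod_ratio_le_1[OF that order_refl]
     by (auto simp: abs_mult intro!: mult_right_le_one_le)
   qed
  qed (auto intro: mw_abs)
  thus ?thesis by simp
 qed
 have "(%N. - mu 0 - (SUM p<N. g (Suc p))) ----> 0"
  by (rule Lim_null_comparison[OF _ suminf_tail_0[OF mw_abs]]) (use b in auto)
 from tendsto_diff[OF tendsto_const[of "- mu 0"] this] show ?thesis by (simp add: sums_def)
qed

lemma gap_partial: "(SUM p=1..N. g p) <= - mu 0"
proof -
 have "(SUM p=1..N. g p) = (SUM p<N. g (Suc p))" by (rule sum.reindex_bij_witness[of _ Suc "%p. p - 1"]) auto
 also have "... <= - mu 0" using sum_le_suminf[OF sums_summable[OF gap_sum], of "{..<N}"] sums_unique[OF gap_sum]
  by (auto simp: g_nonneg)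
 finally show ?thesis .
qed

lemma KN_inverse:
 "(PROD p:A N - {n}. (mu n - mu p)/(mu n - m p)) = 1/KN n N"
proof -
 have "KN n N = (PROD p:A N - {n}. (mu n - m p)/(mu n - mu p))"
  unfolding KN_def
 proof (rule prod.mono_neutral_cong_right)
  show "1 - g p/(mu p - mu n) = (mu n - m p)/(mu n - mu p)" if "p:A N - {n}" for p
   using factor(1)[of p n] that by (auto simp: A_def m_def)
 qed (auto simp: A_def)
 hence "1/KN n N = (PROD p:A N - {n}. 1/((mu n - m p)/(mu n - mu p)))" by (simp add: prod_dividef)
 thus ?thesis by simp
qed

text \<open>The truncated products stay bounded by \<open>exp (- mu 0)\<close> uniformly in
  \<open>N\<close>, so the relative error becomes an absolute one that vanishes.\<close>

lemma tail_to_limit: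
 assumes "!!N. N >= n ==> \<bar>1 - x/(c*KN n N)\<bar> <= C*(\<Sum>k. \<bar>w (k + Suc N)\<bar>)" and "c > 0" "C >= 0"
 shows "x = c*K n"
proof -
 have "(%N. c*KN n N - x) ----> 0"
 proof (rule Lim_null_comparison)
  show "(%N. c*exp (- mu 0)*C*(\<Sum>k. \<bar>w (k + Suc N)\<bar>)) ----> 0"
   using tendsto_mult_left[OF suminf_tail_0[OF w_abs], of "c*exp (- mu 0)*C"] by simp
  show "EV N. norm (c*KN n N - x) <= c*exp (- mu 0)*C*(\<Sum>k. \<bar>w (k + Suc N)\<bar>)"
   using eventually_ge_at_top[of n]
  proof eventually_elim
   fix N assume N: "n <= N"
   note kn = KN_bounds[OF gap_partial, of n N]
   have kp: "KN n N > 0" using kn(1) by (meson exp_gt_zero less_le_trans)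
   have "c*KN n N - x = c*KN n N*(1 - x/(c*KN n N))" using kp assms(2) by (simp add: field_simps)
   hence "norm (c*KN n N - x) = c*KN n N*\<bar>1 - x/(c*KN n N)\<bar>" using kp assms(2) by (simp add: abs_mult)
   also have "... <= c*exp (- mu 0)*(C*(\<Sum>k. \<bar>w (k + Suc N)\<bar>))"
    by (intro mult_mono kn assms N) (use kp assms(2) in auto)
   finally show "norm (c*KN n N - x) <= c*exp (- mu 0)*C*(\<Sum>k. \<bar>w (k + Suc N)\<bar>)" by (simp add: mult_ac)
  qed
 qed
 moreover have "(%N. c*KN n N - x) ----> c*K n - x"
  by (intro tendsto_intros K_limit sums_summable[OF gap_sum])
 ultimately have "c*K n - x = 0" using LIMSEQ_unique by blast
 thus ?thesis by simp
qed

text \<open>With zeros at all \<open>mu p\<close> of open gaps, the eigenvalue of index 0 is the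
  only one up to \<open>N\<close> that survives.\<close>

theorem w0_eq: "w 0 = K 0"
proof -
 have "w 0 = 1*K 0"
 proof (rule tail_to_limit[of 0 "w 0" 1 1])
  fix N :: nat
  obtain a where s: "(%k. w k*(PROD p:A N. (mu k - mu p)/(mu k - m p))) sums 1"
   using prod_sums[of N mu] by blast
  have "\<bar>1 - w 0*(PROD p:A N. (mu 0 - mu p)/(mu 0 - m p))\<bar> <= (\<Sum>k. \<bar>w (k + Suc N)\<bar>)"
  proof (rule sums_tail_bound[OF s])
   show "w k*(PROD p:A N. (mu k - mu p)/(mu k - m p)) = 0" if "k <= N" "k ~= 0" for k
   proof (cases "k:A N")
    case True hence "(PROD p:A N. (mu k - mu p)/(mu k - m p)) = 0" using finA by (auto intro!: prod_zero)
    thus ?thesis by simp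
   next
    case False thus ?thesis using w_null' that by auto
   qed
   show "\<bar>w k*(PROD p:A N. (mu k - mu p)/(mu k - m p))\<bar> <= \<bar>w k\<bar>" if "k > N" for k
    using prod_ratio_le_1[OF that order_refl] by (auto simp: abs_mult intro!: mult_right_le_one_le)
  qed (auto intro: w_abs)
  moreover have "A N - {0} = A N" by (auto simp: A_def)
  ultimately show "\<bar>1 - w 0/(1*KN 0 N)\<bar> <= 1*(\<Sum>k. \<bar>w (k + Suc N)\<bar>)"
   using KN_inverse[where n = 0 and N = N] by simp
 qed auto
 thus ?thesis by simp
qed

theorem wn_eq: assumes n: "n >= 1" shows "w n = g n/(mu n - mu 0)*K n"
proof (cases "g n = 0")
 case True
 thus ?thesis using w_null[of "n - 1"] n by simp
next
 case False
 \<comment> \<open>Bounds (mu k - mu 0)/(mu k - m n) for \<open>k > n\<close>, because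
   \<open>mu k - mu n\<close> is at least 1.\<close>
 define C where "C = 1 + (mu n - mu 0)"
 have n0: "mu n - mu 0 >= 1" using dist1[of 0 n] n by simp
 show ?thesis
 proof (rule tail_to_limit[of n _ "g n/(mu n - mu 0)" C])
  show "g n/(mu n - mu 0) > 0" using False g_nonneg[OF n] n0 by simp
  show "C >= 0" using n0 by (simp add: C_def)
  fix N assume N: "n <= N"
  have nA: "n:A N" using False N n by (simp add: A_def)
  \<comment> \<open>Moving the zero from \<open>mu n\<close> to \<open>mu 0\<close> lets the term
    \<open>n\<close> survive instead of the term 0.\<close>
  define nu where "nu = mu(n := mu 0)"
  let ?P = "%k. PROD p:A N. (mu k - nu p)/(mu k - m p)"
  have P: "?P k = (mu k - mu 0)/(mu k - m n)*(PROD p:A N - {n}. (mu k - mu p)/(mu k - m p))" for k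
   by (subst prod.remove[OF finA nA]) (auto simp: nu_def)
  obtain a where s: "(%k. w k*?P k) sums 1"
   using prod_sums[of N nu] by blast
  have "\<bar>1 - w n*?P n\<bar> <= (\<Sum>k. C*\<bar>w (k + Suc N)\<bar>)"
  proof (rule sums_tail_bound[OF s _ N])
   show "w k*?P k = 0" if k: "k <= N" "k ~= n" for k
   proof (cases "k = 0 \<or> k:A N")
    case True
    thus ?thesis
    proof
     assume "k = 0" thus ?thesis unfolding P by simp
    next
     assume "k:A N"
     hence "(PROD p:A N - {n}. (mu k - mu p)/(mu k - m p)) = 0" using finA k by (auto intro!: prod_zero)
     thus ?thesis unfolding P by simp
    qed
   next
    case False thus ?thesis using w_null'[of k N] k by auto
   qed
   show "\<bar>w k*?P k\<bar> <= C*\<bar>w k\<bar>" if "k > N" for k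
   proof -
    have d: "mu k - mu n >= 1" "m n < mu n" using dist1[of n k] that N m_strict[OF n False] by auto
    have "mu k - mu 0 <= C*(mu k - mu n)"
     using d n0 mult_left_mono[OF d(1), of "mu n - mu 0"] by (simp add: C_def algebra_simps)
    also have "... <= C*(mu k - m n)" using d n0 by (intro mult_left_mono) (auto simp: C_def)
    finally have "(mu k - mu 0)/(mu k - m n) <= C" using d by (simp add: divide_le_eq)
    moreover have "0 <= (mu k - mu 0)/(mu k - m n)" using d n0 by simp
    moreover note prod_ratio_le_1[OF that, of "A N - {n}"]
    moreover have "x*y <= C*1" "0 <= x*y" if "x <= C" "0 <= x" "0 <= y" "y <= 1" for x y :: real
     using that by (intro mult_mono, auto)
    ultimately have "0 <= ?P k" "?P k <= C*1" unfolding P by blast+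
    hence "\<bar>w k\<bar>*\<bar>?P k\<bar> <= \<bar>w k\<bar>*C" by (intro mult_left_mono) auto
    thus ?thesis by (simp add: abs_mult mult.commute)
   qed
   show "summable (%k. C*\<bar>w k\<bar>)" by (intro summable_mult w_abs)
  qed
  moreover have "(\<Sum>k. C*\<bar>w (k + Suc N)\<bar>) = C*(\<Sum>k. \<bar>w (k + Suc N)\<bar>)"
   by (intro suminf_mult summable_ignore_initial_segment w_abs)
  moreover have "w n*?P n = w n/(g n/(mu n - mu 0)*KN n N)"
  proof -
   have "mu n - m n = g n" by (simp add: m_def g_def)
   thus ?thesis unfolding P KN_inverse by simp
  qed
  ultimately show "\<bar>1 - w n/(g n/(mu n - mu 0)*KN n N)\<bar> <= C*(\<Sum>k. \<bar>w (k + Suc N)\<bar>)" by simp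
 qed
qed

end

context spectral
begin

lemma cd: "cauchy_data mu w"
proof -
 interpret gp: gapped mu by unfold_locales (rule gap)
 have g: "gp.g p = ga p" for p by (simp add: gp.g_def ga_def)
 have s: "summable (%n. mu n*w n)" "summable w"
  using mu_w_sums w_sums by (auto simp: sums_iff)
 show ?thesis
 proof
  show "summable (%n. \<bar>w n\<bar>)" using s(2) by simp
  show "w sums 1" by (rule w_sums)
  have "(%n. mu n*w n - mu 0*w n) sums (0 - mu 0*1)" by (intro sums_diff mu_w_sums sums_mult w_sums)
  thus 1: "(%n. (mu n - mu 0)*w n) sums (- mu 0)" by (simp add: left_diff_distrib)
  thus "summable (%n. (mu n - mu 0)*\<bar>w n\<bar>)" by (simp add: sums_iff)
 qed (auto simp: g w_cauchy w_zero)
qed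

sublocale cd: cauchy_data mu w by (rule cd)

lemma g_ga: "cd.g p = ga p" by (simp add: cd.g_def ga_def)

end

section \<open>Normalised eigenbases and Birkhoff coordinates\<close>

lemma strict_mono_range_eq:
 fixes f g :: "nat => 'a::linorder"
 assumes f: "strict_mono f" and g: "strict_mono g" and r: "range f = range g"
 shows "f = g"
proof
 fix n show "f n = g n"
 proof (induction n rule: less_induct)
  case (less n)
  have le: "g n <= f n" if fg: "strict_mono f" "strict_mono g" "range f = range g" "!!m. m < n ==> f m = g m" for f g :: "nat => 'a"
  proof -
   obtain k where k: "f n = g k" using fg(3) by (metis rangeE rangeI)
   have "\<not> k < n" using fg(4)[of k] k strict_mono_eq[OF fg(1), of n k] by auto
   thus ?thesis using k strict_mono_less_eq[OF fg(2), of n k] by simp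
  qed
  show ?case using le[OF f g r] le[OF g f r[symmetric]] less by (metis antisym)
 qed
qed

text \<open>The closed version of \<open>pos_complex\<close>, which survives limits. Against a
  strictly positive reference it still fixes a unimodular factor, see
  \<open>unimodular_nnr\<close>.\<close>

definition nnr :: "complex => bool" where "nnr z <-> Im z = 0 \<and> Re z >= 0"

lemma pos_complex_iff: "pos_complex z <-> Im z = 0 \<and> Re z > 0"
 by (auto simp: pos_complex_def complex_is_Real_iff)

lemma pos_complex_nnr: "pos_complex z ==> nnr z" by (auto simp: pos_complex_iff nnr_def)

lemma unimodular_nnr:
 assumes "pos_complex a" "nnr (c*a)" "cmod c = 1" shows "c = 1"
proof -
 obtain r where a: "a = of_real r" "r > 0"
  using assms(1) by (intro that[of "Re a"]) (auto simp: pos_complex_iff complex_eq_iff)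
 have "Im c*r = 0" "Re c*r >= 0" using assms(2) by (auto simp: a(1) nnr_def)
 hence "Im c = 0" "Re c >= 0" using a(2) by (auto simp: zero_le_mult_iff)
 moreover have "(Re c)^2 = 1" using assms(3) calculation cmod_power2[of c] by simp
 ultimately show ?thesis by (simp add: complex_eq_iff power2_eq_1_iff)
qed

definition nbasis :: "cseq => (nat => real) => (nat => nat => complex) => bool" where
 "nbasis v mu F <-> ebasis v mu F \<and> pos_complex (ip (ev 0) (F 0)) \<and> (ALL n. pos_complex (ip (F (Suc n)) (sh (F n))))"

context spectral
begin

lemma w_pos: "w 0 > 0" "ga (Suc p) ~= 0 ==> w (Suc p) > 0"
proof -
 have K: "cd.K n > 0" for n
  using cd.K_bounds(1)[OF cd.gap_sum, of n] by (meson exp_gt_zero less_le_trans)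
 show "w 0 > 0" using cd.w0_eq K by simp
 assume "ga (Suc p) ~= 0"
 hence "ga (Suc p) > 0" using ga_nonneg[of "Suc p"] by simp
 moreover have "mu (Suc p) - mu 0 > 0" using mu_strict[of 0 "Suc p"] by simp
 ultimately show "w (Suc p) > 0" using cd.wn_eq[of "Suc p"] K[of "Suc p"] by (simp add: g_ga)
qed

lemma yv0_nonzero: "yv 0 ~= 0" using w_pos(1) by (auto simp: w_def)

lemma yv_nonzero_iff: "yv (Suc p) = 0 <-> ga (Suc p) = 0"
 using w_pos(2)[of p] yv_zero[of p] by (auto simp: w_def)

text \<open>Makes the normalisation by positive inner products possible: the entry is unimodular at
  a closed gap and given by the Cauchy formula at an open one.\<close>

lemma sm_sub_nonzero: "sm (Suc p) p ~= 0"
proof (cases "ga (Suc p) = 0")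
 case True thus ?thesis using sm_trivial(1)[OF True] by auto
next
 case False
 have "mu (Suc p) - (mu p + 1) ~= 0" using False by (simp add: ga_def)
 thus ?thesis unfolding sm_eq[OF False] using cc_nonzero[OF False] False yv_nonzero_iff[of p]
  by (metis divide_eq_0_iff mult_eq_0_iff of_real_eq_0_iff)
qed

lemma nbasis_exists: "EX G. nbasis v mu G"
proof -
 define a where "a n = ip (F (Suc n)) (sh (F n))" for n
 have a0: "a n ~= 0" for n
  using sm_sub_nonzero[of n] ip_commute[of "F (Suc n)" "sh (F n)"] by (simp add: a_def sm_def)
 \<comment> \<open>The phases are fixed recursively: the first by the constant, each next one by the
   shift of its predecessor.\<close>
 define th where "th = rec_nat (yv 0/of_real (cmod (yv 0))) (%n t. t*cnj (a n)/of_real (cmod (a n)))"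
 have t: "th 0 = yv 0/of_real (cmod (yv 0))" "th (Suc n) = th n*cnj (a n)/of_real (cmod (a n))" for n
  by (auto simp: th_def)
 have t1: "cmod (th n) = 1" for n
  by (induction n) (use yv0_nonzero a0 in "auto simp: t norm_mult norm_divide")
 hence tt: "th n*cnj (th n) = 1" for n by (simp add: complex_norm_square[symmetric])
 define G where "G = (%n k. th n*F n k)"
 have ipG: "ip (G m) (G n) = (if m = n then 1 else 0)" for m n
  by (simp add: G_def ip_scale_left ip_scale_right onF tt)
 have ep: "epair v (mu n) (G n)" for n
  unfolding epair_def by (simp add: G_def hs_scale qf_scale_left ip_scale_left qfF)
 have feas: "feas n G h <-> feas n F h" for n h
 proof -
  have "th i ~= 0" for i using t1[of i] by auto
  thus ?thesis by (auto simp: feas_def G_def ip_scale_right)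
 qed
 have "ebasis v mu G" unfolding ebasis_def eigen_system_def
  by (auto simp: ep ipG feas intro: minF)
 moreover have "pos_complex (ip (ev 0) (G 0))"
 proof -
  have "ip (ev 0) (G 0) = cnj (th 0)*yv 0" by (simp add: G_def ip_scale_right yv_def)
  also have "... = of_real (cmod (yv 0))"
   using yv0_nonzero by (simp add: t mult.commute[of "cnj _"] complex_norm_square[symmetric] power2_eq_square)
  finally show ?thesis using yv0_nonzero by (simp add: pos_complex_iff)
 qed
 moreover have "pos_complex (ip (G (Suc n)) (sh (G n)))" for n
 proof -
  have "sh (G n) = (%k. th n * sh (F n) k)" by (auto simp: G_def sh_def fun_eq_iff split: nat.splits)
  hence "ip (G (Suc n)) (sh (G n)) = th (Suc n)*cnj (th n)*a n"
   by (simp add: G_def ip_scale_right ip_scale_left a_def)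
  also have "... = (th n*cnj (th n))*(a n*cnj (a n))/of_real (cmod (a n))" by (simp add: t)
  also have "... = of_real (cmod (a n))"
   using a0[of n] t1[of n] unfolding complex_norm_square[symmetric] by (simp add: power2_eq_square)
  finally show ?thesis using a0[of n] by (simp add: pos_complex_iff)
 qed
 ultimately show ?thesis unfolding nbasis_def by blast
qed

end

locale nspectral =
 fixes s v mu F assumes npot: "pot s v" and nb: "nbasis v mu F"

sublocale nspectral \<subseteq> spectral
 by unfold_locales (use npot nb in "auto simp: nbasis_def")

context nspectral
begin

lemma pos0: "pos_complex (yv 0)" using nb by (simp add: nbasis_def yv_def)
lemma posS: "pos_complex (ip (F (Suc n)) (sh (F n)))" using nb by (simp add: nbasis_def)

lemma sm_pos: "pos_complex (sm (Suc n) n)"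
 using posS[of n] ip_commute[of "sh (F n)" "F (Suc n)"] by (simp add: sm_def pos_complex_iff)

text \<open>Simplicity of the spectrum makes each \<open>G n\<close> a multiple of some
  \<open>F k\<close>, coverage and monotonicity match the indices, and the signs fix the phases.
  Only nonnegativity is asked, so limits of normalised bases qualify; the same principle later
  identifies the finite gap bases and the actual eigenfunctions.\<close>

lemma identify:
 assumes ep: "!!n. epair v (l n) (G n)" and G1: "!!n. nsq (G n) = 1" and l: "strict_mono l"
  and cpl: "!!m. EX n. ip (F m) (G n) ~= 0"
  and p0: "nnr (ip (ev 0) (G 0))" and pS: "!!n. nnr (ip (G (Suc n)) (sh (G n)))"
 shows "l = mu" "G = F"
proof -
 have "ALL n. EX k. l n = mu k \<and> G n = (%j. ip (G n) (F k)*F k j)"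
 proof
  fix n
  obtain k where "l n = mu k" "G n = (%j. ip (G n) (F k)*F k j)"
   using epair_unique[OF ep[of n]] G1[of n] by auto
  thus "EX k. l n = mu k \<and> G n = (%j. ip (G n) (F k)*F k j)" by blast
 qed
 then obtain sg where sg: "!!n. l n = mu (sg n)" "!!n. G n = (%j. ip (G n) (F (sg n))*F (sg n) j)" by metis
 have "range l = range mu"
 proof
  show "range l \<subseteq> range mu" using sg(1) by auto
  show "range mu \<subseteq> range l"
  proof
   fix x assume "x:range mu"
   then obtain m where m: "x = mu m" by auto
   obtain n where n: "ip (F m) (G n) ~= 0" using cpl by blast
   have "ip (F m) (G n) = cnj (ip (G n) (F (sg n)))*ip (F m) (F (sg n))"
    by (subst sg(2)) (simp add: ip_scale_right)
   hence "sg n = m" using n onF[of m "sg n"] by (auto split: if_splits)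
   thus "x:range l" using sg(1)[of n] m by (metis rangeI)
  qed
 qed
 thus lm: "l = mu" by (rule strict_mono_range_eq[OF l strict_mono_mu])
 hence sn: "sg n = n" for n using sg(1)[of n] mu_inj by metis
 define c where "c n = ip (G n) (F n)" for n
 have Gc: "G n = (%j. c n*F n j)" for n using sg(2)[of n] sn by (simp add: c_def)
 have c1: "cmod (c n) = 1" for n
 proof -
  have "sqn (c n) = 1" using G1[of n] unfolding Gc nsq_scale by simp
  thus ?thesis by (metis norm_ge_zero power2_eq_1_iff abs_of_nonneg abs_minus abs_one)
 qed
 have "c n = 1" for n
 proof (induction n)
  case 0
  have "nnr (cnj (c 0)*yv 0)" using p0 unfolding Gc by (simp add: ip_scale_right yv_def)
  hence "cnj (c 0) = 1" by (rule unimodular_nnr[OF pos0]) (simp add: c1)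
  thus ?case by (metis complex_cnj_cnj complex_cnj_one)
 next
  case (Suc n)
  have "nnr (c (Suc n)*ip (F (Suc n)) (sh (F n)))" using pS[of n] Suc unfolding Gc by (simp add: ip_scale_left)
  thus ?case using unimodular_nnr[OF posS] c1 by blast
 qed
 thus "G = F" using Gc by auto
qed

text \<open>Polar form of the Birkhoff coordinate: by \<open>wn_eq\<close> the modulus of
  \<open>yv n\<close> is \<open>sqrt (ga n)\<close> times the normalising constant, and dividing by
  the latter leaves this. At a closed gap \<open>yv n\<close> is 0 and the coordinate
  vanishes.\<close>

definition ze :: cseq where
 "ze n = (if n = 0 \<or> yv n = 0 then 0 else yv n/of_real (cmod (yv n)) * of_real (sqrt (ga n)))"

lemma ze_sq: "n >= 1 ==> sqn (ze n) = ga n"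
 using ga_nonneg[of n] yv_nonzero_iff[of "n - 1"]
 by (auto simp: ze_def norm_mult norm_divide power_mult_distrib)

lemma yv_ze: assumes "n >= 1" shows "yv n = of_real (sqrt (cd.K n/(mu n - mu 0)))*ze n"
proof (cases "yv n = 0")
 case True thus ?thesis by (simp add: ze_def)
next
 case False
 have w: "sqn (yv n) = ga n*(cd.K n/(mu n - mu 0))"
  using cd.wn_eq[OF assms] by (simp add: g_ga w_def)
 hence "cmod (yv n) = sqrt (ga n) * sqrt (cd.K n/(mu n - mu 0))"
  by (metis norm_ge_zero real_sqrt_mult real_sqrt_unique)
 hence "complex_of_real (sqrt (ga n) * sqrt (cd.K n/(mu n - mu 0))) = of_real (cmod (yv n))" by simp
 hence "of_real (sqrt (cd.K n/(mu n - mu 0)))*ze n = yv n/of_real (cmod (yv n)) * of_real (cmod (yv n))"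
  using False assms by (simp add: ze_def mult_ac)
 thus ?thesis using False by simp
qed

lemma yv0_K: "yv 0 = of_real (sqrt (cd.K 0))"
proof -
 have "(Re (yv 0))^2 = cd.K 0" "Im (yv 0) = 0" "Re (yv 0) > 0"
  using cd.w0_eq pos0 cmod_power2[of "yv 0"] by (auto simp: w_def pos_complex_iff)
 thus ?thesis by (auto simp: complex_eq_iff intro: real_sqrt_unique[symmetric])
qed

end

lemma nbasis_ex: assumes "pot s v" shows "EX mu F. nbasis v mu F"
proof -
 obtain mu F where "ebasis v mu F" using ebasis_exists[OF assms] .
 then interpret spectral s v mu F using assms by unfold_locales
 show ?thesis using nbasis_exists by blast
qed

lemma nbasis_unique:
 assumes "pot s v" "nbasis v mu F" "nbasis v mu' F'" shows "mu' = mu" "F' = F"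
proof -
 interpret A: nspectral s v mu F using assms by unfold_locales
 interpret B: nspectral s v mu' F' using assms by unfold_locales
 have c: "EX n. ip (F m) (F' n) ~= 0" for m
 proof (rule ccontr)
  assume "\<not> ?thesis"
  hence "F m k = 0" for k using B.complete[of "F m" k] by auto
  thus False using A.nsqF[of m] by (simp add: nsq_def)
 qed
 show "mu' = mu" "F' = F"
  using A.identify[OF B.epF B.nsqF B.strict_mono_mu c pos_complex_nnr[OF B.pos0[unfolded B.yv_def]] pos_complex_nnr[OF B.posS]] .
qed

text \<open>The choice does not mention \<open>s\<close>, so \<open>zet\<close> is one function for
  all exponents.\<close>

definition emu :: "cseq => nat => real" where
 "emu v = fst (SOME p. nbasis v (fst p) (snd p))"
definition efn :: "cseq => nat => nat => complex" where
 "efn v = snd (SOME p. nbasis v (fst p) (snd p))"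

lemma nbasis_chosen: "pot s v ==> nbasis v (emu v) (efn v)"
 unfolding emu_def efn_def using nbasis_ex[of s v] by (metis (mono_tags, lifting) fst_conv snd_conv someI)

lemma nspectral_chosen: "pot s v ==> nspectral s v (emu v) (efn v)"
 by unfold_locales (auto intro: nbasis_chosen)

definition zet :: "cseq => nat => complex" where
 "zet v n = (let y = ip (ev 0) (efn v n) in if n = 0 \<or> y = 0 then 0
  else y/of_real (cmod y) * of_real (sqrt (emu v n - emu v (n - 1) - 1)))"

lemma (in nspectral) zet_eq: "zet v = ze"
proof -
 have e: "emu v = mu" "efn v = F" using nbasis_unique[OF npot nb nbasis_chosen[OF npot]] by auto
 show ?thesis by (rule ext) (simp add: zet_def ze_def Let_def yv_def ga_def e)
qed

section \<open>Dyadic weights\<close>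

lemma geometric_tail_le:
 fixes r :: real assumes "0 < r" "r < 1"
 shows "(SUM i:{a..<b}. r^i) <= r^a/(1 - r)"
proof -
 have "(SUM i:{a..<b}. r^i) <= (SUM i:{a..<max a b}. r^i)"
  by (rule sum_mono2) (use assms in auto)
 also have "(SUM i:{a..<max a b}. r^i) = (r^a - r^max a b)/(1 - r)"
  using sum_gp_offset[of r a "max a b - a"] assms sum_gp[of r a "max a b"]
  by (subst sum.atLeastLessThan_shift_0) (simp add: power_add sum_distrib_left[symmetric] lessThan_atLeast0[symmetric] sum_gp_strict right_diff_distrib)
 also have "... <= r^a/(1 - r)" using assms by (intro divide_right_mono) auto
 finally show ?thesis .
qed

lemma has_sum_finite_sum:
 fixes f :: "'i => 'a => 'b::topological_comm_monoid_add"
 shows "finite I ==> (!!i. i:I ==> (f i has_sum S i) A) ==> ((%x. SUM i:I. f i x) has_sum (SUM i:I. S i)) A"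
 by (induction I rule: finite_induct) (auto intro!: has_sum_add)

lemma real_dyadic: "2^j <= n ==> 2^j <= real n" "n <= 2^j ==> real n <= 2^j"
 using of_nat_le_iff[of "2^j" n, where 'a = real] of_nat_le_iff[of n "2^j", where 'a = real] by simp_all

text \<open>A superposition of the weights 1/(x + 2^i) at the dyadic energies, comparable to x^(-2s)
  for \<open>x\<close> between 2^a and 2^b.\<close>

definition WW :: "real => nat => nat => real => real" where
 "WW s a b x = (SUM i:{a..<b}. (2 powr (1 - 2 * s))^i/(x + 2^i))"

text \<open>Two geometric series, from the energies above and below the scale of
  \<open>x\<close>.\<close>

definition CW :: "real => real" where
 "CW s = 1/(1 - 2 powr (- (2 * s))) + 1/(1 - 2 powr (- (1 - 2 * s)))"

context
 fixes s :: real assumes s: "0 < s" "s < 1/2"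
begin

lemma pw: "(2 powr a)^i = (2 powr (a*real i) :: real)"
 by (simp add: powr_powr[symmetric] powr_realpow)

lemma CW_parts: "0 < 1/(1 - 2 powr (- (2 * s)))" "0 < 1/(1 - 2 powr (- (1 - 2 * s)))"
proof -
 have "2 powr (- (2 * s)) < (1::real)" "2 powr (- (1 - 2 * s)) < (1::real)"
  using s powr_less_mono[of "- (2 * s)" 0 2] powr_less_mono[of "- (1 - 2 * s)" 0 2] by simp_all
 thus "0 < 1/(1 - 2 powr (- (2 * s)))" "0 < 1/(1 - 2 powr (- (1 - 2 * s)))"
  by (simp_all only: zero_less_divide_1_iff diff_gt_0_iff_gt)
qed

lemma CW_nonneg: "CW s >= 0" using CW_parts by (simp add: CW_def)

lemma WW_nonneg: "x >= 0 ==> WW s a b x >= 0"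
 unfolding WW_def by (intro sum_nonneg divide_nonneg_nonneg) auto

lemma dyadic_tail: "(SUM i:{a..<b}. (2 powr (1 - 2 * s))^i/2^i) <= tp s a*(1/(1 - 2 powr (- (2 * s))))"
proof -
 have "(2 powr (1 - 2 * s))^i/2^i = (2 powr (- (2 * s)))^i" for i
  by (simp add: power_divide[symmetric] powr_diff powr_minus_divide)
 hence "(SUM i:{a..<b}. (2 powr (1 - 2 * s))^i/2^i) = (SUM i:{a..<b}. (2 powr (- (2 * s)))^i)" by simp
 also have "... <= (2 powr (- (2 * s)))^a/(1 - 2 powr (- (2 * s)))"
  by (rule geometric_tail_le) (use CW_parts in auto)
 finally show ?thesis by (simp add: pw)
qed

lemma WW_upper1: assumes "x >= 0" shows "WW s a b x <= CW s*tp s a"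
proof -
 have "WW s a b x <= (SUM i:{a..<b}. (2 powr (1 - 2 * s))^i/2^i)"
  unfolding WW_def by (intro sum_mono divide_left_mono) (use assms in "auto intro!: mult_pos_pos add_nonneg_pos")
 also have "... <= tp s a*(1/(1 - 2 powr (- (2 * s))))" by (rule dyadic_tail)
 also have "... <= tp s a*CW s"
  unfolding CW_def using CW_parts by (intro mult_left_mono) auto
 finally show ?thesis by (simp add: mult.commute)
qed

lemma dyadic_bracket: assumes "(n::nat) >= 1" obtains j where "2^j <= n" "n < 2^Suc j"
 using ex_power_ivl1[of 2 n] assms by auto

text \<open>With 2^j the dyadic scale of \<open>n\<close>, use 1/n for the energies up to
  \<open>j\<close>, where the coefficients grow geometrically, and 1/2^i beyond, where the quotients
  decay geometrically.\<close>

lemma WW_upper2: assumes n: "n >= 1" shows "WW s a b (real n) <= CW s*dw s n"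
proof -
 obtain j where j: "2^j <= n" "n < 2^Suc j" using dyadic_bracket[OF n] .
 have n0: "real n > 0" using n by simp
 have jn: "2 powr real j <= real n" "real n <= 2 powr real (Suc j)"
  using real_dyadic(1)[OF j(1)] real_dyadic(2)[OF less_imp_le[OF j(2)]]
  by (simp_all only: powr_realpow zero_less_numeral)
 let ?t = "%i. (2 powr (1 - 2 * s))^i/(real n + 2^i)"
 have "WW s a b (real n) <= sum ?t ({..j} Un {Suc j..<max b (Suc j)})"
  unfolding WW_def by (rule sum_mono2) auto
 also have "... = sum ?t {..j} + sum ?t {Suc j..<max b (Suc j)}"
  by (rule sum.union_disjoint) auto
 also have "sum ?t {..j} <= dw s n*(1/(1 - 2 powr (- (1 - 2 * s))))"
 proof -
  let ?q = "2 powr (- (1 - 2 * s)) :: real"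
  have "sum ?t {..j} <= (SUM i:{..j}. (2 powr (1 - 2 * s))^i/real n)"
   by (intro sum_mono divide_left_mono) (use n in "auto intro!: mult_pos_pos add_pos_nonneg")
  also have "... = (SUM i:{..j}. (2 powr (1 - 2 * s))^(j - i)/real n)"
   by (rule sum.reindex_bij_witness[of _ "%i. j - i" "%i. j - i"]) auto
  also have "... = (SUM i:{0..<Suc j}. ?q^i)*((2 powr (1 - 2 * s))^j/real n)"
   unfolding sum_distrib_right
  proof (rule sum.cong)
   fix i assume "i:{0..<Suc j}"
   hence "(2 powr (1 - 2 * s))^(j - i) = ?q^i*(2 powr (1 - 2 * s))^j"
    by (simp add: pw powr_add[symmetric] of_nat_diff algebra_simps)
   thus "(2 powr (1 - 2 * s))^(j - i)/real n = ?q^i*((2 powr (1 - 2 * s))^j/real n)" by simp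
  qed auto
  also have "... <= (?q^0/(1 - ?q))*(dw s n)"
  proof (rule mult_mono)
   show "(SUM i:{0..<Suc j}. ?q^i) <= ?q^0/(1 - ?q)"
    by (rule geometric_tail_le) (use CW_parts in auto)
   have "(2 powr (1 - 2 * s))^j = (2 powr real j) powr (1 - 2 * s)" by (simp add: pw powr_powr mult.commute)
   also have "... <= real n powr (1 - 2 * s)" by (rule powr_mono2) (use s jn in auto)
   finally have "(2 powr (1 - 2 * s))^j/real n <= real n powr (1 - 2 * s)/real n" using n0 by (intro divide_right_mono) auto
   also have "... = dw s n" using n0 powr_diff[of "real n" "- (2 * s) + 1" 1] by (simp add: algebra_simps)
   finally show "(2 powr (1 - 2 * s))^j/real n <= dw s n" .
  qed (use CW_parts in "auto intro!: sum_nonneg")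
  finally show ?thesis by (simp add: mult.commute)
 qed
 also have "sum ?t {Suc j..<max b (Suc j)} <= dw s n*(1/(1 - 2 powr (- (2 * s))))"
 proof -
  have "sum ?t {Suc j..<max b (Suc j)} <= (SUM i:{Suc j..<max b (Suc j)}. (2 powr (1 - 2 * s))^i/2^i)"
   by (intro sum_mono divide_left_mono) (auto intro!: mult_pos_pos add_nonneg_pos)
  also have "... <= tp s (Suc j)*(1/(1 - 2 powr (- (2 * s))))" by (rule dyadic_tail)
  also have "... <= dw s n*(1/(1 - 2 powr (- (2 * s))))"
  proof (rule mult_right_mono)
   have "tp s (Suc j) = (2 powr real (Suc j)) powr (- (2 * s))" by (simp add: powr_powr mult.commute)
   also have "... <= dw s n" by (rule powr_mono2') (use s jn n0 in auto)
   finally show "tp s (Suc j) <= dw s n" .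
  qed (use CW_parts in auto)
  finally show ?thesis .
 qed
 finally show ?thesis by (simp add: CW_def algebra_simps)
qed

text \<open>The single term at the scale 2^j of \<open>n\<close> suffices; there n + 2^j is at most
  3 times 2^j.\<close>

lemma WW_lower:
 assumes n: "2^a <= n" "n < 2^b" shows "dw s n <= 3*WW s a b (real n)"
proof -
 have n1: "n >= 1" using n(1) by (metis one_le_numeral one_le_power order_trans)
 obtain j where j: "2^j <= n" "n < 2^Suc j" using dyadic_bracket[OF n1] .
 have "a <= j" using n(1) j(2) by (metis less_Suc_eq_le order_le_less_trans one_less_numeral_iff power_less_imp_less_exp semiring_norm(76))
 moreover have "j < b" using n(2) j(1) by (metis order_le_less_trans one_less_numeral_iff power_less_imp_less_exp semiring_norm(76))
 ultimately have jm: "j:{a..<b}" by simp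
 have jr: "2^j <= real n" "real n <= 2*2^j"
  using real_dyadic(1)[OF j(1)] real_dyadic(2)[OF less_imp_le[OF j(2)]] by simp_all
 have "dw s n <= (2^j) powr (- (2 * s))"
  by (rule powr_mono2') (use s jr in auto)
 also have "... = 3*((2 powr (1 - 2 * s))^j/(3*2^j))"
 proof -
  have "(2 powr (1 - 2 * s))^j = (2^j) powr (1 - 2 * s)"
   by (simp add: pw powr_realpow[symmetric] powr_powr mult.commute)
  also have "... = 2^j*(2^j) powr (- (2 * s))"
   using powr_add[of "2^j" 1 "- (2 * s)"] by simp
  finally show ?thesis by simp
 qed
 also have "... <= 3*((2 powr (1 - 2 * s))^j/(real n + 2^j))"
  using jr by (intro mult_left_mono divide_left_mono) (auto intro!: mult_pos_pos add_nonneg_pos)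
 also have "... <= 3*WW s a b (real n)"
  unfolding WW_def using member_le_sum[of j "{a..<b}" "%i. (2 powr (1 - 2 * s))^i/(real n + 2^i)"] jm
  by (intro mult_left_mono) (auto intro!: divide_nonneg_nonneg)
 finally show ?thesis .
qed

text \<open>Below the lowest energy only the term \<open>i = a\<close> is kept, at the price of a
  factor depending on \<open>a\<close>.\<close>

lemma WW_lower_small:
 assumes n: "1 <= n" "n <= 2^a" "a < b" shows "dw s n <= 2*2^a*WW s a b (real n)"
proof -
 have "dw s n <= real n powr 0" by (rule powr_mono) (use s n in auto)
 also have "... <= (2 powr (1 - 2 * s))^a" using n s by (simp add: ge_one_powr_ge_zero one_le_power)
 also have "... = 2*2^a*((2 powr (1 - 2 * s))^a/(2^a + 2^a))" by simp
 also have "... <= 2*2^a*((2 powr (1 - 2 * s))^a/(real n + 2^a))"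
 proof -
  have "real n <= 2^a" by (rule real_dyadic(2)[OF n(2)])
  thus ?thesis by (intro mult_left_mono divide_left_mono) (auto intro!: mult_pos_pos add_nonneg_pos)
 qed
 also have "... <= 2*2^a*WW s a b (real n)"
  unfolding WW_def using member_le_sum[of a "{a..<b}" "%i. (2 powr (1 - 2 * s))^i/(real n + 2^i)"] n(3)
  by (intro mult_left_mono) (auto intro!: divide_nonneg_nonneg)
 finally show ?thesis .
qed

text \<open>A comparison of the averages \<open>\<Sum> a k / (k + L)\<close> at all dyadic \<open>L\<close> is a comparison of the
  weighted sums \<open>\<Sum> k\<^sup>-\<^sup>2\<^sup>s a k\<close>, including their tails.\<close>

lemma dyadic_transfer:
 fixes a b :: "nat => real" and K :: nat
 assumes a: "!!k. a k >= 0" and b: "!!n. b n >= 0" and M: "M >= 0"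
  and bs: "(%n. dw s n*b n) summable_on {1..}"
  and cmp: "!!i F. i >= i1 ==> finite F ==> (SUM k:F. a k/(real k + 2^i)) <= M*(INFSUM n. b n/(real n + 2^i))"
  and F: "finite F"
 defines "B \<equiv> M*CW s*((INFSUM n:{K<..}. dw s n*b n) + tp s i1*(SUM n<=K. b n))"
 shows "F \<subseteq> {2^i1..} ==> (SUM k:F. dw s k*a k) <= 3*B"
  and "F \<subseteq> {1..} ==> (SUM k:F. dw s k*a k) <= (3 + 2*2^i1)*B"
proof -
 obtain J where J: "F \<subseteq> {..<J}" using finite_nat_bounded[OF F] by blast
 \<comment> \<open>Large enough that \<open>F\<close> lies below 2^I and that the energy 2^i1 itself
   occurs.\<close>
 define I where "I = max J (Suc i1)"
 have FI: "k < 2^I" if "k:F" for k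
 proof -
  have "k < J" using J that by auto
  also have "J <= I" by (simp add: I_def)
  also have "I < 2^I" by (rule less_exp)
  finally show ?thesis .
 qed
 have sb: "(%n. b n/(real n + 2^i)) summable_on UNIV" for i
 proof -
  have "(%n. b n/(real n + 2^i)) summable_on {1..}"
  proof (rule summable_on_le[OF bs])
   fix n :: nat assume n: "n:{1..}"
   have "b n/(real n + 2^i) <= b n/real n"
    using b n by (intro divide_left_mono) (auto intro!: mult_pos_pos add_pos_nonneg)
   also have "... = real n powr (- 1)*b n" using n by (simp add: powr_minus_divide)
   also have "... <= dw s n*b n" using n s b by (intro mult_right_mono powr_mono) auto
   finally show "b n/(real n + 2^i) <= dw s n*b n" .
  qed (use b in "auto intro!: divide_nonneg_nonneg")
  hence "(%n. b n/(real n + 2^i)) summable_on ({0} Un {1..})"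
   by (intro summable_on_Un_disjoint) auto
  moreover have "{0} Un {1..} = (UNIV :: nat set)" by auto
  ultimately show ?thesis by simp
 qed
 have W: "(SUM k:F. a k*WW s i1 I (real k)) <= B"
 proof -
  have "(SUM k:F. a k*WW s i1 I (real k)) = (SUM i:{i1..<I}. (2 powr (1 - 2 * s))^i*(SUM k:F. a k/(real k + 2^i)))"
   unfolding WW_def sum_distrib_left by (subst sum.swap) (simp add: mult_ac)
  also have "... <= (SUM i:{i1..<I}. (2 powr (1 - 2 * s))^i*(M*(INFSUM n. b n/(real n + 2^i))))"
   by (intro sum_mono mult_left_mono cmp F) auto
  also have "... = M*(SUM i:{i1..<I}. (INFSUM n. (2 powr (1 - 2 * s))^i*(b n/(real n + 2^i))))"
   by (simp only: sum_distrib_left infsum_cmult_right' mult.left_commute)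
  also have "(SUM i:{i1..<I}. (INFSUM n. (2 powr (1 - 2 * s))^i*(b n/(real n + 2^i)))) = (INFSUM n. b n*WW s i1 I (real n))"
  proof -
   have "((%n. SUM i:{i1..<I}. (2 powr (1 - 2 * s))^i*(b n/(real n + 2^i))) has_sum
    (SUM i:{i1..<I}. (INFSUM n. (2 powr (1 - 2 * s))^i*(b n/(real n + 2^i))))) UNIV"
    by (intro has_sum_finite_sum has_sum_infsum summable_on_cmult_right sb) auto
   thus ?thesis unfolding WW_def sum_distrib_left by (simp add: infsumI mult_ac)
  qed
  also have "(INFSUM n. b n*WW s i1 I (real n)) <= CW s*((INFSUM n:{K<..}. dw s n*b n) + tp s i1*(SUM n<=K. b n))"
  proof (rule infsum_le_bound(2))
   show "b n*WW s i1 I (real n) >= 0" for n using b WW_nonneg by simp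
   fix A :: "nat set" assume A: "finite A"
   have "(SUM n:A. b n*WW s i1 I (real n)) = (SUM n:A Int {K<..}. b n*WW s i1 I (real n)) + (SUM n:A - {K<..}. b n*WW s i1 I (real n))"
    by (rule sum.Int_Diff[OF A])
   also have "... <= (SUM n:A Int {K<..}. CW s*(dw s n*b n)) + (SUM n:A - {K<..}. CW s*tp s i1*b n)"
   proof (intro add_mono sum_mono)
    fix n assume "n:A Int {K<..}"
    hence "b n*WW s i1 I (real n) <= b n*(CW s*dw s n)" by (intro mult_left_mono WW_upper2 b) auto
    thus "b n*WW s i1 I (real n) <= CW s*(dw s n*b n)" by (simp add: mult_ac)
   next
    fix n
    have "b n*WW s i1 I (real n) <= b n*(CW s*tp s i1)" by (intro mult_left_mono WW_upper1 b) auto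
    thus "b n*WW s i1 I (real n) <= CW s*tp s i1*b n" by (simp add: mult_ac)
   qed
   also have "... = CW s*(SUM n:A Int {K<..}. dw s n*b n) + CW s*tp s i1*(SUM n:A - {K<..}. b n)"
    by (simp add: sum_distrib_left)
   also have "... <= CW s*(INFSUM n:{K<..}. dw s n*b n) + CW s*tp s i1*(SUM n<=K. b n)"
   proof (intro add_mono mult_left_mono)
    show "(SUM n:A Int {K<..}. dw s n*b n) <= (INFSUM n:{K<..}. dw s n*b n)"
     by (intro infsum_ge_sum summable_on_subset_banach[OF bs]) (use A b in auto)
    show "(SUM n:A - {K<..}. b n) <= (SUM n<=K. b n)" by (rule sum_mono2) (use b in auto)
   qed (use CW_nonneg in auto)
   finally show "(SUM n:A. b n*WW s i1 I (real n)) <= CW s*((INFSUM n:{K<..}. dw s n*b n) + tp s i1*(SUM n<=K. b n))"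
    by (simp add: distrib_left mult_ac)
  qed
  finally show ?thesis using M by (simp add: B_def mult_left_mono mult.assoc)
 qed
 show "(SUM k:F. dw s k*a k) <= 3*B" if "F \<subseteq> {2^i1..}"
 proof -
  have "(SUM k:F. dw s k*a k) <= (SUM k:F. 3*WW s i1 I (real k)*a k)"
   by (intro sum_mono mult_right_mono WW_lower a) (use that FI in auto)
  also have "... = 3*(SUM k:F. a k*WW s i1 I (real k))" by (simp add: sum_distrib_left mult_ac)
  also have "... <= 3*B" using W by simp
  finally show ?thesis .
 qed
 show "(SUM k:F. dw s k*a k) <= (3 + 2*2^i1)*B" if F1: "F \<subseteq> {1..}"
 proof -
  have "(SUM k:F. dw s k*a k) <= (SUM k:F. (3 + 2*2^i1)*WW s i1 I (real k)*a k)"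
  proof (intro sum_mono mult_right_mono a)
   fix k assume k: "k:F"
   have w: "WW s i1 I (real k) >= 0" by (rule WW_nonneg) simp
   show "dw s k <= (3 + 2*2^i1)*WW s i1 I (real k)"
   proof (cases "2^i1 <= k")
    case True
    hence "dw s k <= 3*WW s i1 I (real k)" using FI k by (intro WW_lower) auto
    also have "... <= (3 + 2*2^i1)*WW s i1 I (real k)" using w by (intro mult_right_mono) auto
    finally show ?thesis .
   next
    case False
    hence "dw s k <= 2*2^i1*WW s i1 I (real k)" using F1 k by (intro WW_lower_small) (auto simp: I_def)
    also have "... <= (3 + 2*2^i1)*WW s i1 I (real k)" using w by (intro mult_right_mono) auto
    finally show ?thesis .
   qed
  qed
  also have "... = (3 + 2*2^i1)*(SUM k:F. a k*WW s i1 I (real k))" unfolding sum_distrib_left by (simp only: mult_ac)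
  also have "... <= (3 + 2*2^i1)*B" using W by (intro mult_left_mono) auto
  finally show ?thesis .
 qed
qed

end

section \<open>Two-sided estimates between potential and Birkhoff coordinates\<close>

lemma hplus_0: "v:hplus sg ==> v 0 = 0" by (simp add: hplus_def)

lemma pot_0: "pot s v ==> v 0 = 0" unfolding pot_def using hplus_0 by blast

lemma hplus_summable: "v:hplus sg ==> (%n. hw sg v n) summable_on {1..}"
 by (simp add: hplus_def)

lemma summable_on_add_zero:
 fixes f :: "nat => real" assumes "f summable_on {1..}" shows "f summable_on UNIV"
proof -
 have "f summable_on ({0} Un {1..})" using assms by (intro summable_on_Un_disjoint) auto
 moreover have "{0} Un {1..} = (UNIV :: nat set)" by auto
 ultimately show ?thesis by simp
qed

lemma pot_summable:
 assumes "pot s v" "L > 0" shows "(%k. sqn (v k)/(real k + L)) summable_on UNIV"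
proof (rule summable_on_add_zero)
 show "(%k. sqn (v k)/(real k + L)) summable_on {1..}"
 proof (rule summable_on_le)
  show "(%n. hw (- s) v n) summable_on {1..}"
   using assms by (intro hplus_summable) (simp add: pot_def)
  fix n :: nat assume n: "n:{1..}"
  have "sqn (v n)/(real n + L) <= sqn (v n)/real n"
   using n assms by (intro divide_left_mono) auto
  also have "... = real n powr (- 1) * sqn (v n)" using n by (simp add: powr_minus_divide)
  also have "... <= hw (- s) v n"
   using n assms by (intro mult_right_mono powr_mono) (auto simp: pot_def)
  finally show "sqn (v n)/(real n + L) <= hw (- s) v n" .
 qed (use assms in auto)
qed

text \<open>The Lax operator sends the constant to minus the projected potential, so the form at the
  constant reads off \<open>v\<close>.\<close>

lemma qf_ev0:
 assumes "pot s v" shows "qf v (ev 0) g = - (INFSUM k. v k*cnj (g k))"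
 using uc_of_nat[of v, OF pot_0[OF assms]] by (simp add: qf_def dpart_ev_left tf_ev_left)

text \<open>The free resolvent (D + L)^(-1) applied to \<open>v\<close>. Its energy at level
  \<open>L\<close> is the average of |v k|^2 with weights 1/(k + L).\<close>

definition rs :: "cseq => real => nat => complex" where
 "rs v L k = v k/of_real (real k + L)"

lemma rs_cmod: "L > 0 ==> cmod (rs v L k) = cmod (v k)/(real k + L)"
 unfolding rs_def norm_divide norm_of_real by simp

lemma wt_rs: "L > 0 ==> sqn (wt L (rs v L) k) = sqn (v k)/(real k + L)"
 by (simp add: wt_cmod_sq rs_cmod power_divide) (simp add: power2_eq_square)

lemma cauchy_schwarz_sum: "(SUM x:J. a x*b x) <= sqrt (SUM x:J. (a x)^2) * sqrt (SUM x:J. (b x :: real)^2)"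
 using real_le_rsqrt[OF Cauchy_Schwarz_ineq_sum[of a b J]] by (simp add: real_sqrt_mult)

lemma rs_hs: "pot s v ==> L > 0 ==> hs (rs v L)"
 unfolding hs_iff[of L, symmetric] ell2_def by (simp add: wt_rs pot_summable)

lemma en_rs: "L > 0 ==> en L (rs v L) = (INFSUM k. sqn (v k)/(real k + L))"
 by (simp add: en_def nsq_def wt_rs)

lemma rs_cs:
 assumes v: "pot s v" and L: "L > 0" and g: "hs g"
 shows "cmod (INFSUM k. v k*cnj (g k)) <= sqrt (en L (rs v L)) * sqrt (en L g)"
proof -
 have "v k*cnj (g k) = wt L (rs v L) k*cnj (wt L g k)" for k
 proof -
  have "wt L (rs v L) k*cnj (wt L g k) = of_real (sqrt (real k + L) * sqrt (real k + L))/of_real (real k + L)*(v k*cnj (g k))"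
   unfolding wt_def rs_def of_real_mult by (simp add: mult_ac)
  also have "sqrt (real k + L) * sqrt (real k + L) = real k + L" using L by simp
  also have "complex_of_real (real k + L)/of_real (real k + L) = 1"
  proof -
   have "real k + L ~= 0" using L by simp
   thus ?thesis by (metis of_real_eq_0_iff divide_self)
  qed
  finally show ?thesis by simp
 qed
 hence "(INFSUM k. v k*cnj (g k)) = ip (wt L (rs v L)) (wt L g)" by (simp add: ip_def)
 thus ?thesis unfolding en_def using ip_bound[of "wt L (rs v L)" "wt L g"] hs_iff[OF L] rs_hs[OF v L] g by simp
qed

text \<open>In the cubic term \<open>\<Sum> v (k - l) g l (g k)\<^sup>*\<close> with \<open>g k = v k / (k + L)\<close>, the coefficient
  \<open>v j = (j + L) g j\<close> is absorbed using \<open>j + L \<le> (j + l) + L\<close>; no positive power of the energy is lost.\<close>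

lemma tf_rs_bound:
 assumes v: "pot s v" and L: "L > 0" and l1: "(%k. cmod (rs v L k)) summable_on UNIV"
 shows "cmod (tf v (rs v L) (rs v L)) <= 2*(INFSUM k. cmod (rs v L k))*en L (rs v L)"
proof -
 define g where "g = rs v L"
 define G where "G = (INFSUM k. cmod (g k))"
 have gh: "hs g" unfolding g_def by (rule rs_hs[OF v L])
 have gw: "ell2 (wt L g)" using hs_iff[OF L] gh by simp
 define h where "h p = cmod (tz v (fst p) (snd p)*g (snd p)*cnj (g (fst p)))" for p
 have hsym: "h (prod.swap p) = h p" for p
  using uc_uminus[of v "int (fst p) - int (snd p)"] by (simp add: h_def norm_mult)
 have g0: "g 0 = 0" using pot_0[OF v] by (simp add: g_def rs_def)
 have vg: "cmod (v j) = (real j + L)*cmod (g j)" for j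
  using rs_cmod[OF L, of v j] L by (simp add: g_def)
 have row: "(SUM j:J. cmod (v j)*cmod (g (j + l))) <= en L g" if J: "finite J" for J l
 proof -
  have "(SUM j:J. cmod (v j)*cmod (g (j + l))) <= (SUM j:J. cmod (wt L g j)*cmod (wt L g (j + l)))"
  proof (rule sum_mono)
   fix j
   have "cmod (v j)*cmod (g (j + l)) = (sqrt (real j + L)*cmod (g j))*(sqrt (real j + L)*cmod (g (j + l)))"
    using L by (simp add: vg)
   also have "... <= (sqrt (real j + L)*cmod (g j))*(sqrt (real (j + l) + L)*cmod (g (j + l)))"
    using L by (intro mult_left_mono mult_right_mono) auto
   also have "... = cmod (wt L g j)*cmod (wt L g (j + l))" using L by (simp add: wt_def norm_mult)
   finally show "cmod (v j)*cmod (g (j + l)) <= cmod (wt L g j)*cmod (wt L g (j + l))" .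
  qed
  also have "... <= sqrt (SUM j:J. sqn (wt L g j)) * sqrt (SUM j:J. sqn (wt L g (j + l)))"
   by (rule cauchy_schwarz_sum)
  also have "... <= sqrt (en L g) * sqrt (en L g)"
  proof (intro mult_mono real_sqrt_le_mono)
   show "(SUM j:J. sqn (wt L g j)) <= en L g" unfolding en_def by (rule sum_le_nsq[OF gw J])
   have "(SUM j:J. sqn (wt L g (j + l))) = (SUM j:(%j. j + l) ` J. sqn (wt L g j))"
    by (subst sum.reindex) (auto simp: inj_on_def)
   also have "... <= en L g" unfolding en_def by (rule sum_le_nsq[OF gw]) (use J in auto)
   finally show "(SUM j:J. sqn (wt L g (j + l))) <= en L g" .
  qed (auto intro!: sum_nonneg)
  finally show ?thesis by simp
 qed
 have upper: "sum h {p:F. snd p < fst p} <= G*en L g" if F: "finite F" for F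
 proof -
  have "sum h {p:F. snd p < fst p} = (SUM q:(%p. (snd p, fst p - snd p)) ` {p:F. snd p < fst p}. cmod (g (fst q))*(cmod (v (snd q))*cmod (g (snd q + fst q))))"
  proof (subst sum.reindex)
   show "inj_on (%p. (snd p, fst p - snd p)) {p:F. snd p < fst p}" by (auto simp: inj_on_def)
   show "sum h {p:F. snd p < fst p} = sum ((%q. cmod (g (fst q))*(cmod (v (snd q))*cmod (g (snd q + fst q)))) \<circ> (%p. (snd p, fst p - snd p))) {p:F. snd p < fst p}"
   proof (rule sum.cong[OF refl])
    fix p assume "p:{p:F. snd p < fst p}"
    hence "int (fst p) - int (snd p) = int (fst p - snd p)" "fst p - snd p + snd p = fst p" by auto
    thus "h p = ((%q. cmod (g (fst q))*(cmod (v (snd q))*cmod (g (snd q + fst q)))) \<circ> (%p. (snd p, fst p - snd p))) p"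
     using uc_of_nat[of v "fst p - snd p", OF pot_0[OF v]] unfolding h_def o_def by (simp add: norm_mult)
   qed
  qed
  also have "... <= (SUM q:snd ` F \<times> (%p. fst p - snd p) ` F. cmod (g (fst q))*(cmod (v (snd q))*cmod (g (snd q + fst q))))"
   by (rule sum_mono2) (use F in auto)
  also have "... = (SUM l:snd ` F. cmod (g l)*(SUM j:(%p. fst p - snd p) ` F. cmod (v j)*cmod (g (j + l))))"
   unfolding sum_distrib_left sum.cartesian_product by (rule sum.cong) auto
  also have "... <= (SUM l:snd ` F. cmod (g l)*en L g)"
   by (intro sum_mono mult_left_mono row) (use F in auto)
  also have "... = (SUM l:snd ` F. cmod (g l))*en L g" by (simp add: sum_distrib_right)
  also have "... <= G*en L g"
   unfolding G_def by (intro mult_right_mono infsum_ge_sum) (use F l1 in "auto simp: g_def")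
  finally show ?thesis .
 qed
 have "sum h F <= 2*G*en L g" if F: "finite F" for F
 proof -
  have "sum h F = sum h {p:F. snd p < fst p} + sum h {p:F. \<not> snd p < fst p}"
   by (subst sum.union_disjoint[symmetric]) (use F in "auto intro: sum.cong")
  also have "sum h {p:F. \<not> snd p < fst p} = sum h {p:F. fst p < snd p}"
   by (rule sum.mono_neutral_right) (use F in "auto simp: h_def not_less le_less")
  also have "... = sum h {p:prod.swap ` F. snd p < fst p}"
   by (rule sum.reindex_bij_witness[of _ prod.swap prod.swap]) (use hsym in auto)
  also have "sum h {p:F. snd p < fst p} + ... <= G*en L g + G*en L g"
   by (intro add_mono upper) (use F in auto)
  finally show ?thesis by simp
 qed
 hence "(INFSUM p. h p) <= 2*G*en L g" by (intro infsum_le_bound(2)) (auto simp: h_def)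
 moreover have "cmod (tf v g g) <= (INFSUM p. h p)"
  unfolding tf_def h_def by (rule norm_infsum_bound[OF tf_abs_summable[OF v gh gh]])
 ultimately show ?thesis by (simp add: g_def G_def)
qed

definition CS :: "real => real" where
 "CS s = sqrt (INFSUM n:{1..}. real n powr (- (2 - 2 * s)))"

lemma CS_nonneg: "CS s >= 0" by (simp add: CS_def infsum_nonneg)

text \<open>Cauchy-Schwarz with k^(s-1), square summable because s < 1/2. The bound does not depend
  on \<open>L\<close>, as the superposition over energies demands.\<close>

lemma rs_l1:
 assumes v: "pot s v" and L: "L > 0"
 shows "(%k. cmod (rs v L k)) summable_on UNIV" "(INFSUM k. cmod (rs v L k)) <= CS s * sqrt (wn (- s) v)"
proof -
 have s: "0 < s" "s < 1/2" "v:hplus (- s)" using v by (auto simp: pot_def)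
 note r = rs_cmod[OF L, of v]
 let ?a = "%n. real n powr (s - 1)" and ?b = "%n. real n powr (- s)*cmod (v n)"
 have sa: "(%n. (?a n)^2) summable_on {1..}"
 proof -
  have "(%k. real k powr (- (2 - 2 * s))) summable_on Suc ` UNIV"
   using summable_powr_shift[of "2 - 2 * s"] s by (subst summable_on_reindex) (auto simp: o_def)
  moreover have "Suc ` UNIV = {1..}" by (auto simp: image_iff Suc_le_eq gr0_conv_Suc)
  moreover have "(?a n)^2 = real n powr (- (2 - 2 * s))" for n
   by (simp add: powr_power[symmetric] powr_powr power2_eq_square powr_add[symmetric])
  ultimately show ?thesis by simp
 qed
 have a2: "(INFSUM n:{1..}. (?a n)^2) = (CS s)^2"
  unfolding CS_def by (subst real_sqrt_pow2) (auto intro!: infsum_nonneg infsum_cong simp: power2_eq_square powr_add[symmetric])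
 have b2: "(?b n)^2 = hw (- s) v n" for n
  by (simp add: power_mult_distrib power2_eq_square powr_add[symmetric])
 have sb: "(%n. (?b n)^2) summable_on {1..}" unfolding b2 by (rule hplus_summable[OF s(3)])
 note cs = cauchy_schwarz_infsum[of "{1..}" ?a ?b, OF _ _ sa sb]
 have le: "cmod (rs v L n) <= ?a n*?b n" if "n:{1..}" for n
 proof -
  have "?a n*?b n = real n powr (- 1)*cmod (v n)" by (simp add: mult.assoc[symmetric] powr_add[symmetric])
  also have "... = cmod (v n)/real n" using that by (simp add: powr_minus_divide)
  finally show ?thesis unfolding r using that L by (simp add: divide_left_mono)
 qed
 have s1: "(%k. cmod (rs v L k)) summable_on {1..}"
  by (rule summable_on_le[OF cs(1)]) (use le in auto)
 thus "(%k. cmod (rs v L k)) summable_on UNIV" by (rule summable_on_add_zero)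
 have "(INFSUM k. cmod (rs v L k)) = (INFSUM k:{1..}. cmod (rs v L k))"
  by (rule infsum_cong_neutral) (use pot_0[OF v] in "auto simp: r Suc_le_eq")
 also have "... <= (INFSUM n:{1..}. ?a n*?b n)" by (rule infsum_mono[OF s1 cs(1)]) (use le in auto)
 also have "... <= sqrt ((CS s)^2) * sqrt (INFSUM n:{1..}. (?b n)^2)" using cs(2) unfolding a2 by auto
 also have "... = CS s * sqrt (wn (- s) v)" unfolding b2 wn_def using CS_nonneg by simp
 finally show "(INFSUM k. cmod (rs v L k)) <= CS s * sqrt (wn (- s) v)" .
qed

section \<open>Testing the form against resolvent type vectors\<close>

context spectral
begin

text \<open>The spectral sum \<open>Q\<close> is both the pairing of the potential with
  \<open>g\<close> and the shifted form at \<open>g\<close>. Duality bounds the pairing by the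
  energies of \<open>rs v L\<close> and \<open>g\<close>, and coercivity returns the latter to
  \<open>Q\<close>.\<close>

lemma test_forward:
 assumes L: "small_at v L"
 shows "(SUM n<N. (mu n)^2*w n/(mu n + L)) <= 2*(INFSUM k. sqn (v k)/(real k + L))"
proof -
 have L1: "L >= 1" using L by (simp add: small_at_def)
 have pos: "mu n + L > 0" for n
 proof -
  have "en L (F 0)/2 <= mu 0 + L" using qd_coercive(1)[OF pot L hsF[of 0]] by (simp add: qdF)
  moreover have "L*nsq (F 0) <= en L (F 0)" by (rule nsq_le_en) (use L1 in auto)
  ultimately have "mu 0 + L > 0" using L1 nsqF[of 0] by simp
  thus ?thesis using mu_mono[of 0 n] by simp
 qed
 \<comment> \<open>Coefficients of (A + L)^(-1) A applied to the constant, with A the Lax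
   operator.\<close>
 define c where "c n = of_real (mu n/(mu n + L))*yv n" for n
 define g where "g = (%k. SUM n<N. c n*F n k)"
 define Q where "Q = (SUM n<N. (mu n)^2*w n/(mu n + L))"
 have gh: "hs g" unfolding g_def by (rule comb) simp
 have Q0: "Q >= 0" unfolding Q_def by (intro sum_nonneg divide_nonneg_nonneg) (use pos less_imp_le in auto)
 have cn: "sqn (c n) = (mu n/(mu n + L))^2*w n" for n
  by (simp add: c_def norm_mult power_mult_distrib power_divide w_def del: of_real_divide)
 have "qf v (ev 0) g = (SUM n<N. of_real (mu n)*(cnj (c n)*yv n))"
  unfolding g_def yv_def by (rule comb) auto
 also have "... = (SUM n<N. of_real ((mu n)^2*w n/(mu n + L)))"
 proof (rule sum.cong[OF refl])
  fix n
  have "of_real (mu n)*(cnj (c n)*yv n) = of_real (mu n*(mu n/(mu n + L)))*(yv n*cnj (yv n))"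
   unfolding c_def of_real_mult complex_cnj_mult complex_cnj_complex_of_real by (simp only: mult_ac)
  also have "... = of_real ((mu n)^2*w n/(mu n + L))"
   unfolding w_def complex_norm_square[symmetric] of_real_mult[symmetric]
   by (simp add: power2_eq_square)
  finally show "of_real (mu n)*(cnj (c n)*yv n) = complex_of_real ((mu n)^2*w n/(mu n + L))" .
 qed
 finally have "qf v (ev 0) g = of_real Q" by (simp add: Q_def)
 hence "Q = cmod (INFSUM k. v k*cnj (g k))" using qf_ev0[OF pot, of g] Q0
  by (metis norm_minus_cancel norm_of_real abs_of_nonneg)
 also have "... <= sqrt (en L (rs v L)) * sqrt (en L g)" by (rule rs_cs[OF pot _ gh]) (use L1 in simp)
 also have "... <= sqrt (en L (rs v L)) * sqrt (2*Q)"
 proof (intro mult_left_mono real_sqrt_le_mono)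
  have "qd v g + L*nsq g = (SUM n<N. (mu n + L) * sqn (c n))"
   unfolding g_def by (subst comb(2), simp, subst comb(3), simp) (simp add: sum_distrib_left sum.distrib algebra_simps)
  also have "... = Q"
   unfolding Q_def cn by (intro sum.cong refl) (use pos in "simp add: power2_eq_square less_imp_neq[THEN not_sym]")
  finally show "en L g <= 2*Q" using qd_coercive(1)[OF pot L gh] by simp
 qed simp
 finally have "Q^2 <= (sqrt (en L (rs v L)) * sqrt (2*Q))^2" using Q0 by (intro power_mono)
 also have "... = en L (rs v L)*(2*Q)" using Q0 by (simp add: power_mult_distrib)
 finally have "Q*Q <= (2*en L (rs v L))*Q" by (simp add: power2_eq_square mult_ac)
 hence "Q <= 2*en L (rs v L)" using Q0 en_nonneg[of L "rs v L"]
  by (cases "Q = 0") (auto simp: mult_le_cancel_right)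
 thus ?thesis using L1 by (simp add: Q_def en_rs)
qed

text \<open>Now \<open>rs v L\<close> is the test vector. Its energy \<open>a\<close> is a pairing
  bounded by B and the shifted form \<open>E\<close>, and \<open>E\<close> exceeds \<open>a\<close>
  only by the cubic term; this costs one power of the norm of \<open>v\<close>.\<close>

lemma test_backward:
 assumes L: "L > 0" "mu 0 + L > 0" and B: "!!N. (SUM n<N. (mu n)^2*w n/(mu n + L)) <= B"
 shows "(INFSUM k. sqn (v k)/(real k + L)) <= B*(1 + 2*(CS s * sqrt (wn (- s) v)))"
proof -
 define g where "g = rs v L"
 define a where "a = en L g"
 have gh: "hs g" unfolding g_def by (rule rs_hs[OF pot L(1)])
 have pos: "mu n + L > 0" for n using mu_mono[of 0 n] L by simp
 have a0: "a >= 0" by (simp add: a_def)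
 have B0: "B >= 0" using B[of 0] by simp
 have "(INFSUM k. v k*cnj (g k)) = of_real a"
 proof -
  have "(INFSUM k. v k*cnj (g k)) = (INFSUM k. complex_of_real (sqn (v k)/(real k + L)))"
   by (intro infsum_cong) (simp add: g_def rs_def complex_norm_square del: of_real_power of_real_add)
  also have "... = of_real a"
   unfolding a_def g_def en_rs[OF L(1)]
   by (intro infsumI has_sum_of_real has_sum_infsum pot_summable[OF pot L(1)])
  finally show ?thesis .
 qed
 hence q: "qf v (ev 0) g = - of_real a" by (simp add: qf_ev0[OF pot])
 define E where "E = qd v g + L*nsq g"
 have E1: "(SUM n<N. (mu n + L) * sqn (ip g (F n))) <= E" for N
  unfolding E_def by (rule coord_energy(3)[OF gh]) (use L in simp)
 have E0: "E >= 0" using E1[of 0] by simp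
 have fin: "cmod (SUM n<N. of_real (mu n)*(yv n*cnj (ip g (F n)))) <= sqrt B * sqrt E" for N
 proof -
  let ?x = "%n. \<bar>mu n\<bar>*cmod (yv n)/sqrt (mu n + L)" and ?y = "%n. sqrt (mu n + L)*cmod (ip g (F n))"
  have "cmod (SUM n<N. of_real (mu n)*(yv n*cnj (ip g (F n)))) <= (SUM n<N. cmod (of_real (mu n)*(yv n*cnj (ip g (F n)))))"
   by (rule norm_sum)
  also have "... = (SUM n<N. ?x n*?y n)"
   by (intro sum.cong refl) (use pos in "simp add: norm_mult less_imp_neq[THEN not_sym]")
  also have "... <= sqrt (SUM n<N. (?x n)^2) * sqrt (SUM n<N. (?y n)^2)"
   by (rule cauchy_schwarz_sum)
  also have "... <= sqrt B * sqrt E"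
  proof (intro mult_mono real_sqrt_le_mono)
   have "(?x n)^2 = (mu n)^2*w n/(mu n + L)" for n using pos[of n] by (simp add: power_divide power_mult_distrib w_def)
   thus "(SUM n<N. (?x n)^2) <= B" using B[of N] by simp
   have "(?y n)^2 = (mu n + L) * sqn (ip g (F n))" for n using pos[of n] by (simp add: power_mult_distrib)
   thus "(SUM n<N. (?y n)^2) <= E" using E1[of N] by simp
  qed (auto intro!: sum_nonneg B0)
  finally show ?thesis .
 qed
 have "(%N. cmod (SUM n<N. of_real (mu n)*(yv n*cnj (ip g (F n))))) ----> cmod (qf v (ev 0) g)"
  using qf_sums[of "ev 0" g] gh unfolding sums_def yv_def by (intro tendsto_norm) auto
 hence "cmod (qf v (ev 0) g) <= sqrt B * sqrt E"
  by (rule LIMSEQ_le_const2) (use fin in auto)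
 hence "a <= sqrt B * sqrt E" using a0 by (simp add: q)
 hence "a^2 <= (sqrt B * sqrt E)^2" using a0 by (intro power_mono)
 also have "... = B*E" using B0 E0 by (simp add: power_mult_distrib)
 also have "E <= a + 2*(CS s * sqrt (wn (- s) v))*a"
 proof -
  have "E = a - Re (tf v g g)" using qd_eq[OF gh L(1), of v] by (simp add: E_def a_def)
  also have "... <= a + cmod (tf v g g)" using abs_Re_le_cmod[of "tf v g g"] by linarith
  also have "cmod (tf v g g) <= 2*(INFSUM k. cmod (rs v L k))*a"
   unfolding g_def a_def by (rule tf_rs_bound[OF pot L(1) rs_l1(1)[OF pot L(1)]])
  also have "... <= 2*(CS s * sqrt (wn (- s) v))*a"
   by (intro mult_right_mono mult_left_mono rs_l1(2)[OF pot L(1)] a0) auto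
  finally show ?thesis by simp
 qed
 finally have "a^2 <= B*(a + 2*(CS s * sqrt (wn (- s) v))*a)" using B0 by (simp add: mult_left_mono)
 hence "a*a <= (B*(1 + 2*(CS s * sqrt (wn (- s) v))))*a" by (simp add: power2_eq_square algebra_simps)
 moreover have "0 <= B*(1 + 2*(CS s * sqrt (wn (- s) v)))"
  using B0 CS_nonneg[of s] by simp
 ultimately have "a <= B*(1 + 2*(CS s * sqrt (wn (- s) v)))"
  using a0 by (cases "a = 0") (auto simp: mult_le_cancel_right)
 thus ?thesis by (simp add: a_def g_def en_rs[OF L(1)])
qed

text \<open>By the trace formula the gaps up to \<open>n\<close> cannot exceed
  \<open>- mu 0\<close>.\<close>

lemma mu_le: "mu n <= real n"
proof -
 have "mu n = mu 0 + real n + (SUM p=1..n. ga p)"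
  by (induction n) (auto simp: ga_def)
 thus ?thesis using cd.gap_partial[of n] by (simp add: g_ga)
qed

lemma mu0_nonpos: "mu 0 <= 0" using mu_le[of 0] by simp

text \<open>Here and in the next lemma \<open>w n\<close> is compared with \<open>ga n/n\<close>,
  with constants governed by \<open>mu 0\<close> alone.\<close>

lemma w_Suc_upper: assumes n: "n >= 1" shows "w n <= exp (- mu 0)*ga n/real n"
proof -
 have d: "mu n - mu 0 >= real n" using mu_ge[of 0 n] by simp
 have "w n = ga n/(mu n - mu 0)*cd.K n" using cd.wn_eq[OF n] by (simp add: g_ga)
 also have "... <= ga n/real n*exp (- mu 0)"
 proof (intro mult_mono)
  show "ga n/(mu n - mu 0) <= ga n/real n" using d n ga_nonneg[OF n] by (intro divide_left_mono) auto
  show "cd.K n <= exp (- mu 0)" by (rule cd.K_bounds[OF cd.gap_sum])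
  show "0 <= cd.K n" using cd.K_bounds(1)[OF cd.gap_sum, of n] by (meson exp_ge_zero order_trans)
 qed (use n ga_nonneg[OF n] in auto)
 finally show ?thesis by (simp add: mult_ac)
qed

lemma w_Suc_lower: assumes n: "n >= 1" shows "exp (mu 0)*ga n/(real n - mu 0) <= w n"
proof -
 have d: "mu n - mu 0 >= real n" using mu_ge[of 0 n] by simp
 have "ga n/(real n - mu 0)*exp (mu 0) <= ga n/(mu n - mu 0)*cd.K n"
 proof (intro mult_mono)
  show "ga n/(real n - mu 0) <= ga n/(mu n - mu 0)"
   using d n ga_nonneg[OF n] mu_le[of n] by (intro divide_left_mono mult_pos_pos) auto
  show "exp (mu 0) <= cd.K n" using cd.K_bounds(1)[OF cd.gap_sum, of n] by simp
  show "0 <= ga n/(mu n - mu 0)" using d n ga_nonneg[OF n] by simp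
 qed simp
 thus ?thesis using cd.wn_eq[OF n] by (simp add: g_ga mult_ac)
qed

lemma ga_sum_le: "finite A ==> A \<subseteq> {1..} ==> sum ga A <= - mu 0"
proof -
 assume A: "finite A" "A \<subseteq> {1..}"
 obtain N where "A \<subseteq> {..<N}" using finite_nat_bounded[OF A(1)] by blast
 hence "A \<subseteq> {1..N}" using A by (auto simp: subset_iff less_imp_le)
 hence "sum ga A <= (SUM p=1..N. ga p)" by (intro sum_mono2) (auto intro: ga_nonneg)
 thus ?thesis using cd.gap_partial[of N] by (simp add: g_ga)
qed

end

section \<open>Bounds for norms and tails in both directions\<close>

definition tailw :: "real => nat => cseq => real" where
 "tailw sg K z = (INFSUM n:{K<..}. hw sg z n)"

lemma tailw_0: "tailw sg 0 z = wn sg z"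
proof -
 have "{0<..} = {1::nat..}" by auto
 thus ?thesis by (simp add: tailw_def wn_def)
qed

lemma tailw_nonneg: "tailw sg K z >= 0" unfolding tailw_def by (intro infsum_nonneg) auto

lemma summable_shift:
 fixes b :: "nat => real"
 assumes b: "!!n. b n >= 0" and bs: "(%n. dw s n*b n) summable_on {1..}"
  and s: "s < 1/2" and L: "L > 0"
 shows "(%n. b n/(real n + L)) summable_on UNIV"
proof (rule summable_on_add_zero, rule summable_on_le[OF bs])
 fix n :: nat assume n: "n:{1..}"
 have "b n/(real n + L) <= b n/real n"
  using b n L by (intro divide_left_mono) (auto intro!: mult_pos_pos add_pos_nonneg)
 also have "... = real n powr (- 1)*b n" using n by (simp add: powr_minus_divide)
 also have "... <= dw s n*b n" using n s b by (intro mult_right_mono powr_mono) auto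
 finally show "b n/(real n + L) <= dw s n*b n" .
qed (use b L in "auto intro!: divide_nonneg_nonneg")

lemma weight_half: "n >= 1 ==> real n powr (2*(1/2 - s)) = dw s n*real n"
 using powr_add[of "real n" "- (2 * s)" 1] by (simp add: algebra_simps)

lemma pow2_ge: obtains i0 :: nat where "!!i. i >= i0 ==> (2::real)^i >= C"
proof -
 obtain i0 where "C < 2^i0" using real_arch_pow[of 2 C] by auto
 moreover have "(2::real)^i0 <= 2^i" if "i >= i0" for i using that by (intro power_increasing) auto
 ultimately show ?thesis using that by (meson less_le_trans less_imp_le)
qed

text \<open>Absorbs the linear growth left by the cubic term.\<close>

lemma quadratic_bound:
 fixes x A :: real assumes "x >= 0" "A >= 0" "x^2 <= A*(1 + x)" shows "x <= 1 + 2*A"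
proof (rule ccontr)
 assume "\<not> ?thesis"
 hence x: "x > 1 + 2*A" by simp
 have "A*(1 + x) <= A*(2*x)" using x assms by (intro mult_left_mono) auto
 also have "... < x*x" using x assms by (simp add: mult.assoc[symmetric] mult.commute[of A 2])
 finally show False using assms(3) by (simp add: power2_eq_square)
qed

text \<open>The tail beyond \<open>K\<close> plus the price of the first \<open>K\<close> entries at
  energies above 2^i; it becomes small by taking \<open>K\<close> large and afterwards
  \<open>i\<close> large.\<close>

abbreviation "tb s sg K z i == tailw sg K z + tp s i*(1 + real K)"

lemma tb_nonneg: "0 <= tb s sg K z i"
 using tailw_nonneg by (intro add_nonneg_nonneg) auto

lemma tp_le_1: "s > 0 ==> tp s i*(1 + real 0) <= 1"
 using powr_mono[of "- (2 * s)*real i" 0 2] by (simp add: mult_nonpos_nonneg)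

text \<open>\<open>test_backward\<close> is the comparison hypothesis of
  \<open>dyadic_transfer\<close>. The two values of \<open>c\<close> are its two conclusions, high
  frequencies only or all of them; the norm of \<open>v\<close> is still present on the
  right.\<close>

lemma backward_tail:
 assumes s: "0 < s" "s < 1/2" and R: "R >= 0"
 obtains i0 M where "M >= 0"
  "!!v i1 F K c. pot s v ==> zet v:hplus (1/2 - s) ==> wn (1/2 - s) (zet v) <= R ==> i1 >= i0 ==> finite F ==>
   F \<subseteq> {2^i1..} \<and> c = 3 \<or> F \<subseteq> {1..} \<and> c = 3 + 2*2^i1 ==>
   sum (hw (- s) v) F <= c*(M*(1 + sqrt (wn (- s) v))*tb s (1/2 - s) K (zet v) i1)"
proof -
 \<comment> \<open>From |mu n| <= n (1 + R) and w n <= exp R times ga n/n; the factor 2 is lost in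
   the denominator below.\<close>
 define CR where "CR = 2*exp R*(1 + R)^2"
 have CR0: "CR >= 0" using R by (simp add: CR_def)
 define M where "M = (1 + 2*CS s)*CW s*(CR + 2*R^2 + CR*R)"
 \<comment> \<open>At such energies mu n + 2^i is at least half of n + 2^i.\<close>
 obtain i0 where i0: "!!i. i >= i0 ==> (2::real)^i >= 2*R + 1" using pow2_ge by blast
 have M0: "M >= 0" using R CR0 CS_nonneg CW_nonneg[OF s] by (simp add: M_def)
 have main: "sum (hw (- s) v) F <= c*(M*(1 + sqrt (wn (- s) v))*tb s (1/2 - s) K (zet v) i1)"
  if v: "pot s v" and z: "zet v:hplus (1/2 - s)" "wn (1/2 - s) (zet v) <= R" and i1: "i1 >= i0" and F: "finite F"
   and c: "F \<subseteq> {2^i1..} \<and> c = 3 \<or> F \<subseteq> {1..} \<and> c = 3 + 2*2^i1" for v i1 F K c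
 proof -
  interpret nspectral s v "emu v" "efn v" by (rule nspectral_chosen[OF v])
  define mu where "mu = emu v"
  have zg: "sqn (zet v n) = ga n" if "n >= 1" for n using ze_sq[OF that] zet_eq by simp
  have sumR: "(SUM n:A. real n powr (2*(1/2 - s))*ga n) <= R" if "finite A" "A \<subseteq> {1..}" for A
  proof -
   have "(SUM n:A. real n powr (2*(1/2 - s))*ga n) = sum (hw (1/2 - s) (zet v)) A"
    by (intro sum.cong refl) (use that zg in auto)
   also have "... <= R" using wn_sum_le[OF z(1) that] z(2) by simp
   finally show ?thesis .
  qed
  have gaR: "(SUM n:A. ga n) <= R" if "finite A" "A \<subseteq> {1..}" for A
  proof -
   have "(SUM n:A. ga n) <= (SUM n:A. real n powr (2*(1/2 - s))*ga n)"
   proof (rule sum_mono)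
    fix n assume "n:A"
    hence n: "n >= 1" using that by auto
    have "1 <= real n powr (2*(1/2 - s))" using n s by (intro ge_one_powr_ge_zero) auto
    thus "ga n <= real n powr (2*(1/2 - s))*ga n" using ga_nonneg[OF n] by (simp add: mult_right_mono[of 1 _ "ga n", simplified])
   qed
   thus ?thesis using sumR[OF that] by linarith
  qed
  have m0: "- mu 0 <= R"
  proof (rule LIMSEQ_le_const2)
   show "(%N. SUM p<N. ga (Suc p)) ----> - mu 0" using cd.gap_sum unfolding sums_def g_ga mu_def .
   have "(SUM p<N. ga (Suc p)) = sum ga (Suc ` {..<N})" for N by (simp add: sum.reindex)
   thus "EX N. ALL n>=N. (SUM p<n. ga (Suc p)) <= R" using gaR[of "Suc ` {..<_}"] by auto
  qed
  have mu: "mu n <= real n" "mu n >= real n - R" for n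
   using mu_le[of n] mu_ge[of 0 n] m0 by (auto simp: mu_def)
  \<comment> \<open>A majorant of 2 (mu n)^2 w n. At index 0 it uses |mu 0| <= R and w 0 <= 1;
    elsewhere its \<open>dw s\<close> weighted sum is a multiple of the norm of the
    coordinates.\<close>
  define b where "b n = (if n = 0 then 2*R^2 else CR*(real n*ga n))" for n
  have b0: "b n >= 0" for n using CR0 ga_nonneg[of n] by (auto simp: b_def)
  have wb: "dw s n*b n = CR*(hw (1/2 - s) (zet v) n)" if "n >= 1" for n
   using that weight_half[OF that, of s] zg[OF that] by (simp add: b_def mult_ac)
  have bs: "(%n. dw s n*b n) summable_on {1..}"
   using summable_on_cmult_right[OF hplus_summable[OF z(1)], of CR] wb by (subst summable_on_cong[where g = "%n. CR*(hw (1/2 - s) (zet v) n)"]) auto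
  have Dn: "2*((mu n)^2*w n) <= b n" for n
  proof (cases "n = 0")
   case True
   have "(mu 0)^2 <= R^2" using m0 mu0_nonpos by (intro power2_le_iff_abs_le[THEN iffD2]) (auto simp: R mu_def)
   moreover have "w 0 <= 1" using sum_le_suminf[OF sums_summable[OF w_sums], of "{0}"] sums_unique[OF w_sums] by simp
   ultimately have "(mu 0)^2*w 0 <= R^2*1" by (intro mult_mono) auto
   thus ?thesis using True by (simp add: b_def)
  next
   case False
   hence n: "n >= 1" by simp
   have "R <= real n*R" using n R by (simp add: mult_right_mono[of 1 "real n" R, simplified])
   hence "\<bar>mu n\<bar> <= real n*(1 + R)" using mu[of n] R by (simp add: abs_le_iff algebra_simps)
   hence "(mu n)^2 <= (real n*(1 + R))^2" using R by (intro power2_le_iff_abs_le[THEN iffD2]) auto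
   moreover have "w n <= exp R*ga n/real n"
   proof -
    have "w n <= exp (- mu 0)*ga n/real n" using w_Suc_upper[OF n] by (simp add: mu_def)
    also have "... <= exp R*ga n/real n" using m0 ga_nonneg[OF n] by (intro divide_right_mono mult_right_mono) auto
    finally show ?thesis .
   qed
   ultimately have "(mu n)^2*w n <= (real n*(1 + R))^2*(exp R*ga n/real n)" by (intro mult_mono) auto
   also have "... = exp R*(1 + R)^2*(real n*ga n)" using n by (simp add: power2_eq_square field_simps)
   finally show ?thesis using False by (simp add: b_def CR_def)
  qed
  have cmp: "(SUM k:A. sqn (v k)/(real k + 2^i)) <= (1 + 2*(CS s * sqrt (wn (- s) v)))*(INFSUM n. b n/(real n + 2^i))"
   if i: "i >= i1" and A: "finite A" for i A
  proof -
   have L: "(2::real)^i >= 2*R + 1" using i0 i i1 by simp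
   have "(SUM k:A. sqn (v k)/(real k + 2^i)) <= (INFSUM k. sqn (v k)/(real k + 2^i))"
    by (intro infsum_ge_sum pot_summable[OF v] A) auto
   also have "... <= (INFSUM n. b n/(real n + 2^i))*(1 + 2*(CS s * sqrt (wn (- s) v)))"
   proof (rule test_backward)
    show "emu v 0 + 2^i > 0" using L m0 R by (simp add: mu_def)
    fix N
    have "(SUM n<N. (mu n)^2*w n/(mu n + 2^i)) <= (SUM n<N. b n/(real n + 2^i))"
    proof (rule sum_mono)
     fix n
     have d: "mu n + 2^i >= (real n + 2^i)/2" using mu(2)[of n] L R by (simp add: field_simps)
     have p: "(real n + 2^i)/2 > 0" by (simp add: add_nonneg_pos)
     have "(mu n)^2*w n/(mu n + 2^i) <= (mu n)^2*w n/((real n + 2^i)/2)"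
      using d p by (intro divide_left_mono mult_pos_pos) (auto intro: less_le_trans[OF p d])
     also have "... = 2*((mu n)^2*w n)/(real n + 2^i)" by simp
     also have "... <= b n/(real n + 2^i)" by (intro divide_right_mono Dn) auto
     finally show "(mu n)^2*w n/(mu n + 2^i) <= b n/(real n + 2^i)" .
    qed
    also have "... <= (INFSUM n. b n/(real n + 2^i))"
     by (intro infsum_ge_sum summable_shift[OF b0 bs s(2)]) (use b0 in "auto intro!: divide_nonneg_nonneg")
    finally show "(SUM n<N. (emu v n)^2*w n/(emu v n + 2^i)) <= (INFSUM n. b n/(real n + 2^i))" by (simp add: mu_def)
   qed simp
   finally show ?thesis by (simp add: mult.commute)
  qed
  have Mp: "0 <= 1 + 2*(CS s * sqrt (wn (- s) v))" using CS_nonneg[of s] by simp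
  note dt = dyadic_transfer[OF s, of "%k. sqn (v k)" b, OF _ b0 Mp bs cmp F, where K = K]
  have tlb: "(INFSUM n:{K<..}. dw s n*b n) = CR*tailw (1/2 - s) K (zet v)"
   unfolding tailw_def infsum_cmult_right'[symmetric] by (rule infsum_cong) (use wb in auto)
  have hb: "(SUM n<=K. b n) <= (2*R^2 + CR*R)*(1 + real K)"
  proof -
   have "(SUM n<=K. b n) = b 0 + (SUM n:{1..K}. b n)"
    by (simp add: atMost_atLeast0 sum.atLeast_Suc_atMost)
   also have "(SUM n:{1..K}. b n) <= (SUM n:{1..K}. CR*(real K*ga n))"
    by (intro sum_mono) (use CR0 ga_nonneg in "auto simp: b_def intro!: mult_left_mono mult_right_mono")
   also have "... = CR*real K*(SUM n:{1..K}. ga n)" by (simp add: sum_distrib_left mult_ac)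
   also have "... <= CR*real K*R" by (intro mult_left_mono gaR) (use CR0 in auto)
   also have "b 0 + CR*real K*R <= (2*R^2 + CR*R)*(1 + real K)"
    using CR0 R by (simp add: b_def algebra_simps)
   finally show ?thesis by simp
  qed
  have fin: "(1 + 2*(CS s * sqrt (wn (- s) v)))*CW s*((INFSUM n:{K<..}. dw s n*b n) + tp s i1*(SUM n<=K. b n)) <= M*(1 + sqrt (wn (- s) v))*tb s (1/2 - s) K (zet v) i1"
  proof -
   have t0: "tailw (1/2 - s) K (zet v) >= 0" by (rule tailw_nonneg)
   define P where "P = tp s i1*(1 + real K)"
   have P0: "P >= 0" by (simp add: P_def)
   have "(INFSUM n:{K<..}. dw s n*b n) + tp s i1*(SUM n<=K. b n)
    <= CR*tailw (1/2 - s) K (zet v) + tp s i1*((2*R^2 + CR*R)*(1 + real K))"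
    unfolding tlb by (intro add_left_mono mult_left_mono hb) auto
   also have "... = CR*tailw (1/2 - s) K (zet v) + (2*R^2 + CR*R)*P" by (simp add: P_def mult_ac)
   also have "... <= (CR + 2*R^2 + CR*R)*tailw (1/2 - s) K (zet v) + (CR + 2*R^2 + CR*R)*P"
    using CR0 R t0 P0 by (intro add_mono mult_right_mono) auto
   finally have 1: "(INFSUM n:{K<..}. dw s n*b n) + tp s i1*(SUM n<=K. b n)
    <= (CR + 2*R^2 + CR*R)*(tailw (1/2 - s) K (zet v) + P)" by (simp add: distrib_left)
   have 2: "1 + 2*(CS s * sqrt (wn (- s) v)) <= (1 + 2*CS s)*(1 + sqrt (wn (- s) v))"
    using CS_nonneg[of s] by (simp add: algebra_simps)
   have "(1 + 2*(CS s * sqrt (wn (- s) v)))*CW s*((INFSUM n:{K<..}. dw s n*b n) + tp s i1*(SUM n<=K. b n))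
    <= ((1 + 2*CS s)*(1 + sqrt (wn (- s) v))*CW s)*((CR + 2*R^2 + CR*R)*(tailw (1/2 - s) K (zet v) + P))"
    by (intro mult_mono mult_right_mono 1 2)
     (use CS_nonneg[of s] CW_nonneg[OF s] b0 in "auto intro!: add_nonneg_nonneg mult_nonneg_nonneg infsum_nonneg sum_nonneg")
   also have "... = M*(1 + sqrt (wn (- s) v))*(tailw (1/2 - s) K (zet v) + P)" by (simp add: M_def mult_ac)
   finally show ?thesis by (simp add: P_def)
  qed
  have "sum (hw (- s) v) F <= c*((1 + 2*(CS s * sqrt (wn (- s) v)))*CW s*((INFSUM n:{K<..}. dw s n*b n) + tp s i1*(SUM n<=K. b n)))"
   using c dt by auto
  also have "... <= c*(M*(1 + sqrt (wn (- s) v))*tb s (1/2 - s) K (zet v) i1)"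
   by (rule mult_left_mono[OF fin]) (use c in auto)
  finally show ?thesis .
 qed
 show ?thesis
  by (rule that[OF M0, of i0]) (rule main)
qed

text \<open>Taking all frequencies, \<open>K = 0\<close> and \<open>i1 = i0\<close>, the squared
  norm of \<open>v\<close> is at most affine in its norm, hence bounded. Inserting this bound frees
  the tail estimate of the norm of \<open>v\<close>.\<close>

lemma backward_bound:
 assumes s: "0 < s" "s < 1/2" and R: "R >= 0"
 obtains i0 M where "M >= 0"
  "!!v. pot s v ==> zet v:hplus (1/2 - s) ==> wn (1/2 - s) (zet v) <= R ==> wn (- s) v <= M"
  "!!v i1 F K. pot s v ==> zet v:hplus (1/2 - s) ==> wn (1/2 - s) (zet v) <= R ==> i1 >= i0 ==> finite F ==> F \<subseteq> {2^i1..} ==>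
   sum (hw (- s) v) F <= M*tb s (1/2 - s) K (zet v) i1"
proof -
 obtain i0 M where M: "M >= 0"
  and t: "!!v i1 F K c. pot s v ==> zet v:hplus (1/2 - s) ==> wn (1/2 - s) (zet v) <= R ==> i1 >= i0 ==> finite F ==>
   F \<subseteq> {2^i1..} \<and> c = 3 \<or> F \<subseteq> {1..} \<and> c = 3 + 2*2^i1 ==>
   sum (hw (- s) v) F <= c*(M*(1 + sqrt (wn (- s) v))*tb s (1/2 - s) K (zet v) i1)"
  by (rule backward_tail[OF s R]) (rule that, assumption, blast)
 define A where "A = (3 + 2*2^i0)*(M*(R + 1))"
 have A0: "A >= 0" using M R by (simp add: A_def)
 define W where "W = 1 + 2*A"
 have bd: "sqrt (wn (- s) v) <= W" if v: "pot s v" and z: "zet v:hplus (1/2 - s)" "wn (1/2 - s) (zet v) <= R" for v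
 proof -
  have "wn (- s) v <= A*(1 + sqrt (wn (- s) v))"
   unfolding wn_def[of "- s"]
  proof (rule infsum_le_bound(2))
   fix F :: "nat set" assume F: "finite F" "F \<subseteq> {1..}"
   have "sum (hw (- s) v) F <= (3 + 2*2^i0)*(M*(1 + sqrt (wn (- s) v))*tb s (1/2 - s) 0 (zet v) i0)"
    by (rule t[OF v z order_refl F(1)]) (use F(2) in simp)
   also have "... <= (3 + 2*2^i0)*(M*(1 + sqrt (wn (- s) v))*(R + 1))"
    by (intro mult_left_mono add_mono tp_le_1 s) (use M z in "auto simp: tailw_0")
   also have "... = A*(1 + sqrt (wn (- s) v))" by (simp add: A_def mult_ac)
   finally show "sum (hw (- s) v) F <= A*(1 + sqrt (INFSUM n:{1..}. hw (- s) v n))"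
    by (simp only: wn_def)
  qed auto
  thus ?thesis unfolding W_def by (intro quadratic_bound A0) auto
 qed
 have W0: "W >= 0" using A0 by (simp add: W_def)
 define M' where "M' = max (W^2) (3*(M*(1 + W)))"
 show ?thesis
 proof (rule that[of M' i0])
  show "M' >= 0" by (simp add: M'_def max.coboundedI1)
  fix v assume v: "pot s v" "zet v:hplus (1/2 - s)" "wn (1/2 - s) (zet v) <= R"
  have "(sqrt (wn (- s) v))^2 <= W^2" by (intro power_mono bd v) simp
  thus "wn (- s) v <= M'" by (simp add: M'_def max.coboundedI1)
  fix i1 K and F :: "nat set" assume F: "i1 >= i0" "finite F" "F \<subseteq> {2^i1..}"
  have "sum (hw (- s) v) F <= 3*(M*(1 + sqrt (wn (- s) v))*tb s (1/2 - s) K (zet v) i1)"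
   by (rule t[OF v F(1,2)]) (use F(3) in simp)
  also have "... = (3*(M*(1 + sqrt (wn (- s) v))))*tb s (1/2 - s) K (zet v) i1"
   by (simp only: mult.assoc)
  also have "... <= M'*tb s (1/2 - s) K (zet v) i1"
  proof (rule mult_right_mono[OF _ tb_nonneg])
   have "3*(M*(1 + sqrt (wn (- s) v))) <= 3*(M*(1 + W))"
    using bd[OF v] M by (intro mult_left_mono) auto
   thus "3*(M*(1 + sqrt (wn (- s) v))) <= M'" by (simp add: M'_def)
  qed
  finally show "sum (hw (- s) v) F <= M'*tb s (1/2 - s) K (zet v) i1" .
 qed
qed

text \<open>\<open>test_forward\<close> and \<open>dyadic_transfer\<close> control the coordinates
  at high index, where (mu n)^2 w n is comparable to n times the gap; the finitely many low indices
  are covered by the trace formula.\<close>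

lemma forward_bound:
 assumes s: "0 < s" "s < 1/2" and R: "R >= 0"
 obtains i0 M where "M >= 0"
  "!!v. pot s v ==> wn (- s) v <= R ==> zet v:hplus (1/2 - s)"
  "!!v. pot s v ==> wn (- s) v <= R ==> wn (1/2 - s) (zet v) <= M"
  "!!v i1 F K. pot s v ==> wn (- s) v <= R ==> i1 >= i0 ==> finite F ==> F \<subseteq> {2^i1..} ==>
   sum (hw (1/2 - s) (zet v)) F <= M*tb s (- s) K v i1"
proof -
 obtain L0 where L0: "L0 >= 1" "!!v L. v:hplus (- s) ==> wn (- s) v <= R ==> L >= L0 ==> small_at v L"
  using small_at_exists[OF s] by metis
 obtain i0 where i0: "!!i. i >= i0 ==> (2::real)^i >= 2*L0" using pow2_ge by blast
 \<comment> \<open>From mu n >= n/2 and w n >= exp (- L0) ga n/(2n), both valid for n >= 2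
   L0.\<close>
 define c where "c = exp (- L0)/8"
 have c0: "c > 0" by (simp add: c_def)
 define M1 where "M1 = 6*CW s/c*(1 + R)"
 have M10: "M1 >= 0" using CW_nonneg[OF s] c0 R by (simp add: M1_def)
 define M where "M = max M1 (M1*(R + 1) + 2^i0*L0)"
 have M0: "M >= 0" using M10 by (simp add: M_def max.coboundedI1)
 have key: "- emu v 0 <= L0 \<and> (ALL n>=1. sqn (zet v n) = spectral.ga (emu v) n) \<and>
   (ALL i1 F K. i1 >= i0 --> finite F --> F \<subseteq> {2^i1..} --> sum (hw (1/2 - s) (zet v)) F <= M1*tb s (- s) K v i1)"
  if v: "pot s v" and vR: "wn (- s) v <= R" for v
 proof -
  interpret nspectral s v "emu v" "efn v" by (rule nspectral_chosen[OF v])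
  have vh: "v:hplus (- s)" using v by (simp add: pot_def)
  define mu where "mu = emu v"
  have zg: "sqn (zet v n) = ga n" if "n >= 1" for n using ze_sq[OF that] zet_eq by simp
  have m0: "- mu 0 <= L0"
  proof -
   have "en L0 (efn v 0)/2 <= mu 0 + L0"
    using qd_coercive(1)[OF v L0(2)[OF vh vR order_refl] hsF[of 0]] by (simp add: qdF mu_def)
   thus ?thesis using en_nonneg[of L0 "efn v 0"] by linarith
  qed
  have mu: "mu n <= real n" "mu n >= real n - L0" for n
   using mu_le[of n] mu_ge[of 0 n] m0 by (auto simp: mu_def)
  \<comment> \<open>Cut off below 2 L0, where mu n may be close to 0 and the lower bound for (mu
    n)^2 w n fails.\<close>
  define a where "a n = (if 2*L0 <= real n then c*(real n*ga n) else 0)" for n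
  have n1: "n >= 1" if "2*L0 <= real n" for n
  proof -
   have "real n > 0" using that L0(1) by linarith
   thus ?thesis by simp
  qed
  have a0: "a n >= 0" for n using c0 ga_nonneg[OF n1] by (auto simp: a_def)
  have aD: "a n <= (mu n)^2*w n" for n
  proof (cases "2*L0 <= real n")
   case True
   note n = n1[OF True]
   have h: "real n/2 <= mu n" using mu(2)[of n] True by simp
   have "(real n/2)^2 <= (mu n)^2" using h by (intro power_mono) auto
   moreover have "exp (- L0)*ga n/(2*real n) <= w n"
   proof -
    have "exp (- L0)*ga n/(2*real n) <= exp (mu 0)*ga n/(real n - mu 0)"
     using m0 ga_nonneg[OF n] n True mu0_nonpos by (intro frac_le mult_right_mono) (auto simp: mu_def)
    thus ?thesis using w_Suc_lower[OF n] by (simp add: mu_def)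
   qed
   ultimately have "(real n/2)^2*(exp (- L0)*ga n/(2*real n)) <= (mu n)^2*w n"
    using ga_nonneg[OF n] by (intro mult_mono) auto
   moreover have "(real n/2)^2*(exp (- L0)*ga n/(2*real n)) = c*(real n*ga n)"
    using n by (simp add: c_def power2_eq_square field_simps)
   ultimately show ?thesis using True by (simp add: a_def)
  qed (auto simp: a_def)
  have bs: "(%n. dw s n * sqn (v n)) summable_on {1..}"
   using hplus_summable[OF vh] by simp
  have cmp: "(SUM k:A. a k/(real k + 2^i)) <= 2*(INFSUM k. sqn (v k)/(real k + 2^i))"
   if i: "i >= i1" "i1 >= i0" and A: "finite A" for i i1 A
  proof -
   have L: "(2::real)^i >= 2*L0" using i0 i by simp
   have pos: "mu n + 2^i > 0" for n using mu(2)[of n] L L0(1) of_nat_0_le_iff[of n] by linarith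
   obtain N where N: "A \<subseteq> {..<N}" using finite_nat_bounded[OF A] by blast
   have "(SUM k:A. a k/(real k + 2^i)) <= (SUM k<N. a k/(real k + 2^i))"
    by (rule sum_mono2) (use N a0 in "auto intro!: divide_nonneg_nonneg")
   also have "... <= (SUM n<N. (mu n)^2*w n/(mu n + 2^i))"
    by (intro sum_mono frac_le aD) (use mu pos a0 in "auto intro: order_trans[OF a0 aD]")
   also have "... <= 2*(INFSUM k. sqn (v k)/(real k + 2^i))"
    unfolding mu_def by (rule test_forward[OF L0(2)[OF vh vR]]) (use L L0(1) in simp)
   finally show ?thesis .
  qed
  have tail: "sum (hw (1/2 - s) (zet v)) F <= M1*tb s (- s) K v i1"
   if i1: "i1 >= i0" and F: "finite F" "F \<subseteq> {2^i1..}" for i1 F K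
  proof -
   have "(SUM k:F. dw s k*a k) <= 3*(2*CW s*((INFSUM n:{K<..}. dw s n * sqn (v n)) + tp s i1*(SUM n<=K. sqn (v n))))"
    by (rule dyadic_transfer(1)[OF s a0 _ _ bs cmp F(1) F(2)]) (use i1 in auto)
   also have "... <= 3*(2*CW s*(tailw (- s) K v + tp s i1*((1 + R)*(1 + real K))))"
   proof (intro mult_left_mono add_mono)
    show "(INFSUM n:{K<..}. dw s n * sqn (v n)) <= tailw (- s) K v" by (simp add: tailw_def)
    have "(SUM n<=K. sqn (v n)) = (SUM n:{1..K}. sqn (v n))"
     by (rule sum.mono_neutral_right) (use pot_0[OF v] in "auto simp: not_le Suc_le_eq")
    also have "... <= (SUM n:{1..K}. real K*(hw (- s) v n))"
    proof (rule sum_mono)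
     fix n assume n: "n:{1..K}"
     have "real n powr (2 * s) <= real n powr 1" by (rule powr_mono) (use n s in auto)
     also have "... <= real K" using n by simp
     finally have "1 <= real K*real n powr (2*- s)" using n by (simp add: powr_minus field_simps)
     hence "1 * sqn (v n) <= (real K*real n powr (2*- s)) * sqn (v n)" by (rule mult_right_mono) simp
     thus "sqn (v n) <= real K*(hw (- s) v n)" by (simp add: mult.assoc)
    qed
    also have "... <= real K*R"
     unfolding sum_distrib_left[symmetric] using wn_sum_le[OF vh, of "{1..K}"] vR by (intro mult_left_mono) auto
    also have "... <= (1 + R)*(1 + real K)" using R by (simp add: algebra_simps)
    finally show "(SUM n<=K. sqn (v n)) <= (1 + R)*(1 + real K)" .
   qed (use CW_nonneg[OF s] in auto)
   also have "... <= 3*(2*CW s*((1 + R)*tailw (- s) K v + tp s i1*((1 + R)*(1 + real K))))"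
   proof (intro mult_left_mono add_right_mono)
    show "tailw (- s) K v <= (1 + R)*tailw (- s) K v" using tailw_nonneg[of "- s" K v] R by (simp add: mult_right_mono[of 1 "1 + R", simplified])
   qed (use CW_nonneg[OF s] in auto)
   also have "... = c*(M1*tb s (- s) K v i1)"
   proof -
    have "c*M1 = 6*CW s*(1 + R)" using c0 by (simp add: M1_def)
    thus ?thesis by (simp only: mult.assoc[symmetric]) (simp add: algebra_simps)
   qed
   finally have 1: "(SUM k:F. dw s k*a k) <= c*(M1*tb s (- s) K v i1)" .
   have "(SUM k:F. dw s k*a k) = c * sum (hw (1/2 - s) (zet v)) F"
    unfolding sum_distrib_left
   proof (rule sum.cong[OF refl])
    fix n assume "n:F"
    hence "2^i1 <= n" using F by auto
    hence "2*L0 <= real n" using order_trans[OF i0[OF i1] real_dyadic(1)] by simp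
    thus "dw s n*a n = c*(hw (1/2 - s) (zet v) n)"
     using n1 weight_half[of n s] zg[of n] by (simp add: a_def mult_ac)
   qed
   thus ?thesis using 1 c0 by simp
  qed
  show ?thesis
  proof (intro conjI allI impI)
   show "- emu v 0 <= L0" using m0 by (simp add: mu_def)
  qed (simp add: zg, rule tail)
 qed
 have fin: "sum (hw (1/2 - s) (zet v)) F <= M1*(R + 1) + 2^i0*L0"
  if v: "pot s v" "wn (- s) v <= R" and F: "finite F" "F \<subseteq> {1..}" for v F
 proof -
  interpret nspectral s v "emu v" "efn v" by (rule nspectral_chosen[OF v(1)])
  let ?t = "%n. hw (1/2 - s) (zet v) n"
  have "sum ?t F = sum ?t (F Int {2^i0..}) + sum ?t (F - {2^i0..})" by (rule sum.Int_Diff[OF F(1)])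
  also have "sum ?t (F Int {2^i0..}) <= M1*tb s (- s) 0 v i0"
   using key[OF v] F(1) by blast
  also have "... <= M1*(R + 1)"
   by (intro mult_left_mono add_mono M10 tp_le_1 s) (use v in "simp add: tailw_0")
  \<comment> \<open>For low indices the weight is at most 2^i0, and the gaps add up to at most
    L0.\<close>
  also have "sum ?t (F - {2^i0..}) <= (SUM n:F - {2^i0..}. 2^i0*ga n)"
  proof (rule sum_mono)
   fix n assume n: "n:F - {2^i0..}"
   hence n1: "n >= 1" using F by auto
   have "real n powr (2*(1/2 - s)) <= real n powr 1" by (rule powr_mono) (use n1 s in auto)
   also have "... <= 2^i0" using n n1 real_dyadic(2)[of n i0] by simp
   finally have "real n powr (2*(1/2 - s))*ga n <= 2^i0*ga n" by (rule mult_right_mono) (rule ga_nonneg[OF n1])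
   thus "?t n <= 2^i0*ga n" using key[OF v] n1 by simp
  qed
  also have "... = 2^i0*(SUM n:F - {2^i0..}. ga n)" by (simp add: sum_distrib_left)
  also have "... <= 2^i0*L0"
  proof (rule mult_left_mono)
   have "(SUM n:F - {2^i0..}. ga n) <= - emu v 0" by (rule ga_sum_le) (use F in auto)
   thus "(SUM n:F - {2^i0..}. ga n) <= L0" using key[OF v] by linarith
  qed simp
  finally show ?thesis by simp
 qed
 have mem: "zet v:hplus (1/2 - s)" "wn (1/2 - s) (zet v) <= M" if v: "pot s v" "wn (- s) v <= R" for v
 proof -
  have *: "(%n. hw (1/2 - s) (zet v) n) summable_on {1..}"
   "(INFSUM n:{1..}. hw (1/2 - s) (zet v) n) <= M1*(R + 1) + 2^i0*L0"
   using infsum_le_bound[of "{1..}" "%n. hw (1/2 - s) (zet v) n"] fin[OF v] by auto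
  have "zet v 0 = 0" by (simp add: zet_def)
  thus "zet v:hplus (1/2 - s)" using *(1) by (simp add: hplus_def)
  show "wn (1/2 - s) (zet v) <= M" using *(2) unfolding wn_def M_def by (rule max.coboundedI2)
 qed
 show ?thesis
 proof (rule that[OF M0 mem, of i0])
  fix v i1 K and F :: "nat set" assume v: "pot s v" "wn (- s) v <= R" and F: "i1 >= i0" "finite F" "F \<subseteq> {2^i1..}"
  have "sum (hw (1/2 - s) (zet v)) F <= M1*tb s (- s) K v i1"
   using key[OF v] F by blast
  also have "... <= M*tb s (- s) K v i1"
   by (rule mult_right_mono[OF _ tb_nonneg]) (simp add: M_def)
  finally show "sum (hw (1/2 - s) (zet v)) F <= M*tb s (- s) K v i1" .
 qed
qed

section \<open>Weak continuity and injectivity of the Birkhoff coordinates\<close>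

lemma subseq_principle:
 fixes x :: "nat => 'a::metric_space"
 assumes "!!r. strict_mono (r :: nat => nat) ==> EX r'. strict_mono r' \<and> (%j. x (r (r' j))) ----> l"
 shows "x ----> l"
proof (rule ccontr)
 assume "\<not> ?thesis"
 then obtain e where e: "e > 0" "!!N. EX n>=N. dist (x n) l >= e"
  unfolding lim_sequentially by (auto simp: not_less)
 have "infinite {n. dist (x n) l >= e}" unfolding infinite_nat_iff_unbounded_le using e(2) by auto
 then obtain r where r: "strict_mono (r :: nat => nat)" "!!n. r n:{n. dist (x n) l >= e}"
  using infinite_enumerate by blast
 obtain r' where r': "(%j. x (r (r' j))) ----> l" using assms[OF r(1)] by blast
 then obtain N where "!!n. n >= N ==> dist (x (r (r' n))) l < e" using e(1) unfolding lim_sequentially by blast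
 thus False using r(2)[of "r' N"] by force
qed

section \<open>Weighted sequence spaces: tails, weak limits and compactness\<close>

lemma hplus_bound:
 assumes "z 0 = 0" "!!F. finite F ==> F \<subseteq> {1..} ==> (SUM n:F. hw sg z n) <= C"
 shows "z:hplus sg" "wn sg z <= C"
 using infsum_le_bound[of "{1..}" "%n. hw sg z n" C] assms
 by (auto simp: hplus_def wn_def)

lemma hplus_fatou:
 assumes v: "!!j. v j:hplus sg" "!!j. wn sg (v j) <= R" and lim: "!!k. (%j::nat. v j k) ----> v' k"
 shows "v':hplus sg" "wn sg v' <= R"
proof -
 have 0: "v' 0 = 0" using lim[of 0] hplus_0[OF v(1)] by (simp add: LIMSEQ_const_iff)
 have b: "(SUM n:F. hw sg v' n) <= R" if "finite F" "F \<subseteq> {1..}" for F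
 proof (rule LIMSEQ_le_const2)
  show "(%j. SUM n:F. hw sg (v j) n) ----> (SUM n:F. hw sg v' n)"
   by (intro tendsto_intros lim)
  show "EX N. ALL j>=N. (SUM n:F. hw sg (v j) n) <= R"
   using wn_sum_le[OF v(1) that] v(2) order_trans by blast
 qed
 show "v':hplus sg" "wn sg v' <= R" using hplus_bound[of v' sg R] 0 b by blast+
qed

text \<open>The isometry with ell2. Coordinate 0 is annihilated because
  \<open>0 powr sg = 0\<close>, so its vanishing has to be stated separately in
  \<open>hplus_W\<close>.\<close>

definition W :: "real => cseq => cseq" where "W sg v n = of_real (real n powr sg) * v n"

lemma sqn_W: "sqn (W sg v n) = hw sg v n"
 by (cases "n = 0") (simp_all add: W_def norm_mult power_mult_distrib powr_add[symmetric] power2_eq_square[of "_ powr _"])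

lemma hplus_W: "v:hplus sg <-> v 0 = 0 \<and> ell2 (W sg v)"
proof -
 have "(%n. hw sg v n) summable_on {1..} <-> (%n. hw sg v n) summable_on UNIV"
  by (rule summable_on_cong_neutral) (auto simp: not_le)
 thus ?thesis by (simp add: hplus_def ell2_def sqn_W)
qed

lemma tailw_W: "tailw sg K v = nsq (%n. if n <= K then 0 else W sg v n)"
 unfolding tailw_def nsq_def by (rule infsum_cong_neutral) (auto simp: sqn_W)

lemma wn_W: "wn sg v = nsq (W sg v)"
 unfolding wn_def nsq_def sqn_W by (rule infsum_cong_neutral) (auto simp: not_le)

lemma hplus_diff:
 assumes "v:hplus sg" "w:hplus sg"
 shows "(%n. v n - w n):hplus sg" "wn sg (%n. v n - w n) <= 2*wn sg v + 2*wn sg w"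
  "tailw sg K (%n. v n - w n) <= 2*tailw sg K v + 2*tailw sg K w"
proof -
 have e: "W sg (%n. v n - w n) = (%n. W sg v n - W sg w n)" by (simp add: W_def fun_eq_iff right_diff_distrib)
 show "(%n. v n - w n):hplus sg" "wn sg (%n. v n - w n) <= 2*wn sg v + 2*wn sg w"
  using assms ell2_diff[of "W sg v" "W sg w"] by (simp_all add: hplus_W wn_W e)
 have l: "ell2 (%n. if n <= K then 0 else W sg u n)" if "u:hplus sg" for u
  by (rule ell2_le(1)[of "W sg u"]) (use that in "auto simp: hplus_W")
 have d: "(%n. if n <= K then 0 else W sg v n - W sg w n) = (%n. (if n <= K then 0 else W sg v n) - (if n <= K then 0 else W sg w n))" by auto
 show "tailw sg K (%n. v n - w n) <= 2*tailw sg K v + 2*tailw sg K w"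
  unfolding tailw_W e d by (intro ell2_diff(2) l assms)
qed

lemma wn_coord: assumes "v:hplus sg" shows "hw sg v n <= wn sg v"
 using coord_le_nsq[of "W sg v" n] assms by (simp add: hplus_W wn_W sqn_W)

lemma wn_tailw:
 assumes "z:hplus sg"
 shows "wn sg z = (SUM n=1..K. hw sg z n) + tailw sg K z"
proof -
 have s: "hw sg z summable_on {1..}" using assms by (simp add: hplus_def)
 have e: "{1..} = {1..K} Un {K<..}" by auto
 have "infsum (hw sg z) ({1..K} Un {K<..}) = infsum (hw sg z) {1..K} + infsum (hw sg z) {K<..}"
  by (rule infsum_Un_disjoint) (auto intro: summable_on_subset_banach[OF s])
 thus ?thesis unfolding wn_def tailw_def e by simp
qed

lemma tailw_le: "(!!F. finite F ==> F \<subseteq> {K<..} ==> (SUM n:F. hw sg z n) <= C) ==> tailw sg K z <= C"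
 unfolding tailw_def by (rule infsum_le_bound(2)) auto

text \<open>The passage from coordinatewise to norm convergence. Tails are asked on finite sets, the
  form in which the dyadic estimates deliver them; the limit inherits them.\<close>

lemma wn_tendsto_of_tails:
 assumes z: "!!j. z j:hplus sg" "z':hplus sg" and lim: "!!n. (%j::nat. z j n) ----> z' n"
  and tails: "!!e. e > 0 ==> EX K. EV j. ALL F. finite F \<and> F \<subseteq> {K<..} -->
    (SUM n:F. hw sg (z j) n) <= e"
 shows "(%j. wn sg (%n. z j n - z' n)) ----> 0"
proof (rule LIMSEQ_I)
 fix e :: real assume "e > 0"
 hence e: "e/8 > 0" by simp
 obtain K where K: "EV j. ALL F. finite F \<and> F \<subseteq> {K<..} --> (SUM n:F. hw sg (z j) n) <= e/8"
  using tails[OF e] by blast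
 have T': "tailw sg K z' <= e/8"
 proof (rule tailw_le, rule tendsto_upperbound)
  fix F :: "nat set" assume F: "finite F" "F \<subseteq> {K<..}"
  show "(%j. SUM n:F. hw sg (z j) n) ----> (SUM n:F. hw sg z' n)"
   by (intro tendsto_intros lim)
  show "EV j. (SUM n:F. hw sg (z j) n) <= e/8"
   by (rule eventually_mono[OF K]) (use F in blast)
 qed simp
 let ?S = "%j. SUM n=1..K. real n powr (2 * sg) * sqn (z j n - z' n)"
 have "?S ----> (SUM n=1..K. real n powr (2 * sg) * sqn (z' n - z' n))" by (intro tendsto_intros lim)
 hence "EV j. ?S j < e/8" by (rule order_tendstoD(2)) (use e in simp)
 hence "EV j. norm (wn sg (%n. z j n - z' n) - 0) < e"
  using K
 proof eventually_elim
  case (elim j)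
  have "tailw sg K (z j) <= e/8" by (rule tailw_le) (use elim(2) in blast)
  thus ?case unfolding diff_0_right real_norm_def abs_of_nonneg[OF wn_nonneg]
   using elim(1) T' e hplus_diff(3)[OF z, of K j] wn_tailw[OF hplus_diff(1)[OF z], of j K] by linarith
 qed
 thus "EX N. ALL j>=N. norm (wn sg (%n. z j n - z' n) - 0) < e" by (simp add: eventually_sequentially)
qed

text \<open>Tails beyond \<open>K\<close> gain the factor (K + 1)^(2 sg' - 2 sg), uniformly in the
  sequence.\<close>

lemma wn_weaker_tendsto:
 assumes d: "!!j. d j:hplus sg" "!!j. wn sg (d j) <= C" and lim: "!!k. (%j::nat. d j k) ----> 0" and sg: "sg' < sg"
 shows "d j:hplus sg'" "(%j. wn sg' (d j)) ----> 0"
proof -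
 have C0: "C >= 0" using d(2)[of 0] wn_nonneg[of sg "d 0"] by linarith
 have b: "(SUM n:F. hw sg' (d j) n) <= real (Suc K) powr (2 * sg' - 2 * sg)*C"
  if F: "finite F" "F \<subseteq> {K<..}" for F j K
 proof -
  have "(SUM n:F. hw sg' (d j) n) <= (SUM n:F. real (Suc K) powr (2 * sg' - 2 * sg)*(hw sg (d j) n))"
  proof (rule sum_mono)
   fix n assume "n:F"
   hence n: "Suc K <= n" using F by auto
   have "real n powr (2 * sg') = real n powr (2 * sg' - 2 * sg)*real n powr (2 * sg)" by (simp add: powr_add[symmetric])
   also have "... <= real (Suc K) powr (2 * sg' - 2 * sg)*real n powr (2 * sg)"
    by (intro mult_right_mono powr_mono2') (use n sg in auto)
   finally show "hw sg' (d j) n <= real (Suc K) powr (2 * sg' - 2 * sg)*(hw sg (d j) n)"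
    by (simp add: mult.assoc[symmetric] mult_right_mono)
  qed
  also have "... <= real (Suc K) powr (2 * sg' - 2 * sg)*C"
   unfolding sum_distrib_left[symmetric]
   by (intro mult_left_mono order_trans[OF wn_sum_le[OF d(1)] d(2)]) (use F in auto)
  finally show ?thesis .
 qed
 show h: "d j:hplus sg'" for j by (rule hplus_bound(1)[OF hplus_0[OF d(1)] b[of _ 0]]) auto
 have "(%j. wn sg' (%n. d j n - 0)) ----> 0"
 proof (rule wn_tendsto_of_tails[OF h _ lim])
  fix r :: real assume r: "r > 0"
  have "(%K. real (Suc K) powr (2 * sg' - 2 * sg)*C) ----> 0*C"
   by (intro tendsto_mult tendsto_const tendsto_neg_powr filterlim_compose[OF filterlim_real_sequentially filterlim_Suc]) (use sg in auto)
  hence "EV K. real (Suc K) powr (2 * sg' - 2 * sg)*C < r" by (rule order_tendstoD) (use r in simp)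
  then obtain K where K: "real (Suc K) powr (2 * sg' - 2 * sg)*C < r" unfolding eventually_sequentially by blast
  thus "EX K. EV j. ALL F. finite F \<and> F \<subseteq> {K<..} --> (SUM n:F. hw sg' (d j) n) <= r"
   using order_trans[OF b less_imp_le[OF K]] by (intro exI[of _ K]) simp
 qed (simp add: hplus_def)
 thus "(%j. wn sg' (d j)) ----> 0" by simp
qed

lemma hk_diff: "hk L (%n. v n - w n) p = hk L v p - hk L w p"
 by (simp add: hk_def uc_diff diff_divide_distrib)

lemma hk_tendsto:
 assumes v: "!!j. pot s (v j)" "!!j. wn (- s) (v j) <= R" and v': "pot s v'" and lim: "!!k. (%j::nat. v j k) ----> v' k"
 shows "(%j. nsq (hk 1 (%n. v j n - v' n))) ----> 0"
proof -
 \<comment> \<open>Between \<open>s\<close> and 1/2: weak enough that bounded coordinatewise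
   convergence is norm convergence, strong enough for \<open>hk_bound\<close>.\<close>
 define s' where "s' = (s + 1/2)/2"
 have s: "0 < s" "s < 1/2" using v' by (auto simp: pot_def)
 have s': "0 < s'" "s' < 1/2" "- s' < - s" using s by (auto simp: s'_def)
 have hv: "v j:hplus (- s)" "v':hplus (- s)" for j using v v' by (auto simp: pot_def)
 have b: "wn (- s) (%n. v j n - v' n) <= 2*R + 2*wn (- s) v'" for j
  using hplus_diff(2)[OF hv, of j] v(2)[of j] by simp
 have l: "(%j. v j k - v' k) ----> 0" for k using lim[of k] by (simp add: LIM_zero)
 note w = wn_weaker_tendsto[of "%j n. v j n - v' n" "- s" _ "- s'", OF hplus_diff(1)[OF hv] b l s'(3)]
 show ?thesis
 proof (rule Lim_null_comparison)
  show "EV j. norm (nsq (hk 1 (%n. v j n - v' n))) <= KK s'*wn (- s') (%n. v j n - v' n)"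
   using hk_bound(2)[OF s'(1,2) _ w(1), of 1] by simp
  show "(%j. KK s'*wn (- s') (%n. v j n - v' n)) ----> 0"
   using tendsto_mult_left[OF w(2), of "KK s'"] by simp
 qed
qed

lemma tf_diff_pot:
 assumes "pot s v" "pot s w" "hs f" "hs g"
 shows "tf v f g - tf w f g = ip (hk 1 (%n. v n - w n)) (pr 1 f g)"
 unfolding tf_ip[of 1, OF zero_less_one] hk_diff
 by (rule ip_diff_left[symmetric]) (auto intro!: pot_hk pr_ell2 assms)

text \<open>The change of potential is small in Hilbert-Schmidt norm, uniformly on bounded energy;
  for a fixed potential \<open>qf_tendsto\<close> applies.\<close>

lemma qf_pot_tendsto:
 assumes v: "!!j. pot s (v j)" "!!j. wn (- s) (v j) <= R" and v': "pot s v'" and lim: "!!k. (%j::nat. v j k) ----> v' k"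
  and f: "!!j. hs (f j)" "!!j. en 1 (f j) <= C" "!!k. (%j::nat. f j k) ----> f' k" and g: "hs g"
 shows "(%j. qf (v j) (f j) g) ----> qf v' f' g"
proof -
 have "(%j. qf v' (f j) g) ----> qf v' f' g" by (rule qf_tendsto[OF v' f g])
 moreover have "(%j. qf v' (f j) g - qf (v j) (f j) g) ----> 0"
 proof (rule Lim_null_comparison)
  have C: "C >= 0" using f(2)[of 0] en_nonneg[of 1 "f 0"] by linarith
  show "EV j. norm (qf v' (f j) g - qf (v j) (f j) g) <= sqrt (nsq (hk 1 (%n. v j n - v' n))) * sqrt (C*en 1 g)"
  proof (intro always_eventually allI)
   fix j
   have l: "ell2 (hk 1 (%n. v j n - v' n))"
    unfolding hk_diff[abs_def] by (intro ell2_diff pot_hk[OF v(1)] pot_hk[OF v']) auto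
   have "qf v' (f j) g - qf (v j) (f j) g = tf (v j) (f j) g - tf v' (f j) g" by (simp add: qf_def)
   hence "norm (qf v' (f j) g - qf (v j) (f j) g) <= sqrt (nsq (hk 1 (%n. v j n - v' n))) * sqrt (nsq (pr 1 (f j) g))"
    using tf_diff_pot[OF v(1) v' f(1) g, of j] ip_bound[OF l pr_ell2(1)[OF f(1) g, of 1 j]] by simp
   also have "... <= sqrt (nsq (hk 1 (%n. v j n - v' n))) * sqrt (C*en 1 g)"
    by (intro mult_left_mono real_sqrt_le_mono order_trans[OF pr_ell2(2)] mult_right_mono f g) auto
   finally show "norm (qf v' (f j) g - qf (v j) (f j) g) <= sqrt (nsq (hk 1 (%n. v j n - v' n))) * sqrt (C*en 1 g)" .
  qed
  show "(%j. sqrt (nsq (hk 1 (%n. v j n - v' n))) * sqrt (C*en 1 g)) ----> 0"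
   using tendsto_mult_right[OF tendsto_real_sqrt[OF hk_tendsto[OF v v' lim]], of "sqrt (C*en 1 g)"] by simp
 qed
 ultimately have "(%j. qf v' (f j) g - (qf v' (f j) g - qf (v j) (f j) g)) ----> qf v' f' g - 0" by (rule tendsto_diff)
 thus ?thesis by simp
qed

lemma ip_tendsto_strong:
 assumes f: "!!j. ell2 (f j)" "ell2 f'" "(%j. nsq (%k. f j k - f' k)) ----> 0"
  and g: "!!j. ell2 (g j)" "ell2 g'" "(%j. nsq (%k. g j k - g' k)) ----> 0" and gb: "!!j. nsq (g j) <= 1"
 shows "(%j::nat. ip (f j) (g j)) ----> ip f' g'"
proof -
 have "(%j. ip (f j) (g j) - ip f' g') ----> 0"
 proof (rule Lim_null_comparison)
  show "(%j. sqrt (nsq (%k. f j k - f' k))*1 + sqrt (nsq f') * sqrt (nsq (%k. g j k - g' k))) ----> 0"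
   using tendsto_add[OF tendsto_mult_right[OF tendsto_real_sqrt[OF f(3)], of 1] tendsto_mult_left[OF tendsto_real_sqrt[OF g(3)], of "sqrt (nsq f')"]] by simp
  show "EV j. norm (ip (f j) (g j) - ip f' g') <= sqrt (nsq (%k. f j k - f' k))*1 + sqrt (nsq f') * sqrt (nsq (%k. g j k - g' k))"
  proof (intro always_eventually allI)
   fix j
   have "ip (f j) (g j) - ip f' g' = ip (%k. f j k - f' k) (g j) + ip f' (%k. g j k - g' k)"
    using f g by (simp add: ip_diff_left ip_diff_right)
   hence "norm (ip (f j) (g j) - ip f' g') <= cmod (ip (%k. f j k - f' k) (g j)) + cmod (ip f' (%k. g j k - g' k))"
    by (simp add: norm_triangle_ineq)
   also have "... <= sqrt (nsq (%k. f j k - f' k)) * sqrt (nsq (g j)) + sqrt (nsq f') * sqrt (nsq (%k. g j k - g' k))"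
    by (intro add_mono ip_bound ell2_diff f g)
   also have "... <= sqrt (nsq (%k. f j k - f' k))*1 + sqrt (nsq f') * sqrt (nsq (%k. g j k - g' k))"
    using gb[of j] by (intro add_right_mono mult_left_mono) auto
   finally show "norm (ip (f j) (g j) - ip f' g') <= sqrt (nsq (%k. f j k - f' k))*1 + sqrt (nsq f') * sqrt (nsq (%k. g j k - g' k))" .
  qed
 qed
 thus ?thesis by (simp add: LIM_zero_iff)
qed

lemma nnr_limit: assumes "!!j. nnr (z j)" "z ----> l" shows "nnr l"
proof -
 have "(%j. Im (z j)) ----> Im l" "(%j. Re (z j)) ----> Re l" using assms(2) by (auto intro: tendsto_intros)
 moreover have "Im (z j) = 0" "Re (z j) >= 0" for j using assms(1)[of j] by (auto simp: nnr_def)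
 ultimately show ?thesis using LIMSEQ_le_const[of "%j. Re (z j)" "Re l" 0] by (auto simp: nnr_def LIMSEQ_const_iff)
qed

text \<open>Eigenvalues and eigenvectors of index \<open>n\<close> are bounded uniformly along the
  sequence; a subsequence converges, its limits are normalised eigenpairs of \<open>v'\<close>, and
  \<open>identify\<close> shows that they are the chosen ones.\<close>

lemma zet_subsequence:
 assumes v: "!!j. pot s (v j)" "!!j. wn (- s) (v j) <= R" and v': "pot s v'" and lim: "!!k. (%j::nat. v j k) ----> v' k"
 shows "EX r. strict_mono (r :: nat => nat) \<and> (ALL n. (%j. zet (v (r j)) n) ----> zet v' n)"
proof -
 have s: "0 < s" "s < 1/2" and hv: "v j:hplus (- s)" for j using v(1)[of j] by (auto simp: pot_def)
 obtain L where L1: "L >= 1" and L: "!!j. small_at (v j) L"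
  using small_at_exists[OF s, of R] hv v(2) by (metis order_refl)
 have nsp: "nspectral s (v j) (emu (v j)) (efn (v j))" for j by (rule nspectral_chosen[OF v(1)])
 have spc: "spectral s (v j) (emu (v j)) (efn (v j))" for j
  unfolding spectral_def using v(1) nbasis_chosen[OF v(1)] by (simp add: nbasis_def)
 note fh = spectral.hsF[OF spc] and fn = spectral.nsqF[OF spc]
 have mu_u: "emu (v j) n <= real n" for j n by (rule spectral.mu_le[OF spc])
 have en: "en L (efn (v j) n) <= 2*(real n + L)" "emu (v j) n + L >= 0" for j n
 proof -
  have *: "en L (efn (v j) n)/2 <= emu (v j) n + L"
   using qd_coercive(1)[OF v(1)[of j] L[of j] fh[of j n]] by (simp add: fn spectral.qdF[OF spc])
  thus "en L (efn (v j) n) <= 2*(real n + L)" using mu_u[of j n] by argo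
  show "emu (v j) n + L >= 0" using * en_nonneg[of L "efn (v j) n"] by linarith
 qed
 have en1: "en 1 (efn (v j) n) <= 2*(real n + L)" for j n
  using en_mono[OF fh, of 1 L j n] en(1)[of j n] L1 by simp
 \<comment> \<open>One countable index type for the coordinates of all eigenvectors and all
   eigenvalues, so a single extraction serves both.\<close>
 define x :: "nat => (nat \<times> nat) + nat => complex" where
  "x j i = (case i of Inl p => efn (v j) (fst p) (snd p) | Inr n => of_real (emu (v j) n))" for j i
 have "cmod (x j i) <= (case i of Inl p => 1 | Inr n => real n + L)" for j i
 proof (cases i)
  case (Inl p)
  thus ?thesis using coord_le_sqrt_nsq[OF hs_ell2[OF fh], of j "fst p" "snd p"] by (simp add: x_def fn)
 next
  case (Inr n)
  thus ?thesis using mu_u[of j n] en(2)[of j n] L1 by (simp add: x_def abs_le_iff)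
 qed
 then obtain r g where r: "strict_mono (r :: nat => nat)" and g: "!!i. (%j. x (r j) i) ----> g i"
  by (rule pointwise_subsequence) (rule that)
 define V where "V j = v (r j)" for j
 have V: "pot s (V j)" "wn (- s) (V j) <= R" for j using v by (auto simp: V_def)
 have Vlim: "(%j. V j k) ----> v' k" for k
  unfolding V_def using LIMSEQ_subseq_LIMSEQ[OF lim r] by (simp add: o_def)
 define G where "G n k = g (Inl (n, k))" for n k
 define l where "l n = Re (g (Inr n))" for n
 have Glim: "(%j. efn (V j) n k) ----> G n k" for n k
  using g[of "Inl (n, k)"] by (simp add: x_def G_def V_def)
 have llim: "(%j. emu (V j) n) ----> l n" for n
  using tendsto_Re[OF g[of "Inr n"]] by (simp add: x_def l_def V_def)
 have Vn: "nspectral s (V j) (emu (V j)) (efn (V j))" and Vs: "spectral s (V j) (emu (V j)) (efn (V j))" for j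
  using nsp spc by (auto simp: V_def)
 have Vh: "hs (efn (V j) n)" "nsq (efn (V j) n) = 1" and Ve: "en 1 (efn (V j) n) <= 2*(real n + L)" for j n
  using fh fn en1 by (auto simp: V_def)
 have Gh: "hs (G n)" and Gs: "(%j. nsq (%k. efn (V j) n k - G n k)) ----> 0" for n
  using hs_limit[of "%j. efn (V j) n" "2*(real n + L)" "G n"] Vh(1) Ve Glim by blast+
 have ipl: "(%j. ip (efn (V j) n) h) ----> ip (G n) h" if "hs h" for n h
  by (rule dpart_tendsto(2)[of "%j. efn (V j) n" "2*(real n + L)"]) (rule Vh Ve Glim that)+
 have ipr: "(%j. ip h (efn (V j) n)) ----> ip h (G n)" if "hs h" for n h
 proof -
  have "(%j. cnj (ip (efn (V j) n) h)) ----> cnj (ip (G n) h)" by (intro tendsto_cnj ipl that)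
  thus ?thesis by (simp add: ip_commute[symmetric])
 qed
 have ipG: "(%j. ip (efn (V j) m) (efn (V j) n)) ----> ip (G m) (G n)" for m n
  by (rule ip_tendsto_strong[of "%j. efn (V j) m" "G m" "%j. efn (V j) n" "G n"]) (use Vh Gh Gs in auto)
 have G1: "nsq (G n) = 1" for n
 proof -
  have "(%j. ip (efn (V j) n) (efn (V j) n)) ----> ip (G n) (G n)" by (rule ipG)
  thus ?thesis by (simp add: ip_self Vh LIMSEQ_const_iff)
 qed
 have Gep: "epair v' (l n) (G n)" for n
  unfolding epair_def
 proof (intro conjI allI impI Gh)
  fix h assume h: "hs h"
  have 1: "(%j. qf (V j) (efn (V j) n) h) ----> qf v' (G n) h"
   by (rule qf_pot_tendsto[of s V R v' "%j. efn (V j) n" "2*(real n + L)"]) (rule V v' Vlim Vh Ve Glim h)+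
  have 2: "(%j. of_real (emu (V j) n)*ip (efn (V j) n) h) ----> of_real (l n)*ip (G n) h"
   by (intro tendsto_mult tendsto_of_real llim ipl h)
  show "qf v' (G n) h = of_real (l n)*ip (G n) h"
   using LIMSEQ_unique[OF 1] 2 spectral.qfF[OF Vs h] by simp
 qed
 have lmono: "strict_mono l"
 proof (rule strict_mono_Suc_iff[THEN iffD2], rule allI)
  fix n
  have "l n + 1 <= l (Suc n)"
   by (rule LIMSEQ_le[OF tendsto_add[OF llim tendsto_const] llim]) (use spectral.gap[OF Vs] in auto)
  thus "l n < l (Suc n)" by simp
 qed
 interpret nspectral s v' "emu v'" "efn v'" by (rule nspectral_chosen[OF v'])
 \<comment> \<open>No eigenvector is lost: the residual estimate \<open>rm_small\<close> is uniform
   in \<open>j\<close> and passes to the limit. A vector orthogonal to all \<open>G n\<close> would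
   give N <= E for every N.\<close>
 have cpl: "EX n. ip (efn v' m) (G n) ~= 0" for m
 proof (rule ccontr)
  assume "\<not> ?thesis"
  hence z: "ip (efn v' m) (G n) = 0" for n by simp
  define h where "h = efn v' m"
  have h: "hs h" "nsq h = 1" by (auto simp: h_def)
  define E where "E = 3/2*en L h"
  have E: "real N*(1 - (SUM n<N. sqn (ip h (efn (V j) n)))) <= E" for j N
  proof -
   have "real N*nsq (spectral.rm (efn (V j)) h N) <= qd (V j) h + L*nsq h"
    by (rule spectral.rm_small[OF Vs h(1)]) (use en(2) in "auto simp: V_def")
   also have "... <= E" unfolding E_def by (rule qd_coercive(2)[OF V(1) _ h(1)]) (use L in "simp add: V_def")
   finally show ?thesis by (simp add: spectral.rm_nsq[OF Vs h(1)] h(2))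
  qed
  have "(%j. real N*(1 - (SUM n<N. sqn (ip h (efn (V j) n))))) ----> real N*(1 - (SUM n<N. sqn (ip h (G n))))" for N
   by (intro tendsto_intros ipr h)
  hence "real N*(1 - (SUM n<N. sqn (ip h (G n)))) <= E" for N
   by (rule LIMSEQ_le_const2) (use E in auto)
  hence "real N <= E" for N using z by (simp add: h_def)
  thus False using reals_Archimedean2[of E] by (meson not_less)
 qed
 have "nnr (ip (ev 0) (G 0))"
 proof (rule nnr_limit)
  show "nnr (ip (ev 0) (efn (V j) 0))" for j
   using nspectral.pos0[OF Vn[of j]] pos_complex_nnr by (simp add: spectral.yv_def[OF Vs])
  show "(%j. ip (ev 0) (efn (V j) 0)) ----> ip (ev 0) (G 0)" by (rule ipr) simp
 qed
 moreover have "nnr (ip (G (Suc n)) (sh (G n)))" for n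
 proof (rule nnr_limit)
  show "nnr (ip (efn (V j) (Suc n)) (sh (efn (V j) n)))" for j
   using nspectral.posS[OF Vn[of j]] pos_complex_nnr by blast
  have d: "(%k. sh (efn (V j) n) k - sh (G n) k) = sh (%k. efn (V j) n k - G n k)" for j
   by (auto simp: sh_def fun_eq_iff split: nat.splits)
  show "(%j. ip (efn (V j) (Suc n)) (sh (efn (V j) n))) ----> ip (G (Suc n)) (sh (G n))"
   by (rule ip_tendsto_strong[of "%j. efn (V j) (Suc n)" "G (Suc n)" "%j. sh (efn (V j) n)" "sh (G n)"]) (use Vh Gh Gs in "auto simp: d nsq_sh intro!: ell2_sh")
 qed
 ultimately have id: "l = emu v'" "G = efn v'"
  using identify[of l G, OF Gep G1 lmono cpl] by blast+
 have ylim: "(%j. ip (ev 0) (efn (V j) n)) ----> ip (ev 0) (efn v' n)" for n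
  using ipr[of "ev 0" n] by (simp add: id)
 have mlim: "(%j. emu (V j) n) ----> emu v' n" for n using llim[of n] by (simp add: id)
 have "(%j. zet (V j) n) ----> zet v' n" for n
 proof (cases "n = 0")
  case True thus ?thesis by (simp add: zet_def)
 next
  case False
  hence n: "n >= 1" by simp
  let ?g = "%u. emu u n - emu u (n - 1) - 1"
  have glim: "(%j. ?g (V j)) ----> ?g v'" by (intro tendsto_intros mlim)
  show ?thesis
  proof (cases "ip (ev 0) (efn v' n) = 0")
   \<comment> \<open>The phase need not converge here, but the gap closes in the limit, so the
     modulus tends to 0.\<close>
   case True
   hence "ga n = 0" using yv_nonzero_iff[of "n - 1"] n by (simp add: yv_def)
   hence "(%j. sqrt (?g (V j))) ----> sqrt 0" using tendsto_real_sqrt[OF glim] by (simp add: ga_def)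
   moreover have "cmod (zet (V j) n) = sqrt (?g (V j))" for j
   proof -
    have "sqn (zet (V j) n) = ?g (V j)"
     using nspectral.ze_sq[OF Vn n, of j] nspectral.zet_eq[OF Vn, of j] spectral.ga_def[OF Vs, of j n] by simp
    thus ?thesis by (metis norm_ge_zero real_sqrt_unique)
   qed
   ultimately have "(%j. cmod (zet (V j) n)) ----> 0" by simp
   hence "(%j. zet (V j) n) ----> 0" by (rule tendsto_norm_zero_cancel)
   moreover have "zet v' n = 0" using True by (simp add: zet_def)
   ultimately show ?thesis by simp
  next
   case ne: False
   let ?z = "%u. ip (ev 0) (efn u n)/of_real (cmod (ip (ev 0) (efn u n))) * of_real (sqrt (?g u))"
   have "(%j. ?z (V j)) ----> ?z v'"
    using ne by (intro tendsto_intros ylim glim) auto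
   moreover have "?z v' = zet v' n" using ne n by (simp add: zet_def Let_def)
   moreover have "EV j. ?z (V j) = zet (V j) n"
    using tendsto_imp_eventually_ne[OF ylim ne]
    by eventually_elim (use n in "simp add: zet_def Let_def")
   ultimately show ?thesis using Lim_transform_eventually by fastforce
  qed
 qed
 thus ?thesis using r by (auto simp: V_def)
qed

theorem zet_weak:
 assumes v: "!!j. pot s (v j)" "!!j. wn (- s) (v j) <= R" and v': "pot s v'" and lim: "!!k. (%j::nat. v j k) ----> v' k"
 shows "(%j. zet (v j) n) ----> zet v' n"
proof (rule subseq_principle)
 fix r :: "nat => nat" assume r: "strict_mono r"
 have "(%j. v (r j) k) ----> v' k" for k using LIMSEQ_subseq_LIMSEQ[OF lim r] by (simp add: o_def)
 from zet_subsequence[of s "%j. v (r j)" R v', OF v v' this]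
 show "EX r'. strict_mono r' \<and> (%j. zet (v (r (r' j))) n) ----> zet v' n" by blast
qed

section \<open>Recovering the potential from its coordinates\<close>

context nspectral
begin

text \<open>Column \<open>p\<close> of the shift divided by its entry in row \<open>Suc p\<close>,
  written through gaps, eigenvalues and \<open>yv\<close> only.\<close>

definition tt :: "nat => nat => complex" where
 "tt n p = (if ga (Suc p) = 0 then (if n = Suc p then 1 else 0)
  else of_real (ga (Suc p))*yv n/(yv (Suc p) * of_real (mu n - (mu p + 1))))"

lemma sm_tt: "sm n p = sm (Suc p) p*tt n p"
proof (cases "ga (Suc p) = 0")
 case True thus ?thesis using sm_trivial(2)[OF True, of n] by (auto simp: tt_def)
next
 case False
 have y: "yv (Suc p) ~= 0" using False by (simp add: yv_nonzero_iff)
 have "mu (Suc p) - (mu p + 1) = ga (Suc p)" by (simp add: ga_def)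
 hence "sm (Suc p) p = cc p*yv (Suc p)/of_real (ga (Suc p))" using sm_eq[OF False, of "Suc p"] by metis
 hence "sm (Suc p) p*tt n p = cc p*yv n/of_real (mu n - (mu p + 1))"
  using False y by (simp add: tt_def del: of_real_diff of_real_add)
 thus ?thesis using sm_eq[OF False, of n] by simp
qed

text \<open>The columns of the shift have norm 1, so the norm of the rescaled column determines the
  positive entry divided out.\<close>

lemma tt_sums: "(%n. sqn (tt n p)) sums (1/(Re (sm (Suc p) p))^2)"
proof -
 have c: "cmod (sm (Suc p) p) = Re (sm (Suc p) p)" "Re (sm (Suc p) p) > 0"
  using sm_pos[of p] by (auto simp: pos_complex_iff cmod_eq_Re)
 have "(%n. (Re (sm (Suc p) p))^2 * sqn (tt n p)) sums ((Re (sm (Suc p) p))^2*(1/(Re (sm (Suc p) p))^2))"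
 proof -
  have "sqn (sm n p) = (Re (sm (Suc p) p))^2 * sqn (tt n p)" for n
   by (subst sm_tt) (simp add: norm_mult power_mult_distrib c(1))
  thus ?thesis using sm_col[of p] c(2) by simp
 qed
 thus ?thesis by (rule sums_mult_iff[THEN iffD1, rotated]) (use c in auto)
qed

text \<open>The shift matrix carries the coordinates of \<open>ev k\<close> to those of
  \<open>ev (Suc k)\<close>.\<close>

lemma ev_step: "(%p. ip (ev k) (F p) * sm n p) sums ip (ev (Suc k)) (F n)"
proof -
 have "(%p. ip (ev k) (F p)*cnj (ip (bs (F n)) (F p))) sums ip (ev k) (bs (F n))"
  by (rule parseval_sums) (auto intro: ell2_bs)
 moreover have "ip (bs (F n)) (F p) = cnj (sm n p)" for p
  using ip_commute[of "bs (F n)" "F p"] by (simp add: sm_def ip_sh_bs)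
 ultimately show ?thesis by (simp add: ip_sh_bs[symmetric] sh_ev)
qed

lemma potential_sums: assumes "k >= 1" shows "(%n. of_real (mu n)*(yv n*cnj (ip (ev k) (F n)))) sums (- v k)"
 using qf_sums[of "ev 0" "ev k"] uc_of_nat[of v k, OF pot_0[OF npot]] assms by (simp add: yv_def qf_ev_ev)

end

text \<open>The moduli give the gaps, the trace formula gives \<open>mu 0\<close> and so all
  eigenvalues, the product formula gives \<open>yv\<close>, and these determine the shift matrix.
  Iterating the shift on the constant recovers the eigenbasis, and the form at the constant returns
  \<open>v\<close>.\<close>

theorem zet_inj:
 assumes v: "pot s v" and w: "pot s w" and eq: "zet v = zet w"
 shows "v = w"
proof -
 interpret A: nspectral s v "emu v" "efn v" by (rule nspectral_chosen[OF v])
 interpret B: nspectral s w "emu w" "efn w" by (rule nspectral_chosen[OF w])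
 have ze: "A.ze n = B.ze n" for n using A.zet_eq B.zet_eq eq by simp
 have ga: "A.ga n = B.ga n" if "n >= 1" for n using A.ze_sq[OF that] B.ze_sq[OF that] ze by simp
 have m0: "emu v 0 = emu w 0"
  using A.cd.gap_sum B.cd.gap_sum unfolding A.g_ga B.g_ga by (simp add: ga sums_unique2 sums_iff)
 have mu: "emu v n = emu w n" for n
 proof (induction n)
  case (Suc n) thus ?case using ga[of "Suc n"] by (simp add: A.ga_def B.ga_def)
 qed (rule m0)
 hence mu': "emu v = emu w" by auto
 have y: "A.yv n = B.yv n" for n
  using A.yv_ze[of n] B.yv_ze[of n] A.yv0_K B.yv0_K ze[of n] mu' by (cases "n = 0") auto
 have t: "A.tt n p = B.tt n p" for n p by (simp add: A.tt_def B.tt_def y mu ga)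
 have s1: "A.sm (Suc p) p = B.sm (Suc p) p" for p
 proof -
  have "1/(Re (A.sm (Suc p) p))^2 = 1/(Re (B.sm (Suc p) p))^2"
   using A.tt_sums[of p] B.tt_sums[of p] unfolding t by (rule sums_unique2)
  hence "(Re (A.sm (Suc p) p))^2 = (Re (B.sm (Suc p) p))^2" by simp
  thus ?thesis using A.sm_pos[of p] B.sm_pos[of p]
   by (auto simp: pos_complex_iff complex_eq_iff power2_eq_iff)
 qed
 have sm: "A.sm n p = B.sm n p" for n p using A.sm_tt[of n p] B.sm_tt[of n p] t s1 by simp
 have ek: "ip (ev k) (efn v n) = ip (ev k) (efn w n)" for k n
 proof (induction k arbitrary: n)
  case 0 thus ?case using y[of n] by (simp add: A.yv_def B.yv_def)
 next
  case (Suc k)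
  show ?case using A.ev_step[of k n] B.ev_step[of k n] unfolding Suc sm by (rule sums_unique2)
 qed
 show "v = w"
 proof
  fix k show "v k = w k"
  proof (cases "k = 0")
   case True thus ?thesis using pot_0[OF v] pot_0[OF w] by simp
  next
   case False
   hence "- v k = - w k"
    using A.potential_sums[of k] B.potential_sums[of k] unfolding ek y mu by (intro sums_unique2) auto
   thus ?thesis by simp
  qed
 qed
qed

section \<open>Square integrable potentials: regularity of eigenfunctions\<close>

lemma uc_inj_sum:
 assumes v: "ell2 v" and F: "finite F" "inj_on g F"
 shows "(SUM l:F. sqn (uc v (g l))) <= 2*nsq v"
proof -
 define u where "u n = (if n = 0 then 0 else v n)" for n
 have W: "W 0 u = u" by (auto simp: W_def u_def fun_eq_iff)
 have l: "ell2 u" "nsq u <= nsq v" using ell2_le[OF v, of u] by (auto simp: u_def)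
 have e: "\<bar>real_of_int m\<bar> powr (2*0) * sqn (uc u m) = sqn (uc v m)" for m by (auto simp: uc_def u_def)
 have "(SUM m:g ` F. sqn (uc v m)) <= 2*nsq u"
  using uc_sum_le[of u 0 "g ` F"] l F unfolding e wn_W W by (simp add: hplus_W W, simp add: u_def)
 thus ?thesis using l(2) F(2) by (simp add: sum.reindex)
qed

lemma uc_row: assumes "ell2 v" shows "ell2 (%l. tz v k l)" "nsq (%l. tz v k l) <= 2*nsq v"
 using ell2I_bound[of "%l. tz v k l", OF uc_inj_sum[OF assms]] by (auto simp: inj_on_def)

definition cv :: "cseq => cseq => nat => complex" where
 "cv v f k = (INFSUM l. tz v k l*f l)"

lemma cv_abs: assumes "ell2 v" "ell2 f" shows "(%l. cmod (tz v k l)*cmod (f l)) summable_on UNIV"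
 "cmod (cv v f k) <= (INFSUM l. cmod (tz v k l)*cmod (f l))"
proof -
 show 1: "(%l. cmod (tz v k l)*cmod (f l)) summable_on UNIV"
  by (rule ell2_mult(1)[OF uc_row(1)[OF assms(1)] assms(2)])
 thus "cmod (cv v f k) <= (INFSUM l. cmod (tz v k l)*cmod (f l))"
  unfolding cv_def using norm_infsum_bound[of "%l. tz v k l*f l" UNIV] by (simp add: norm_mult)
qed

lemma cv_summable: assumes "ell2 v" "ell2 f" shows "(%l. tz v k l*f l) summable_on UNIV"
 by (rule abs_summable_summable) (use cv_abs(1)[OF assms] in "simp add: norm_mult")

lemma cv_bound: assumes "ell2 v" "ell2 f" shows "cmod (cv v f k) <= sqrt (2*nsq v) * sqrt (nsq f)"
proof -
 have "cmod (cv v f k) <= (INFSUM l. cmod (tz v k l)*cmod (f l))" by (rule cv_abs(2)[OF assms])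
 also have "... <= sqrt (nsq (%l. tz v k l)) * sqrt (nsq f)" by (rule ell2_mult(2)[OF uc_row(1)[OF assms(1)] assms(2)])
 also have "... <= sqrt (2*nsq v) * sqrt (nsq f)" by (intro mult_right_mono real_sqrt_le_mono uc_row(2) assms) simp
 finally show ?thesis .
qed

text \<open>A square summable potential bounds every row and column of the kernel, so decay a + b >
  1 shared between the two indices is enough.\<close>

lemma weighted_kernel_sum:
 assumes v: "ell2 v" and ab: "a >= 0" "b >= 0" "a + b > 1" and F: "finite F" "finite G"
 shows "(SUM k:F. (SUM l:G. sqn (tz v k l)*real (Suc l) powr (- b))*real (Suc k) powr (- a))
  <= 4*nsq v * (INFSUM k. real (Suc k) powr (- (a + b)))"
proof -
 let ?u = "%k l. sqn (tz v k l)" and ?w = "%k. real (Suc k) powr (- (a + b))"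
 let ?T = "INFSUM k. ?w k"
 have T: "sum ?w A <= ?T" if "finite A" for A
  by (intro infsum_ge_sum summable_powr_shift) (use that ab in auto)
 have "(SUM k:F. (SUM l:G. ?u k l*real (Suc l) powr (- b))*real (Suc k) powr (- a))
  = (SUM k:F. SUM l:G. ?u k l*(real (Suc k) powr (- a)*real (Suc l) powr (- b)))"
  unfolding sum_distrib_right by (intro sum.cong refl) (simp only: mult_ac)
 also have "... <= (SUM k:F. SUM l:G. ?u k l*(?w k + ?w l))"
  by (intro sum_mono mult_left_mono powr_max_bound) (use ab in auto)
 also have "... = (SUM k:F. (SUM l:G. ?u k l)*?w k) + (SUM k:F. SUM l:G. ?u k l*?w l)"
  by (simp add: sum.distrib distrib_left sum_distrib_right)
 also have "(SUM k:F. SUM l:G. ?u k l*?w l) = (SUM l:G. (SUM k:F. ?u k l)*?w l)"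
  by (subst sum.swap) (simp add: sum_distrib_right)
 also have "(SUM k:F. (SUM l:G. ?u k l)*?w k) + (SUM l:G. (SUM k:F. ?u k l)*?w l)
  <= (SUM k:F. (2*nsq v)*?w k) + (SUM l:G. (2*nsq v)*?w l)"
  by (intro add_mono sum_mono mult_right_mono uc_inj_sum v F) (auto simp: inj_on_def)
 also have "... = (2*nsq v) * sum ?w F + (2*nsq v) * sum ?w G" by (simp add: sum_distrib_left)
 also have "... <= (2*nsq v)*?T + (2*nsq v)*?T"
  by (intro add_mono mult_left_mono T F) auto
 finally show ?thesis by simp
qed

text \<open>Bootstrap: the equation gives f = O(1/k), this makes the Toeplitz image weighted square
  summable, then f is absolutely summable, hence the Toeplitz image is square summable and k f k is
  too. It links form eigenvectors to the operator domain \<open>hardy1\<close>.\<close>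

lemma regularity:
 assumes v: "ell2 v" and f: "ell2 f" and eq: "!!k. of_real (real k - mu)*f k = cv v f k"
 shows "ell2 (%k. of_nat (Suc k)*f k)" "(%k. cmod (f k)) summable_on UNIV" "hs f"
proof -
 define c where "c k = cmod (cv v f k)" for k
 \<comment> \<open>From here on k + 1 is at most 3 (k - mu).\<close>
 define K0 :: nat where "K0 = nat \<lceil>2*\<bar>mu\<bar> + 2\<rceil>"
 define D where "D = (real K0 + 1) * sqrt (nsq f)"
 have D0: "D >= 0" by (simp add: D_def)
 have key: "real (Suc k)*cmod (f k) <= 3*c k + (if k < K0 then D else 0)" for k
 proof (cases "k < K0")
  case True
  hence "real (Suc k)*cmod (f k) <= D" unfolding D_def
   by (intro mult_mono coord_le_sqrt_nsq f) auto
  thus ?thesis using True by (simp add: c_def add_increasing)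
 next
  case False
  hence "real k >= 2*\<bar>mu\<bar> + 2" unfolding K0_def by linarith
  hence k: "real (Suc k) <= 3*(real k - mu)" by (simp add: abs_if split: if_splits)
  hence "real (Suc k)*cmod (f k) <= 3*(real k - mu)*cmod (f k)" by (rule mult_right_mono) simp
  also have "... = 3*cmod (of_real (real k - mu)*f k)" using k unfolding norm_mult norm_of_real by simp
  finally show ?thesis using False eq[of k] by (simp add: c_def)
 qed
 define C1 where "C1 = 3*(sqrt (2*nsq v) * sqrt (nsq f)) + D"
 have C10: "C1 >= 0" using D0 by (simp add: C1_def)
 have f1: "cmod (f k) <= C1/real (Suc k)" for k
 proof -
  have "real (Suc k)*cmod (f k) <= C1" unfolding C1_def
   by (rule order_trans[OF key add_mono]) (use cv_bound[OF v f, of k] D0 in "auto simp: c_def")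
  thus ?thesis by (simp add: field_simps)
 qed
 \<comment> \<open>Weighted Schur test: Cauchy-Schwarz in \<open>l\<close> against \<open>w\<close>,
   with \<open>V\<close> the sum of |f|^2/w. The weight may vanish where \<open>f\<close> does,
   which admits w = |f| below.\<close>
 have schur: "(SUM k:A. (c k)^2*g k) <= V*T"
  if A: "finite A" and g: "!!k. g k >= 0" and w: "!!l. w l >= 0" "!!l. w l = 0 ==> f l = 0"
   and V: "((%l. sqn (f l)/w l) has_sum V) UNIV" and u: "!!k. (%l. sqn (tz v k l)*w l) summable_on UNIV"
   and T: "!!G. finite G ==> (SUM k:A. (SUM l:G. sqn (tz v k l)*w l)*g k) <= T" for A g V T and w :: "nat => real"
 proof -
  let ?I = "%k. INFSUM l. sqn (tz v k l)*w l"
  have V0: "V >= 0" by (rule has_sum_nonneg[OF V]) (use w in auto)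
  have cs: "(c k)^2 <= ?I k*V" for k
  proof -
   let ?a = "%l. cmod (tz v k l) * sqrt (w l)" and ?b = "%l. cmod (f l)/sqrt (w l)"
   have a2: "(?a l)^2 = sqn (tz v k l)*w l" and b2: "(?b l)^2 = sqn (f l)/w l"
    and ab: "?a l*?b l = cmod (tz v k l)*cmod (f l)" for l
    using w[of l] by (auto simp: power_mult_distrib power_divide)
   have "(INFSUM l. ?a l*?b l) <= sqrt (INFSUM l. (?a l)^2) * sqrt (INFSUM l. (?b l)^2)"
    by (rule cauchy_schwarz_infsum(2), unfold a2 b2) (use w u V in "auto simp: summable_on_def")
   hence "c k <= sqrt (?I k*V)"
    unfolding ab a2 b2 infsumI[OF V] c_def using cv_abs(2)[OF v f, of k] by (simp add: real_sqrt_mult)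
   from power_mono[OF this, of 2] show ?thesis using V0 w by (simp add: c_def infsum_nonneg)
  qed
  have "(SUM k:A. (c k)^2*g k) <= (SUM k:A. ?I k*V*g k)" by (intro sum_mono mult_right_mono cs g)
  also have "... = V*(SUM k:A. ?I k*g k)" by (simp add: sum_distrib_left mult_ac)
  also have "... <= V*T"
  proof (rule mult_left_mono[OF _ V0])
   have hs: "((%l. SUM k:A. sqn (tz v k l)*w l*g k) has_sum (SUM k:A. ?I k*g k)) UNIV"
    by (intro has_sum_finite_sum A has_sum_cmult_left has_sum_infsum u)
   show "(SUM k:A. ?I k*g k) <= T"
    by (rule has_sum_le_finite_sums[OF hs]) (subst sum.swap, use T in "simp add: sum_distrib_right")
  qed
  finally show ?thesis .
 qed
 \<comment> \<open>With weight exponent 3/4 the quotients |f l|^2/w l are of size l^(-5/4), and 3/4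
   + 1/2 > 1 suits the kernel bound.\<close>
 have csum: "(%k. (c k)^2*real (Suc k) powr (- (1/2))) summable_on UNIV"
 proof (rule infsum_le_bound(1), simp, rule schur)
  let ?w = "%l. real (Suc l) powr (- (3/4))"
  have "(%l. sqn (f l)/?w l) summable_on UNIV"
  proof (rule summable_on_le)
   show "(%l. C1^2*real (Suc l) powr (- (5/4))) summable_on UNIV"
    by (intro summable_on_cmult_right summable_powr_shift) simp
   fix l :: nat
   have "sqn (f l)/?w l <= (C1/real (Suc l))^2/?w l"
    by (intro divide_right_mono power_mono f1) auto
   also have "... = C1^2*(real (Suc l) powr (- 2)*real (Suc l) powr (3/4))"
    by (simp add: power_divide powr_minus_divide powr_numeral)
   also have "... = C1^2*real (Suc l) powr (- (5/4))" by (simp only: powr_add[symmetric]) simp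
   finally show "sqn (f l)/?w l <= C1^2*real (Suc l) powr (- (5/4))" .
  qed auto
  thus "((%l. sqn (f l)/?w l) has_sum (INFSUM l. sqn (f l)/?w l)) UNIV" by (rule has_sum_infsum)
  fix k
  show "(%l. sqn (tz v k l)*?w l) summable_on UNIV"
  proof (rule summable_on_le)
   show "(%l. sqn (tz v k l)) summable_on UNIV" using uc_row(1)[OF v, of k] by (simp add: ell2_def)
   show "sqn (tz v k l)*?w l <= sqn (tz v k l)" for l
    using powr_mono[of "- (3/4)" 0 "real (Suc l)"] by (intro mult_right_le_one_le) auto
  qed auto
 next
  fix A G :: "nat set" assume "finite A" "finite G"
  thus "(SUM k:A. (SUM l:G. sqn (tz v k l)*real (Suc l) powr (- (3/4)))*real (Suc k) powr (- (1/2)))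
   <= 4*nsq v * (INFSUM k. real (Suc k) powr (- (1/2 + 3/4)))" by (intro weighted_kernel_sum v) auto
 qed auto
 have Dsum: "(%k. if k < K0 then D else 0) summable_on UNIV"
  by (rule finite_nonzero_values_imp_summable_on) (auto intro: finite_subset[of _ "{..<K0}"])
 have l1: "(%k. cmod (f k)) summable_on UNIV"
 proof (rule summable_on_le)
  let ?a = "%k. c k*real (Suc k) powr (- (1/4))" and ?b = "%k. real (Suc k) powr (- (3/4))"
  have a2: "(?a k)^2 = (c k)^2*real (Suc k) powr (- (1/2))" for k
   by (simp add: power_mult_distrib power2_eq_square powr_add[symmetric])
  have b2: "(?b k)^2 = real (Suc k) powr (- (3/2))" for k
   by (simp add: power2_eq_square powr_add[symmetric])
  have "(%k. ?a k*?b k) summable_on UNIV"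
   by (rule cauchy_schwarz_infsum(1)) (simp add: c_def, simp, simp only: a2 csum, unfold b2, rule summable_powr_shift, simp)
  thus "(%k. 3*(?a k*?b k) + (if k < K0 then D else 0)) summable_on UNIV"
   by (intro summable_on_add summable_on_cmult_right Dsum)
  fix k
  have "?a k*?b k = c k*(real (Suc k) powr (- (1/4))*real (Suc k) powr (- (3/4)))" by (simp only: mult.assoc)
  also have "... = c k/real (Suc k)" by (simp only: powr_add[symmetric]) (simp add: powr_minus_divide)
  finally have ab: "?a k*?b k = c k/real (Suc k)" .
  have "cmod (f k) <= (3*c k + (if k < K0 then D else 0))/real (Suc k)" using key[of k] by (simp add: field_simps)
  also have "... <= 3*(c k/real (Suc k)) + (if k < K0 then D else 0)"
   using D0 by (auto simp: add_divide_distrib divide_le_eq algebra_simps)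
  finally show "cmod (f k) <= 3*(?a k*?b k) + (if k < K0 then D else 0)" unfolding ab .
 qed simp
 thus "(%k. cmod (f k)) summable_on UNIV" .
 define S where "S = (INFSUM l. cmod (f l))"
 have rowf: "(%l. sqn (tz v k l)*cmod (f l)) summable_on UNIV" for k
 proof (rule summable_on_le)
  show "(%l. (2*nsq v)*cmod (f l)) summable_on UNIV" by (intro summable_on_cmult_right l1)
  show "sqn (tz v k l)*cmod (f l) <= (2*nsq v)*cmod (f l)" for l
   by (intro mult_right_mono order_trans[OF coord_le_nsq[OF uc_row(1)[OF v], of k l] uc_row(2)[OF v]]) auto
 qed auto
 \<comment> \<open>Schur test with the weight |f| itself, now known to be summable.\<close>
 have cl2: "(SUM k:A. (c k)^2) <= S*(2*nsq v * S)" if A: "finite A" for A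
 proof -
  have e: "sqn (f l)/cmod (f l) = cmod (f l)" for l by (simp add: power2_eq_square)
  have "(SUM k:A. (c k)^2*1) <= S*(2*nsq v * S)"
  proof (rule schur[OF A, of "%_. 1" "%l. cmod (f l)"])
   fix G :: "nat set" assume G: "finite G"
   have "(SUM k:A. (SUM l:G. sqn (tz v k l)*cmod (f l))*1) = (SUM l:G. (SUM k:A. sqn (tz v k l))*cmod (f l))"
    by (simp add: sum_distrib_right) (rule sum.swap)
   also have "... <= (SUM l:G. 2*nsq v * cmod (f l))"
    by (intro sum_mono mult_right_mono uc_inj_sum v A) (auto simp: inj_on_def)
   also have "... = 2*nsq v * (SUM l:G. cmod (f l))" by (simp add: sum_distrib_left)
   also have "... <= 2*nsq v * S" unfolding S_def by (intro mult_left_mono infsum_ge_sum l1 G) auto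
   finally show "(SUM k:A. (SUM l:G. sqn (tz v k l)*cmod (f l))*1) <= 2*nsq v * S" .
  qed (use l1 rowf in "auto simp: e S_def")
  thus ?thesis by simp
 qed
 have l2c: "ell2 (cv v f)" using ell2I_bound(1)[OF cl2[unfolded c_def]] .
 have l2D: "ell2 (%k. of_real (if k < K0 then D else 0))"
  by (rule ell2_finite_support) (auto intro: finite_subset[of _ "{..<K0}"])
 have "ell2 (%k. of_real (3*c k) + complex_of_real (if k < K0 then D else 0))"
 proof (rule ell2_add(1)[OF _ l2D])
  have "ell2 (%k. 3*cv v f k)" by (rule ell2_scale[OF l2c])
  thus "ell2 (%k. complex_of_real (3*c k))" by (rule ell2_le(1)) (simp add: c_def norm_mult)
 qed
 thus h1: "ell2 (%k. of_nat (Suc k)*f k)"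
 proof (rule ell2_le(1))
  fix k
  have "cmod (of_nat (Suc k)*f k) = real (Suc k)*cmod (f k)" by (simp only: norm_mult norm_of_nat)
  also have "... <= 3*c k + (if k < K0 then D else 0)" by (rule key)
  also have "... = cmod (of_real (3*c k) + complex_of_real (if k < K0 then D else 0))"
   unfolding of_real_add[symmetric] norm_of_real using D0 by (simp add: c_def)
  finally show "cmod (of_nat (Suc k)*f k) <= cmod (of_real (3*c k) + complex_of_real (if k < K0 then D else 0))" .
 qed
 show "hs f" unfolding hs_def
 proof (rule ell2_le(1)[OF h1])
  fix k
  have "sqrt (real k + 1) <= real k + 1" by (rule real_le_lsqrt) (auto simp: power2_eq_square algebra_simps)
  thus "cmod (wt 1 f k) <= cmod (of_nat (Suc k)*f k)"
   unfolding wt_def norm_mult norm_of_real norm_of_nat by (intro mult_right_mono) auto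
 qed
qed

lemma ell2_hplus: assumes "v 0 = 0" "ell2 v" "sg <= 0" shows "v:hplus sg"
proof (rule hplus_bound(1)[of v, OF assms(1)])
 fix F :: "nat set" assume F: "finite F" "F \<subseteq> {1..}"
 have "(SUM n:F. hw sg v n) <= (SUM n:F. sqn (v n))"
 proof (rule sum_mono)
  fix n assume "n:F"
  hence "real n powr (2 * sg) <= real n powr 0" using F assms by (intro powr_mono) auto
  also have "... <= 1" by simp
  finally show "hw sg v n <= sqn (v n)" by (intro mult_left_le_one_le) auto
 qed
 also have "... <= nsq v" by (rule sum_le_nsq[OF assms(2) F(1)])
 finally show "(SUM n:F. hw sg v n) <= nsq v" .
qed

lemma tf_cv:
 assumes "pot s v" "hs f" "hs h"
 shows "tf v f h = (INFSUM k. cv v f k*cnj (h k))"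
proof -
 let ?t = "%p. tz v (fst p) (snd p)*f (snd p)*cnj (h (fst p))"
 have "?t summable_on (UNIV \<times> UNIV)" using tf_summable[OF assms] by simp
 hence "tf v f h = (INFSUM k. INFSUM l. ?t (k, l))"
  unfolding tf_def using infsum_Sigma_banach[of ?t UNIV "%_. UNIV"] by simp
 also have "... = (INFSUM k. cv v f k*cnj (h k))"
  unfolding cv_def by (simp add: infsum_cmult_left')
 finally show ?thesis .
qed

text \<open>For a square summable potential a merely square summable solution of the coordinate
  equations lies in the form domain by \<open>regularity\<close>, so the two notions of eigenvector
  agree.\<close>

lemma epair_iff_coord:
 assumes v: "pot s v" "ell2 v" and f: "ell2 f"
 shows "epair v mu f <-> (ALL k. of_real (real k - mu)*f k = cv v f k)"
proof
 assume e: "epair v mu f"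
 hence fh: "hs f" by (simp add: epair_def)
 show "ALL k. of_real (real k - mu)*f k = cv v f k"
 proof
  fix k
  have "qf v f (ev k) = of_real mu*f k" using e by (simp add: epair_def ip_ev_right)
  moreover have "dpart f (ev k) = of_nat k*f k" using dpart_ev_left[of k f] dpart_commute[of f "ev k"] by simp
  moreover have "tf v f (ev k) = cv v f k"
  proof -
   have "tf v f (ev k) = (INFSUM j. if j = k then cv v f j else 0)"
    unfolding tf_cv[OF v(1) fh hs_ev] by (intro infsum_cong) (simp add: ev_def)
   thus ?thesis by (simp add: infsum_single)
  qed
  ultimately show "of_real (real k - mu)*f k = cv v f k" by (simp add: qf_def algebra_simps)
 qed
next
 assume eq: "ALL k. of_real (real k - mu)*f k = cv v f k"
 have fh: "hs f" by (rule regularity(3)[OF v(2) f]) (use eq in auto)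
 show "epair v mu f" unfolding epair_def
 proof (intro conjI allI impI fh)
  fix h assume h: "hs h"
  have "tf v f h = (INFSUM k. of_nat k*f k*cnj (h k) - of_real mu*(f k*cnj (h k)))"
   unfolding tf_cv[OF v(1) fh h] by (intro infsum_cong) (simp add: eq[rule_format, symmetric] algebra_simps)
  also have "... = dpart f h - of_real mu*ip f h"
  proof -
   have "((%k. of_nat k*f k*cnj (h k) + - (of_real mu*(f k*cnj (h k)))) has_sum (dpart f h + - (of_real mu*ip f h))) UNIV"
    unfolding dpart_def
    by (intro has_sum_add has_sum_infsum dpart_summable has_sum_uminusI has_sum_cmult_right ip_has_sum fh h hs_ell2)
   thus ?thesis by (simp add: infsumI)
  qed
  finally show "qf v f h = of_real mu*ip f h" by (simp add: qf_def)
 qed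
qed

section \<open>Finite gap potentials\<close>

lemma ell2_fin: "(!!n. n > (M::nat) ==> f n = 0) ==> ell2 f"
 by (rule ell2_finite_support) (rule finite_subset[of _ "{..M}"], auto simp: not_less[symmetric])

lemma ip_finite: "(!!n. n > (M::nat) ==> f n = 0 \<or> h n = 0) ==> ip f h = (SUM n<=M. f n*cnj (h n))"
 unfolding ip_def by (subst infsum_finite[symmetric], simp, rule infsum_cong_neutral) (auto simp: not_le)

lemma nsq_finite: "(!!n. n > (M::nat) ==> f n = 0) ==> nsq f = (SUM n<=M. sqn (f n))"
 unfolding nsq_def by (subst infsum_finite[symmetric], simp, rule infsum_cong_neutral) (auto simp: not_le)

locale finite_gap =
 fixes N :: nat and z :: cseq
 assumes z0: "z 0 = 0" and zN: "n > N ==> z n = 0"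
begin

section \<open>Prescribed eigenvalues and spectral weights\<close>

definition gm :: "nat => real" where "gm n = sqn (z n)"
text \<open>The only choice compatible with the prescribed gaps and the trace formula.\<close>

definition mu :: "nat => real" where "mu n = real n - (SUM k:{n<..N}. gm k)"

lemma gm_nonneg [simp]: "gm n >= 0" by (simp add: gm_def)

lemma mu_Suc: "mu (Suc n) = mu n + 1 + gm (Suc n)"
proof (cases "n < N")
 case True
 hence "{n<..N} = insert (Suc n) {Suc n<..N}" by auto
 thus ?thesis by (simp add: mu_def)
next
 case False
 hence "{n<..N} = {}" "{Suc n<..N} = {}" "gm (Suc n) = 0" using zN[of "Suc n"] by (auto simp: gm_def)
 thus ?thesis by (simp add: mu_def)
qed

lemma gapped_mu: "gapped mu" by unfold_locales (simp add: mu_Suc)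

sublocale gp: gapped mu by (rule gapped_mu)

lemma g_gm: "p >= 1 ==> gp.g p = gm p" using mu_Suc[of "p - 1"] by (simp add: gp.g_def)

lemma mu_0: "mu 0 = - (SUM k:{1..N}. gm k)"
proof -
 have "{0<..N} = {1..N}" by auto
 thus ?thesis by (simp add: mu_def)
qed

definition IA :: "nat set" where "IA = {p:{1..N}. gm p ~= 0}"
lemma finA [simp]: "finite IA" by (simp add: IA_def)
lemma zero_notin_A [simp]: "0 ~: IA" by (simp add: IA_def)

lemma mu_strict: "m < n ==> mu m + 1 <= mu n" by (rule gp.dist1)
lemma mu_inj: "mu m = mu n <-> m = n"
 using mu_strict[of m n] mu_strict[of n m] by (cases m n rule: linorder_cases) auto

lemma avoid: assumes "gm (Suc p) ~= 0" shows "mu n ~= mu p + 1"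
proof (cases "n <= p")
 case True thus ?thesis using gp.mono[OF True] by simp
next
 case False
 hence "mu (Suc p) <= mu n" by (intro gp.mono) simp
 thus ?thesis using mu_Suc[of p] assms gm_nonneg[of "Suc p"] by linarith
qed

text \<open>The weights are the residues of the product of (x - mu (p-1) - 1)/(x - mu p), divided by
  x - mu 0. The zeros of the product give the vanishing Cauchy sums.\<close>

lemma weights:
 obtains w where "!!n. n ~: insert 0 IA ==> w n = 0" "(SUM n:insert 0 IA. w n) = 1"
  "(SUM n:insert 0 IA. (mu n - mu 0)*w n) = - mu 0"
  "!!p. gm (Suc p) ~= 0 ==> (SUM n:insert 0 IA. w n/(mu n - (mu p + 1))) = 0"
proof -
 have "inj_on mu IA" by (auto simp: inj_on_def mu_inj)
 from partial_fractions[OF finA this, of "%p. mu (p - 1) + 1"]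
 obtain a where a: "(SUM p:IA. a p) = (SUM p:IA. mu p - (mu (p - 1) + 1))"
  "!!x. (ALL p:IA. x ~= mu p) ==> (PROD p:IA. (x - (mu (p - 1) + 1))/(x - mu p)) = 1 + (SUM p:IA. a p/(x - mu p))"
  by blast
 have suma: "(SUM p:IA. a p) = - mu 0"
 proof -
  have "(SUM p:IA. mu p - (mu (p - 1) + 1)) = (SUM p:IA. gm p)"
  proof (rule sum.cong[OF refl])
   fix p assume "p:IA" thus "mu p - (mu (p - 1) + 1) = gm p" using mu_Suc[of "p - 1"] by (simp add: IA_def)
  qed
  also have "... = (SUM k:{1..N}. gm k)" by (rule sum.mono_neutral_left) (auto simp: IA_def)
  finally show ?thesis using a(1) mu_0 by simp
 qed
 have d0: "mu p - mu 0 ~= 0" if "p:IA" for p using that mu_inj[of p 0] by (auto simp: IA_def)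
 define w where "w n = (if n = 0 then 1 - (SUM p:IA. a p/(mu p - mu 0)) else if n:IA then a n/(mu n - mu 0) else 0)" for n
 have wA: "w p = a p/(mu p - mu 0)" if "p:IA" for p using that by (auto simp: w_def)
 have sumw: "(SUM n:IA. f n (w n)) = (SUM n:IA. f n (a n/(mu n - mu 0)))" for f :: "nat => real => real"
  by (rule sum.cong) (auto simp: wA)
 show ?thesis
 proof (rule that[of w])
  show "n ~: insert 0 IA ==> w n = 0" for n by (simp add: w_def)
  show "(SUM n:insert 0 IA. w n) = 1" using sumw[of "%n x. x"] by simp (simp add: w_def)
  show "(SUM n:insert 0 IA. (mu n - mu 0)*w n) = - mu 0"
   using sumw[of "%n x. (mu n - mu 0)*x"] suma d0 by simp
  fix p assume p: "gm (Suc p) ~= 0"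
  define x where "x = mu p + 1"
  have xn: "mu n - x ~= 0" for n using avoid[OF p, of n] by (simp add: x_def)
  have "Suc p:IA" using p zN[of "Suc p"] by (auto simp: IA_def gm_def not_less[symmetric])
  hence "(PROD q:IA. (x - (mu (q - 1) + 1))/(x - mu q)) = 0"
   by (intro prod_zero) (auto simp: x_def intro!: bexI[of _ "Suc p"])
  moreover have "ALL q:IA. x ~= mu q" using xn by (metis diff_self)
  ultimately have "1 + (SUM q:IA. a q/(x - mu q)) = 0" using a(2)[of x] by argo
  moreover have "(SUM q:IA. a q/(x - mu q)) = - (SUM q:IA. a q/(mu q - x))"
   unfolding sum_negf[symmetric] by (intro sum.cong refl) (metis divide_minus_right minus_diff_eq)
  ultimately have 1: "(SUM q:IA. a q/(mu q - x)) = 1" by simp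
  have x0: "x - mu 0 ~= 0" using xn[of 0] by simp
  have "(SUM q:IA. w q/(mu q - x)) = (SUM q:IA. (a q/(mu q - x) - a q/(mu q - mu 0))/(x - mu 0))"
  proof (rule sum.cong[OF refl])
   fix q assume q: "q:IA"
   have "1/(mu q - x) - 1/(mu q - mu 0) = (x - mu 0)/((mu q - x)*(mu q - mu 0))"
    using xn[of q] d0[OF q] by (simp add: diff_frac_eq)
   hence "(1/(mu q - x) - 1/(mu q - mu 0))/(x - mu 0) = 1/((mu q - x)*(mu q - mu 0))"
    using x0 by simp
   hence "a q*((1/(mu q - x) - 1/(mu q - mu 0))/(x - mu 0)) = a q*(1/((mu q - x)*(mu q - mu 0)))" by simp
   thus "w q/(mu q - x) = (a q/(mu q - x) - a q/(mu q - mu 0))/(x - mu 0)"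
    by (simp add: wA[OF q] right_diff_distrib mult.commute)
  qed
  also have "... = (1 - (1 - w 0))/(x - mu 0)"
   by (simp add: sum_divide_distrib[symmetric] sum_subtractf 1) (simp add: w_def)
  finally have 2: "(SUM q:IA. w q/(mu q - x)) = w 0/(x - mu 0)" by simp
  have "w 0/(mu 0 - x) = - (w 0/(x - mu 0))" by (metis divide_minus_right minus_diff_eq)
  thus "(SUM n:insert 0 IA. w n/(mu n - (mu p + 1))) = 0" using 2 by (simp add: x_def)
 qed
qed

definition w :: "nat => real" where
 "w n = (if n = 0 then gp.K 0 else gm n/(mu n - mu 0)*gp.K n)"

text \<open>The residues satisfy the hypotheses of \<open>cauchy_data\<close> and therefore equal
  the product formulas, whose positivity is visible. That positivity permits the square roots in
  \<open>y\<close>.\<close>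

lemma w_sums:
 "(SUM n<=N. w n) = 1" "(SUM n<=N. mu n*w n) = 0"
 "gm (Suc p) ~= 0 ==> (SUM n<=N. w n/(mu n - (mu p + 1))) = 0"
 and K_pos: "gp.K n > 0"
proof -
 obtain u where u: "!!n. n ~: insert 0 IA ==> u n = 0" "(SUM n:insert 0 IA. u n) = 1"
  "(SUM n:insert 0 IA. (mu n - mu 0)*u n) = - mu 0"
  "!!p. gm (Suc p) ~= 0 ==> (SUM n:insert 0 IA. u n/(mu n - (mu p + 1))) = 0"
  using weights by blast
 have fs: "(%n. f n*u n) sums (SUM n:insert 0 IA. f n*u n)" for f
  by (rule sums_finite) (use u(1) in auto)
 interpret c: cauchy_data mu u
 proof
  show "summable (%n. \<bar>u n\<bar>)" by (rule summable_finite[of "insert 0 IA"]) (use u(1) in auto)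
  show "summable (%n. (mu n - mu 0)*\<bar>u n\<bar>)" by (rule summable_finite[of "insert 0 IA"]) (use u(1) in auto)
  show "u sums 1" using fs[of "%_. 1"] u(2) by simp
  show "(%n. (mu n - mu 0)*u n) sums - mu 0" using fs[of "%n. mu n - mu 0"] u(3) by simp
  show "gp.g (Suc p) ~= 0 ==> (%n. u n/(mu n - (mu p + 1))) sums 0" for p
   using fs[of "%n. 1/(mu n - (mu p + 1))"] u(4)[of p] g_gm[of "Suc p"] by simp
  show "gp.g (Suc p) = 0 ==> u (Suc p) = 0" for p
   using u(1)[of "Suc p"] g_gm[of "Suc p"] by (simp add: IA_def)
 qed
 have "u n = w n" for n using c.w0_eq c.wn_eq[of n] g_gm[of n] by (cases "n = 0") (auto simp: w_def)
 hence uw: "u = w" by auto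
 have sub: "insert 0 IA \<subseteq> {..N}" by (auto simp: IA_def)
 have ext: "(SUM n<=N. f n*w n) = (SUM n:insert 0 IA. f n*w n)" for f
  by (rule sum.mono_neutral_right) (use sub u(1) uw in auto)
 show s1: "(SUM n<=N. w n) = 1" using ext[of "%_. 1"] u(2) uw by simp
 have "(SUM n<=N. (mu n - mu 0)*w n) = - mu 0" using ext[of "%n. mu n - mu 0"] u(3) uw by simp
 thus "(SUM n<=N. mu n*w n) = 0"
  using s1 by (simp add: left_diff_distrib sum_subtractf sum_distrib_left[symmetric])
 show "gm (Suc p) ~= 0 ==> (SUM n<=N. w n/(mu n - (mu p + 1))) = 0"
  using ext[of "%n. 1/(mu n - (mu p + 1))"] u(4)[of p] uw by simp
 show "gp.K n > 0" using gp.K_bounds(1)[OF c.gap_sum, of n] by (meson exp_gt_zero less_le_trans)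
qed

lemma mu_gt0: "n >= 1 ==> mu n - mu 0 > 0" using mu_strict[of 0 n] by simp

definition y :: cseq where
 "y n = (if n = 0 then of_real (sqrt (gp.K 0)) else of_real (sqrt (gp.K n/(mu n - mu 0)))*z n)"

lemma y_sq: "sqn (y n) = w n"
proof (cases "n = 0")
 case True thus ?thesis using K_pos[of 0] by (simp add: y_def w_def)
next
 case False
 hence "gp.K n/(mu n - mu 0) >= 0" using K_pos[of n] mu_gt0[of n] by simp
 thus ?thesis using False by (simp add: y_def w_def gm_def norm_mult power_mult_distrib)
qed

lemma y_zero: "n > N ==> y n = 0" using zN[of n] by (auto simp: y_def)

lemma y_Suc_zero: "y (Suc p) = 0 <-> gm (Suc p) = 0"
 using K_pos[of "Suc p"] mu_gt0[of "Suc p"] by (auto simp: y_def gm_def)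

lemma y_ell2 [simp]: "ell2 y" by (rule ell2_fin[OF y_zero])

lemma nsq_y: "nsq y = 1"
 by (subst nsq_finite[of N]) (auto simp: y_zero y_sq w_sums(1))

text \<open>The rescaled columns as in \<open>nspectral\<close>, but with the column index first, so
  that \<open>tt p\<close> is a vector.\<close>

definition tt :: "nat => nat => complex" where
 "tt p n = (if gm (Suc p) = 0 then (if n = Suc p then 1 else 0)
  else of_real (gm (Suc p))*y n/(y (Suc p) * of_real (mu n - (mu p + 1))))"

lemma tt_supp: "n > max N (Suc p) ==> tt p n = 0"
 by (auto simp: tt_def y_zero)

lemma gm_large: "p >= N ==> gm (Suc p) = 0" using zN[of "Suc p"] by (simp add: gm_def)

lemma tt_diag: "tt p (Suc p) = 1"
proof (cases "gm (Suc p) = 0")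
 case True thus ?thesis by (simp add: tt_def)
next
 case False
 thus ?thesis using y_Suc_zero[of p] mu_Suc[of p] by (simp add: tt_def)
qed

lemma tt_ell2 [simp]: "ell2 (tt p)" by (rule ell2_fin[OF tt_supp])

lemma nsq_tt: "nsq (tt p) > 0"
proof -
 have "sqn (tt p (Suc p)) <= nsq (tt p)" by (rule coord_le_nsq) simp
 thus ?thesis by (simp add: tt_diag)
qed

section \<open>The prospective matrix of the shift\<close>

definition mm :: "nat => real" where "mm p = 1/sqrt (nsq (tt p))"
definition T :: "nat => nat => complex" where "T p n = of_real (mm p)*tt p n"
definition cc :: cseq where "cc p = (if gm (Suc p) = 0 then 0 else of_real (mm p*gm (Suc p))/y (Suc p))"

lemma mm_pos: "mm p > 0" using nsq_tt[of p] by (simp add: mm_def)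
lemma T_ell2 [simp]: "ell2 (T p)" unfolding T_def[abs_def] by (rule ell2_scale) simp
lemma T_supp: "n > max N (Suc p) ==> T p n = 0" by (simp add: T_def tt_supp)

text \<open>All gaps beyond \<open>N\<close> are closed, so there the matrix is the ordinary
  shift.\<close>

lemma T_large: assumes "p >= N" shows "T p = ev (Suc p)"
proof -
 have t: "tt p = ev (Suc p)" using gm_large[OF assms] by (auto simp: tt_def ev_def fun_eq_iff)
 have "mm p = 1" unfolding mm_def t by simp
 thus ?thesis by (simp add: T_def[abs_def] t fun_eq_iff)
qed

lemma T_rel: "of_real (mu n - mu p - 1)*T p n = cc p*y n"
proof (cases "gm (Suc p) = 0")
 case True
 thus ?thesis using mu_Suc[of p] by (auto simp: T_def tt_def cc_def)
next
 case False
 have "mu n - (mu p + 1) ~= 0" using avoid[OF False, of n] by simp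
 hence "complex_of_real (mu n - (mu p + 1)) ~= 0" by (simp only: of_real_eq_0_iff not_False_eq_True)
 hence "of_real (mu n - (mu p + 1))*T p n = cc p*y n"
  using False by (simp add: T_def tt_def cc_def del: of_real_diff of_real_add)
 thus ?thesis by (simp add: algebra_simps)
qed

lemma T_formula: "gm (Suc p) ~= 0 ==> T p n = cc p*(y n/of_real (mu n - (mu p + 1)))"
 by (simp add: T_def tt_def cc_def del: of_real_diff of_real_add)

lemma T_trivial: "gm (Suc p) = 0 ==> T p = (%n. of_real (mm p)*ev (Suc p) n)"
 by (auto simp: T_def tt_def ev_def fun_eq_iff)

lemma T_y: "ip (T p) y = 0"
proof (cases "gm (Suc p) = 0")
 case True
 thus ?thesis using y_Suc_zero[of p] by (simp add: T_trivial ip_scale_left ip_ev_left)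
next
 case False
 have "ip (T p) y = (SUM n<=N. T p n*cnj (y n))" by (rule ip_finite) (auto simp: y_zero)
 also have "... = (SUM n<=N. cc p * of_real (w n/(mu n - (mu p + 1))))"
 proof (intro sum.cong refl)
  fix n
  have "T p n*cnj (y n) = cc p*((y n*cnj (y n))/of_real (mu n - (mu p + 1)))"
   unfolding T_formula[OF False] by (simp del: of_real_diff of_real_add)
  thus "T p n*cnj (y n) = cc p * of_real (w n/(mu n - (mu p + 1)))"
   unfolding complex_norm_square[symmetric] y_sq by (simp only: of_real_divide)
 qed
 also have "... = cc p * of_real (SUM n<=N. w n/(mu n - (mu p + 1)))" by (simp add: sum_distrib_left del: of_real_divide of_real_diff)
 also have "... = 0" using w_sums(3)[OF False] by simp
 finally show ?thesis .
qed

lemma T_trivial_orth: assumes "gm (Suc p) = 0" "p ~= q" shows "ip (T p) (T q) = 0"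
proof -
 have "T q (Suc p) = 0"
 proof (cases "gm (Suc q) = 0")
  case True thus ?thesis using assms(2) by (simp add: T_trivial ev_def)
 next
  case False thus ?thesis using y_Suc_zero[of p] assms(1) by (simp add: T_formula)
 qed
 thus ?thesis using assms by (simp add: T_trivial ip_scale_left ip_ev_left)
qed

text \<open>Two Cauchy kernels with different poles a, b split by partial fractions into a
  difference over a - b, and each part is one of the vanishing sums of
  \<open>w_sums\<close>.\<close>

lemma T_on: "ip (T p) (T q) = (if p = q then 1 else 0)"
proof (cases "p = q")
 case True
 have "nsq (T p) = 1" using nsq_tt[of p] unfolding T_def[abs_def] nsq_scale by (simp add: mm_def norm_divide power_divide)
 thus ?thesis using True by (simp add: ip_self)
next
 case ne: False
 consider "gm (Suc p) = 0" | "gm (Suc q) = 0" | "gm (Suc p) ~= 0" "gm (Suc q) ~= 0" by blast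
 thus ?thesis
 proof cases
  case 1 thus ?thesis using T_trivial_orth[OF 1 ne] ne by simp
 next
  case 2 thus ?thesis using T_trivial_orth[OF 2, of p] ne ip_commute[of "T p" "T q"] by simp
 next
  case 3
  define a where "a = mu p + 1"
  define b where "b = mu q + 1"
  have ab: "a - b ~= 0" using ne mu_inj[of p q] by (simp add: a_def b_def)
  have an: "mu n - a ~= 0" and bn: "mu n - b ~= 0" for n using avoid[OF 3(1), of n] avoid[OF 3(2), of n] by (auto simp: a_def b_def)
  have "ip (T p) (T q) = (SUM n<=N. T p n*cnj (T q n))" by (rule ip_finite) (auto simp: y_zero T_formula[OF 3(1)])
  also have "... = (SUM n<=N. cc p*cnj (cc q) * of_real ((w n/(mu n - a) - w n/(mu n - b))/(a - b)))"
  proof (intro sum.cong refl)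
   fix n
   have "T p n*cnj (T q n) = cc p*cnj (cc q)*((y n*cnj (y n))/(of_real (mu n - a) * of_real (mu n - b)))"
    unfolding T_formula[OF 3(1)] T_formula[OF 3(2)] a_def b_def by (simp del: of_real_diff of_real_add)
   also have "... = cc p*cnj (cc q) * of_real (w n/((mu n - a)*(mu n - b)))"
    unfolding complex_norm_square[symmetric] y_sq by (simp only: of_real_divide of_real_mult)
   also have "w n/((mu n - a)*(mu n - b)) = (w n/(mu n - a) - w n/(mu n - b))/(a - b)"
   proof -
    have "w n/(mu n - a) - w n/(mu n - b) = w n*(a - b)/((mu n - a)*(mu n - b))"
     using an[of n] bn[of n] by (simp add: diff_frac_eq algebra_simps)
    thus ?thesis using ab by simp
   qed
   finally show "T p n*cnj (T q n) = cc p*cnj (cc q) * of_real ((w n/(mu n - a) - w n/(mu n - b))/(a - b))" .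
  qed
  also have "... = cc p*cnj (cc q) * of_real (((SUM n<=N. w n/(mu n - a)) - (SUM n<=N. w n/(mu n - b)))/(a - b))"
   unfolding sum_subtractf[symmetric] sum_divide_distrib of_real_sum sum_distrib_left ..
  also have "... = 0" using w_sums(3)[OF 3(1)] w_sums(3)[OF 3(2)] by (simp add: a_def b_def)
  finally show ?thesis using ne by simp
 qed
qed

text \<open>The isometry with columns \<open>T p\<close>, truncated at \<open>P\<close> so that it
  acts by finite sums; on vectors supported in {..P} the truncation is invisible.\<close>

definition SS :: "nat => cseq => nat => complex" where
 "SS P f n = (SUM p<=P. f p*T p n)"
definition MM :: "cseq => nat => complex" where "MM f n = of_real (mu n)*f n"

lemma SS_ell2 [simp]: "ell2 (SS P f)" unfolding SS_def[abs_def] by (intro ell2_sum ell2_scale) auto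

lemma ip_SS_right: "ell2 x ==> ip x (SS P f) = (SUM p<=P. cnj (f p)*ip x (T p))"
 unfolding SS_def[abs_def] by (subst ip_sum_right) (auto intro!: ell2_scale simp: ip_scale_right)

lemma ip_SS_T: "ip (SS P f) (T q) = (if q <= P then f q else 0)"
proof -
 have "ip (SS P f) (T q) = (SUM p<=P. f p*ip (T p) (T q))"
  unfolding SS_def[abs_def] by (subst ip_sum_left) (auto intro!: ell2_scale simp: ip_scale_left)
 also have "... = (SUM p<=P. if p = q then f p else 0)" by (intro sum.cong refl) (simp add: T_on)
 finally show ?thesis by (simp add: sum.delta)
qed

lemma ip_SS: assumes "!!n. n > P ==> f n = 0" "!!n. n > P ==> h n = 0" shows "ip (SS P f) (SS P h) = ip f h"
proof -
 have "ip (SS P f) (SS P h) = (SUM p<=P. cnj (h p)*f p)" by (subst ip_SS_right) (auto simp: ip_SS_T)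
 also have "... = ip f h" by (subst ip_finite[of P]) (auto simp: assms mult.commute)
 finally show ?thesis .
qed

lemma ip_SS_y: "ip (SS P f) y = 0"
 unfolding SS_def[abs_def] by (subst ip_sum_left) (auto intro!: ell2_scale simp: ip_scale_left T_y)

lemma MM_SS: "MM (SS P f) n = SS P (%p. MM f p + f p) n + (SUM p<=P. f p*cc p)*y n"
proof -
 have "MM (SS P f) n = (SUM p<=P. f p*(of_real (mu n)*T p n))" by (simp add: MM_def SS_def sum_distrib_left mult_ac)
 also have "... = (SUM p<=P. f p*((of_real (mu p) + 1)*T p n + cc p*y n))"
 proof (intro sum.cong refl)
  fix p
  have "of_real (mu n)*T p n = (of_real (mu p) + 1)*T p n + cc p*y n" using T_rel[of n p] by (simp add: algebra_simps)
  thus "f p*(of_real (mu n)*T p n) = f p*((of_real (mu p) + 1)*T p n + cc p*y n)" by simp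
 qed
 also have "... = SS P (%p. MM f p + f p) n + (SUM p<=P. f p*cc p)*y n"
  by (simp add: SS_def MM_def sum_distrib_right sum.distrib[symmetric]) (simp add: algebra_simps)
 finally show ?thesis .
qed

text \<open>The counterpart of \<open>qf_sh\<close>: the rank one term of \<open>MM_SS\<close> is a
  multiple of \<open>y\<close>, orthogonal to the range of \<open>SS\<close>.\<close>

lemma form_shift:
 assumes f: "!!n. n > P ==> f n = 0" and h: "!!n. n > P ==> h n = 0" and fl: "ell2 f" and hl: "ell2 h"
 shows "ip (MM (SS P f)) (SS P h) = ip (MM f) h + ip f h"
proof -
 have ml: "ell2 (MM f)" by (rule ell2_fin[of P]) (simp add: MM_def f)
 have "ip (MM (SS P f)) (SS P h) = ip (SS P (%p. MM f p + f p)) (SS P h) + (SUM p<=P. f p*cc p)*ip y (SS P h)"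
  unfolding MM_SS[abs_def, of P f] by (subst ip_add_left) (auto intro!: ell2_scale simp: ip_scale_left)
 also have "ip y (SS P h) = 0" using ip_SS_y[of P h] ip_commute[of y "SS P h"] by simp
 also have "ip (SS P (%p. MM f p + f p)) (SS P h) = ip (%p. MM f p + f p) h"
  by (rule ip_SS) (auto simp: f h MM_def)
 also have "... = ip (MM f) h + ip f h" by (rule ip_add_left[OF ml fl hl])
 finally show ?thesis by simp
qed

lemma ip_MM: "ip (MM f) h = ip f (MM h)"
 unfolding ip_def MM_def by (intro infsum_cong) (simp add: mult_ac)

text \<open>The vectors \<open>a k\<close> represent the Fourier basis in the prospective eigenbasis.\<close>

primrec a :: "nat => nat => complex" where
 "a 0 = y"
| "a (Suc k) = SS (N + k) (a k)"

lemma a_supp: "n > N + k ==> a k n = 0"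
proof (induction k arbitrary: n)
 case 0 thus ?case by (simp add: y_zero)
next
 case (Suc k)
 have "T p n = 0" if "p <= N + k" for p using Suc.prems that by (intro T_supp) auto
 thus ?case by (simp add: SS_def)
qed

lemma a_ell2 [simp]: "ell2 (a k)" by (cases k) auto

lemma a_Suc: assumes "P >= N + k" shows "a (Suc k) = SS P (a k)"
proof
 fix n
 have "(SUM p<=P. a k p*T p n) = (SUM p<=N + k. a k p*T p n)"
  by (rule sum.mono_neutral_right) (use assms in "auto simp: a_supp")
 thus "a (Suc k) n = SS P (a k) n" by (simp add: SS_def)
qed

lemma a_shift: "ip (a (Suc k)) (a (Suc l)) = ip (a k) (a l)"
 "ip (MM (a (Suc k))) (a (Suc l)) = ip (MM (a k)) (a l) + ip (a k) (a l)"
proof -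
 define P where "P = N + k + l"
 have e: "a (Suc k) = SS P (a k)" "a (Suc l) = SS P (a l)" by (rule a_Suc, simp add: P_def)+
 have s: "a k n = 0" "a l n = 0" if "n > P" for n using that by (auto simp: P_def a_supp)
 show "ip (a (Suc k)) (a (Suc l)) = ip (a k) (a l)" unfolding e by (rule ip_SS) (use s in auto)
 show "ip (MM (a (Suc k))) (a (Suc l)) = ip (MM (a k)) (a l) + ip (a k) (a l)"
  unfolding e by (rule form_shift) (use s in auto)
qed

lemma a_on: "ip (a k) (a l) = (if k = l then 1 else 0)"
proof (induction k arbitrary: l)
 case 0
 show ?case
 proof (cases l)
  case 0 thus ?thesis by (simp add: ip_self nsq_y)
 next
  case (Suc m)
  thus ?thesis using ip_SS_y[of "N + m" "a m"] ip_commute[of y "SS (N + m) (a m)"] by simp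
 qed
next
 case (Suc k)
 show ?case
 proof (cases l)
  case 0 thus ?thesis using ip_SS_y[of "N + k" "a k"] by simp
 next
  case (Suc m) thus ?thesis using a_shift(1)[of k m] Suc.IH[of m] by (simp del: a.simps)
 qed
qed

text \<open>Forced by \<open>potential_sums\<close>, with \<open>y\<close> in the role of the
  constant and \<open>a k\<close> in that of the k-th Fourier vector.\<close>

definition v :: cseq where
 "v k = (if k = 0 then 0 else - ip (MM y) (a k))"

lemma MM_y_ell2 [simp]: "ell2 (MM y)" by (rule ell2_fin[of N]) (simp add: MM_def y_zero)

lemma MM_a_ell2 [simp]: "ell2 (MM (a k))" by (rule ell2_fin[of "N + k"]) (simp add: MM_def a_supp)

lemma v_ell2: "ell2 v"
proof -
 have "ell2 (%k. ip (MM y) (a k))" by (rule bessel(1)) (auto simp: a_on)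
 thus ?thesis by (rule ell2_le(1)) (auto simp: v_def)
qed

lemma ip_MM_y: "ip (MM y) y = 0"
proof -
 have "ip (MM y) y = (SUM n<=N. complex_of_real (mu n*w n))"
  by (subst ip_finite[of N]) (auto simp: y_zero MM_def y_sq[symmetric] complex_norm_square mult.assoc simp del: of_real_power)
 thus ?thesis unfolding of_real_sum[symmetric] w_sums(2) by simp
qed

text \<open>The shift relation moves along diagonals, adding 1 on the main one; the first column is
  the definition of \<open>v\<close>, the first row its conjugate.\<close>

lemma form_matrix: "ip (MM (a l)) (a k) = (if k = l then of_nat l else 0) - tz v k l"
proof (induction l arbitrary: k)
 case 0
 show ?case
 proof (cases "k = 0")
  case True thus ?thesis by (simp add: ip_MM_y)
 next
  case False
  hence "tz v k 0 = - ip (MM y) (a k)" using uc_of_nat[of v k] v_def[of 0] by (simp add: v_def[of k])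
  thus ?thesis using False by simp
 qed
next
 case (Suc l)
 show ?case
 proof (cases k)
  case 0
  have "ip (MM (a (Suc l))) (a 0) = cnj (ip (MM (a 0)) (a (Suc l)))"
   using ip_MM[of "a (Suc l)" "a 0"] ip_commute[of "a (Suc l)" "MM (a 0)"] by (simp del: a.simps)
  also have "... = cnj (- v (Suc l))" by (simp add: v_def del: a.simps(2))
  also have "... = - uc v (- int (Suc l))" unfolding uc_uminus using uc_of_nat[of v "Suc l"] by (simp add: v_def[of 0] v_def[of "Suc l"])
  finally show ?thesis using 0 by simp
 next
  case (Suc m)
  thus ?thesis using a_shift(2)[of l m] Suc.IH[of m] a_on[of l m] by (simp del: a.simps)
 qed
qed

text \<open>Completeness of \<open>a\<close>. For \<open>x\<close> supported in \<open>{..N}\<close> the iterates \<open>x j\<close> of the adjoint shift satisfy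
  \<open>x j = S (x (j+1)) + beta j y\<close>; if \<open>\<parallel>x j\<parallel>\<close> did not tend to zero, the energy, which drops by about
  \<open>\<parallel>x j\<parallel>\<^sup>2\<close> in each step, would be unbounded below.\<close>

definition bk :: "cseq => nat => complex" where "bk x p = ip x (T p)"

lemma bk_supp: assumes "!!n. n > N ==> x n = 0" "p >= N" shows "bk x p = 0"
 using assms T_large[OF assms(2)] by (simp add: bk_def ip_ev_right)

text \<open>The \<open>N + 1\<close> orthonormal vectors \<open>y\<close>, \<open>T p\<close> (\<open>p < N\<close>) span the vectors supported in \<open>{..N}\<close>:
 the squared distances of the unit vectors from their span add up to \<open>0\<close>.\<close>

lemma decomposition:
 assumes x: "!!n. n > N ==> x n = 0"
 shows "x = (%n. SS N (bk x) n + ip x y*y n)"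
proof
 define e where "e i = (case i of 0 => y | Suc p => T p)" for i
 have yT: "ip y (T p) = 0" for p using T_y[of p] ip_commute[of y "T p"] by simp
 have on: "ip (e i) (e j) = (if i = j then 1 else 0)" for i j
  by (auto simp: e_def T_on T_y yT ip_self[of y] nsq_y split: nat.splits)
 have el: "ell2 (e i)" for i by (auto simp: e_def split: nat.splits)
 have es: "e i n = 0" if "i <= N" "n > N" for i n using that by (auto simp: e_def y_zero T_supp split: nat.splits)
 let ?r = "%n k. ev n k - (SUM i<=N. ip (ev n) (e i)*e i k)"
 have r: "nsq (?r n) = 1 - (SUM i<=N. sqn (e i n))" for n
  using bessel_identity[of "{..N}" e "ev n"] el on by (simp add: ip_ev_left)
 have "(SUM n<=N. SUM i<=N. sqn (e i n)) = (SUM i<=N. nsq (e i))"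
  by (subst sum.swap) (auto intro!: sum.cong nsq_finite[symmetric] es)
 also have "... = real (Suc N)" using on[of i i for i] by (simp add: ip_self)
 finally have "(SUM n<=N. nsq (?r n)) = 0" unfolding r sum_subtractf by simp
 hence z: "?r n = (%k. 0)" if "n <= N" for n using that nsq_eq_0[of "?r n"] el by (auto simp: sum_nonneg_eq_0_iff ell2_diff ell2_sum ell2_scale)
 fix k
 have S: "(SUM i<=N. ip x (e i)*e i k) = SS N (bk x) k + ip x y*y k"
  using bk_supp[of x N] x unfolding sum.atMost_shift by (simp add: e_def SS_def bk_def lessThan_Suc_atMost[symmetric])
 show "x k = SS N (bk x) k + ip x y*y k"
 proof (cases "k <= N")
  case True
  have "ev k = (%j. SUM i<=N. ip (ev k) (e i)*e i j)" using z[OF True] by (auto simp: fun_eq_iff)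
  hence "ip x (ev k) = ip x (%j. SUM i<=N. ip (ev k) (e i)*e i j)" by (rule arg_cong)
  also have "... = (SUM i<=N. ip x (e i)*e i k)"
   by (subst ip_sum_right) (auto intro!: ell2_scale el ell2_fin[OF x] simp: ip_scale_right ip_ev_left mult.commute[of "ip x _"])
  finally show ?thesis by (simp add: S ip_ev_right)
 next
  case False thus ?thesis using S es[of _ k] x[of k] by simp
 qed
qed

lemma ip_a_Suc: assumes x: "!!n. n > N ==> x n = 0" shows "ip x (a (Suc k)) = ip (bk x) (a k)"
proof -
 have "ip x (a (Suc k)) = (SUM p<=N + k. cnj (a k p)*bk x p)"
  unfolding a.simps by (subst ip_SS_right) (auto simp: bk_def ell2_fin[OF x])
 also have "... = ip (bk x) (a k)" by (subst ip_finite[of "N + k"]) (auto simp: a_supp mult.commute)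
 finally show ?thesis .
qed

lemma one_step:
 assumes x: "!!n. n > N ==> x n = 0"
 defines "beta \<equiv> ip x y" and "x' \<equiv> bk x"
 shows "nsq x = nsq x' + sqn beta"
  "Re (ip (MM x) x) >= Re (ip (MM x') x') + nsq x' - 2*cmod beta*(sqrt (nsq x') * sqrt (nsq (MM y)))"
proof -
 have s': "x' n = 0" if "n > N" for n unfolding x'_def by (rule bk_supp) (use x that in auto)
 have l': "ell2 x'" by (rule ell2_fin) (rule s')
 let ?S = "SS N x'"
 have d: "x = (%n. ?S n + beta*y n)" unfolding x'_def beta_def by (rule decomposition) (rule x)
 have Sy: "ip ?S y = 0" by (rule ip_SS_y)
 have nS: "nsq ?S = nsq x'"
 proof -
  have "ip ?S ?S = ip x' x'" by (rule ip_SS) (use s' in auto)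
  thus ?thesis by (simp add: ip_self)
 qed
 show "nsq x = nsq x' + sqn beta"
  by (subst d, subst nsq_add) (auto intro!: ell2_scale simp: ip_scale_right Sy nS nsq_scale nsq_y)
 have MSl: "ell2 (MM ?S)"
  unfolding MM_SS[abs_def] by (intro ell2_add(1) ell2_scale) auto
 have "MM x = (%n. MM ?S n + beta*MM y n)" by (subst d) (auto simp: MM_def algebra_simps)
 hence "ip (MM x) x = ip (%n. MM ?S n + beta*MM y n) (%n. ?S n + beta*y n)" using d by simp
 also have "... = ip (MM ?S) ?S + cnj beta*ip (MM ?S) y + (beta*ip (MM y) ?S + beta*cnj beta*ip (MM y) y)"
  using MSl by (simp add: ip_add_left ip_add_right ip_scale_left ip_scale_right ell2_add ell2_scale algebra_simps)
 also have "ip (MM ?S) ?S = ip (MM x') x' + ip x' x'"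
  by (rule form_shift) (use s' l' in auto)
 also have "ip (MM ?S) y = cnj (ip (MM y) ?S)" using ip_MM[of ?S y] ip_commute[of ?S "MM y"] by simp
 finally have "ip (MM x) x = ip (MM x') x' + of_real (nsq x') + (cnj (beta*ip (MM y) ?S) + beta*ip (MM y) ?S)"
  by (simp add: ip_MM_y ip_self)
 hence "Re (ip (MM x) x) = Re (ip (MM x') x') + nsq x' + 2*Re (beta*ip (MM y) ?S)"
  by (simp only: plus_complex.sel Re_complex_of_real) simp
 moreover have "\<bar>Re (beta*ip (MM y) ?S)\<bar> <= cmod beta*(sqrt (nsq x') * sqrt (nsq (MM y)))"
 proof -
  have "\<bar>Re (beta*ip (MM y) ?S)\<bar> <= cmod beta*cmod (ip (MM y) ?S)" using abs_Re_le_cmod[of "beta*ip (MM y) ?S"] by (simp add: norm_mult)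
  also have "... <= cmod beta*(sqrt (nsq (MM y)) * sqrt (nsq ?S))" by (intro mult_left_mono ip_bound) auto
  finally show ?thesis by (simp add: nS mult.commute)
 qed
 ultimately show "Re (ip (MM x) x) >= Re (ip (MM x') x') + nsq x' - 2*cmod beta*(sqrt (nsq x') * sqrt (nsq (MM y)))" by linarith
qed

lemma complete_small:
 assumes x: "!!n. n > N ==> x n = 0"
 shows "nsq (%k. ip x (a k)) = nsq x"
proof -
 define X where "X = (%j. (bk ^^ j) x)"
 have XS: "X (Suc j) = bk (X j)" "X 0 = x" for j by (auto simp: X_def)
 have Xs: "X j n = 0" if "n > N" for j n
  using that by (induction j arbitrary: n) (auto simp: XS x bk_supp)
 define beta where "beta j = ip (X j) y" for j
 have XA: "ip (X j) (a k) = beta (j + k)" for j k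
 proof (induction k arbitrary: j)
  case 0 thus ?case by (simp add: beta_def)
 next
  case (Suc k)
  have "ip (X j) (a (Suc k)) = ip (bk (X j)) (a k)" by (rule ip_a_Suc) (rule Xs)
  also have "... = beta (Suc j + k)" using Suc.IH[of "Suc j"] by (simp add: XS)
  finally show ?case by simp
 qed
 have xa: "ip x (a k) = beta k" for k using XA[of 0 k] by (simp add: XS)
 have n1: "nsq (X j) = nsq (X (Suc j)) + sqn (beta j)" for j
  unfolding XS beta_def by (rule one_step(1)) (rule Xs)
 define C where "C = sqrt (nsq (MM y))"
 define E where "E j = Re (ip (MM (X j)) (X j))" for j
 have E1: "E j >= E (Suc j) + nsq (X (Suc j)) - 2*cmod (beta j)*(sqrt (nsq (X (Suc j)))*C)" for j
  unfolding E_def XS C_def beta_def by (rule one_step(2)) (rule Xs)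
 have nX: "nsq (X k) = nsq x - (SUM j<k. sqn (beta j))" for k
 proof (induction k)
  case (Suc k) thus ?case using n1[of k] by simp
 qed (simp add: XS)
 have bl: "ell2 beta" "nsq beta <= nsq x"
  using bessel[of a x] a_on ell2_fin[OF x] by (auto simp: xa)
 define rho where "rho = nsq x - nsq beta"
 have rhoX: "nsq (X k) >= rho" for k unfolding nX rho_def using sum_le_nsq[OF bl(1), of "{..<k}"] by simp
 have Xx: "nsq (X k) <= nsq x" for k unfolding nX by (simp add: sum_nonneg)
 have Eb: "E k >= mu 0*nsq x" for k
 proof -
  have "ip (MM (X k)) (X k) = (SUM n<=N. complex_of_real (mu n * sqn (X k n)))"
   by (subst ip_finite[of N]) (auto simp: Xs MM_def complex_norm_square mult.assoc simp del: of_real_power)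
  hence "E k = (SUM n<=N. mu n * sqn (X k n))" unfolding E_def of_real_sum[symmetric] by simp
  also have "... >= (SUM n<=N. mu 0 * sqn (X k n))" by (intro sum_mono mult_right_mono gp.mono) auto
  also have "(SUM n<=N. mu 0 * sqn (X k n)) = mu 0*nsq (X k)" by (simp add: nsq_finite[OF Xs] sum_distrib_left)
  also have "mu 0*nsq (X k) >= mu 0*nsq x"
   using Xx[of k] mu_0 by (intro mult_left_mono_neg) (auto intro!: sum_nonneg)
  finally show ?thesis by simp
 qed
 have "rho <= 0"
 proof (rule ccontr)
  assume "\<not> ?thesis"
  hence rho: "rho > 0" by simp
  \<comment> \<open>From Young's inequality 2q <= rho/2 + 2q^2/rho for the cross term
    \<open>q\<close> of \<open>one_step\<close>.\<close>
  define B where "B = 2*C^2*nsq x/rho"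
  have step: "E j - E (Suc j) >= rho/2 - B * sqn (beta j)" for j
  proof -
   have C0: "C >= 0" by (simp add: C_def)
   have "2*cmod (beta j)*(sqrt (nsq (X (Suc j)))*C) <= 2*cmod (beta j)*(sqrt (nsq x)*C)"
    using C0 Xx[of "Suc j"] by (intro mult_left_mono mult_right_mono) auto
   also have "... <= rho/2 + B * sqn (beta j)"
   proof -
    define q where "q = cmod (beta j)*(sqrt (nsq x)*C)"
    have "0 <= (rho - 2*q)^2" by simp
    hence "4*rho*q <= rho^2 + 4*q^2" by (simp add: power2_eq_square algebra_simps)
    hence "2*q <= (rho^2 + 4*q^2)/(2*rho)" using rho by (simp add: le_divide_eq algebra_simps)
    also have "... = rho/2 + 2*q^2/rho" using rho by (simp add: add_divide_distrib power2_eq_square)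
    also have "2*q^2/rho = B * sqn (beta j)" by (simp add: q_def B_def power_mult_distrib mult_ac)
    finally show ?thesis by (simp add: q_def mult_ac)
   qed
   finally show ?thesis using E1[of j] rhoX[of "Suc j"] by linarith
  qed
  \<comment> \<open>The coefficients \<open>beta\<close> are square summable, so the energy drops
    linearly in \<open>k\<close>, against its lower bound.\<close>
  have tele: "E 0 - E k >= real k*(rho/2) - B*nsq x" for k
  proof -
   have "E 0 - E k >= real k*(rho/2) - B*(SUM j<k. sqn (beta j))"
   proof (induction k)
    case (Suc k)
    have "B*(SUM j<Suc k. sqn (beta j)) = B*(SUM j<k. sqn (beta j)) + B * sqn (beta k)"
     by (simp add: distrib_left)
    moreover have "real (Suc k)*(rho/2) = real k*(rho/2) + rho/2" by (simp add: field_simps)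
    ultimately show ?case using Suc step[of k] by argo
   qed simp
   moreover have "B*(SUM j<k. sqn (beta j)) <= B*nsq x"
    using order_trans[OF sum_le_nsq[OF bl(1), of "{..<k}"] bl(2)] rho by (intro mult_left_mono) (auto simp: B_def)
   ultimately show ?thesis by linarith
  qed
  obtain k :: nat where k: "(E 0 - mu 0*nsq x + B*nsq x)/(rho/2) < real k" using reals_Archimedean2 by blast
  hence "E 0 - mu 0*nsq x + B*nsq x < real k*(rho/2)" using rho by (simp add: divide_less_eq)
  thus False using tele[of k] Eb[of k] by linarith
 qed
 hence "nsq beta = nsq x" using bl(2) by (simp add: rho_def)
 thus ?thesis by (simp add: xa)
qed

lemma a_high: assumes "n > N" shows "a 0 n = 0" "a (Suc k) n = a k (n - 1)"
proof -
 show "a 0 n = 0" using assms by (simp add: y_zero)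
 have "(SUM p<=N + k. a k p*T p n) = (SUM p<=N + k. if p = n - 1 then a k p else 0)"
 proof (intro sum.cong refl)
  fix p
  show "a k p*T p n = (if p = n - 1 then a k p else 0)"
  proof (cases "p >= N")
   case True thus ?thesis using T_large[OF True] assms by (auto simp: ev_def)
  next
   case False
   hence "T p n = 0" using assms by (intro T_supp) auto
   thus ?thesis using False assms by auto
  qed
 qed
 also have "... = a k (n - 1)" by (auto simp: sum.delta a_supp)
 finally show "a (Suc k) n = a k (n - 1)" by (simp add: SS_def)
qed

text \<open>Up to \<open>N\<close> this is \<open>complete_small\<close>; beyond,
  \<open>a_high\<close> makes row \<open>n\<close> the shift of row \<open>n - 1\<close>.\<close>

lemma complete_row: "nsq (%k. ip (ev n) (a k)) = 1"
proof (induction n)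
 case 0
 have "ev 0 n = 0" if "n > N" for n using that by (simp add: ev_def)
 thus ?case using complete_small[of "ev 0"] by simp
next
 case (Suc n)
 show ?case
 proof (cases "Suc n <= N")
  case True
  hence "ev (Suc n) m = 0" if "m > N" for m using that by (auto simp: ev_def)
  thus ?thesis using complete_small[of "ev (Suc n)"] by simp
 next
  case False
  hence h: "a 0 (Suc n) = 0" "!!k. a (Suc k) (Suc n) = a k n" using a_high[of "Suc n"] by auto
  have "(%k. ip (ev (Suc n)) (a k)) = sh (%k. ip (ev n) (a k))"
  proof
   fix k show "ip (ev (Suc n)) (a k) = sh (%k. ip (ev n) (a k)) k"
    using h by (cases k) (auto simp: ip_ev_left simp del: a.simps)
  qed
  thus ?thesis using Suc by (simp add: nsq_sh)
 qed
qed

section \<open>The eigenbasis of the reconstructed potential\<close>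

lemma parseval_row: "ell2 x ==> ip (ev n) x = ip (%k. ip (ev n) (a k)) (%k. ip x (a k))"
 by (rule parseval_of_bessel_eq) (auto simp: a_on complete_row)

text \<open>The matrix with columns \<open>a k\<close> is unitary; its conjugated rows are the
  eigenvectors in Fourier coordinates.\<close>

definition F :: "nat => nat => complex" where "F n k = cnj (a k n)"

lemma F_ip: "F n = (%k. ip (ev n) (a k))" by (auto simp: F_def ip_ev_left)

lemma F_ell2 [simp]: "ell2 (F n)" unfolding F_ip using bessel(1)[of a "ev n"] by (simp add: a_on)

lemma F_on: "ip (F m) (F n) = (if m = n then 1 else 0)"
proof -
 have "ip (F m) (F n) = ip (ev m) (ev n)" unfolding F_ip by (rule parseval_row[symmetric]) simp
 thus ?thesis by (simp add: ip_ev_left ev_def)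
qed

lemma F_coord: "of_real (real k - mu n)*F n k = cv v (F n) k"
proof -
 have hs: "((%l. ip (ev n) (a l)*cnj (ip (MM (a k)) (a l))) has_sum ip (ev n) (MM (a k))) UNIV"
  unfolding parseval_row[OF MM_a_ell2] by (rule ip_has_sum) (use bessel(1)[of a] a_on in auto)
 have t: "ip (ev n) (a l)*cnj (ip (MM (a k)) (a l)) = (if l = k then of_nat k*F n k else 0) - tz v k l*F n l" for l
 proof -
  have "cnj (ip (MM (a k)) (a l)) = ip (MM (a l)) (a k)" using ip_MM[of "a l" "a k"] ip_commute[of "a l" "MM (a k)"] by simp
  moreover have "ip (ev n) (a l) = F n l" by (simp add: F_ip)
  ultimately show ?thesis by (cases "l = k") (auto simp: form_matrix algebra_simps)
 qed
 have 1: "((%l. if l = k then of_nat k*F n k else 0) has_sum (of_nat k*F n k)) UNIV"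
  by (rule has_sum_finite_neutralI[of "{k}"]) auto
 have 2: "((%l. tz v k l*F n l) has_sum cv v (F n) k) UNIV"
  unfolding cv_def by (intro has_sum_infsum cv_summable v_ell2 F_ell2)
 have "((%l. (if l = k then of_nat k*F n k else 0) + - (tz v k l*F n l)) has_sum (of_nat k*F n k + - cv v (F n) k)) UNIV"
  by (intro has_sum_add 1 has_sum_uminusI 2)
 hence "of_nat k*F n k - cv v (F n) k = ip (ev n) (MM (a k))"
  using hs unfolding t by (simp add: has_sum_unique)
 also have "... = of_real (mu n)*F n k" by (simp add: ip_ev_left MM_def F_def)
 finally show ?thesis by (simp add: algebra_simps)
qed

theorem finite_gap_zet:
 assumes s: "0 < s" "s < 1/2" shows "pot s v" "zet v = z"
proof -
 have v0: "v 0 = 0" by (simp add: v_def)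
 show pv: "pot s v" unfolding pot_def using s ell2_hplus[OF v0 v_ell2, of "- s"] by simp
 interpret n: nspectral s v "emu v" "efn v" by (rule nspectral_chosen[OF pv])
 have ep: "epair v (mu n) (F n)" for n
  using epair_iff_coord[OF pv v_ell2 F_ell2] F_coord by blast
 have F1: "nsq (F n) = 1" for n using F_on[of n n] by (simp add: ip_self)
 have mono: "strict_mono mu" by (rule strict_monoI) (use mu_strict in fastforce)
 have cpl: "EX n. ip (efn v m) (F n) ~= 0" for m
 proof (rule ccontr)
  assume "\<not> ?thesis"
  hence zz: "ip (efn v m) (F n) = 0" for n by simp
  have "efn v m k = 0" for k
  proof -
   have ipF: "ip (ev k) (F n) = a k n" for n by (simp add: ip_ev_left F_def)
   have "nsq (%n. ip (ev k) (F n)) = nsq (ev k)"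
    unfolding ipF using a_on[of k k] by (simp add: ip_self)
   hence "ip (ev k) (efn v m) = ip (%n. ip (ev k) (F n)) (%n. ip (efn v m) (F n))"
    by (intro parseval_of_bessel_eq) (auto simp: F_on)
   thus ?thesis by (simp add: zz ip_ev_left)
  qed
  thus False using n.nsqF[of m] by (simp add: nsq_def)
 qed
 have p0: "nnr (ip (ev 0) (F 0))"
  using K_pos[of 0] by (simp add: ip_ev_left F_def y_def nnr_def)
 have pS: "nnr (ip (F (Suc n)) (sh (F n)))" for n
 proof -
  \<comment> \<open>The conjugate of row \<open>Suc n\<close> of \<open>T\<close>; pairing
    \<open>a k\<close> with it is one step of the recursion for \<open>a\<close>. This identifies
    the inner product to be signed with the positive number \<open>mm n\<close>.\<close>
  define rho where "rho = (%p. cnj (T p (Suc n)))"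
  have T0: "T p (Suc n) = 0" if "p > max N n" for p
   using that T_large[of p] by (auto simp: ev_def)
  have rl: "ell2 rho" by (rule ell2_fin[of "max N n"]) (simp add: rho_def T0)
  have aS: "a (Suc k) (Suc n) = ip (a k) rho" for k
  proof -
   have "ip (a k) rho = (SUM p<=N + k. a k p*T p (Suc n))"
    by (subst ip_finite[of "N + k"]) (auto simp: a_supp rho_def)
   thus ?thesis by (simp add: SS_def)
  qed
  have "ip (ev n) rho = ip (%k. ip (ev n) (a k)) (%k. ip rho (a k))" by (rule parseval_row[OF rl])
  also have "... = ip (F n) (bs (F (Suc n)))"
  proof -
   have "ip rho (a k) = cnj (a (Suc k) (Suc n))" for k using ip_commute[of rho "a k"] aS[of k] by simp
   hence r: "(%k. ip rho (a k)) = bs (F (Suc n))" by (auto simp: bs_def F_def fun_eq_iff simp del: a.simps)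
   show ?thesis unfolding r F_ip[symmetric] ..
  qed
  also have "... = ip (sh (F n)) (F (Suc n))" by (simp add: ip_sh_bs)
  finally have "ip (sh (F n)) (F (Suc n)) = T n (Suc n)" by (simp add: ip_ev_left rho_def)
  hence "ip (F (Suc n)) (sh (F n)) = of_real (mm n)" using ip_commute[of "F (Suc n)" "sh (F n)"] by (simp add: T_def tt_diag)
  thus ?thesis using mm_pos[of n] by (simp add: nnr_def)
 qed
 have id: "mu = emu v" "F = efn v"
  using n.identify[of mu F, OF ep F1 mono cpl p0 pS] by blast+
 show "zet v = z"
 proof
  fix n show "zet v n = z n"
  proof (cases n)
   case 0 thus ?thesis by (simp add: zet_def z0)
  next
   case (Suc p)
   have yn: "ip (ev 0) (efn v n) = y n" by (simp add: id(2)[symmetric] ip_ev_left F_def)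
   have g: "emu v n - emu v (n - 1) - 1 = gm n" using Suc mu_Suc[of p] by (simp add: id(1)[symmetric])
   show ?thesis
   proof (cases "y n = 0")
    case True
    hence "gm n = 0" using y_Suc_zero[of p] Suc by simp
    thus ?thesis using True yn by (simp add: zet_def gm_def)
   next
    case False
    define t where "t = sqrt (gp.K n/(mu n - mu 0))"
    have t: "t > 0" using K_pos[of n] mu_gt0[of n] Suc by (simp add: t_def)
    have yt: "y n = of_real t*z n" using Suc by (simp add: y_def t_def)
    have zn: "z n ~= 0" using False yt by auto
    have "zet v n = y n/of_real (cmod (y n)) * of_real (sqrt (gm n))"
     using False yn g Suc by (simp add: zet_def Let_def)
    also have "... = of_real t*z n/of_real (t*cmod (z n)) * of_real (cmod (z n))"
     using t by (simp add: yt norm_mult gm_def)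
    also have "... = z n" using t zn by simp
    finally show ?thesis .
   qed
  qed
 qed
qed

end

section \<open>The map \<open>zet\<close> is a homeomorphism of weighted sequence spaces\<close>

lemma hplus_add:
 assumes "v:hplus sg" "w:hplus sg"
 shows "(%n. v n + w n):hplus sg" "sqrt (wn sg (%n. v n + w n)) <= sqrt (wn sg v) + sqrt (wn sg w)"
proof -
 have "W sg (%n. v n + w n) = (%n. W sg v n + W sg w n)" by (simp add: W_def fun_eq_iff distrib_left)
 thus "(%n. v n + w n):hplus sg" "sqrt (wn sg (%n. v n + w n)) <= sqrt (wn sg v) + sqrt (wn sg w)"
  using assms ell2_add(1)[of "W sg v" "W sg w"] sqrt_nsq_add[of "W sg v" "W sg w"] by (simp_all add: hplus_W wn_W)
qed

lemma wn_eq_0: assumes "v:hplus sg" "wn sg v = 0" shows "v = (%n. 0)"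
proof
 fix n show "v n = 0"
  using nsq_eq_0[of "W sg v" n] assms by (cases "n = 0") (auto simp: hplus_W wn_W W_def)
qed

lemma tails_of_wn_tendsto:
 assumes z: "!!j. z j:hplus sg" "z':hplus sg" and lim: "(%j::nat. wn sg (%n. z j n - z' n)) ----> 0" and e: "e > 0"
 shows "EX K. EV j. tailw sg K (z j) <= e"
proof -
 have l: "ell2 (W sg z')" using z(2) by (simp add: hplus_W)
 obtain F where F: "finite F" "nsq (%k. if k:F then 0 else W sg z' k) < e/4"
  using ell2_tail[OF l, of "e/4"] e by auto
 obtain K where K: "F \<subseteq> {..<K}" using finite_nat_bounded[OF F(1)] by blast
 have "tailw sg K z' <= nsq (%k. if k:F then 0 else W sg z' k)"
  unfolding tailw_W by (rule ell2_le(2), rule ell2_le(1)[OF l]) (use K in auto)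
 hence tK: "tailw sg K z' <= e/4" using F(2) by simp
 have "EV j. wn sg (%n. z j n - z' n) < e/4" by (rule order_tendstoD(2)[OF lim]) (use e in simp)
 hence "EV j. tailw sg K (z j) <= e"
 proof (rule eventually_mono)
  fix j assume j: "wn sg (%n. z j n - z' n) < e/4"
  have hd: "(%n. z j n - z' n):hplus sg" by (rule hplus_diff(1)[OF z])
  have m: "(%n. - z' n):hplus sg" "tailw sg K (%n. - z' n) = tailw sg K z'" using z(2) by (simp_all add: hplus_def tailw_def)
  have "tailw sg K (%n. z j n - z' n) <= wn sg (%n. z j n - z' n)" using wn_tailw[OF hd, of K] by (simp add: sum_nonneg)
  thus "tailw sg K (z j) <= e" using hplus_diff(3)[OF hd m(1), of K] m(2) j tK by simp
 qed
 thus ?thesis by blast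
qed

lemma hplus_dist_wn: "hplus_dist sg z w = sqrt (wn sg (%n. z n - w n))"
 by (simp add: hplus_dist_def hplus_norm_wn)

lemma wn_minus: "wn sg (%n. w n - v n) = wn sg (%n. v n - w n)"
 by (simp add: wn_def norm_minus_commute)

lemma hplus_metric: "Metric_space (hplus sg) (hplus_dist sg)"
proof
 fix x y z assume h: "x:hplus sg" "y:hplus sg"
 show "hplus_dist sg x y = 0 <-> x = y"
 proof
  assume "hplus_dist sg x y = 0"
  hence "wn sg (%n. x n - y n) = 0" by (simp add: hplus_dist_wn)
  hence "(%n. x n - y n) = (%n. 0)" by (rule wn_eq_0[OF hplus_diff(1)[OF h]])
  thus "x = y" by (simp add: fun_eq_iff)
 qed (simp add: hplus_dist_wn wn_def)
 assume z: "z:hplus sg"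
 show "hplus_dist sg x z <= hplus_dist sg x y + hplus_dist sg y z"
  using hplus_add(2)[OF hplus_diff(1)[OF h] hplus_diff(1)[OF h(2) z]] by (simp add: hplus_dist_wn)
qed (simp add: hplus_dist_wn, unfold hplus_dist_wn, rule arg_cong[where f = sqrt, OF wn_minus])

lemma wn_tendsto_coord:
 assumes "!!j. d j:hplus sg" "(%j::nat. wn sg (d j)) ----> 0"
 shows "(%j. d j n) ----> 0"
proof (cases "n = 0")
 case True thus ?thesis using hplus_0[OF assms(1)] by simp
next
 case False
 hence p: "real n powr (2 * sg) > 0" by simp
 show ?thesis
 proof (rule Lim_null_comparison)
  show "EV j. norm (d j n) <= sqrt (wn sg (d j)/real n powr (2 * sg))"
  proof (intro always_eventually allI real_le_rsqrt)
   fix j show "(norm (d j n))^2 <= wn sg (d j)/real n powr (2 * sg)"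
    using wn_coord[OF assms(1), of n j] False p by (simp add: le_divide_eq mult.commute)
  qed
  show "(%j. sqrt (wn sg (d j)/real n powr (2 * sg))) ----> 0"
   using tendsto_real_sqrt[OF tendsto_divide[OF assms(2) tendsto_const[of "real n powr (2 * sg)"]]] p by simp
 qed
qed

text \<open>\<open>K\<close> is chosen for the tail of the given sequence, then the energy 2^i so
  high that the first \<open>K\<close> entries cost little.\<close>

lemma transfer_tails:
 fixes T :: "nat => nat => real"
 assumes b: "!!j i1 F K. i1 >= i0 ==> finite F ==> F \<subseteq> {2^i1..} ==>
   S j F <= M*(T K j + tp s i1*(1 + real K))"
  and T: "!!e. e > 0 ==> EX K. EV j. T K j <= e"
  and s: "s > 0" and M: "M >= 0" and e: "e > 0"
 shows "EX K::nat. EV j. ALL F. finite F \<and> F \<subseteq> {K<..} --> S j F <= (e :: real)"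
proof -
 have M1: "e/(2*(M + 1)) > 0" using M e by simp
 obtain K where K: "EV j. T K j <= e/(2*(M + 1))" using T[OF M1] by blast
 have "(%i. tp s i*(1 + real K)) ----> 0"
  by (rule tendsto_mult_left_zero) (use s in real_asymp)
 hence "EV i. tp s i*(1 + real K) < e/(2*(M + 1))"
  using M1 by (rule order_tendstoD(2))
 then obtain i where i: "i >= i0" "tp s i*(1 + real K) < e/(2*(M + 1))"
  unfolding eventually_sequentially by (metis le_cases order_refl)
 have "EV j. ALL F. finite F \<and> F \<subseteq> {2^i<..} --> S j F <= e"
  using K
 proof (rule eventually_mono, intro allI impI)
  fix j and F :: "nat set" assume j: "T K j <= e/(2*(M + 1))" and F: "finite F \<and> F \<subseteq> {2^i<..}"
  have "S j F <= M*(T K j + tp s i*(1 + real K))" by (rule b[OF i(1)]) (use F in auto)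
  also have "... <= M*(e/(M + 1))"
  proof (intro mult_left_mono M)
   have "e/(2*(M + 1)) + e/(2*(M + 1)) = e/(M + 1)" using M by (simp add: divide_simps)
   thus "T K j + tp s i*(1 + real K) <= e/(M + 1)"
    using add_mono[OF j less_imp_le[OF i(2)]] by (simp only:)
  qed
  also have "... <= e" using M e by (simp add: mult_le_cancel_left pos_divide_le_eq distrib_left mult.commute)
  finally show "S j F <= e" .
 qed
 thus ?thesis by blast
qed

section \<open>Continuity, properness and surjectivity of \<open>zet\<close>\<close>

context
 fixes s :: real assumes s: "0 < s" "s < 1/2"
begin

lemma pot_iff: "pot s v <-> v:hplus (- s)" using s by (simp add: pot_def)

lemma zet_hplus: "v:hplus (- s) ==> zet v:hplus (1/2 - s)"
 by (rule forward_bound[OF s, of "wn (- s) v"]) (auto simp: pot_iff)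

lemma zet_bounded: "EX M. ALL v:hplus (- s). wn (- s) v <= R --> wn (1/2 - s) (zet v) <= M"
proof (cases "R >= 0")
 case True
 show ?thesis by (rule forward_bound[OF s True]) (use pot_iff in blast)
next
 case False
 hence "\<not> wn (- s) v <= R" for v using wn_nonneg[of "- s" v] by linarith
 thus ?thesis by blast
qed

lemma zet_proper: "EX M. ALL v:hplus (- s). wn (1/2 - s) (zet v) <= R --> wn (- s) v <= M"
proof (cases "R >= 0")
 case True
 show ?thesis by (rule backward_bound[OF s True]) (use pot_iff zet_hplus in blast)
next
 case False
 hence "\<not> wn (1/2 - s) (zet v) <= R" for v using wn_nonneg[of "1/2 - s" "zet v"] by linarith
 thus ?thesis by blast
qed

lemma zet_continuous:
 assumes v: "!!j. v j:hplus (- s)" "v':hplus (- s)" and lim: "(%j::nat. wn (- s) (%n. v j n - v' n)) ----> 0"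
 shows "(%j. wn (1/2 - s) (%n. zet (v j) n - zet v' n)) ----> 0"
proof -
 obtain B where B: "!!j. norm (wn (- s) (%n. v j n - v' n)) <= B"
  using convergent_imp_Bseq[OF convergentI[OF lim]] by (auto simp: Bseq_def)
 define R where "R = 2*B + 2*wn (- s) v'"
 have R: "wn (- s) (v j) <= R" for j
 proof -
  have "wn (- s) (%n. (v j n - v' n) - - v' n) <= 2*wn (- s) (%n. v j n - v' n) + 2*wn (- s) (%n. - v' n)"
   by (intro hplus_diff(2) hplus_diff(1)[OF v]) (use v(2) in "simp add: hplus_def")
  moreover have "wn (- s) (%n. - v' n) = wn (- s) v'" by (simp add: wn_def)
  moreover have "wn (- s) (%n. v j n - v' n) <= B" using B[of j] by simp
  ultimately show ?thesis by (simp add: R_def)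
 qed
 have R0: "R >= 0" using R[of 0] wn_nonneg[of "- s" "v 0"] by linarith
 have pt: "(%j. v j n) ----> v' n" for n
  using wn_tendsto_coord[of "%j n. v j n - v' n" "- s" n] hplus_diff(1)[OF v] lim by (simp add: LIM_zero_iff)
 have pv: "pot s (v j)" "pot s v'" for j using v by (auto simp: pot_iff)
 obtain i0 M where FW: "M >= 0"
  "!!v. pot s v ==> wn (- s) v <= R ==> zet v:hplus (1/2 - s)"
  "!!v. pot s v ==> wn (- s) v <= R ==> wn (1/2 - s) (zet v) <= M"
  "!!v i1 F K. pot s v ==> wn (- s) v <= R ==> i1 >= i0 ==> finite F ==> F \<subseteq> {2^i1..} ==>
   (SUM n:F. hw (1/2 - s) (zet v) n)
    <= M*(tailw (- s) K v + tp s i1*(1 + real K))"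
  by (rule forward_bound[OF s R0]; rule that; assumption)
 note M = FW(1) and t = FW(4)
 show ?thesis
 proof (rule wn_tendsto_of_tails)
  show "zet (v j):hplus (1/2 - s)" "zet v':hplus (1/2 - s)" for j using v by (auto intro: zet_hplus)
  show "(%j. zet (v j) n) ----> zet v' n" for n by (rule zet_weak[of s v R v' n, OF pv(1) R pv(2) pt])
  fix e :: real assume e: "e > 0"
  show "EX K. EV j. ALL F. finite F \<and> F \<subseteq> {K<..} -->
    (SUM n:F. hw (1/2 - s) (zet (v j)) n) <= e"
   by (rule transfer_tails[where T = "%K j. tailw (- s) K (v j)", OF t[OF pv(1) R] tails_of_wn_tendsto[OF v lim] s(1) M e])
 qed
qed

text \<open>The preimages are bounded, so a subsequence converges in each coordinate; weak
  continuity identifies the image of the limit, and the backward tail bounds turn the convergence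
  into norm convergence. Closedness of the range and continuity of the inverse both follow.\<close>

lemma zet_precompact:
 assumes v: "!!j. v j:hplus (- s)" and z: "z:hplus (1/2 - s)"
  and lim: "(%j::nat. wn (1/2 - s) (%n. zet (v j) n - z n)) ----> 0"
 shows "EX r v'. strict_mono (r :: nat => nat) \<and> v':hplus (- s) \<and> zet v' = z \<and> (%j. wn (- s) (%n. v (r j) n - v' n)) ----> 0"
proof -
 have hz: "zet (v j):hplus (1/2 - s)" for j by (rule zet_hplus[OF v])
 obtain B where B: "!!j. norm (wn (1/2 - s) (%n. zet (v j) n - z n)) <= B"
  using convergent_imp_Bseq[OF convergentI[OF lim]] by (auto simp: Bseq_def)
 define R where "R = 2*B + 2*wn (1/2 - s) z"
 have R: "wn (1/2 - s) (zet (v j)) <= R" for j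
 proof -
  have "wn (1/2 - s) (%n. (zet (v j) n - z n) - - z n) <= 2*wn (1/2 - s) (%n. zet (v j) n - z n) + 2*wn (1/2 - s) (%n. - z n)"
   by (intro hplus_diff(2) hplus_diff(1)[OF hz z]) (use z in "simp add: hplus_def")
  moreover have "wn (1/2 - s) (%n. - z n) = wn (1/2 - s) z" by (simp add: wn_def)
  moreover have "wn (1/2 - s) (%n. zet (v j) n - z n) <= B" using B[of j] by simp
  ultimately show ?thesis by (simp add: R_def)
 qed
 have R0: "R >= 0" using R[of 0] wn_nonneg[of "1/2 - s" "zet (v 0)"] by linarith
 have pv: "pot s (v j)" for j using v by (auto simp: pot_iff)
 obtain i0 M where BW: "M >= 0"
  "!!v. pot s v ==> zet v:hplus (1/2 - s) ==> wn (1/2 - s) (zet v) <= R ==> wn (- s) v <= M"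
  "!!v i1 F K. pot s v ==> zet v:hplus (1/2 - s) ==> wn (1/2 - s) (zet v) <= R ==> i1 >= i0 ==> finite F ==> F \<subseteq> {2^i1..} ==>
   (SUM k:F. hw (- s) v k)
    <= M*(tailw (1/2 - s) K (zet v) + tp s i1*(1 + real K))"
  by (rule backward_bound[OF s R0]; rule that; assumption)
 note M = BW(1) and w = BW(2) and t = BW(3)
 have wv: "wn (- s) (v j) <= M" for j by (rule w[OF pv hz R])
 have "cmod (v j k) <= sqrt (M/real k powr (2*- s))" for j k
 proof (cases "k = 0")
  case True thus ?thesis using hplus_0[OF v] M by simp
 next
  case False
  hence p: "real k powr (2*- s) > 0" by simp
  have "hw (- s) (v j) k <= M" using wn_coord[OF v, of k j] wv[of j] by simp
  thus ?thesis using p by (intro real_le_rsqrt) (simp add: le_divide_eq mult.commute)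
 qed
 then obtain r v' where r: "strict_mono (r :: nat => nat)" and pt: "!!k. (%j. v (r j) k) ----> v' k"
  using pointwise_subsequence[of v "%k. sqrt (M/real k powr (2*- s))"] by blast
 have v': "v':hplus (- s)" by (rule hplus_fatou(1)[of "%j. v (r j)" "- s" M v', OF v wv pt])
 have "(%j. zet (v (r j)) n) ----> zet v' n" for n
  by (rule zet_weak[of s "%j. v (r j)" M v' n, OF pv wv _ pt]) (use v' pot_iff in blast)
 moreover have "(%j. zet (v (r j)) n) ----> z n" for n
 proof -
  have "(%j. zet (v j) n - z n) ----> 0"
   using wn_tendsto_coord[of "%j n. zet (v j) n - z n" "1/2 - s" n] hplus_diff(1)[OF hz z] lim by simp
  hence "(%j. zet (v j) n) ----> z n" by (simp add: LIM_zero_iff)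
  from LIMSEQ_subseq_LIMSEQ[OF this r] show ?thesis by (simp add: o_def)
 qed
 ultimately have zv: "zet v' = z" using LIMSEQ_unique by blast
 have lim': "(%j. wn (1/2 - s) (%n. zet (v (r j)) n - z n)) ----> 0"
  using LIMSEQ_subseq_LIMSEQ[OF lim r] by (simp add: o_def)
 have "(%j. wn (- s) (%n. v (r j) n - v' n)) ----> 0"
 proof (rule wn_tendsto_of_tails[OF v v' pt])
  fix e :: real assume e: "e > 0"
  have T: "EX K. EV j. tailw (1/2 - s) K (zet (v (r j))) <= e" if "e > 0" for e
   by (rule tails_of_wn_tendsto[of "%j. zet (v (r j))", OF hz z lim' that])
  show "EX K. EV j. ALL F. finite F \<and> F \<subseteq> {K<..} -->
    (SUM n:F. hw (- s) (v (r j)) n) <= e"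
   by (rule transfer_tails[where T = "%K j. tailw (1/2 - s) K (zet (v (r j)))", OF t[OF pv hz R] T s(1) M e])
 qed
 thus ?thesis using r v' zv by blast
qed

lemma zet_inj_on: "inj_on zet (hplus (- s))"
 by (rule inj_onI) (use zet_inj[of s] pot_iff in blast)

text \<open>Truncations of \<open>z\<close> are attained by finite gap potentials and converge to
  \<open>z\<close>.\<close>

lemma zet_surj: assumes z: "z:hplus (1/2 - s)" shows "EX v:hplus (- s). zet v = z"
proof -
 define zN where "zN N n = (if n <= N then z n else 0)" for N n
 have "finite_gap N (zN N)" for N by unfold_locales (use hplus_0[OF z] in "auto simp: zN_def")
 hence "EX v. v:hplus (- s) \<and> zet v = zN N" for N
  using finite_gap.finite_gap_zet[of N "zN N", OF _ s] pot_iff by blast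
 then obtain v where v: "!!N. v N:hplus (- s)" "!!N. zet (v N) = zN N" by metis
 have "(%N. wn (1/2 - s) (%n. zN N n - z n)) ----> 0"
 proof -
  have "wn (1/2 - s) (%n. zN N n - z n) = tailw (1/2 - s) N z" for N
   unfolding wn_def tailw_def by (rule infsum_cong_neutral) (auto simp: zN_def)
  moreover have "(%N. tailw (1/2 - s) N z) ----> 0"
  proof (rule LIMSEQ_I)
   fix e :: real assume e: "e > 0"
   have "EX K. \<forall>\<^sub>F j::nat in sequentially. tailw (1/2 - s) K z <= e/2"
    by (rule tails_of_wn_tendsto[of "%j. z" _ z]) (use z e in "auto simp: wn_def")
   then obtain K where K: "tailw (1/2 - s) K z <= e/2" by auto
   have "norm (tailw (1/2 - s) N z - 0) < e" if "N >= K" for N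
   proof -
    have "tailw (1/2 - s) N z <= tailw (1/2 - s) K z"
     unfolding tailw_W by (rule ell2_le(2), rule ell2_le(1)[of "W (1/2 - s) z"]) (use that z in "auto simp: hplus_W")
    thus ?thesis using K e tailw_nonneg[of "1/2 - s" N z] by simp
   qed
   thus "EX K. ALL N>=K. norm (tailw (1/2 - s) N z - 0) < e" by blast
  qed
  ultimately show ?thesis by simp
 qed
 thus ?thesis using zet_precompact[of v z, OF v(1) z] v(2) by auto
qed

text \<open>Every subsequence has a convergent further subsequence by precompactness, and
  injectivity fixes its limit.\<close>

lemma zet_inverse_continuous:
 assumes v: "!!j. v j:hplus (- s)" "v':hplus (- s)" and lim: "(%j::nat. wn (1/2 - s) (%n. zet (v j) n - zet v' n)) ----> 0"
 shows "(%j. wn (- s) (%n. v j n - v' n)) ----> 0"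
proof (rule subseq_principle)
 fix r :: "nat => nat" assume r: "strict_mono r"
 have "(%j. wn (1/2 - s) (%n. zet (v (r j)) n - zet v' n)) ----> 0"
  using LIMSEQ_subseq_LIMSEQ[OF lim r] by (simp add: o_def)
 from zet_precompact[of "%j. v (r j)", OF v(1) zet_hplus[OF v(2)] this]
 obtain r' v'' where r': "strict_mono (r' :: nat => nat)" "v'':hplus (- s)" "zet v'' = zet v'"
  "(%j. wn (- s) (%n. v (r (r' j)) n - v'' n)) ----> 0" by blast
 moreover have "v'' = v'" using zet_inj_on r'(2,3) v(2) by (auto dest: inj_onD)
 ultimately show "EX r'. strict_mono r' \<and> (%j. wn (- s) (%n. v (r (r' j)) n - v' n)) ----> 0" by blast
qed

end

section \<open>Square integrable functions on the torus\<close>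

definition tch :: "int => real => complex" where
 "tch n x = exp (\<i> * of_int n * of_real x)"

lemma tch_cis: "tch n x = cis (of_int n*x)" by (simp add: tch_def cis_conv_exp mult_ac)

lemma tch_0 [simp]: "tch 0 x = 1" by (simp add: tch_def)
lemma tch_add: "tch (m + n) x = tch m x*tch n x" by (simp add: tch_cis cis_mult distrib_right)
lemma cnj_tch: "cnj (tch n x) = tch (- n) x" by (simp add: tch_cis cis_cnj)
lemma norm_tch [simp]: "cmod (tch n x) = 1" by (simp add: tch_cis)
lemma tch_periodic: "tch n (x + 2*pi) = tch n x"
proof -
 have "tch n (x + 2*pi) = cis (of_int n*x)*cis (2*pi * of_int n)"
  by (simp add: tch_cis cis_mult algebra_simps)
 thus ?thesis by (simp add: tch_cis cis_multiple_2pi)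
qed
lemma tch_deriv: "(tch n has_vector_derivative \<i> * of_int n*tch n x) (at x within S)"
proof -
 have "((%z. exp (\<i> * of_int n*z)) has_field_derivative \<i> * of_int n*tch n x) (at (of_real x))"
  by (auto intro!: derivative_eq_intros simp: tch_def)
 thus ?thesis unfolding tch_def[abs_def] by (rule has_vector_derivative_real_field)
qed
lemma continuous_tch: "continuous_on S (tch n)"
 unfolding tch_def[abs_def] by (intro continuous_intros)

lemma torus_finite: "finite_measure torus"
 unfolding torus_def by (rule finite_measure_lebesgue_on) simp

lemma space_torus: "space torus = {0..2*pi}" by (simp add: torus_def)

lemma measure_torus: "measure torus (space torus) = 2*pi"
 by (simp add: torus_def measure_restrict_space)

lemma measurable_torus: "continuous_on {0..2*pi} f ==> f:borel_measurable torus"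
 unfolding torus_def by (rule continuous_imp_measurable_on_sets_lebesgue) auto

lemma integrable_torus_bounded:
 fixes f :: "real => 'a::{banach, second_countable_topology}"
 assumes "f:borel_measurable torus" "!!x. x:{0..2*pi} ==> norm (f x) <= C" shows "integrable torus f"
 by (rule finite_measure.integrable_const_bound[OF torus_finite, of f C]) (use assms in "auto simp: space_torus")

lemma integral_torus_eq:
 fixes f :: "real => complex"
 assumes "integrable torus f" shows "(LINT x|torus. f x) = integral {0..2*pi} f"
 using assms unfolding torus_def by (intro lebesgue_integral_eq_integral) auto

lemma tch_measurable [measurable]: "tch n:borel_measurable torus" by (rule measurable_torus) (rule continuous_tch)

lemma integral_tch: "(LINT x|torus. tch n x) = (if n = 0 then 2 * of_real pi else 0)"
proof -
 have i: "integrable torus (tch n)" by (rule integrable_torus_bounded[of _ 1]) auto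
 show ?thesis
 proof (cases "n = 0")
  case True
  have "integral {0..2*pi} (tch 0) = integral {0..2*pi} (%x. 1 :: complex)" by (rule integral_cong) simp
  thus ?thesis using True integral_torus_eq[OF i] by (simp add: scaleR_conv_of_real)
 next
  case False
  have "(tch n has_integral tch n (2*pi)/(\<i> * of_int n) - tch n 0/(\<i> * of_int n)) {0..2*pi}"
  proof (rule fundamental_theorem_of_calculus)
   show "((%x. tch n x/(\<i> * of_int n)) has_vector_derivative tch n x) (at x within {0..2*pi})" for x
    using has_vector_derivative_divide[OF tch_deriv[of n x "{0..2*pi}"], of "\<i> * of_int n"] False by simp
  qed simp
  moreover have "tch n (2*pi) = tch n 0" using tch_periodic[of n 0] by simp
  ultimately show ?thesis using False integral_torus_eq[OF i] by (simp add: integral_unique)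
 qed
qed

lemma L2_measurable: "f:L2 ==> f:borel_measurable torus" by (simp add: L2_def)
lemma L2_square: "f:L2 ==> integrable torus (%x. sqn (f x))" by (simp add: L2_def)

lemma L2_product:
 assumes f: "f:L2" and g: "g:L2" shows "integrable torus (%x. f x*g x)"
proof (rule Bochner_Integration.integrable_bound)
 show "integrable torus (%x. sqn (f x) + sqn (g x))"
  by (intro Bochner_Integration.integrable_add L2_square f g)
 show "(%x. f x*g x):borel_measurable torus"
  by (intro borel_measurable_times L2_measurable f g)
 have "cmod (f x)*cmod (g x) <= sqn (f x) + sqn (g x)" for x
 proof -
  have "2*(cmod (f x)*cmod (g x)) <= sqn (f x) + sqn (g x)"
   using sum_squares_bound[of "cmod (f x)" "cmod (g x)"] by (simp add: mult.assoc)
  moreover have "0 <= cmod (f x)*cmod (g x)" by simp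
  ultimately show ?thesis by linarith
 qed
 thus "AE x in torus. norm (f x*g x) <= norm (sqn (f x) + sqn (g x))" by (simp add: norm_mult)
qed

lemma L2_bounded: assumes "f:borel_measurable torus" "!!x. x:{0..2*pi} ==> cmod (f x) <= C" shows "f:L2"
 unfolding L2_def
proof (safe)
 show "integrable torus (%x. sqn (f x))"
 proof (rule integrable_torus_bounded[of _ "C^2"])
  show "(%x. sqn (f x)):borel_measurable torus" using assms(1) by measurable
  show "norm (sqn (f x)) <= C^2" if "x:{0..2*pi}" for x using assms(2)[OF that] by (simp add: power_mono)
 qed
qed (rule assms)

lemma L2_tch [simp]: "tch n:L2" by (rule L2_bounded[of _ 1]) auto
lemma L2_const [simp]: "(%x. c):L2" by (rule L2_bounded[of _ "cmod c"]) auto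

lemma L2_cnj: "f:L2 ==> (%x. cnj (f x)):L2"
 by (auto simp: L2_def intro!: borel_measurable_continuous_on[of cnj] continuous_intros)

lemma L2_integrable: "f:L2 ==> integrable torus f" using L2_product[of f "%x. 1"] by simp

lemma L2_add: assumes f: "f:L2" and g: "g:L2" shows "(%x. f x + g x):L2"
 unfolding L2_def
proof (safe)
 show m: "(%x. f x + g x):borel_measurable torus" by (intro borel_measurable_add L2_measurable f g)
 show "integrable torus (%x. sqn (f x + g x))"
 proof (rule Bochner_Integration.integrable_bound)
  show "integrable torus (%x. 2 * sqn (f x) + 2 * sqn (g x))"
   by (intro Bochner_Integration.integrable_add integrable_mult_right L2_square f g)
  show "(%x. sqn (f x + g x)):borel_measurable torus" using m by measurable
  show "AE x in torus. norm (sqn (f x + g x)) <= norm (2 * sqn (f x) + 2 * sqn (g x))"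
   using cmod_add_sq_le by simp
 qed
qed

lemma L2_mult_bounded:
 assumes f: "f:L2" and g: "g:borel_measurable torus" and b: "AE x in torus. cmod (g x) <= C"
 shows "(%x. f x*g x):L2"
 unfolding L2_def
proof (safe)
 show m: "(%x. f x*g x):borel_measurable torus" by (intro borel_measurable_times L2_measurable f g)
 show "integrable torus (%x. sqn (f x*g x))"
 proof (rule Bochner_Integration.integrable_bound)
  show "integrable torus (%x. C^2 * sqn (f x))" by (intro integrable_mult_right L2_square f)
  show "(%x. sqn (f x*g x)):borel_measurable torus" using m by measurable
  show "AE x in torus. norm (sqn (f x*g x)) <= norm (C^2 * sqn (f x))"
   using b
  proof (eventually_elim)
   case (elim x)
   hence "sqn (g x) <= C^2" by (intro power_mono) auto
   hence "sqn (f x) * sqn (g x) <= sqn (f x)*C^2" by (rule mult_left_mono) simp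
   thus ?case by (simp add: norm_mult power_mult_distrib mult.commute)
  qed
 qed
qed

lemma L2_mult_tch: "f:L2 ==> (%x. tch n x*f x):L2"
 using L2_mult_bounded[of f "tch n" 1] by (simp add: mult.commute)
lemma L2_scale: "f:L2 ==> (%x. c*f x):L2"
 using L2_mult_bounded[of f "%x. c" "cmod c"] by (simp add: mult.commute)
lemma L2_diff: "f:L2 ==> g:L2 ==> (%x. f x - g x):L2"
 using L2_add[OF _ L2_scale[of g "- 1"]] by simp
lemma L2_sum: "(!!i. i:I ==> f i:L2) ==> (%x. SUM i:I. f i x):L2"
 by (induction I rule: infinite_finite_induct) (auto intro!: L2_add)

lemma inner2_add_left: "f:L2 ==> g:L2 ==> h:L2 ==> inner2 (%x. f x + g x) h = inner2 f h + inner2 g h"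
 unfolding inner2_def by (simp add: distrib_right add_divide_distrib L2_product L2_cnj)
lemma inner2_scale_left: "inner2 (%x. c*f x) h = c*inner2 f h"
 unfolding inner2_def by (simp add: mult.assoc)
lemma inner2_diff_left: "f:L2 ==> g:L2 ==> h:L2 ==> inner2 (%x. f x - g x) h = inner2 f h - inner2 g h"
 unfolding inner2_def by (simp add: left_diff_distrib diff_divide_distrib L2_product L2_cnj)
lemma inner2_commute: "inner2 g f = cnj (inner2 f g)"
proof -
 have "(LINT x|torus. cnj (f x*cnj (g x))) = cnj (LINT x|torus. f x*cnj (g x))" by (rule Bochner_Integration.integral_cnj)
 thus ?thesis by (simp add: inner2_def mult.commute)
qed
lemma inner2_sum_left: "(!!i. i:I ==> f i:L2) ==> h:L2 ==> inner2 (%x. SUM i:I. f i x) h = (SUM i:I. inner2 (f i) h)"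
proof (induction I rule: infinite_finite_induct)
 case (insert i I)
 thus ?case by (simp add: inner2_add_left L2_sum)
qed (simp_all add: inner2_def)
lemma inner2_cong_AE: assumes "AE x in torus. f x = g x" "f:L2" "g:L2" "h:L2" shows "inner2 f h = inner2 g h"
 unfolding inner2_def
proof (rule arg_cong[where f = "%z. z/(2 * of_real pi)"], rule integral_cong_AE)
 show "(%x. f x*cnj (h x)):borel_measurable torus" "(%x. g x*cnj (h x)):borel_measurable torus"
  using L2_product[OF assms(2) L2_cnj[OF assms(4)]] L2_product[OF assms(3) L2_cnj[OF assms(4)]] by auto
 show "AE x in torus. f x*cnj (h x) = g x*cnj (h x)" using assms(1) by eventually_elim simp
qed

definition n2 :: "(real => complex) => real" where "n2 f = (LINT x|torus. sqn (f x))/(2*pi)"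

lemma inner2_self: "inner2 f f = of_real (n2 f)"
 unfolding inner2_def n2_def by (simp add: complex_norm_square[symmetric] del: of_real_power)
lemma n2_nonneg [simp]: "n2 f >= 0" unfolding n2_def by simp

lemma n2_eq_0: assumes "f:L2" "n2 f = 0" shows "AE x in torus. f x = 0"
proof -
 have "(LINT x|torus. sqn (f x)) = 0" using assms(2) by (simp add: n2_def)
 hence "AE x in torus. sqn (f x) = 0" using integral_nonneg_eq_0_iff_AE[OF L2_square[OF assms(1)]] by simp
 thus ?thesis by simp
qed

lemma inner2_young:
 assumes f: "f:L2" and g: "g:L2" and t: "t > 0"
 shows "2*(LINT x|torus. cmod (f x)*cmod (g x))/(2*pi) <= t*n2 f + n2 g/t"
proof -
 have i: "integrable torus (%x. cmod (f x)*cmod (g x))" using integrable_norm[OF L2_product[OF f g]] by (simp add: norm_mult)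
 have "(LINT x|torus. 2*(cmod (f x)*cmod (g x))) <= (LINT x|torus. t * sqn (f x) + sqn (g x)/t)"
 proof (rule integral_mono)
  show "integrable torus (%x. t * sqn (f x) + sqn (g x)/t)" using f g by (auto intro!: L2_square)
  fix x
  have "0 <= (t*cmod (f x) - cmod (g x))^2/t" using t by simp
  also have "... = t * sqn (f x) + sqn (g x)/t - 2*(cmod (f x)*cmod (g x))"
   using t by (simp add: power2_eq_square field_simps)
  finally show "2*(cmod (f x)*cmod (g x)) <= t * sqn (f x) + sqn (g x)/t" by simp
 qed (use i in simp)
 also have "... = t*(LINT x|torus. sqn (f x)) + (LINT x|torus. sqn (g x))/t" using L2_square[OF f] L2_square[OF g] by simp
 finally have "(2*(LINT x|torus. cmod (f x)*cmod (g x)))/(2*pi) <= (t*(LINT x|torus. sqn (f x)) + (LINT x|torus. sqn (g x))/t)/(2*pi)"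
  by (intro divide_right_mono) auto
 thus ?thesis by (simp add: n2_def add_divide_distrib mult.commute)
qed

lemma L1_bound:
 assumes f: "f:L2" and g: "g:L2"
 shows "(LINT x|torus. cmod (f x)*cmod (g x))/(2*pi) <= sqrt (n2 f) * sqrt (n2 g)"
proof (cases "n2 f = 0 \<or> n2 g = 0")
 case True
 hence "AE x in torus. cmod (f x)*cmod (g x) = 0" using n2_eq_0[OF f] n2_eq_0[OF g] by auto
 thus ?thesis by (simp add: integral_eq_zero_AE)
next
 case False
 define p where "p = sqrt (n2 f)" define q where "q = sqrt (n2 g)"
 have pq: "p > 0" "q > 0" "n2 f = p*p" "n2 g = q*q" using False by (auto simp: p_def q_def less_le)
 \<comment> \<open>The value q/p of the parameter optimises Young's inequality.\<close>
 show ?thesis using inner2_young[OF f g, of "q/p"] pq(1,2) unfolding p_def[symmetric] q_def[symmetric] pq(3,4) by (simp add: mult.commute)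
qed

lemma inner2_le: assumes f: "f:L2" and g: "g:L2" shows "cmod (inner2 f g) <= sqrt (n2 f) * sqrt (n2 g)"
proof -
 have "cmod (inner2 f g) <= (LINT x|torus. cmod (f x)*cmod (g x))/(2*pi)"
  unfolding inner2_def using integral_norm_bound[of torus "%x. f x*cnj (g x)"]
  by (simp add: norm_divide norm_mult divide_right_mono)
 thus ?thesis using L1_bound[OF f g] by linarith
qed

definition FC :: "(real => complex) => int => complex" where "FC f n = inner2 f (tch n)"

lemma FC_eq: "FC f n = (LINT x|torus. f x*tch (- n) x)/(2 * of_real pi)"
 by (simp add: FC_def inner2_def cnj_tch)

lemma FC_tch: "FC (tch m) n = (if m = n then 1 else 0)"
 by (simp add: FC_eq tch_add[symmetric] integral_tch)

lemma FC_add: "f:L2 ==> g:L2 ==> FC (%x. f x + g x) n = FC f n + FC g n"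
 by (simp add: FC_def inner2_add_left)
lemma FC_diff: "f:L2 ==> g:L2 ==> FC (%x. f x - g x) n = FC f n - FC g n"
 by (simp add: FC_def inner2_diff_left)
lemma FC_scale: "FC (%x. c*f x) n = c*FC f n"
 by (simp add: FC_def inner2_scale_left)
lemma FC_mult_tch: "FC (%x. tch m x*f x) n = FC f (n - m)"
proof -
 have "(%x. tch m x*f x*tch (- n) x) = (%x. f x*tch (- (n - m)) x)"
  using tch_add[of m "- n"] by (simp add: fun_eq_iff mult_ac)
 thus ?thesis by (simp only: FC_eq)
qed
lemma FC_sum: "(!!i. i:I ==> f i:L2) ==> FC (%x. SUM i:I. f i x) n = (SUM i:I. FC (f i) n)"
 unfolding FC_def by (rule inner2_sum_left) auto

section \<open>Uniqueness of Fourier coefficients\<close>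

lemma linear_form_cis:
 "complex_of_real (cos x*a + sin x*b) = (of_real a - \<i> * of_real b)/2*cis x + (of_real a + \<i> * of_real b)/2*cis (- x)"
 by (simp add: complex_eq_iff field_simps)

text \<open>A linear form in cis x is a combination of two characters, whose multiplication shifts
  the coefficients; vanishing is preserved throughout the polynomial.\<close>

lemma null_coefficients_polynomial:
 assumes "real_polynomial_function p" "f:L2" "!!n. FC f n = 0"
 shows "(%x. of_real (p (cis x))*f x):L2 \<and> (ALL n. FC (%x. of_real (p (cis x))*f x) n = 0)"
 using assms
proof (induction p arbitrary: f rule: real_polynomial_function.induct)
 case (linear p)
 note prems = linear.prems
 interpret bounded_linear p by fact
 define \<alpha> where "\<alpha> = (of_real (p 1) - \<i> * of_real (p \<i>))/2"
 have pz: "p z = Re z*p 1 + Im z*p \<i>" for z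
 proof -
  have "p z = p (Re z *\<^sub>R 1 + Im z *\<^sub>R \<i>)" by (rule arg_cong[of _ _ p]) (simp add: complex_eq_iff)
  thus ?thesis by (simp add: add scale)
 qed
 have "of_real (p (cis x)) = \<alpha>*tch 1 x + cnj \<alpha>*tch (- 1) x" for x
 proof -
  have t: "tch 1 x = cis x" "tch (- 1) x = cis (- x)" "cnj \<alpha> = (of_real (p 1) + \<i> * of_real (p \<i>))/2"
   by (auto simp: tch_cis \<alpha>_def)
  have "p (cis x) = cos x*p 1 + sin x*p \<i>" by (subst pz) simp
  thus ?thesis unfolding t by (simp only: linear_form_cis \<alpha>_def)
 qed
 hence e: "(%x. of_real (p (cis x))*f x) = (%x. \<alpha>*(tch 1 x*f x) + cnj \<alpha>*(tch (- 1) x*f x))"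
  by (auto simp: algebra_simps)
 show ?case unfolding e using prems by (auto simp: FC_add FC_scale FC_mult_tch L2_mult_tch L2_scale intro!: L2_add)
next
 case (const c)
 thus ?case by (simp add: L2_scale FC_scale)
next
 case (add p q)
 thus ?case by (simp add: distrib_right L2_add FC_add)
next
 case (mult p q)
 have i: "(%x. of_real (q (cis x))*f x):L2" "!!n. FC (%x. of_real (q (cis x))*f x) n = 0"
  using mult.IH(2)[OF mult.prems] by auto
 have "(%x. of_real (p (cis x)*q (cis x))*f x) = (%x. of_real (p (cis x))*(of_real (q (cis x))*f x))"
  by (simp add: mult.assoc)
 thus ?case using mult.IH(1)[OF i] by (simp only: simp_thms)
qed

text \<open>Stone-Weierstrass on the circle, with an error measured by the integral of |f|.\<close>

lemma null_coefficients_continuous: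
 assumes f: "f:L2" "!!n. FC f n = 0" and g: "continuous_on (sphere 0 1) (g :: complex => real)"
 shows "(LINT x|torus. of_real (g (cis x))*f x) = 0"
proof -
 define C where "C = (LINT x|torus. cmod (f x))"
 have C0: "C >= 0" by (simp add: C_def)
 have gm: "(%x. complex_of_real (g (cis x))):borel_measurable torus"
  by (rule measurable_torus) (intro continuous_intros continuous_on_compose2[OF g], auto)
 obtain B where B: "!!z. z:sphere 0 1 ==> norm (g z) <= B"
  using compact_imp_bounded[OF compact_continuous_image[OF g]] unfolding bounded_iff by (metis compact_sphere imageI)
 have gi: "integrable torus (%x. of_real (g (cis x))*f x)"
  using L2_integrable[OF L2_mult_bounded[OF f(1) gm, of B]] B by (simp add: mult.commute)
 have "cmod (LINT x|torus. of_real (g (cis x))*f x) <= 0 + e" if e: "e > 0" for e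
 proof -
  define d where "d = e/(C + 1)"
  have d: "d > 0" using e C0 by (simp add: d_def)
  obtain p where p: "polynomial_function p" "!!z. z:sphere 0 1 ==> norm (g z - p z) < d"
   using Stone_Weierstrass_polynomial_function[OF _ g d] by auto
  have rp: "real_polynomial_function p" using p(1) by (simp add: real_polynomial_function_eq)
  from null_coefficients_polynomial[OF rp f] have q: "(%x. of_real (p (cis x))*f x):L2" "FC (%x. of_real (p (cis x))*f x) 0 = 0" by auto
  have q0: "(LINT x|torus. of_real (p (cis x))*f x) = 0" using q(2) by (simp add: FC_eq)
  have "(LINT x|torus. of_real (g (cis x))*f x) = (LINT x|torus. of_real (g (cis x))*f x - of_real (p (cis x))*f x)"
   using gi L2_integrable[OF q(1)] q0 by simp
  also have "cmod ... <= (LINT x|torus. cmod (of_real (g (cis x))*f x - of_real (p (cis x))*f x))"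
   by (rule Bochner_Integration.integral_norm_bound)
  also have "... <= (LINT x|torus. d*cmod (f x))"
  proof (rule Bochner_Integration.integral_mono)
   fix x
   have "cmod (of_real (g (cis x))*f x - of_real (p (cis x))*f x) = \<bar>g (cis x) - p (cis x)\<bar>*cmod (f x)"
    unfolding left_diff_distrib[symmetric] norm_mult of_real_diff[symmetric] norm_of_real ..
   also have "... <= d*cmod (f x)" using p(2)[of "cis x"] by (intro mult_right_mono) auto
   finally show "cmod (of_real (g (cis x))*f x - of_real (p (cis x))*f x) <= d*cmod (f x)" .
  qed (use gi L2_integrable[OF q(1)] L2_integrable[OF f(1)] in auto)
  also have "... = d*C" using L2_integrable[OF f(1)] by (simp add: C_def)
  also have "... <= e" using e C0 by (simp add: d_def divide_le_eq mult.commute)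
  finally show ?thesis by simp
 qed
 hence "cmod (LINT x|torus. of_real (g (cis x))*f x) <= 0" by (rule field_le_epsilon)
 thus ?thesis by simp
qed

lemma cis_inj_arc: assumes "0 <= a" "b <= 2*pi" "x:{a<..<b}" shows "cis x ~: cis ` ({0..a} Un {b..2*pi})"
proof
 assume "cis x:cis ` ({0..a} Un {b..2*pi})"
 then obtain y where y: "cis x = cis y" "y:{0..a} Un {b..2*pi}" by (rule imageE)
 obtain k :: int where k: "x = y + 2*pi * of_int k" using y(1) sin_cos_eq_iff[of x y] by (auto simp: complex_eq_iff)
 have d: "\<bar>x - y\<bar> < 2*pi" "x ~= y" using y(2) assms by auto
 have "\<bar>of_int k\<bar> < (1::real)"
 proof -
  have "2*pi*\<bar>of_int k\<bar> < 2*pi*1" using d(1) by (simp add: k abs_mult)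
  thus ?thesis by (subst (asm) mult_less_cancel_left_pos) auto
 qed
 hence "k = 0" by linarith
 thus False using k d by simp
qed

lemma indicator_torus: "(%x. complex_of_real (indicator {a<..<b} x)):borel_measurable torus"
proof -
 have "{a<..<b} Int space torus:sets torus" unfolding torus_def space_lebesgue_on sets_restrict_space by (rule image_eqI[of _ _ "{a<..<b}"]) auto
 hence "(indicator {a<..<b} :: real => real):borel_measurable torus" by (simp only: borel_measurable_indicator_iff)
 thus ?thesis by measurable
qed

lemma null_coefficients_interval:
 assumes f: "f:L2" "!!n. FC f n = 0" and ab: "0 <= a" "b <= 2*pi"
 shows "(LINT x|torus. of_real (indicator {a<..<b} x)*f x) = 0"
proof -
 define C where "C = cis ` ({0..a} Un {b..2*pi})"
 \<comment> \<open>Continuous functions on the circle that increase to the indicator of the open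
   arc; \<open>C\<close> is the complementary arc.\<close>
 define G where "G k z = min 1 (real k*infdist z C)" for k :: nat and z :: complex
 have cC: "closed C" unfolding C_def by (intro compact_imp_closed compact_continuous_image continuous_intros compact_Un) auto
 have neC: "C ~= {}" using ab by (auto simp: C_def)
 have G0: "0 <= G k z" "G k z <= 1" for k z by (auto simp: G_def infdist_nonneg)
 have Gc: "continuous_on S (G k)" for k S unfolding G_def[abs_def] by (intro continuous_intros)
 have Gm: "(%x. complex_of_real (G k (cis x))):borel_measurable torus" for k
  by (rule measurable_torus) (intro continuous_intros continuous_on_compose2[OF Gc[of UNIV]], auto)
 have z: "(LINT x|torus. of_real (G k (cis x))*f x) = 0" for k
  by (rule null_coefficients_continuous[OF f Gc])
 have "(%k. LINT x|torus. of_real (G k (cis x))*f x) ----> (LINT x|torus. of_real (indicator {a<..<b} x)*f x)"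
 proof (rule Bochner_Integration.integral_dominated_convergence[where w = "%x. cmod (f x)"
    and s = "%k x. of_real (G k (cis x))*f x" and f = "%x. of_real (indicator {a<..<b} x)*f x"])
  show "integrable torus (%x. cmod (f x))" using L2_integrable[OF f(1)] by simp
  show "(%x. of_real (indicator {a<..<b} x)*f x):borel_measurable torus"
   by (intro borel_measurable_times indicator_torus L2_measurable f(1))
  show "(%x. of_real (G k (cis x))*f x):borel_measurable torus" for k
   by (intro borel_measurable_times L2_measurable f(1) Gm)
  show "AE x in torus. cmod (of_real (G k (cis x))*f x) <= cmod (f x)" for k
   using G0[of k] by (simp add: norm_mult mult_left_le_one_le)
  show "AE x in torus. (%k. of_real (G k (cis x))*f x) ----> of_real (indicator {a<..<b} x)*f x"
  proof (rule AE_I2)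
   fix x assume x: "x:space torus"
   have "(%k. G k (cis x)) ----> indicator {a<..<b} x"
   proof (cases "x:{a<..<b}")
    case True
    hence "infdist (cis x) C > 0"
     using cis_inj_arc[OF ab True] in_closed_iff_infdist_zero[OF cC neC] infdist_nonneg[of "cis x" C] by (auto simp: C_def less_le)
    then obtain k0 :: nat where k0: "1/infdist (cis x) C < real k0" using reals_Archimedean2 by blast
    have "G k (cis x) = 1" if "k >= k0" for k
    proof -
     have "1/infdist (cis x) C <= real k" using k0 that by simp
     hence "1 <= real k*infdist (cis x) C" using \<open>infdist (cis x) C > 0\<close> by (simp add: divide_le_eq)
     thus ?thesis by (simp add: G_def)
    qed
    thus ?thesis using True by (intro tendsto_eventually) (auto simp: eventually_sequentially)
   next
    case False
    hence "cis x:C" using x by (auto simp: C_def space_torus)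
    hence "G k (cis x) = 0" for k by (simp add: G_def)
    thus ?thesis using False by simp
   qed
   thus "(%k. of_real (G k (cis x))*f x) ----> of_real (indicator {a<..<b} x)*f x"
    by (intro tendsto_intros)
  qed
 qed
 thus ?thesis unfolding z by (simp add: LIMSEQ_const_iff)
qed

text \<open>All integrals over intervals vanish, so Lebesgue differentiation of the extension by
  zero \<open>h\<close> gives the claim almost everywhere.\<close>

theorem null_coefficients:
 assumes f: "f:L2" "!!n. FC f n = 0"
 shows "AE x in torus. f x = 0"
proof -
 define h where "h x = (if x:{0..2*pi} then f x else 0)" for x
 have fi: "f integrable_on {0..2*pi}"
  using L2_integrable[OF f(1)] unfolding torus_def by (rule integrable_on_lebesgue_on) simp
 hence "h integrable_on UNIV" unfolding h_def[abs_def] by (simp only: Henstock_Kurzweil_Integration.integrable_restrict_UNIV)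
 hence "h integrable_on cbox a b" for a b by (rule integrable_on_subcbox) simp
 then obtain N where N: "negligible N" "!!x e. x ~: N ==> 0 < e ==> EX d>0. ALL k. 0 < k \<and> k < d -->
    norm (integral (cbox x (x + k *\<^sub>R One)) h /\<^sub>R k^DIM(real) - h x) < e"
  using integrable_ccontinuous_explicit[of h] by metis
 have z: "integral {a..b} h = 0" if ab: "0 <= a" "b <= 2*pi" for a b
 proof -
  have "integrable torus (%x. of_real (indicator {a<..<b} x)*f x)"
  proof (rule Bochner_Integration.integrable_bound[OF L2_integrable[OF f(1)]])
   show "(%x. of_real (indicator {a<..<b} x)*f x):borel_measurable torus"
    by (intro borel_measurable_times L2_measurable f(1) indicator_torus)
   show "AE x in torus. norm (of_real (indicator {a<..<b} x)*f x) <= norm (f x)" by (simp add: norm_mult indicator_def)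
  qed
  from integral_torus_eq[OF this] have "integral {0..2*pi} (%x. of_real (indicator {a<..<b} x)*f x) = 0"
   using null_coefficients_interval[OF f ab] by simp
  also have "(%x. of_real (indicator {a<..<b} x)*f x) = (%x. if x:{a<..<b} then f x else 0)" by (auto simp: indicator_def)
  finally have "integral {0..2*pi} (%x. if x:{a<..<b} then f x else 0) = 0" .
  moreover have "integral {0..2*pi} (%x. if x:{a<..<b} then f x else 0) = integral {a<..<b} f"
  proof -
   have "{a<..<b} Int {0..2*pi} = {a<..<b}" using ab by auto
   thus ?thesis by (simp only: Henstock_Kurzweil_Integration.integral_restrict_Int)
  qed
  moreover have "integral {a<..<b} f = integral {a<..<b} h" by (rule integral_cong) (use ab in "auto simp: h_def")
  ultimately show ?thesis by (simp add: integral_open_interval_real)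
 qed
 \<comment> \<open>The right end point is left out because the difference quotients use intervals to
   the right of \<open>x\<close> inside the period.\<close>
 have nz: "f x = 0" if x: "x:{0..2*pi}" "x ~: N Un {2*pi}" for x
 proof (rule ccontr)
  assume "f x ~= 0"
  hence "norm (f x) > 0" by simp
  then obtain d where d: "d > 0" "!!k. 0 < k ==> k < d ==> norm (integral (cbox x (x + k *\<^sub>R One)) h /\<^sub>R k^DIM(real) - h x) < norm (f x)"
   using N(2)[of x "norm (f x)"] x(2) by blast
  define k where "k = min (d/2) (2*pi - x)"
  have k: "0 < k" "k < d" "x + k <= 2*pi" using d(1) x by (auto simp: k_def)
  show False using d(2)[OF k(1,2)] z[of x "x + k"] k x by (simp add: h_def)
 qed
 have "AE x in lebesgue. x ~: N Un {2*pi}"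
  by (rule AE_not_in) (use N(1) in "auto simp: negligible_iff_null_sets[symmetric]")
 hence "AE x in lebesgue. x:{0..2*pi} --> f x = 0" by eventually_elim (use nz in blast)
 thus ?thesis unfolding torus_def by (subst AE_restrict_space_iff) auto
qed

definition sym_int :: "nat => int set" where "sym_int N = {- int N..int N}"

lemma finite_sym_int [simp]: "finite (sym_int N)" by (simp add: sym_int_def)
lemma sym_int_mono: "N <= M ==> sym_int N \<subseteq> sym_int M" by (auto simp: sym_int_def)

lemma sym_int_filterlim: "filterlim sym_int (finite_subsets_at_top UNIV) sequentially"
 unfolding filterlim_finite_subsets_at_top
proof (intro allI impI)
 fix X :: "int set" assume X: "finite X \<and> X \<subseteq> UNIV"
 obtain N :: nat where N: "!!x. x:X ==> \<bar>x\<bar> <= int N"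
 proof
  fix x assume "x:X"
  hence "nat \<bar>x\<bar> <= Max (insert 0 ((%x. nat \<bar>x\<bar>) ` X))" using X by auto
  thus "\<bar>x\<bar> <= int (Max (insert 0 ((%x. nat \<bar>x\<bar>) ` X)))" by auto
 qed
 have "X \<subseteq> sym_int M" if "M >= N" for M using N that by (fastforce simp: sym_int_def)
 thus "EV y. finite (sym_int y) \<and> X \<subseteq> sym_int y \<and> sym_int y \<subseteq> UNIV"
  by (auto simp: eventually_sequentially)
qed

lemma has_sum_sym_int: "(f has_sum s) UNIV ==> (%N. SUM n:sym_int N. f n) ----> s"
 unfolding has_sum_def using filterlim_compose[OF _ sym_int_filterlim, of "sum f"] by auto

section \<open>Trigonometric sums, Riesz-Fischer and Parseval\<close>

definition trig :: "(int => complex) => int set => real => complex" where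
 "trig c I x = (SUM n:I. c n*tch n x)"

lemma L2_trig [simp]: "trig c I:L2"
 unfolding trig_def[abs_def] by (intro L2_sum L2_scale L2_tch)

lemma FC_trig: "finite I ==> FC (trig c I) n = (if n:I then c n else 0)"
proof -
 assume I: "finite I"
 have "FC (trig c I) n = (SUM i:I. c i*FC (tch i) n)" unfolding trig_def[abs_def] by (subst FC_sum) (auto intro: L2_scale simp: FC_scale)
 also have "... = (SUM i:I. if n = i then c i else 0)" by (intro sum.cong refl) (simp add: FC_tch)
 also have "... = (if n:I then c n else 0)" by (rule sum.delta'[OF I])
 finally show ?thesis .
qed

lemma inner2_trig: "g:L2 ==> inner2 (trig c I) g = (SUM n:I. c n*cnj (FC g n))"
proof -
 assume g: "g:L2"
 have "inner2 (trig c I) g = (SUM n:I. c n*inner2 (tch n) g)"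
  unfolding trig_def[abs_def] by (subst inner2_sum_left) (auto intro: L2_scale g simp: inner2_scale_left)
 thus ?thesis unfolding FC_def by (simp add: inner2_commute[of "tch _" g])
qed

lemma n2_trig: "finite I ==> n2 (trig c I) = (SUM n:I. sqn (c n))"
proof -
 assume I: "finite I"
 have "complex_of_real (n2 (trig c I)) = (SUM n:I. c n*cnj (FC (trig c I) n))"
  unfolding inner2_self[symmetric] by (rule inner2_trig) simp
 also have "... = (SUM n:I. of_real (sqn (c n)))"
  by (intro sum.cong refl) (simp add: FC_trig I complex_norm_square del: of_real_power)
 finally show ?thesis unfolding of_real_sum[symmetric] of_real_eq_iff .
qed

lemma trig_diff: "finite J ==> I \<subseteq> J ==> (%x. trig c J x - trig c I x) = trig c (J - I)"
 by (simp add: trig_def fun_eq_iff sum_diff)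

lemma n2_1: "n2 (%x. 1) = 1" by (simp add: n2_def measure_torus)

lemma n2_tch: "n2 (tch n) = 1" by (simp add: n2_def measure_torus)

lemma L1_le_n2: "f:L2 ==> (LINT x|torus. cmod (f x)) <= 2*pi * sqrt (n2 f)"
 using L1_bound[of f "%x. 1"] by (simp add: n2_1 divide_le_eq mult.commute)

lemma L2_fatou:
 assumes h: "!!i::nat. h i:L2" "!!i. n2 (h i) <= C" and lim: "AE x in torus. (%i. h i x) ----> g x"
  and g: "g:borel_measurable torus"
 shows "g:L2" "n2 g <= C"
proof -
 have C: "C >= 0" using h(2)[of 0] n2_nonneg[of "h 0"] by linarith
 have hm: "h i:borel_measurable torus" for i by (rule L2_measurable[OF h(1)])
 have "(\<integral>\<^sup>+x. ennreal (sqn (g x)) \<partial>torus) = (\<integral>\<^sup>+x. liminf (%i. ennreal (sqn (h i x))) \<partial>torus)"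
 proof (rule nn_integral_cong_AE)
  show "AE x in torus. ennreal (sqn (g x)) = liminf (%i. ennreal (sqn (h i x)))"
   using lim
  proof eventually_elim
   case (elim x)
   have "(%i. ennreal (sqn (h i x))) ----> ennreal (sqn (g x))"
    by (intro tendsto_intros elim)
   thus ?case by (intro lim_imp_Liminf[symmetric]) simp
  qed
 qed
 also have "... <= liminf (%i. \<integral>\<^sup>+x. ennreal (sqn (h i x)) \<partial>torus)"
  by (rule nn_integral_liminf) (use hm in measurable)
 also have "... <= liminf (%i::nat. ennreal (2*pi*C))"
 proof (intro Liminf_mono always_eventually allI)
  fix i
  have "(\<integral>\<^sup>+x. ennreal (sqn (h i x)) \<partial>torus) = ennreal (LINT x|torus. sqn (h i x))"
   by (intro nn_integral_eq_integral L2_square h) simp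
  also have "(LINT x|torus. sqn (h i x)) <= 2*pi*C" using h(2)[of i] by (simp add: n2_def divide_le_eq mult.commute)
  finally show "(\<integral>\<^sup>+x. ennreal (sqn (h i x)) \<partial>torus) <= ennreal (2*pi*C)"
   by (simp add: ennreal_leI)
 qed
 also have "... = ennreal (2*pi*C)" by (simp add: Liminf_const)
 finally have b: "(\<integral>\<^sup>+x. ennreal (sqn (g x)) \<partial>torus) <= ennreal (2*pi*C)" .
 have i: "integrable torus (%x. sqn (g x))"
 proof (rule integrableI_nonneg)
  show "(%x. sqn (g x)):borel_measurable torus" using g by auto
  show "(\<integral>\<^sup>+x. ennreal (sqn (g x)) \<partial>torus) < \<infinity>" using b by (simp add: le_less_trans)
 qed simp
 thus "g:L2" using g by (simp add: L2_def)
 have "ennreal (LINT x|torus. sqn (g x)) <= ennreal (2*pi*C)"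
  using b nn_integral_eq_integral[OF i] by simp
 hence "(LINT x|torus. sqn (g x)) <= 2*pi*C" using C by auto
 thus "n2 g <= C" by (simp add: n2_def divide_le_eq mult.commute)
qed

lemma ell2_int_tail:
 assumes c: "ell2 (c :: int => complex)" and e: "e > 0"
 obtains N where "!!F. finite F ==> F Int sym_int N = {} ==> (SUM n:F. sqn (c n)) <= e"
proof -
 have "((%n. sqn (c n)) has_sum nsq c) UNIV" using c by (simp add: ell2_def nsq_def)
 hence "(%N. SUM n:sym_int N. sqn (c n)) ----> nsq c" by (rule has_sum_sym_int)
 hence "EV N. (SUM n:sym_int N. sqn (c n)) > nsq c - e" by (rule order_tendstoD(1)) (use e in simp)
 then obtain N where N: "(SUM n:sym_int N. sqn (c n)) > nsq c - e" by (auto simp: eventually_sequentially)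
 show ?thesis
 proof (rule that[of N])
  fix F :: "int set" assume F: "finite F" "F Int sym_int N = {}"
  have "(SUM n:F Un sym_int N. sqn (c n)) <= nsq c" by (rule sum_le_nsq[OF c]) (use F in simp)
  thus "(SUM n:F. sqn (c n)) <= e" using F N by (simp add: sum.union_disjoint)
 qed
qed

text \<open>Partial sums are Cauchy in the quadratic mean, hence in the mean, so a subsequence
  converges almost everywhere; Fatou's lemma upgrades this limit to a limit in the quadratic
  mean.\<close>

theorem riesz_fischer:
 assumes c: "ell2 c"
 obtains f where "f:L2" "!!n. FC f n = c n" "(%N. n2 (%x. f x - trig c (sym_int N) x)) ----> 0"
proof -
 let ?S = "%N. trig c (sym_int N)"
 have d: "n2 (%x. ?S i x - ?S j x) <= e" if N: "!!F. finite F ==> F Int sym_int N = {} ==> (SUM n:F. sqn (c n)) <= e"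
  and ij: "i >= N" "j >= N" for N i j e
 proof -
  have *: "n2 (%x. ?S i x - ?S j x) <= e" if "j <= i" "j >= N" for i j
  proof -
   have "n2 (%x. ?S i x - ?S j x) = (SUM n:sym_int i - sym_int j. sqn (c n))"
    using that by (subst trig_diff) (auto simp: n2_trig sym_int_mono)
   also have "... <= e" by (rule N) (use sym_int_mono[OF that(2)] in auto)
   finally show ?thesis .
  qed
  have "n2 (%x. ?S i x - ?S j x) = n2 (%x. ?S j x - ?S i x)" by (simp add: n2_def norm_minus_commute)
  thus ?thesis using *[of j i] *[of i j] ij by force
 qed
 have dl: "(%x. ?S i x - ?S j x):L2" for i j by (intro L2_diff L2_trig)
 have "EX N. ALL i>=N. ALL j>=N. (LINT x|torus. norm (?S i x - ?S j x)) < e" if e: "e > 0" for e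
 proof -
  \<comment> \<open>Makes the bound 2 pi sqrt e' of \<open>L1_le_n2\<close> equal to e/2.\<close>
  define e' where "e' = (e/(4*pi))^2"
  have e': "e' > 0" using e by (simp add: e'_def)
  obtain N where N: "!!F. finite F ==> F Int sym_int N = {} ==> (SUM n:F. sqn (c n)) <= e'"
   using ell2_int_tail[OF c e'] by blast
  have "(LINT x|torus. norm (?S i x - ?S j x)) < e" if "i >= N" "j >= N" for i j
  proof -
   have "sqrt (n2 (%x. ?S i x - ?S j x)) <= e/(4*pi)"
    using d[OF N that] e by (intro real_le_lsqrt) (auto simp: e'_def)
   hence "2*pi * sqrt (n2 (%x. ?S i x - ?S j x)) <= 2*pi*(e/(4*pi))" by (rule mult_left_mono) simp
   also have "... < e" using e by simp
   finally show ?thesis using L1_le_n2[OF dl, of i j] by auto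
  qed
  thus ?thesis by blast
 qed
 then obtain r where r: "strict_mono r" "AE x in torus. Cauchy (%i. ?S (r i) x)"
  using cauchy_L1_AE_cauchy_subseq[of torus ?S] L2_integrable[OF L2_trig] by blast
 define f where "f x = lim (%i. ?S (r i) x)" for x
 have lim: "AE x in torus. (%i. ?S (r i) x) ----> f x"
  using r(2) by eventually_elim (simp add: f_def convergent_LIMSEQ_iff[symmetric] Cauchy_convergent)
 have fm: "f:borel_measurable torus"
  unfolding f_def[abs_def] by (rule borel_measurable_lim_metric) (rule L2_measurable[OF L2_trig])
 have b: "(%x. f x - ?S j x):L2 \<and> n2 (%x. f x - ?S j x) <= e"
  if N: "!!F. finite F ==> F Int sym_int N = {} ==> (SUM n:F. sqn (c n)) <= e" and j: "j >= N" for N j e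
 proof -
  have ri: "r (i + N) >= N" for i using seq_suble[OF r(1), of "i + N"] by simp
  have "AE x in torus. (%i. ?S (r (i + N)) x - ?S j x) ----> f x - ?S j x"
   using lim by eventually_elim (intro tendsto_diff tendsto_const LIMSEQ_ignore_initial_segment)
  from L2_fatou[of "%i x. ?S (r (i + N)) x - ?S j x" e, OF dl d[OF N ri j] this borel_measurable_diff[OF fm L2_measurable[OF L2_trig]]]
  show ?thesis by blast
 qed
 obtain N1 where N1: "!!F. finite F ==> F Int sym_int N1 = {} ==> (SUM n:F. sqn (c n)) <= 1"
  using ell2_int_tail[OF c zero_less_one] by blast
 have fL: "f:L2" using L2_add[OF conjunct1[OF b[of N1 1 N1, OF N1 order_refl]] L2_trig[of c "sym_int N1"]] by simp
 have tend: "(%N. n2 (%x. f x - ?S N x)) ----> 0"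
 proof (rule LIMSEQ_I)
  fix e :: real assume e: "e > 0"
  hence e2: "e/2 > 0" by simp
  obtain N where N: "!!F. finite F ==> F Int sym_int N = {} ==> (SUM n:F. sqn (c n)) <= e/2"
   using ell2_int_tail[OF c e2] by blast
  have "norm (n2 (%x. f x - ?S j x) - 0) < e" if "j >= N" for j using b[of N "e/2" j, OF N that] e by simp
  thus "EX N. ALL j>=N. norm (n2 (%x. f x - ?S j x) - 0) < e" by blast
 qed
 have "FC f n = c n" for n
 proof -
  have "(%N. FC (%x. f x - ?S N x) n) ----> 0"
  proof (rule Lim_null_comparison)
   show "(%N. sqrt (n2 (%x. f x - ?S N x))) ----> 0" using tendsto_real_sqrt[OF tend] by simp
   show "EV N. norm (FC (%x. f x - ?S N x) n) <= sqrt (n2 (%x. f x - ?S N x))"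
    unfolding FC_def using inner2_le[OF L2_diff[OF fL L2_trig] L2_tch[of n]] by (simp add: n2_tch)
  qed
  moreover have "EV N. FC (%x. f x - ?S N x) n = FC f n - c n"
  proof (unfold eventually_sequentially, intro exI[of _ "nat \<bar>n\<bar>"] allI impI)
   fix N assume "nat \<bar>n\<bar> <= N"
   hence "n:sym_int N" by (auto simp: sym_int_def)
   thus "FC (%x. f x - ?S N x) n = FC f n - c n" using fL by (simp add: FC_diff FC_trig)
  qed
  ultimately have "(%N::nat. FC f n - c n) ----> 0" by (rule Lim_transform_eventually)
  thus ?thesis by (simp add: LIMSEQ_const_iff)
 qed
 thus ?thesis using that fL tend by blast
qed

lemma FC_ell2: assumes f: "f:L2" shows "ell2 (FC f)"
proof (rule ell2I_bound)
 fix I :: "int set" assume I: "finite I"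
 let ?p = "trig (FC f) I"
 have dl: "(%x. f x - ?p x):L2" by (intro L2_diff f L2_trig)
 have pf: "inner2 ?p f = of_real (n2 ?p)"
  using inner2_trig[OF f, of "FC f" I] inner2_trig[OF L2_trig[of "FC f" I], of "FC f" I] by (simp add: FC_trig I inner2_self)
 have "of_real (n2 (%x. f x - ?p x)) = inner2 f (%x. f x - ?p x) - inner2 ?p (%x. f x - ?p x)"
  unfolding inner2_self[symmetric] by (rule inner2_diff_left[OF f L2_trig dl])
 also have "inner2 f (%x. f x - ?p x) = cnj (inner2 f f - inner2 ?p f)"
  by (subst inner2_commute, subst inner2_diff_left) (auto simp: f)
 also have "inner2 ?p (%x. f x - ?p x) = cnj (inner2 f ?p - inner2 ?p ?p)"
  by (subst inner2_commute, subst inner2_diff_left) (auto simp: f)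
 also have "inner2 f ?p = cnj (inner2 ?p f)" by (rule inner2_commute)
 finally have "complex_of_real (n2 (%x. f x - ?p x)) = of_real (n2 f - n2 ?p)" by (simp add: pf inner2_self)
 hence "n2 ?p <= n2 f" using n2_nonneg[of "%x. f x - ?p x"] unfolding of_real_eq_iff by auto
 thus "(SUM n:I. sqn (FC f n)) <= n2 f" by (simp add: n2_trig I)
qed

lemma FC_eq_AE: assumes "f:L2" "g:L2" "!!n. FC f n = FC g n" shows "AE x in torus. f x = g x"
proof -
 have "AE x in torus. f x - g x = 0" by (rule null_coefficients) (use assms in "auto simp: FC_diff intro: L2_diff")
 thus ?thesis by auto
qed

lemma FC_cong_AE: assumes "f:L2" "g:L2" "AE x in torus. f x = g x" shows "FC f n = FC g n"
 unfolding FC_def by (rule inner2_cong_AE) (use assms in auto)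

text \<open>By uniqueness of coefficients \<open>f\<close> agrees almost everywhere with the sum of
  its Fourier series.\<close>

theorem torus_parseval:
 assumes f: "f:L2" and g: "g:L2" shows "inner2 f g = ip (FC f) (FC g)"
proof -
 obtain h where h: "h:L2" "!!n. FC h n = FC f n" "(%N. n2 (%x. h x - trig (FC f) (sym_int N) x)) ----> 0"
  using riesz_fischer[OF FC_ell2[OF f]] by blast
 have "AE x in torus. f x = h x" by (rule FC_eq_AE) (use f h in auto)
 hence fh: "inner2 f g = inner2 h g" by (rule inner2_cong_AE) (use f h g in auto)
 have "(%N. inner2 (%x. h x - trig (FC f) (sym_int N) x) g) ----> 0"
 proof (rule Lim_null_comparison)
  show "(%N. sqrt (n2 (%x. h x - trig (FC f) (sym_int N) x)) * sqrt (n2 g)) ----> 0"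
   using tendsto_mult_left_zero[OF tendsto_real_sqrt[OF h(3), simplified]] by simp
  show "EV N. norm (inner2 (%x. h x - trig (FC f) (sym_int N) x) g) <= sqrt (n2 (%x. h x - trig (FC f) (sym_int N) x)) * sqrt (n2 g)"
   by (intro always_eventually allI inner2_le L2_diff h(1) L2_trig g)
 qed
 hence "(%N. inner2 h g - (SUM n:sym_int N. FC f n*cnj (FC g n))) ----> 0"
  by (simp add: inner2_diff_left h(1) g inner2_trig)
 hence "(%N. inner2 h g - (inner2 h g - (SUM n:sym_int N. FC f n*cnj (FC g n)))) ----> inner2 h g - 0"
  by (intro tendsto_diff tendsto_const)
 hence "(%N. SUM n:sym_int N. FC f n*cnj (FC g n)) ----> inner2 h g" by simp
 moreover have "(%N. SUM n:sym_int N. FC f n*cnj (FC g n)) ----> ip (FC f) (FC g)"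
  by (intro has_sum_sym_int ip_has_sum FC_ell2 f g)
 ultimately show ?thesis unfolding fh by (rule LIMSEQ_unique)
qed

section \<open>Test functions and distributions\<close>

text \<open>An explicit chain of derivatives certifies a test function and computes its iterated
  derivatives, so closure properties need no separate induction.\<close>

lemma test_chain:
 assumes d: "!!k x. (\<Phi> k has_vector_derivative \<Phi> (Suc k) x) (at x)" and p: "!!x. \<Phi> 0 (x + 2*pi) = \<Phi> 0 x"
 shows "\<Phi> 0:test_fun" "(vderiv ^^ k) (\<Phi> 0) = \<Phi> k"
proof -
 have v: "vderiv (\<Phi> k) = \<Phi> (Suc k)" for k
  unfolding vderiv_def using vector_derivative_at[OF d] by blast
 show e: "(vderiv ^^ k) (\<Phi> 0) = \<Phi> k" for k by (induction k) (simp_all add: v)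
 show "\<Phi> 0:test_fun" unfolding test_fun_def mem_Collect_eq e using p differentiableI_vector[OF d] by blast
qed

lemma test_deriv: "phi:test_fun ==> ((vderiv ^^ k) phi has_vector_derivative (vderiv ^^ Suc k) phi x) (at x)"
 by (auto simp: test_fun_def vderiv_def vector_derivative_works)

lemma test_deriv1: "phi:test_fun ==> (phi has_vector_derivative vderiv phi x) (at x)"
 using test_deriv[of phi 0 x] by simp

lemma test_periodic: "phi:test_fun ==> phi (x + 2*pi) = phi x" by (simp add: test_fun_def)

lemma test_vderiv: assumes t: "phi:test_fun" shows "vderiv phi:test_fun"
proof -
 have "((phi \<circ> (%x. x + 2*pi)) has_vector_derivative 1 *\<^sub>R vderiv phi (x + 2*pi)) (at x)" for x
  by (rule vector_diff_chain_at[OF _ test_deriv1[OF t]]) (auto intro!: derivative_eq_intros)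
 moreover have "phi \<circ> (%x. x + 2*pi) = phi" using test_periodic[OF t] by auto
 ultimately have "vderiv phi (x + 2*pi) = vderiv phi x" for x
  using vector_derivative_unique_at[OF _ test_deriv1[OF t], of "vderiv phi (x + 2*pi)" x] by simp
 hence "(%k. (vderiv ^^ Suc k) phi) 0:test_fun"
  by (intro test_chain(1)[of "%k. (vderiv ^^ Suc k) phi"] test_deriv[OF t]) simp
 thus ?thesis by simp
qed

lemma test_vderiv_pow: "phi:test_fun ==> (vderiv ^^ k) phi:test_fun"
 by (induction k) (auto intro: test_vderiv)

lemma test_add: assumes "phi:test_fun" "psi:test_fun"
 shows "(%x. phi x + psi x):test_fun" "(vderiv ^^ k) (%x. phi x + psi x) = (%x. (vderiv ^^ k) phi x + (vderiv ^^ k) psi x)"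
 using test_chain[of "%k x. (vderiv ^^ k) phi x + (vderiv ^^ k) psi x"] assms
 by (simp_all add: test_periodic has_vector_derivative_add test_deriv del: funpow.simps(2))

lemma test_scale: assumes "phi:test_fun"
 shows "(%x. c*phi x):test_fun" "(vderiv ^^ k) (%x. c*phi x) = (%x. c*(vderiv ^^ k) phi x)"
 using test_chain[of "%k x. c*(vderiv ^^ k) phi x"] assms
 by (simp_all add: test_periodic has_vector_derivative_mult_right test_deriv del: funpow.simps(2))

lemma test_cnj: assumes "phi:test_fun"
 shows "(%x. cnj (phi x)):test_fun" "(vderiv ^^ k) (%x. cnj (phi x)) = (%x. cnj ((vderiv ^^ k) phi x))"
 using test_chain[of "%k x. cnj ((vderiv ^^ k) phi x)"] assms
 by (simp_all add: test_periodic has_vector_derivative_cnj test_deriv del: funpow.simps(2))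

lemma test_tch: "tch n:test_fun" "(vderiv ^^ k) (tch n) = (%x. (\<i> * of_int n)^k*tch n x)"
proof -
 have d: "((%x. (\<i> * of_int n)^k*tch n x) has_vector_derivative (\<i> * of_int n)^Suc k*tch n x) (at x)" for k x
  using has_vector_derivative_mult_right[OF tch_deriv[of n x UNIV], of "(\<i> * of_int n)^k"] by (simp add: mult_ac)
 show "tch n:test_fun" "(vderiv ^^ k) (tch n) = (%x. (\<i> * of_int n)^k*tch n x)"
  using test_chain[of "%k x. (\<i> * of_int n)^k*tch n x", OF d] tch_periodic[of n] by auto
qed

lemma test_0: "(%x. 0):test_fun" "(vderiv ^^ k) (%x. 0) = (%x. 0)"
 using test_chain[of "%k x. 0"] by auto

lemma test_trig: "finite I ==> trig c I:test_fun \<and> (vderiv ^^ k) (trig c I) = trig (%n. (\<i> * of_int n)^k*c n) I"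
proof (induction I rule: finite_induct)
 case empty
 thus ?case by (simp add: trig_def[abs_def] test_0)
next
 case (insert n I)
 have e: "trig c (insert n I) = (%x. c n*tch n x + trig c I x)" for c using insert by (simp add: trig_def fun_eq_iff)
 show ?case unfolding e using insert.IH
  by (simp add: test_add test_scale test_tch mult_ac)
qed

lemma periodic_reduce:
 assumes p: "!!x. f (x + 2*pi) = f x"
 obtains y where "y:{0..2*pi}" "f x = f y"
proof
 define m where "m = \<lfloor>x/(2*pi)\<rfloor>"
 have n: "f (y + 2*pi*real k) = f y" for y k
 proof (induction k)
  case (Suc k)
  have "f (y + 2*pi*real (Suc k)) = f (y + 2*pi*real k + 2*pi)" by (simp add: algebra_simps)
  thus ?case using p Suc by simp
 qed simp
 have i: "f (y + 2*pi * of_int m) = f y" for y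
 proof (cases "m >= 0")
  case True thus ?thesis using n[of y "nat m"] by simp
 next
  case False thus ?thesis using n[of "y + 2*pi * of_int m" "nat (- m)"] by simp
 qed
 show "f x = f (x - 2*pi * of_int m)" using i[of "x - 2*pi * of_int m"] by simp
 have "of_int m <= x/(2*pi)" "x/(2*pi) <= of_int m + 1" unfolding m_def by linarith+
 thus "x - 2*pi * of_int m:{0..2*pi}" by (auto simp: field_simps)
qed

lemma test_continuous: "phi:test_fun ==> continuous_on S phi"
 by (rule continuous_on_vector_derivative) (rule has_vector_derivative_at_within[OF test_deriv1])

definition bnd :: "(real => complex) => real" where "bnd phi = (SUP x. cmod (phi x))"

lemma bnd_upper: assumes t: "phi:test_fun" shows "cmod (phi x) <= bnd phi"
proof -
 have "compact (phi ` {0..2*pi})" by (intro compact_continuous_image test_continuous t) simp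
 then obtain B where B: "ALL x:{0..2*pi}. cmod (phi x) <= B"
  using compact_imp_bounded[of "phi ` {0..2*pi}"] unfolding bounded_iff ball_simps by blast
 have "cmod (phi x) <= B" for x
  using periodic_reduce[of phi x, OF test_periodic[OF t]] B by metis
 hence "bdd_above (range (%x. cmod (phi x)))" by (intro bdd_aboveI[of _ B]) auto
 thus ?thesis unfolding bnd_def by (intro cSUP_upper) auto
qed

lemma bnd_le: "(!!x. cmod (phi x) <= B) ==> bnd phi <= B"
 unfolding bnd_def by (rule cSUP_least) auto

lemma bnd_nonneg: "phi:test_fun ==> bnd phi >= 0"
 using bnd_upper[of phi 0] norm_ge_zero[of "phi 0"] by linarith

lemma L2_continuous: assumes "continuous_on {0..2*pi} f" shows "f:L2"
proof -
 have "compact (f ` {0..2*pi})" by (intro compact_continuous_image assms) simp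
 then obtain B where "ALL x:{0..2*pi}. cmod (f x) <= B"
  using compact_imp_bounded[of "f ` {0..2*pi}"] unfolding bounded_iff ball_simps by blast
 thus ?thesis by (intro L2_bounded[OF measurable_torus[OF assms]]) blast
qed

lemma test_L2: "phi:test_fun ==> phi:L2" by (intro L2_continuous test_continuous)

lemma n2_le: assumes f: "f:L2" and b: "!!x. x:{0..2*pi} ==> cmod (f x) <= e" shows "n2 f <= e^2"
proof -
 have i: "integrable torus (%x. e^2)" by (rule finite_measure.integrable_const[OF torus_finite])
 have "(LINT x|torus. sqn (f x)) <= (LINT x|torus. e^2)"
  by (rule Bochner_Integration.integral_mono[OF L2_square[OF f] i]) (auto simp: space_torus intro!: power_mono b)
 thus ?thesis by (simp add: n2_def measure_torus divide_le_eq mult.commute)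
qed

lemma FC_le: assumes f: "f:L2" and b: "!!x. x:{0..2*pi} ==> cmod (f x) <= e" shows "cmod (FC f n) <= e"
proof -
 have e: "e >= 0" using order_trans[OF norm_ge_zero b[of 0]] by simp
 have "cmod (FC f n) <= sqrt (n2 f)" unfolding FC_def using inner2_le[OF f L2_tch[of n]] by (simp add: n2_tch)
 also have "... <= e" using n2_le[OF f b] e by (intro real_le_lsqrt) auto
 finally show ?thesis .
qed

lemma FC_vderiv: assumes t: "phi:test_fun" shows "FC (vderiv phi) n = \<i> * of_int n*FC phi n"
proof -
 have t': "vderiv phi:test_fun" by (rule test_vderiv[OF t])
 let ?f = "%x. vderiv phi x*tch (- n) x" and ?g = "%x. phi x*tch (- n) x"
 have fi: "integrable torus ?f" "integrable torus ?g"
  using t t' by (auto intro!: L2_product L2_tch intro: test_L2)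
 have "((%x. ?f x - \<i> * of_int n*?g x) has_integral phi (2*pi)*tch (- n) (2*pi) - phi 0*tch (- n) 0) {0..2*pi}"
 proof (rule fundamental_theorem_of_calculus)
  fix x
  have "((%x. phi x*tch (- n) x) has_vector_derivative phi x*(\<i> * of_int (- n)*tch (- n) x) + vderiv phi x*tch (- n) x) (at x within {0..2*pi})"
   by (intro has_vector_derivative_mult has_vector_derivative_at_within[OF test_deriv1[OF t]] tch_deriv)
  thus "((%x. phi x*tch (- n) x) has_vector_derivative ?f x - \<i> * of_int n*?g x) (at x within {0..2*pi})"
   by (simp add: algebra_simps)
 qed simp
 moreover have "phi (2*pi)*tch (- n) (2*pi) - phi 0*tch (- n) 0 = 0"
  using test_periodic[OF t, of 0] tch_periodic[of "- n" 0] by simp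
 ultimately have "integral {0..2*pi} (%x. ?f x - \<i> * of_int n*?g x) = 0" by (simp add: integral_unique)
 moreover have "integrable torus (%x. ?f x - \<i> * of_int n*?g x)" using fi by auto
 ultimately have "(LINT x|torus. ?f x - \<i> * of_int n*?g x) = 0" by (simp add: integral_torus_eq)
 hence "(LINT x|torus. ?f x) = \<i> * of_int n*(LINT x|torus. ?g x)" using fi by simp
 thus ?thesis by (simp add: FC_eq)
qed

lemma FC_vderiv_pow: "phi:test_fun ==> FC ((vderiv ^^ k) phi) n = (\<i> * of_int n)^k*FC phi n"
 by (induction k) (simp_all add: FC_vderiv test_vderiv_pow)

definition D2 :: "(real => complex) => real" where "D2 phi = bnd phi + bnd ((vderiv ^^ 2) phi)"

lemma jap_ge_1: "jap n >= 1" by (simp add: jap_def)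

lemma FC_decay: assumes t: "phi:test_fun" shows "cmod (FC phi n) <= D2 phi/(jap n)^2"
proof -
 have 0: "cmod (FC phi n) <= bnd phi" by (intro FC_le test_L2 t bnd_upper)
 have t2: "(vderiv ^^ 2) phi:test_fun" by (rule test_vderiv_pow[OF t])
 have 2: "cmod (FC ((vderiv ^^ 2) phi) n) <= bnd ((vderiv ^^ 2) phi)" by (intro FC_le test_L2 t2 bnd_upper)
 have "(jap n)^2 <= 1 + (of_int n)^2" by (simp add: jap_def max_def power2_eq_square)
 hence "(jap n)^2*cmod (FC phi n) <= (1 + (of_int n)^2)*cmod (FC phi n)" by (rule mult_right_mono) simp
 also have "... = cmod (FC phi n) + cmod (FC ((vderiv ^^ 2) phi) n)"
  unfolding FC_vderiv_pow[OF t] by (simp add: norm_mult norm_power algebra_simps power2_eq_square)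
 also have "... <= D2 phi" using 0 2 by (simp add: D2_def)
 finally have "(jap n)^2*cmod (FC phi n) <= D2 phi" .
 moreover have "(jap n)^2 > 0" using jap_ge_1[of n] by simp
 ultimately show ?thesis by (simp add: le_divide_eq mult.commute)
qed

lemma summable_int:
 fixes f :: "int => real"
 assumes "(%n. f (int n)) summable_on UNIV" "(%n. f (- int n)) summable_on UNIV"
 shows "f summable_on UNIV"
proof -
 have "f summable_on range int" "f summable_on range (%n. - int n)"
  using assms by (auto simp: summable_on_reindex inj_on_def o_def)
 hence "f summable_on (range int Un range (%n. - int n))" by (rule summable_on_union)
 moreover have "range int Un range (%n. - int n) = UNIV"
 proof -
  have "n:range int Un range (%n. - int n)" for n :: int by (cases n rule: int_cases2) auto
  thus ?thesis by auto
 qed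
 ultimately show ?thesis by simp
qed

lemma jap_summable: assumes a: "a > 1" shows "(%n. jap n powr (- a)) summable_on UNIV"
proof (rule summable_int)
 have j: "jap (int n) powr (- a) <= 2 powr a*real (Suc n) powr (- a)" "jap (- int n) = jap (int n)" for n
 proof -
  have "real (Suc n) <= 2*jap (int n)" by (simp add: jap_def)
  hence "(2*jap (int n)) powr (- a) <= real (Suc n) powr (- a)" using a by (intro powr_mono2') auto
  hence "2 powr a*((2*jap (int n)) powr (- a)) <= 2 powr a*real (Suc n) powr (- a)" by simp
  moreover have "2 powr a*((2*jap (int n)) powr (- a)) = (2 powr a*2 powr (- a))*jap (int n) powr (- a)"
   using jap_ge_1[of "int n"] by (subst powr_mult) auto
  moreover have "2 powr a*2 powr (- a) = (1::real)" by (simp only: powr_add[symmetric]) simp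
  ultimately show "jap (int n) powr (- a) <= 2 powr a*real (Suc n) powr (- a)" by simp
 qed (simp add: jap_def)
 have "(%n. 2 powr a*real (Suc n) powr (- a)) summable_on UNIV"
  by (intro summable_on_cmult_right summable_powr_shift a)
 thus "(%n. jap (int n) powr (- a)) summable_on UNIV" by (rule summable_on_le) (use j in auto)
 thus "(%n. jap (- int n) powr (- a)) summable_on UNIV" by (simp add: j(2))
qed

lemma FC_test_summable: assumes t: "phi:test_fun" shows "(%n. cmod (FC phi n)) summable_on UNIV"
proof (rule summable_on_le)
 show "(%n. D2 phi*jap n powr (- 2)) summable_on UNIV" by (intro summable_on_cmult_right jap_summable) simp
 show "cmod (FC phi n) <= D2 phi*jap n powr (- 2)" for n
  using FC_decay[OF t, of n] jap_ge_1[of n] by (simp add: powr_minus powr_numeral divide_inverse)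
qed simp

lemma continuous_AE_0:
 fixes h :: "real => complex"
 assumes c: "continuous_on {0..2*pi} h" and z: "AE x in torus. h x = 0" and x: "x:{0..2*pi}"
 shows "h x = 0"
proof -
 have i: "integrable torus (%x. cmod (h x))" by (intro integrable_norm L2_integrable L2_continuous c)
 have "(LINT x|torus. cmod (h x)) = 0" by (rule integral_eq_zero_AE) (use z in eventually_elim, simp)
 hence "((%x. cmod (h x)) has_integral 0) {0..2*pi}"
  using has_integral_integral_lebesgue_on[of "{0..2*pi}" "%x. cmod (h x)"] i by (simp add: torus_def)
 hence "((%x. cmod (h x)) has_integral 0) (cbox 0 (2*pi))" by simp
 from has_integral_0_cbox_imp_0[OF _ _ this, of x] have "cmod (h x) = 0"
  using x c pi_gt_zero by (auto intro: continuous_on_norm simp: not_le)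
 thus ?thesis by simp
qed

theorem absolutely_convergent_series:
 assumes sm: "(%n. cmod (c n)) summable_on UNIV"
 obtains g where "continuous_on UNIV g" "!!x. g (x + 2*pi) = g x" "g:L2" "!!n. FC g n = c n"
  "!!e. e > 0 ==> EX N0. ALL N>=N0. ALL x. cmod (g x - trig c (sym_int N) x) <= e"
proof -
 let ?S = "%N. trig c (sym_int N)"
 define g where "g x = (INFSUM n. c n*tch n x)" for x
 have hs: "((%n. c n*tch n x) has_sum g x) UNIV" for x
  unfolding g_def by (rule has_sum_infsum, rule abs_summable_summable) (simp add: norm_mult sm)
 have ul: "uniform_limit UNIV ?S g sequentially"
  unfolding trig_def[abs_def]
  by (rule filterlim_compose[OF Weierstrass_m_test_general'[OF _ hs sm] sym_int_filterlim]) (simp add: norm_mult)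
 have gS: "EX N0. ALL N>=N0. ALL x. cmod (g x - ?S N x) <= e" if e: "e > 0" for e
  using uniform_limitD[OF ul e] by (auto simp: eventually_sequentially dist_norm norm_minus_commute intro: less_imp_le)
 have cS: "continuous_on UNIV (?S N)" for N by (rule test_continuous) (simp add: test_trig)
 have cg: "continuous_on UNIV g" by (rule uniform_limit_theorem[OF _ ul]) (use cS in simp_all)
 have gL: "g:L2" by (rule L2_continuous) (rule continuous_on_subset[OF cg], simp)
 have FCg: "FC g n = c n" for n
 proof -
  have "cmod (FC g n - c n) <= 0 + e" if e: "e > 0" for e
  proof -
   obtain N0 where N0: "ALL N>=N0. ALL x. cmod (g x - ?S N x) <= e" using gS[OF e] by blast
   define N where "N = max N0 (nat \<bar>n\<bar>)"
   have "n:sym_int N" by (auto simp: sym_int_def N_def)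
   hence "FC (%x. g x - ?S N x) n = FC g n - c n" by (simp add: FC_diff gL FC_trig)
   moreover have "cmod (FC (%x. g x - ?S N x) n) <= e"
    by (intro FC_le L2_diff gL L2_trig) (use N0 in "auto simp: N_def")
   ultimately show ?thesis by simp
  qed
  hence "cmod (FC g n - c n) <= 0" by (rule field_le_epsilon)
  thus ?thesis by simp
 qed
 have "g (x + 2*pi) = g x" for x by (simp add: g_def tch_periodic)
 thus ?thesis using that[of g] cg gL FCg gS by blast
qed

text \<open>The absolutely convergent series has a continuous sum that agrees with
  \<open>phi\<close> almost everywhere, hence everywhere.\<close>

theorem test_uniform:
 assumes t: "phi:test_fun" and e: "e > 0"
 shows "EX N0. ALL N>=N0. ALL x. cmod (phi x - trig (FC phi) (sym_int N) x) <= e"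
proof -
 obtain g where cg: "continuous_on UNIV g" and gp: "!!x. g (x + 2*pi) = g x" and gL: "g:L2" and FCg: "!!n. FC g n = FC phi n"
  and gS: "!!e. e > 0 ==> EX N0. ALL N>=N0. ALL x. cmod (g x - trig (FC phi) (sym_int N) x) <= e"
  by (rule absolutely_convergent_series[OF FC_test_summable[OF t]]) blast
 have "AE x in torus. g x - phi x = 0"
  using FC_eq_AE[OF gL test_L2[OF t] FCg] by eventually_elim simp
 hence eq: "g x - phi x = 0" if "x:{0..2*pi}" for x
  by (rule continuous_AE_0[rotated]) (use that cg in "auto intro!: continuous_intros test_continuous[OF t] intro: continuous_on_subset")
 have "g x - phi x = 0" for x
 proof -
  have "g (x + 2*pi) - phi (x + 2*pi) = g x - phi x" for x
   by (simp add: gp test_periodic[OF t])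
  thus ?thesis using periodic_reduce[of "%x. g x - phi x" x] eq by metis
 qed
 hence "g = phi" by auto
 thus ?thesis using gS[OF e] by simp
qed

section \<open>Distributions and their Fourier series\<close>

lemma distribution_add: "u:distribution ==> phi:test_fun ==> psi:test_fun ==> u (%x. phi x + psi x) = u phi + u psi"
 by (simp add: distribution_def)
lemma distribution_scale: "u:distribution ==> phi:test_fun ==> u (%x. c*phi x) = c*u phi"
 by (simp add: distribution_def)
lemma distribution_outside: "u:distribution ==> phi ~: test_fun ==> u phi = 0"
 by (simp add: distribution_def)

lemma distribution_trig: assumes u: "u:distribution" shows "finite I ==> u (trig c I) = (SUM n:I. c n*u (tch n))"
proof (induction I rule: finite_induct)
 case empty
 show ?case using distribution_scale[OF u test_0(1), of 0] by (simp add: trig_def[abs_def])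
next
 case (insert n I)
 have e: "trig c (insert n I) = (%x. c n*tch n x + trig c I x)" using insert by (simp add: trig_def fun_eq_iff)
 show ?case unfolding e using insert test_trig[OF insert(1), of c 0]
  by (simp add: distribution_add[OF u] distribution_scale[OF u] test_scale test_tch)
qed

lemma distribution_bound: assumes "u:distribution" obtains C M where "!!phi. phi:test_fun ==> cmod (u phi) <= C*(SUM k<=M. bnd ((vderiv ^^ k) phi))"
 using assms unfolding distribution_def bnd_def by blast

text \<open>All derivatives of the partial Fourier sums converge uniformly, which is convergence in
  every seminorm that may bound \<open>u\<close>.\<close>

lemma distribution_series:
 assumes u: "u:distribution" and t: "phi:test_fun"
 shows "(%N. SUM n:sym_int N. FC phi n*u (tch n)) ----> u phi"
proof -
 obtain C M where CM: "!!phi. phi:test_fun ==> cmod (u phi) <= C*(SUM k<=M. bnd ((vderiv ^^ k) phi))"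
  using distribution_bound[OF u] by blast
 let ?S = "%N. trig (FC phi) (sym_int N)"
 define r where "r N x = phi x + (- 1)*?S N x" for N x
 have St: "?S N:test_fun" and Sd: "(vderiv ^^ k) (?S N) = trig (FC ((vderiv ^^ k) phi)) (sym_int N)" for N k
  using test_trig[of "sym_int N" "FC phi" k] by (auto simp: FC_vderiv_pow[OF t, abs_def] FC_vderiv_pow[OF t])
 have mt: "(%x. (- 1)*?S N x):test_fun" for N by (rule test_scale(1)[OF St])
 have rt: "r N:test_fun" for N unfolding r_def[abs_def] by (rule test_add(1)[OF t mt])
 have rd: "(vderiv ^^ k) (r N) = (%x. (vderiv ^^ k) phi x - trig (FC ((vderiv ^^ k) phi)) (sym_int N) x)" for N k
  unfolding r_def[abs_def] test_add(2)[OF t mt] test_scale(2)[OF St] Sd by simp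
 have b: "(%N. bnd ((vderiv ^^ k) (r N))) ----> 0" for k
 proof (rule LIMSEQ_I)
  fix e :: real assume e: "e > 0"
  obtain N0 where N0: "ALL N>=N0. ALL x. cmod ((vderiv ^^ k) phi x - trig (FC ((vderiv ^^ k) phi)) (sym_int N) x) <= e/2"
   using test_uniform[OF test_vderiv_pow[OF t], of "e/2" k] e by auto
  have "norm (bnd ((vderiv ^^ k) (r N)) - 0) < e" if "N >= N0" for N
   using bnd_le[of "(vderiv ^^ k) (r N)" "e/2"] N0 that e bnd_nonneg[OF test_vderiv_pow[OF rt, of k N]] by (simp add: rd)
  thus "EX N0. ALL N>=N0. norm (bnd ((vderiv ^^ k) (r N)) - 0) < e" by blast
 qed
 have "(%N. u (r N)) ----> 0"
 proof (rule Lim_null_comparison)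
  show "EV N. norm (u (r N)) <= C*(SUM k<=M. bnd ((vderiv ^^ k) (r N)))" using CM[OF rt] by simp
  have "(%N. C*(SUM k<=M. bnd ((vderiv ^^ k) (r N)))) ----> C*(SUM k<=M. 0)" by (intro tendsto_intros b)
  thus "(%N. C*(SUM k<=M. bnd ((vderiv ^^ k) (r N)))) ----> 0" by simp
 qed
 moreover have "u (r N) = u phi - (SUM n:sym_int N. FC phi n*u (tch n))" for N
  unfolding r_def[abs_def] distribution_add[OF u t mt] distribution_scale[OF u St] by (simp add: distribution_trig[OF u])
 ultimately have "(%N. u phi - (SUM n:sym_int N. FC phi n*u (tch n))) ----> 0" by simp
 from tendsto_diff[OF tendsto_const[of "u phi"] this] show ?thesis by simp
qed

lemma fourier_tch: "fourier u n = u (tch (- n))/(2 * of_real pi)"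
 by (simp add: fourier_def tch_def[abs_def])

theorem distribution_eq:
 assumes u: "u:distribution" and v: "v:distribution" and f: "!!n. fourier u n = fourier v n"
 shows "u = v"
proof
 fix phi show "u phi = v phi"
 proof (cases "phi:test_fun")
  case True
  have "u (tch n) = v (tch n)" for n using f[of "- n"] by (simp add: fourier_tch)
  thus ?thesis using distribution_series[OF u True] distribution_series[OF v True] LIMSEQ_unique by fastforce
 qed (simp add: distribution_outside u v)
qed

lemma distr_of_tch: "distr_of f (tch n) = (LINT x|torus. f x*tch n x)" by (simp add: distr_of_def test_tch)

lemma fourier_distr_of: "fourier (distr_of f) n = FC f n" by (simp add: fourier_tch distr_of_tch FC_eq)

lemma distr_of_distribution: assumes f: "f:L2" shows "distr_of f:distribution"
 unfolding distribution_def
proof (intro CollectI conjI ballI allI impI)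
 fix phi psi assume t: "phi:test_fun" "psi:test_fun"
 have "integrable torus (%x. f x*phi x)" "integrable torus (%x. f x*psi x)" using t f by (auto intro!: L2_product test_L2)
 thus "distr_of f (%x. phi x + psi x) = distr_of f phi + distr_of f psi"
  using t by (simp add: distr_of_def test_add distrib_left)
next
 fix c phi assume "phi:test_fun"
 moreover have "(LINT x|torus. f x*(c*phi x)) = c*(LINT x|torus. f x*phi x)"
  unfolding mult.left_commute[of "f _" c] by (rule Bochner_Integration.integral_mult_right_zero)
 ultimately show "distr_of f (%x. c*phi x) = c*distr_of f phi" by (simp add: distr_of_def test_scale)
next
 have "cmod (distr_of f phi) <= (LINT x|torus. cmod (f x))*(SUM k<=0. bnd ((vderiv ^^ k) phi))" if t: "phi:test_fun" for phi
 proof -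
  have "cmod (distr_of f phi) <= (LINT x|torus. cmod (f x*phi x))" using t by (simp add: distr_of_def)
  also have "... <= (LINT x|torus. cmod (f x)*bnd phi)"
  proof (rule Bochner_Integration.integral_mono)
   show "integrable torus (%x. cmod (f x*phi x))" by (intro integrable_norm L2_product f test_L2 t)
   show "integrable torus (%x. cmod (f x)*bnd phi)" using L2_integrable[OF f] by simp
   show "cmod (f x*phi x) <= cmod (f x)*bnd phi" for x
    unfolding norm_mult by (intro mult_left_mono bnd_upper t) simp
  qed
  finally show ?thesis by simp
 qed
 thus "EX C N. ALL phi:test_fun. cmod (distr_of f phi) <= C*(SUM k<=N. SUP x. cmod ((vderiv ^^ k) phi x))"
  unfolding bnd_def by blast
qed (simp add: distr_of_def)

lemma distr_deriv_distribution: assumes u: "u:distribution" shows "distr_deriv u:distribution"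
 unfolding distribution_def
proof (intro CollectI conjI ballI allI impI)
 have v: "vderiv (%x. phi x + psi x) = (%x. vderiv phi x + vderiv psi x)" if "phi:test_fun" "psi:test_fun" for phi psi
  using test_add(2)[OF that, of 1] by simp
 fix phi psi assume t: "phi:test_fun" "psi:test_fun"
 thus "distr_deriv u (%x. phi x + psi x) = distr_deriv u phi + distr_deriv u psi"
  by (simp add: distr_deriv_def test_add v distribution_add[OF u] test_vderiv)
next
 fix c phi assume t: "phi:test_fun"
 have "vderiv (%x. c*phi x) = (%x. c * vderiv phi x)" using test_scale(2)[OF t, of 1 c] by simp
 thus "distr_deriv u (%x. c*phi x) = c*distr_deriv u phi"
  using t by (simp add: distr_deriv_def test_scale distribution_scale[OF u] test_vderiv)
next
 obtain C M where CM: "!!phi. phi:test_fun ==> cmod (u phi) <= C*(SUM k<=M. bnd ((vderiv ^^ k) phi))"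
  using distribution_bound[OF u] by blast
 have "cmod (distr_deriv u phi) <= \<bar>C\<bar>*(SUM k<=Suc M. bnd ((vderiv ^^ k) phi))" if t: "phi:test_fun" for phi
 proof -
  have n: "bnd ((vderiv ^^ k) phi) >= 0" for k by (intro bnd_nonneg test_vderiv_pow t)
  have "cmod (distr_deriv u phi) <= C*(SUM k<=M. bnd ((vderiv ^^ k) (vderiv phi)))"
   using CM[OF test_vderiv[OF t]] t by (simp add: distr_deriv_def)
  also have "... = C*(SUM k<=M. bnd ((vderiv ^^ Suc k) phi))" by (simp only: funpow_Suc_right o_def)
  also have "... <= \<bar>C\<bar>*(SUM k<=M. bnd ((vderiv ^^ Suc k) phi))" by (intro mult_right_mono sum_nonneg n) auto
  also have "... <= \<bar>C\<bar>*(SUM k<=Suc M. bnd ((vderiv ^^ k) phi))"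
   using n[of 0] unfolding sum.atMost_Suc_shift by (intro mult_left_mono) auto
  finally show ?thesis .
 qed
 thus "EX C N. ALL phi:test_fun. cmod (distr_deriv u phi) <= C*(SUM k<=N. SUP x. cmod ((vderiv ^^ k) phi x))"
  unfolding bnd_def by blast
qed (simp add: distr_deriv_def)

lemma fourier_distr_deriv: assumes "u:distribution" shows "fourier (distr_deriv u) n = \<i> * of_int n*fourier u n"
proof -
 have "vderiv (tch (- n)) = (%x. (\<i> * of_int (- n))*tch (- n) x)" using test_tch(2)[of 1 "- n"] by simp
 hence "distr_deriv u (tch (- n)) = - ((\<i> * of_int (- n))*u (tch (- n)))"
  by (simp only: distr_deriv_def test_tch if_True distribution_scale[OF assms test_tch(1)])
 thus ?thesis by (simp add: fourier_tch)
qed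

text \<open>The pairing of distributions is bilinear, without conjugation; hence the coefficient of
  index -n and the factor 2 pi.\<close>

definition of_coeffs :: "(int => complex) => (real => complex) => complex" where
 "of_coeffs c phi = (if phi:test_fun then 2 * of_real pi*(INFSUM n. c n*FC phi (- n)) else 0)"

text \<open>Growth of order 1/2 is what the negative Sobolev spaces with s < 1/2 allow; against the
  quadratic decay of test coefficients it leaves the summable power -3/2.\<close>

lemma of_coeffs:
 assumes c: "!!n. cmod (c n) <= A*jap n powr (1/2)"
 shows "of_coeffs c:distribution" "fourier (of_coeffs c) n = c n"
proof -
 have A: "A >= 0" using order_trans[OF norm_ge_zero c[of 0]] by (simp add: jap_def)
 have b: "cmod (c n*FC phi (- n)) <= A*D2 phi*jap n powr (- (3/2))" if t: "phi:test_fun" for phi n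
 proof -
  have "cmod (FC phi (- n)) <= D2 phi*jap n powr (- 2)"
   using FC_decay[OF t, of "- n"] jap_ge_1[of n] by (simp add: powr_minus powr_numeral divide_inverse jap_def)
  hence "cmod (c n)*cmod (FC phi (- n)) <= A*jap n powr (1/2)*(D2 phi*jap n powr (- 2))"
   using A by (intro mult_mono c) auto
  also have "... = A*D2 phi*(jap n powr (1/2)*jap n powr (- 2))" by simp
  also have "jap n powr (1/2)*jap n powr (- 2) = jap n powr (- (3/2))" by (simp add: powr_add[symmetric])
  finally show ?thesis by (simp add: norm_mult)
 qed
 have Js: "(%n. jap n powr (- (3/2))) summable_on UNIV" by (rule jap_summable) simp
 have sn: "(%n. cmod (c n*FC phi (- n))) summable_on UNIV" if t: "phi:test_fun" for phi
  by (rule summable_on_le[OF summable_on_cmult_right[OF Js, of "A*D2 phi"]]) (use b[OF t] in auto)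
 have s: "(%n. c n*FC phi (- n)) summable_on UNIV" if t: "phi:test_fun" for phi
  by (rule abs_summable_summable[OF sn[OF t]])
 define J where "J = (INFSUM n. jap n powr (- (3/2)))"
 show "of_coeffs c:distribution"
  unfolding distribution_def
 proof (intro CollectI conjI ballI allI impI)
  fix phi psi assume t: "phi:test_fun" "psi:test_fun"
  have "(INFSUM n. c n*FC phi (- n) + c n*FC psi (- n)) = (INFSUM n. c n*FC phi (- n)) + (INFSUM n. c n*FC psi (- n))"
   by (intro infsum_add s t)
  thus "of_coeffs c (%x. phi x + psi x) = of_coeffs c phi + of_coeffs c psi"
   using t by (simp add: of_coeffs_def test_add FC_add test_L2 distrib_left)
 next
  fix d phi assume t: "phi:test_fun"
  have "(INFSUM n. c n*(d*FC phi (- n))) = d*(INFSUM n. c n*FC phi (- n))"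
   by (subst infsum_cmult_right'[symmetric]) (simp add: mult_ac)
  thus "of_coeffs c (%x. d*phi x) = d * of_coeffs c phi"
   using t by (simp add: of_coeffs_def test_scale FC_scale)
 next
  have "cmod (of_coeffs c phi) <= 2*pi*A*J*(SUM k<=2. bnd ((vderiv ^^ k) phi))" if t: "phi:test_fun" for phi
  proof -
   have J0: "J >= 0" unfolding J_def by (intro infsum_nonneg) simp
   have D: "D2 phi <= (SUM k<=2. bnd ((vderiv ^^ k) phi))"
    using bnd_nonneg[OF test_vderiv[OF t]] by (simp add: D2_def numeral_2_eq_2)
   have "cmod (INFSUM n. c n*FC phi (- n)) <= (INFSUM n. cmod (c n*FC phi (- n)))" by (rule norm_infsum_bound) (rule sn[OF t])
   also have "... <= (INFSUM n. A*D2 phi*jap n powr (- (3/2)))"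
    by (intro infsum_mono sn t b summable_on_cmult_right Js)
   also have "... = A*D2 phi*J" unfolding J_def by (rule infsum_cmult_right')
   also have "... <= A*(SUM k<=2. bnd ((vderiv ^^ k) phi))*J" by (intro mult_right_mono mult_left_mono D A J0)
   finally have "2*pi*cmod (INFSUM n. c n*FC phi (- n)) <= 2*pi*(A*(SUM k<=2. bnd ((vderiv ^^ k) phi))*J)" by simp
   thus ?thesis using t by (simp add: of_coeffs_def norm_mult mult_ac)
  qed
  thus "EX C N. ALL phi:test_fun. cmod (of_coeffs c phi) <= C*(SUM k<=N. SUP x. cmod ((vderiv ^^ k) phi x))"
   unfolding bnd_def by blast
 qed (simp add: of_coeffs_def)
 have "(INFSUM m. c m*FC (tch (- n)) (- m)) = c n" unfolding FC_tch
  by (rule infsumI, rule has_sum_finite_neutralI[of "{n}"]) auto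
 thus "fourier (of_coeffs c) n = c n" by (simp add: fourier_tch of_coeffs_def test_tch)
qed

lemma real_valued_fourier: assumes "u:distribution" "real_valued u" shows "fourier u (- n) = cnj (fourier u n)"
proof -
 have "u (%x. cnj (tch (- n) x)) = cnj (u (tch (- n)))" using assms(2) test_tch by (simp add: real_valued_def)
 thus ?thesis by (simp add: fourier_tch cnj_tch)
qed

lemma real_valued_of_fourier: assumes u: "u:distribution" and f: "!!n. fourier u (- n) = cnj (fourier u n)" shows "real_valued u"
 unfolding real_valued_def
proof
 fix phi assume t: "phi:test_fun"
 have ut: "u (tch (- n)) = cnj (u (tch n))" for n using f[of "- n"] by (simp add: fourier_tch)
 have FCc: "FC (%x. cnj (phi x)) n = cnj (FC phi (- n))" for n
  unfolding FC_def inner2_def by (simp add: Bochner_Integration.integral_cnj[symmetric] cnj_tch del: Bochner_Integration.integral_cnj)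
 have "(%N. cnj (SUM n:sym_int N. FC phi n*u (tch n))) ----> cnj (u phi)"
  by (intro tendsto_intros distribution_series u t)
 moreover have "cnj (SUM n:sym_int N. FC phi n*u (tch n)) = (SUM n:sym_int N. FC (%x. cnj (phi x)) n*u (tch n))" for N
 proof -
  have "(SUM n:sym_int N. FC (%x. cnj (phi x)) n*u (tch n)) = (SUM n:sym_int N. cnj (FC phi (- n)*u (tch (- n))))"
   by (simp add: FCc ut)
  also have "... = (SUM n:sym_int N. cnj (FC phi n*u (tch n)))"
   by (rule sum.reindex_bij_witness[of _ uminus uminus]) (auto simp: sym_int_def)
  finally show ?thesis by simp
 qed
 ultimately have "(%N. SUM n:sym_int N. FC (%x. cnj (phi x)) n*u (tch n)) ----> cnj (u phi)" by simp
 thus "u (%x. cnj (phi x)) = cnj (u phi)"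
  using distribution_series[OF u test_cnj(1)[OF t]] LIMSEQ_unique by blast
qed

section \<open>The Lax operator in Fourier coordinates\<close>

definition fcn :: "(real => complex) => nat => complex" where "fcn f k = FC f (int k)"
definition emb :: "cseq => int => complex" where "emb F n = (if n >= 0 then F (nat n) else 0)"

lemma infsum_int_nonneg:
 fixes a :: "int => 'b::{topological_comm_monoid_add, t2_space}"
 assumes "!!n. n < 0 ==> a n = 0"
 shows "infsum a UNIV = infsum (%k. a (int k)) UNIV" "a summable_on UNIV <-> (%k. a (int k)) summable_on UNIV"
proof -
 have z: "a n = 0" if "n ~: range int" for n
  using assms that by (metis nonneg_int_cases not_le rangeI)
 have "infsum a UNIV = infsum a (range int)" by (rule infsum_cong_neutral) (use z in auto)
 thus "infsum a UNIV = infsum (%k. a (int k)) UNIV" by (subst (asm) infsum_reindex) (auto simp: o_def)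
 have "a summable_on UNIV <-> a summable_on range int" by (rule summable_on_cong_neutral) (use z in auto)
 thus "a summable_on UNIV <-> (%k. a (int k)) summable_on UNIV" by (subst (asm) summable_on_reindex) (auto simp: o_def)
qed

lemma ell2_emb: "ell2 (emb F) <-> ell2 F"
 unfolding ell2_def by (subst infsum_int_nonneg(2)) (auto simp: emb_def)

lemma emb_simps [simp]: "emb F (int k) = F k" by (simp add: emb_def)

lemma ip_int: "(!!n. n < 0 ==> a n = 0 \<or> b n = 0) ==> ip a b = ip (%k. a (int k)) (%k. b (int k))"
 unfolding ip_def by (rule infsum_int_nonneg(1)) auto

lemma hardy_iff: "f:hardy <-> f:L2 \<and> (ALL n<0. FC f n = 0)" by (simp add: hardy_def fourier_distr_of)

lemma hardy_FC: "f:hardy ==> FC f = emb (fcn f)"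
 by (auto simp: hardy_iff emb_def fcn_def fun_eq_iff)

lemma hardy_L2: "f:hardy ==> f:L2" by (simp add: hardy_def)

lemma fcn_ell2: "f:L2 ==> ell2 (fcn f)"
proof -
 assume "f:L2"
 hence "(%n. sqn (FC f n)) summable_on range int"
  using FC_ell2 unfolding ell2_def by (blast intro: summable_on_subset_banach)
 thus ?thesis by (simp add: summable_on_reindex o_def ell2_def fcn_def)
qed

lemma hardy_ip: "f:hardy ==> g:L2 ==> inner2 f g = ip (fcn f) (fcn g)"
 unfolding fcn_def by (subst torus_parseval) (auto simp: hardy_iff intro: ip_int)

lemma hardy_ex: assumes "ell2 F" shows "EX f:hardy. fcn f = F"
proof -
 obtain f where "f:L2" "!!n. FC f n = emb F n" using riesz_fischer[of "emb F"] assms ell2_emb by metis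
 thus ?thesis by (intro bexI[of _ f]) (auto simp: hardy_iff fcn_def emb_def)
qed

lemma hardy_null: assumes "f:hardy" shows "(AE x in torus. f x = 0) <-> fcn f = (%k. 0)"
proof
 assume "AE x in torus. f x = 0"
 hence "FC f n = FC (%x. 0) n" for n by (intro FC_cong_AE) (use assms hardy_L2 in auto)
 thus "fcn f = (%k. 0)" by (simp add: fcn_def FC_eq fun_eq_iff)
next
 assume "fcn f = (%k. 0)"
 thus "AE x in torus. f x = 0"
  using hardy_FC[OF assms] by (intro null_coefficients hardy_L2 assms) (auto simp: emb_def)
qed

lemma hardy1_iff: "f:hardy1 <-> f:hardy \<and> (%n. (jap n)^2 * sqn (FC f n)) summable_on UNIV"
proof -
 have "jap n powr (2*1) = (jap n)^2" for n using jap_ge_1[of n] by (simp add: powr_numeral)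
 thus ?thesis
  by (auto simp: hardy1_def sobolev_def fourier_distr_of intro: distr_of_distribution hardy_L2)
qed

lemma hardy1I: assumes f: "f:hardy" and e: "ell2 (%k. of_nat (Suc k)*fcn f k)" shows "f:hardy1"
 unfolding hardy1_iff
proof
 have "ell2 (emb (%k. of_nat (Suc k)*fcn f k))" using e by (simp add: ell2_emb)
 hence "(%n. sqn (emb (%k. of_nat (Suc k)*fcn f k) n)) summable_on UNIV" by (simp only: ell2_def)
 thus "(%n. (jap n)^2 * sqn (FC f n)) summable_on UNIV"
 proof (rule summable_on_le)
  fix n :: int
  have "jap n <= real (Suc (nat n))" if "n >= 0" using that by (simp add: jap_def)
  hence "(jap n)^2 * sqn (fcn f (nat n)) <= (real (Suc (nat n)))^2 * sqn (fcn f (nat n))" if "n >= 0"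
   using that jap_ge_1[of n] by (intro mult_right_mono power_mono) auto
  thus "(jap n)^2 * sqn (FC f n) <= sqn (emb (%k. of_nat (Suc k)*fcn f k) n)"
   unfolding hardy_FC[OF f] by (auto simp: emb_def norm_mult power_mult_distrib simp del: of_nat_Suc)
 qed simp
qed (rule f)

text \<open>The coefficients are absolutely summable. Boundedness makes the product with a square
  integrable potential square integrable, so the projection acts on it.\<close>

lemma hardy1_bounded: assumes f: "f:hardy1" shows "EX C. AE x in torus. cmod (f x) <= C"
proof -
 have fL: "f:L2" using f by (auto simp: hardy1_iff intro: hardy_L2)
 have "(%n. jap n*cmod (FC f n)*jap n powr (- 1)) summable_on UNIV"
 proof (rule cauchy_schwarz_infsum(1))
  show "(%n. (jap n*cmod (FC f n))^2) summable_on UNIV" using f by (simp add: hardy1_iff power_mult_distrib)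
  have "(jap n powr (- 1))^2 = jap n powr (- 2)" for n by (simp only: power2_eq_square powr_add[symmetric]) simp
  thus "(%n. (jap n powr (- 1))^2) summable_on UNIV" using jap_summable[of 2] by simp
 qed (use order_trans[OF zero_le_one jap_ge_1] in auto)
 moreover have "jap n*cmod (FC f n)*jap n powr (- 1) = cmod (FC f n)" for n
  using jap_ge_1[of n] by (simp add: powr_minus)
 ultimately have "(%n. cmod (FC f n)) summable_on UNIV" by simp
 then obtain g where g: "continuous_on UNIV g" "g:L2" "!!n. FC g n = FC f n"
  by (rule absolutely_convergent_series) blast
 have "compact (g ` {0..2*pi})" by (intro compact_continuous_image continuous_on_subset[OF g(1)]) auto
 then obtain C where C: "ALL x:{0..2*pi}. cmod (g x) <= C"
  using compact_imp_bounded[of "g ` {0..2*pi}"] unfolding bounded_iff ball_simps by blast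
 have "AE x in torus. f x = g x" by (rule FC_eq_AE) (use fL g in auto)
 moreover have "AE x in torus. x:space torus" by simp
 ultimately have "AE x in torus. cmod (f x) <= C" by eventually_elim (use C in "auto simp: space_torus")
 thus ?thesis by blast
qed

text \<open>Riesz-Fischer provides a candidate with the right coefficients, and distributions with
  equal coefficients are equal; so the choice in the definition succeeds.\<close>

lemma weak_deriv: assumes f: "f:hardy1" shows "weak_deriv f:L2" "FC (weak_deriv f) n = \<i> * of_int n*FC f n"
proof -
 have fL: "f:L2" using f by (auto simp: hardy1_iff intro: hardy_L2)
 have "ell2 (%n. \<i> * of_int n*FC f n)"
 proof (unfold ell2_def, rule summable_on_le)
  show "(%n. (jap n)^2 * sqn (FC f n)) summable_on UNIV" using f by (simp add: hardy1_iff)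
  fix n :: int
  have "(of_int n)^2 <= (jap n)^2" by (rule abs_le_square_iff[THEN iffD1]) (simp add: jap_def)
  thus "sqn (\<i> * of_int n*FC f n) <= (jap n)^2 * sqn (FC f n)"
   by (simp add: norm_mult power_mult_distrib mult_right_mono)
 qed simp
 then obtain h where h: "h:L2" "!!n. FC h n = \<i> * of_int n*FC f n" by (rule riesz_fischer) blast
 have dd: "distr_of f:distribution" by (rule distr_of_distribution[OF fL])
 have "distr_of h = distr_deriv (distr_of f)"
  by (rule distribution_eq[OF distr_of_distribution[OF h(1)] distr_deriv_distribution[OF dd]])
   (simp add: fourier_distr_deriv[OF dd] fourier_distr_of h)
 hence "EX h. h:L2 \<and> distr_of h = distr_deriv (distr_of f)" using h(1) by blast
 hence w: "weak_deriv f:L2 \<and> distr_of (weak_deriv f) = distr_deriv (distr_of f)"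
  unfolding weak_deriv_def by (rule someI_ex)
 thus "weak_deriv f:L2" by blast
 show "FC (weak_deriv f) n = \<i> * of_int n*FC f n"
  using w fourier_distr_deriv[OF dd, of n] by (metis fourier_distr_of)
qed

lemma szego: assumes h: "h:L2" shows "szego h:hardy" "fcn (szego h) = fcn h"
proof -
 obtain g where g: "g:hardy" "fcn g = fcn h" using hardy_ex[OF fcn_ell2[OF h]] by blast
 have z: "inner2 (%x. h x - g x) k = cnj (ip (fcn k) (%n. fcn h n - fcn g n))" if "k:hardy" "g:hardy" for k g
 proof -
  have "inner2 (%x. h x - g x) k = cnj (inner2 k (%x. h x - g x))" by (rule inner2_commute)
  also have "inner2 k (%x. h x - g x) = ip (fcn k) (fcn (%x. h x - g x))"
   by (rule hardy_ip) (use that h in "auto intro: L2_diff hardy_L2")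
  also have "fcn (%x. h x - g x) = (%n. fcn h n - fcn g n)"
   using that h by (auto simp: fcn_def FC_diff hardy_L2)
  finally show ?thesis .
 qed
 have "inner2 (%x. h x - g x) k = 0" if "k:hardy" for k using z[OF that g(1)] g(2) by (simp add: ip_def)
 hence "EX g. g:hardy \<and> (ALL k:hardy. inner2 (%x. h x - g x) k = 0)" using g(1) by blast
 hence s: "szego h:hardy \<and> (ALL k:hardy. inner2 (%x. h x - szego h x) k = 0)"
  unfolding szego_def by (rule someI_ex)
 thus "szego h:hardy" by blast
 have "fcn h n - fcn (szego h) n = 0" for n
 proof -
  have t: "tch (int n):hardy" by (simp add: hardy_iff FC_tch)
  have "fcn (tch (int n)) = ev n" by (auto simp: fcn_def FC_tch ev_def fun_eq_iff)
  hence "inner2 (%x. h x - szego h x) (tch (int n)) = fcn h n - fcn (szego h) n"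
   using z[OF t, of "szego h"] s by (simp add: ip_ev_left)
  thus ?thesis using s t by simp
 qed
 thus "fcn (szego h) = fcn h" by (simp add: fun_eq_iff)
qed

section \<open>The Lax operator of a square integrable potential\<close>

context
 fixes u :: "real => real" assumes u: "u:L2_r0"
begin

definition pv :: cseq where "pv = fcn (%x. of_real (u x))"

lemma uL2: "(%x. complex_of_real (u x)):L2" using u by (simp add: L2_r0_def)

lemma FC_u_minus: "FC (%x. of_real (u x)) (- n) = cnj (FC (%x. of_real (u x)) n)"
 unfolding FC_def inner2_def
 by (simp add: Bochner_Integration.integral_cnj[symmetric] cnj_tch del: Bochner_Integration.integral_cnj)

lemma pv_0: "pv 0 = 0"
 using u by (simp add: pv_def fcn_def FC_eq L2_r0_def)

lemma pv_ell2: "ell2 pv" unfolding pv_def by (rule fcn_ell2[OF uL2])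

lemma uc_pv: "uc pv n = FC (%x. of_real (u x)) n"
 using pv_0 FC_u_minus[of "- n"] by (auto simp: uc_def pv_def fcn_def not_less)

lemma pot_pv: "0 < s ==> s < 1/2 ==> pot s pv"
 using ell2_hplus[OF pv_0 pv_ell2, of "- s"] by (simp add: pot_def)

lemma toeplitz: assumes f: "f:hardy1" shows "toeplitz u f:hardy" "fcn (toeplitz u f) = cv pv (fcn f)"
proof -
 have fh: "f:hardy" using f by (simp add: hardy1_iff)
 hence fL: "f:L2" by (rule hardy_L2)
 obtain C where C: "AE x in torus. cmod (f x) <= C" using hardy1_bounded[OF f] by blast
 have h: "(%x. of_real (u x)*f x):L2" by (rule L2_mult_bounded[OF uL2 L2_measurable[OF fL] C])
 show "toeplitz u f:hardy" unfolding toeplitz_def by (rule szego(1)[OF h])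
 have "fcn (%x. of_real (u x)*f x) k = cv pv (fcn f) k" for k
 proof -
  have "fcn (%x. of_real (u x)*f x) k = inner2 f (%x. tch (int k) x * of_real (u x))"
   unfolding fcn_def FC_def inner2_def by (simp add: mult_ac)
  also have "... = ip (fcn f) (fcn (%x. tch (int k) x * of_real (u x)))"
   by (rule hardy_ip[OF fh L2_mult_tch[OF uL2]])
  also have "fcn (%x. tch (int k) x * of_real (u x)) = (%l. cnj (tz pv k l))"
   unfolding fcn_def FC_mult_tch using uc_uminus[of pv "int _ - int k"] by (simp add: uc_pv)
  finally show ?thesis by (simp add: ip_def cv_def mult.commute)
 qed
 thus "fcn (toeplitz u f) = cv pv (fcn f)" unfolding toeplitz_def szego(2)[OF h] by blast
qed

text \<open>Equality almost everywhere is equality of Fourier coefficients, and those of negative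
  index vanish on both sides.\<close>

lemma eigenfun_iff:
 "eigenfun u mu f <-> f:hardy1 \<and> fcn f ~= (%k. 0) \<and> (ALL k. of_real (real k - mu)*fcn f k = cv pv (fcn f) k)"
proof (cases "f:hardy1")
 case True
 hence fh: "f:hardy" by (simp add: hardy1_iff)
 note w = weak_deriv[OF True] and t = toeplitz[OF True]
 have tL: "toeplitz u f:L2" by (rule hardy_L2[OF t(1)])
 have e: "lax u f = (%x. - \<i>*weak_deriv f x - toeplitz u f x)" by (simp add: lax_def fun_eq_iff)
 have lL: "lax u f:L2" unfolding e by (intro L2_diff L2_scale w(1) tL)
 have lFC: "FC (lax u f) n = of_int n*FC f n - FC (toeplitz u f) n" for n
  unfolding e FC_diff[OF L2_scale[OF w(1)] tL] FC_scale w(2) by (simp add: mult.assoc)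
 have fL: "(%x. of_real mu*f x):L2" by (intro L2_scale hardy_L2 fh)
 have "(AE x in torus. lax u f x = of_real mu*f x) <-> (ALL n. FC (lax u f) n = FC (%x. of_real mu*f x) n)"
  using FC_eq_AE[OF lL fL] FC_cong_AE[OF lL fL] by blast
 also have "... <-> (ALL n. (of_int n - of_real mu)*emb (fcn f) n = emb (cv pv (fcn f)) n)"
  unfolding lFC FC_scale hardy_FC[OF fh] hardy_FC[OF t(1)] t(2) by (auto simp: algebra_simps)
 also have "... <-> (ALL k. of_real (real k - mu)*fcn f k = cv pv (fcn f) k)"
 proof
  assume a: "ALL n. (of_int n - of_real mu)*emb (fcn f) n = emb (cv pv (fcn f)) n"
  show "ALL k. of_real (real k - mu)*fcn f k = cv pv (fcn f) k"
  proof
   fix k show "of_real (real k - mu)*fcn f k = cv pv (fcn f) k" using a[rule_format, of "int k"] by simp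
  qed
 next
  assume a: "ALL k. of_real (real k - mu)*fcn f k = cv pv (fcn f) k"
  show "ALL n. (of_int n - of_real mu)*emb (fcn f) n = emb (cv pv (fcn f)) n"
  proof
   fix n :: int
   show "(of_int n - of_real mu)*emb (fcn f) n = emb (cv pv (fcn f)) n"
   proof (cases "n >= 0")
    case True thus ?thesis using a[rule_format, of "nat n"] by (simp add: emb_def)
   qed (simp add: emb_def)
  qed
 qed
 finally show ?thesis using True by (simp add: eigenfun_def hardy_null[OF fh])
qed (simp add: eigenfun_def)

lemma eigenfun_epair: "eigenfun u mu f ==> epair pv mu (fcn f) \<and> nsq (fcn f) ~= 0"
proof -
 assume e: "eigenfun u mu f"
 hence l: "ell2 (fcn f)" by (intro fcn_ell2 hardy_L2) (simp add: eigenfun_def hardy1_iff)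
 have "epair pv mu (fcn f)" using e epair_iff_coord[OF pot_pv[of "1/4"] pv_ell2 l] by (simp add: eigenfun_iff)
 moreover have "nsq (fcn f) ~= 0" using nsq_eq_0[OF l] e by (auto simp: eigenfun_iff fun_eq_iff)
 ultimately show ?thesis by blast
qed

text \<open>\<open>regularity\<close> supplies the full derivative demanded by
  \<open>hardy1\<close>.\<close>

lemma epair_eigenfun: assumes e: "epair pv mu F" and F: "nsq F ~= 0" shows "EX f:hardy. fcn f = F \<and> eigenfun u mu f"
proof -
 have l: "ell2 F" using e by (auto simp: epair_def intro: hs_ell2)
 have c: "of_real (real k - mu)*F k = cv pv F k" for k
  using e epair_iff_coord[OF pot_pv[of "1/4"] pv_ell2 l] by simp
 obtain f where f: "f:hardy" "fcn f = F" using hardy_ex[OF l] by blast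
 have "f:hardy1" by (rule hardy1I[OF f(1)]) (use regularity(1)[OF pv_ell2 l c] f(2) in simp)
 moreover have "F ~= (%k. 0)" using F by (auto simp: nsq_def)
 ultimately have "eigenfun u mu f" using f(2) c by (simp add: eigenfun_iff)
 thus ?thesis using f by blast
qed

text \<open>A square integrable potential lies in all negative spaces; 1/4 is one admissible
  exponent.\<close>

interpretation n: nspectral "1/4" pv "emu pv" "efn pv" by (rule nspectral_chosen[OF pot_pv]) auto

lemma emu_mono: "strict_mono (emu pv)"
 by (rule strict_mono_Suc_iff[THEN iffD2]) (use n.gap in "smt (verit)")

lemma lam_emu: "lam u = emu pv"
 unfolding lam_def
proof (rule the_equality)
 have "{mu. EX f. eigenfun u mu f} = range (emu pv)"
 proof (intro equalityI subsetI)
  fix mu assume "mu:{mu. EX f. eigenfun u mu f}"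
  then obtain f where "epair pv mu (fcn f)" "nsq (fcn f) ~= 0" using eigenfun_epair by blast
  then obtain k where "mu = emu pv k" by (rule n.epair_unique)
  thus "mu:range (emu pv)" by simp
 next
  fix mu assume "mu:range (emu pv)"
  then obtain k where k: "mu = emu pv k" by blast
  thus "mu:{mu. EX f. eigenfun u mu f}" using epair_eigenfun[OF n.epF[of k]] n.nsqF[of k] by auto
 qed
 thus *: "strict_mono (emu pv) \<and> range (emu pv) = {mu. EX f. eigenfun u mu f}" using emu_mono by simp
 fix l :: "nat => real" assume "strict_mono l \<and> range l = {mu. EX f. eigenfun u mu f}"
 thus "l = emu pv" using * strict_mono_range_eq[of l "emu pv"] by simp
qed

lemma fcn_mult_tch: "f:hardy ==> fcn (%x. exp (\<i> * of_real x)*f x) = sh (fcn f)"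
proof
 fix k assume f: "f:hardy"
 have e: "(%x. exp (\<i> * of_real x)*f x) = (%x. tch 1 x*f x)" by (simp add: tch_def)
 show "fcn (%x. exp (\<i> * of_real x)*f x) k = sh (fcn f) k"
  unfolding fcn_def e FC_mult_tch using f by (cases k) (auto simp: hardy_iff fcn_def)
qed

lemma inner2_shift: "f:hardy ==> g:hardy ==> inner2 g (%x. exp (\<i> * of_real x)*f x) = ip (fcn g) (sh (fcn f))"
 using hardy_ip[of g "%x. exp (\<i> * of_real x)*f x"] L2_mult_tch[of f 1] fcn_mult_tch[of f]
 by (simp add: tch_def hardy_L2)

lemma inner2_one: "f:hardy ==> inner2 (%x. 1) f = ip (ev 0) (fcn f)"
proof -
 assume f: "f:hardy"
 have e: "(%x. 1) = tch 0" by auto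
 have "tch 0:hardy" by (simp add: hardy_iff FC_tch)
 moreover have "fcn (tch 0) = ev 0" by (auto simp: fcn_def FC_tch ev_def fun_eq_iff)
 ultimately show ?thesis unfolding e using hardy_ip[of "tch 0" f] hardy_L2[OF f] by simp
qed

text \<open>Makes the choice in \<open>efun\<close> harmless: every normalised eigenbasis has the
  same Fourier coefficients.\<close>

lemma normalized_fcn: assumes b: "normalized_eigenbasis u f" shows "fcn (f n) = efn pv n"
proof -
 have e: "eigenfun u (emu pv n) (f n)" for n using b by (simp add: normalized_eigenbasis_def lam_emu)
 have fh: "f n:hardy" for n using e[of n] by (simp add: eigenfun_def hardy1_iff)
 have on: "ip (fcn (f m)) (fcn (f n)) = (if m = n then 1 else 0)" for m n
  using b hardy_ip[OF fh hardy_L2[OF fh], of m n] by (simp add: normalized_eigenbasis_def)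
 have "(%n. fcn (f n)) = efn pv"
 proof (rule n.identify(2)[of "emu pv"])
  show "epair pv (emu pv n) (fcn (f n))" for n using eigenfun_epair[OF e] by blast
  show "nsq (fcn (f n)) = 1" for n using on[of n n] by (simp add: ip_self)
  show "strict_mono (emu pv)" by (rule emu_mono)
  show "EX n. ip (efn pv m) (fcn (f n)) ~= 0" for m
  proof (rule ccontr)
   assume a: "\<not> ?thesis"
   obtain h where h: "h:hardy" "fcn h = efn pv m" using hardy_ex[OF n.l2F[of m]] by blast
   have "inner2 h (f n) = 0" for n using a hardy_ip[OF h(1) hardy_L2[OF fh]] h(2) by simp
   hence "AE x in torus. h x = 0" using b h(1) by (simp add: normalized_eigenbasis_def)
   hence "efn pv m = (%k. 0)" using hardy_null[OF h(1)] h(2) by simp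
   thus False using n.nsqF[of m] by (simp add: nsq_def)
  qed
  show "nnr (ip (ev 0) (fcn (f 0)))"
   using b inner2_one[OF fh[of 0]] by (simp add: normalized_eigenbasis_def pos_complex_nnr)
  show "nnr (ip (fcn (f (Suc n))) (sh (fcn (f n))))" for n
  proof -
   have "pos_complex (inner2 (f (Suc n)) (%x. exp (\<i> * of_real x)*f (Suc n - 1) x))"
    using b unfolding normalized_eigenbasis_def by (metis Suc_eq_plus1 le_add2)
   thus ?thesis using inner2_shift[OF fh[of n] fh[of "Suc n"]] by (simp add: pos_complex_nnr)
  qed
 qed
 thus ?thesis by (simp add: fun_eq_iff)
qed

lemma normalized_ex: "EX f. normalized_eigenbasis u f"
proof -
 have "ALL n. EX f:hardy. fcn f = efn pv n \<and> eigenfun u (emu pv n) f"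
  using epair_eigenfun[OF n.epF] n.nsqF by simp
 then obtain f where f: "!!n. f n:hardy" "!!n. fcn (f n) = efn pv n" "!!n. eigenfun u (emu pv n) (f n)" by metis
 have nb: "nbasis pv (emu pv) (efn pv)" by (rule n.nb)
 have "normalized_eigenbasis u f"
  unfolding normalized_eigenbasis_def lam_emu
 proof (intro conjI allI ballI impI)
  show "eigenfun u (emu pv n) (f n)" for n by (rule f)
  show "inner2 (f m) (f n) = (if m = n then 1 else 0)" for m n
   using hardy_ip[OF f(1) hardy_L2[OF f(1)]] n.onF by (simp add: f(2))
  show "AE x in torus. h x = 0" if h: "h:hardy" "ALL n. inner2 h (f n) = 0" for h
  proof -
   have "ip (fcn h) (efn pv n) = 0" for n using h(2) hardy_ip[OF h(1) hardy_L2[OF f(1)]] f(2) by simp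
   hence "fcn h k = 0" for k by (rule n.complete[OF fcn_ell2[OF hardy_L2[OF h(1)]]])
   thus ?thesis using hardy_null[OF h(1)] by auto
  qed
  show "pos_complex (inner2 (%x. 1) (f 0))" using inner2_one[OF f(1)] nb by (simp add: f(2) nbasis_def)
  show "pos_complex (inner2 (f n) (%x. exp (\<i> * of_real x)*f (n - 1) x))" if n1: "1 <= n" for n
  proof -
   obtain m where "n = Suc m" using n1 by (cases n) auto
   thus ?thesis using inner2_shift[OF f(1)[of m] f(1)[of n]] nb by (simp add: f(2) nbasis_def)
  qed
 qed
 thus ?thesis by blast
qed

text \<open>\<open>kap\<close> is exactly the constant under the square root in
  \<open>yv_ze\<close>, so the division leaves the polar form \<open>ze\<close>.\<close>

lemma zeta_zet: assumes n: "n >= 1" shows "zeta u n = zet pv n"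
proof -
 have b: "normalized_eigenbasis u (efun u)" unfolding efun_def by (rule someI_ex[OF normalized_ex])
 have h: "efun u n:hardy" using b by (simp add: normalized_eigenbasis_def eigenfun_def hardy1_iff)
 have y: "inner2 (%x. 1) (efun u n) = n.yv n" unfolding inner2_one[OF h] normalized_fcn[OF b] n.yv_def ..
 have k: "kap u n = n.cd.K n/(emu pv n - emu pv 0)"
  unfolding kap_def n.cd.K_def gam_def lam_emu n.cd.g_def by simp
 have "n.cd.K n > 0" using n.cd.K_bounds(1)[OF n.cd.gap_sum, of n] by (meson exp_gt_zero less_le_trans)
 moreover have "emu pv n - emu pv 0 > 0" using emu_mono n by (simp add: strict_mono_less)
 ultimately have p: "kap u n > 0" by (simp add: k)
 have "zeta u n = 1/of_real (sqrt (kap u n))*(of_real (sqrt (kap u n))*n.ze n)"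
  unfolding zeta_def y n.yv_ze[OF n] k ..
 also have "... = n.ze n" using p by simp
 finally show ?thesis by (simp add: n.zet_eq)
qed

lemma birkhoff_zet: "birkhoff u = zet pv"
proof
 fix n show "birkhoff u n = zet pv n"
  using zeta_zet[of n] by (cases "n = 0") (auto simp: birkhoff_def zet_def)
qed

end

section \<open>The Birkhoff map on distributions\<close>

definition sq :: "((real => complex) => complex) => nat => complex" where
 "sq U n = (if n = 0 then 0 else fourier U (int n))"

lemma even_sum:
 fixes f :: "int => real"
 assumes f: "!!n. f (- n) = f n" "f 0 = 0"
 shows "f summable_on UNIV <-> (%n. f (int n)) summable_on {1..}"
  "infsum f UNIV = 2*infsum (%n. f (int n)) {1..}"
proof -
 define A where "A = int ` {1..}"
 define B where "B = (%n. - int n) ` {1..}"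
 have d: "A Int B = {}" by (auto simp: A_def B_def)
 have z: "f n = 0" if "n ~: A Un B" for n
 proof (cases n rule: int_cases3)
  case zero thus ?thesis using f(2) by simp
 next
  case (pos k) thus ?thesis using that by (auto simp: A_def)
 next
  case (neg k) thus ?thesis using that by (auto simp: B_def)
 qed
 have s: "f summable_on A <-> (%n. f (int n)) summable_on {1..}" "f summable_on B <-> (%n. f (int n)) summable_on {1..}"
  unfolding A_def B_def by (auto simp: summable_on_reindex inj_on_def o_def f)
 have i: "infsum f A = infsum (%n. f (int n)) {1..}" "infsum f B = infsum (%n. f (int n)) {1..}"
  unfolding A_def B_def by (auto simp: infsum_reindex inj_on_def o_def f)
 have c: "f summable_on UNIV <-> f summable_on (A Un B)" by (rule summable_on_cong_neutral) (use z in auto)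
 show *: "f summable_on UNIV <-> (%n. f (int n)) summable_on {1..}"
  unfolding c using s summable_on_union[of f A B] summable_on_subset_banach[of f "A Un B" A] by auto
 show "infsum f UNIV = 2*infsum (%n. f (int n)) {1..}"
 proof (cases "f summable_on UNIV")
  case True
  have "infsum f UNIV = infsum f (A Un B)" by (rule infsum_cong_neutral) (use z in auto)
  also have "... = infsum f A + infsum f B" by (rule infsum_Un_disjoint[OF _ _ d]) (use True * s in auto)
  finally show ?thesis by (simp add: i)
 qed (use * in "simp add: infsum_not_exists")
qed

text \<open>Hermitian symmetry doubles every term with positive index, whence the factor
  \<open>sqrt 2\<close>.\<close>

lemma sobolev_sq:
 assumes "!!n. fourier U (- n) = cnj (fourier U n)" "fourier U 0 = 0"
 shows "(%n. jap n powr (2 * sg) * sqn (fourier U n)) summable_on UNIV <-> sq U:hplus sg"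
  "sobolev_norm sg U = sqrt 2 * sqrt (wn sg (sq U))"
proof -
 let ?f = "%n. jap n powr (2 * sg) * sqn (fourier U n)"
 have f: "?f (- n) = ?f n" "?f 0 = 0" for n using assms by (auto simp: jap_def)
 have g: "(%n. ?f (int n)) summable_on {1..} <-> (%n. hw sg (sq U) n) summable_on {1..}"
  "infsum (%n. ?f (int n)) {1..} = wn sg (sq U)"
  unfolding wn_def by (auto intro!: summable_on_cong infsum_cong simp: sq_def jap_def max_def)
 show "?f summable_on UNIV <-> sq U:hplus sg"
  unfolding even_sum(1)[of ?f, OF f] g(1) by (simp add: hplus_def sq_def)
 show "sobolev_norm sg U = sqrt 2 * sqrt (wn sg (sq U))"
  unfolding sobolev_norm_def even_sum(2)[of ?f, OF f] g(2) by (rule real_sqrt_mult)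
qed

lemma sobolev_r0_iff:
 "U:sobolev_r0 sg <-> U:distribution \<and> (ALL n. fourier U (- n) = cnj (fourier U n)) \<and> fourier U 0 = 0 \<and> sq U:hplus sg"
 unfolding sobolev_r0_def sobolev_def
 using real_valued_fourier[of U] real_valued_of_fourier[of U] sobolev_sq(1)[of U sg] by blast

lemma sobolev_r0_D:
 assumes "U:sobolev_r0 sg"
 shows "sq U:hplus sg" "sobolev_norm sg U = sqrt 2 * sqrt (wn sg (sq U))"
 using assms sobolev_sq(2)[of U sg] unfolding sobolev_r0_iff by auto

lemma sobolev_dist_sq:
 assumes "U:sobolev_r0 sg" "V:sobolev_r0 sg"
 shows "sobolev_dist sg U V = sqrt 2*hplus_dist sg (sq U) (sq V)"
proof -
 have f: "fourier (%phi. U phi - V phi) n = fourier U n - fourier V n" for n by (simp add: fourier_def diff_divide_distrib)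
 have "sq (%phi. U phi - V phi) = (%n. sq U n - sq V n)" by (auto simp: sq_def f)
 thus ?thesis
  unfolding sobolev_dist_def hplus_dist_wn using assms by (subst sobolev_sq(2)) (auto simp: f sobolev_r0_iff)
qed

lemma fourier_nonneg_or: obtains k where "n = int k" | k where "n = - int k"
 by (cases n rule: int_cases2) auto

lemma sq_inj: assumes U: "U:sobolev_r0 sg" and V: "V:sobolev_r0 sg" and e: "sq U = sq V" shows "U = V"
proof (rule distribution_eq)
 show "U:distribution" "V:distribution" using U V by (auto simp: sobolev_r0_iff)
 have k: "fourier U (int k) = fourier V (int k)" for k
  using fun_cong[OF e, of k] U V by (cases "k = 0") (auto simp: sq_def sobolev_r0_iff)
 show "fourier U n = fourier V n" for n
  by (rule fourier_nonneg_or[of n]) (use k U V in "auto simp: sobolev_r0_iff")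
qed

lemma sq_surj:
 assumes v: "v:hplus (- s)" and s: "s < 1/2"
 shows "EX U:sobolev_r0 (- s). sq U = v"
proof -
 \<comment> \<open>A single term bounds |v k|^2 by the squared norm times k^(2s), and 2s < 1 gives
   the growth allowed in \<open>of_coeffs\<close>.\<close>
 define A where "A = sqrt (wn (- s) v)"
 have vb: "cmod (v k) <= A*jap (int k) powr (1/2)" for k
 proof (cases "k = 0")
  case True thus ?thesis using hplus_0[OF v] by (simp add: A_def)
 next
  case False
  have p: "real k powr (2*- s)*real k powr (2 * s) = 1" using False by (simp add: powr_add[symmetric])
  have "hw (- s) v k <= wn (- s) v" by (rule wn_coord[OF v])
  hence "hw (- s) v k*real k powr (2 * s) <= wn (- s) v * real k powr (2 * s)" by (rule mult_right_mono) simp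
  hence "sqn (v k) <= wn (- s) v * real k powr (2 * s)" using p by (simp add: mult_ac)
  also have "... <= wn (- s) v * real k powr 1" using False s by (intro mult_left_mono powr_mono) auto
  also have "... = (A*jap (int k) powr (1/2))^2"
   using False by (simp add: A_def power_mult_distrib jap_def max_def powr_half_sqrt)
  finally show ?thesis by (rule power2_le_imp_le) (simp add: A_def)
 qed
 have cb: "cmod (uc v n) <= A*jap n powr (1/2)" for n
 proof (rule fourier_nonneg_or[of n])
  fix k assume "n = int k" thus ?thesis using vb[of k] hplus_0[OF v] uc_of_nat[of v k] by simp
 next
  fix k assume "n = - int k"
  thus ?thesis using vb[of k] hplus_0[OF v] uc_of_nat[of v k] by (simp add: uc_uminus jap_def)
 qed
 note c = of_coeffs[of "uc v", OF cb]
 have "sq (of_coeffs (uc v)) = v"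
  using hplus_0[OF v] uc_of_nat[of v] by (auto simp: sq_def c(2) fun_eq_iff)
 moreover have "of_coeffs (uc v):sobolev_r0 (- s)"
  unfolding sobolev_r0_iff using c calculation v by (auto simp: uc_uminus)
 ultimately show ?thesis by blast
qed

lemma sobolev_metric: "Metric_space (sobolev_r0 sg) (sobolev_dist sg)"
proof -
 interpret h: Metric_space "hplus sg" "hplus_dist sg" by (rule hplus_metric)
 show ?thesis
 proof
  show "0 <= sobolev_dist sg U V" for U V
   unfolding sobolev_dist_def sobolev_norm_def by (intro real_sqrt_ge_zero infsum_nonneg) auto
  show "sobolev_dist sg U V = sobolev_dist sg V U" for U V
   unfolding sobolev_dist_def sobolev_norm_def by (simp add: fourier_def diff_divide_distrib[symmetric] norm_divide norm_minus_commute)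
  fix U V W assume UV: "U:sobolev_r0 sg" "V:sobolev_r0 sg"
  show "sobolev_dist sg U V = 0 <-> U = V"
   using h.zero[OF sobolev_r0_D(1)[OF UV(1)] sobolev_r0_D(1)[OF UV(2)]] sq_inj[OF UV] by (auto simp: sobolev_dist_sq UV)
  assume W: "W:sobolev_r0 sg"
  show "sobolev_dist sg U W <= sobolev_dist sg U V + sobolev_dist sg V W"
   using h.triangle[OF sobolev_r0_D(1)[OF UV(1)] sobolev_r0_D(1)[OF UV(2)] sobolev_r0_D(1)[OF W]]
   by (simp add: sobolev_dist_sq UV W distrib_left[symmetric])
 qed
qed

lemma continuous_map_sequential:
 assumes M: "Metric_space M d" and M': "Metric_space M' d'" and f: "f ` M \<subseteq> M'"
  and seq: "!!x a. (!!j. x j:M) ==> a:M ==> (%j::nat. d (x j) a) ----> 0 ==> (%j. d' (f (x j)) (f a)) ----> 0"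
 shows "continuous_map (Metric_space.mtopology M d) (Metric_space.mtopology M' d') f"
proof -
 interpret Metric_space12 M d M' d' by (intro Metric_space12.intro M M')
 show ?thesis
  unfolding continuous_map_atin limit_atin_sequentially M1.topspace_mtopology
  unfolding M1.limitin_metric_dist_null M2.limitin_metric_dist_null o_def
  using f by (auto intro!: always_eventually seq)
qed

lemma hplus_dist_tendsto: "(%j. hplus_dist sg (x j) a) ----> 0 <-> (%j::nat. wn sg (%n. x j n - a n)) ----> 0"
 unfolding hplus_dist_wn using tendsto_power[of "%j. sqrt (wn sg (%n. x j n - a n))" 0 _ 2] tendsto_real_sqrt[of "%j. wn sg (%n. x j n - a n)" 0] by auto

lemma sobolev_dist_tendsto:
 assumes "a:sobolev_r0 sg" "!!j. x j:sobolev_r0 sg"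
 shows "(%j::nat. sobolev_dist sg (x j) a) ----> 0 <-> (%j. wn sg (%n. sq (x j) n - sq a n)) ----> 0"
 unfolding hplus_dist_tendsto[symmetric] sobolev_dist_sq[OF assms(2,1)] using tendsto_mult_left_iff[of "sqrt 2" _ 0] by simp

lemma mbounded_hplus: "Metric_space.mbounded (hplus sg) (hplus_dist sg) B <-> B \<subseteq> hplus sg \<and> (EX C. ALL z:B. wn sg z <= C)"
proof -
 interpret h: Metric_space "hplus sg" "hplus_dist sg" by (rule hplus_metric)
 have z: "(%n. 0):hplus sg" by (simp add: hplus_def)
 have d: "hplus_dist sg (%n. 0) x = sqrt (wn sg x)" for x by (simp add: hplus_dist_wn wn_def)
 show ?thesis
 proof
  assume "h.mbounded B"
  hence "h.mbounded (insert (%n. 0) B)" using z by (simp add: h.mbounded_insert)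
  then obtain C where B: "B \<subseteq> hplus sg" and C: "!!x. x:B ==> sqrt (wn sg x) <= C"
   unfolding h.mbounded_alt by (auto simp: d)
  thus "B \<subseteq> hplus sg \<and> (EX C. ALL z:B. wn sg z <= C)" using sqrt_le_D[OF C] by blast
 next
  assume B: "B \<subseteq> hplus sg \<and> (EX C. ALL z:B. wn sg z <= C)"
  then obtain C where "ALL z:B. wn sg z <= C" by blast
  hence "ALL x:B. hplus_dist sg (%n. 0) x <= sqrt C" by (simp add: d)
  thus "h.mbounded B" unfolding h.mbounded using B z by blast
 qed
qed

lemma mbounded_sobolev:
 "Metric_space.mbounded (sobolev_r0 sg) (sobolev_dist sg) B <-> B \<subseteq> sobolev_r0 sg \<and> (EX C. ALL U:B. wn sg (sq U) <= C)"
proof -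
 interpret h: Metric_space "hplus sg" "hplus_dist sg" by (rule hplus_metric)
 interpret m: Metric_space "sobolev_r0 sg" "sobolev_dist sg" by (rule sobolev_metric)
 have "(EX C. ALL x:B. ALL y:B. sobolev_dist sg x y <= C) <-> (EX C. ALL x:sq ` B. ALL y:sq ` B. hplus_dist sg x y <= C)" if B: "B \<subseteq> sobolev_r0 sg"
 proof
  assume "EX C. ALL x:B. ALL y:B. sobolev_dist sg x y <= C"
  then obtain C where "ALL x:B. ALL y:B. sqrt 2*hplus_dist sg (sq x) (sq y) <= C" using sobolev_dist_sq B by (metis subsetD)
  hence "ALL x:B. ALL y:B. hplus_dist sg (sq x) (sq y) <= C/sqrt 2" by (simp add: le_divide_eq mult.commute)
  thus "EX C. ALL x:sq ` B. ALL y:sq ` B. hplus_dist sg x y <= C" by blast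
 next
  assume "EX C. ALL x:sq ` B. ALL y:sq ` B. hplus_dist sg x y <= C"
  then obtain C where "ALL x:B. ALL y:B. hplus_dist sg (sq x) (sq y) <= C" by blast
  hence "ALL x:B. ALL y:B. sqrt 2*hplus_dist sg (sq x) (sq y) <= sqrt 2*C" by simp
  thus "EX C. ALL x:B. ALL y:B. sobolev_dist sg x y <= C" using sobolev_dist_sq B by (metis subsetD)
 qed
 moreover have "B \<subseteq> sobolev_r0 sg ==> sq ` B \<subseteq> hplus sg" using sobolev_r0_D(1) by blast
 ultimately have "m.mbounded B <-> B \<subseteq> sobolev_r0 sg \<and> h.mbounded (sq ` B)"
  unfolding m.mbounded_alt h.mbounded_alt by blast
 also have "... <-> B \<subseteq> sobolev_r0 sg \<and> (EX C. ALL U:B. wn sg (sq U) <= C)"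
  unfolding mbounded_hplus ball_simps using sobolev_r0_D(1) by (auto simp: subset_iff)
 finally show ?thesis .
qed

theorem theorem5:
  fixes s :: real
  assumes "0 < s" and "s < 1 / 2"
  shows "\<exists>\<Phi> :: ((real \<Rightarrow> complex) \<Rightarrow> complex) \<Rightarrow> nat \<Rightarrow> complex.
    (\<forall>u\<in>L2_r0. \<Phi> (distr_of (\<lambda>x. of_real (u x))) = birkhoff u) \<and>
    homeomorphic_map
      (Metric_space.mtopology (sobolev_r0 (- s)) (sobolev_dist (- s)))
      (Metric_space.mtopology (hplus (1 / 2 - s)) (hplus_dist (1 / 2 - s))) \<Phi> \<and>
    (\<exists>F :: real \<Rightarrow> real. F ` {0..} \<subseteq> {0..} \<and> strict_mono_on {0..} F \<and>
      (\<forall>u\<in>sobolev_r0 (- s). sobolev_norm (- s) u \<le> F (hplus_norm (1 / 2 - s) (\<Phi> u)))) \<and>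
    (\<forall>B. Metric_space.mbounded (sobolev_r0 (- s)) (sobolev_dist (- s)) B \<longrightarrow>
      Metric_space.mbounded (hplus (1 / 2 - s)) (hplus_dist (1 / 2 - s)) (\<Phi> ` B)) \<and>
    (\<forall>B. Metric_space.mbounded (hplus (1 / 2 - s)) (hplus_dist (1 / 2 - s)) B \<longrightarrow>
      Metric_space.mbounded (sobolev_r0 (- s)) (sobolev_dist (- s))
        (inv_into (sobolev_r0 (- s)) \<Phi> ` B))"
proof -
 note s = assms
 define S where "S = sobolev_r0 (- s)"
 define \<Phi> where "\<Phi> U = zet (sq U)" for U
 have sqh: "sq U:hplus (- s)" if "U:S" for U using sobolev_r0_D(1) that by (simp add: S_def)
 have \<Phi>h: "\<Phi> U:hplus (1/2 - s)" if "U:S" for U unfolding \<Phi>_def by (rule zet_hplus[OF s sqh[OF that]])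
 have inj: "inj_on \<Phi> S"
 proof (rule inj_onI)
  fix U V assume "U:S" "V:S" "\<Phi> U = \<Phi> V"
  hence "sq U = sq V" using zet_inj_on[OF s] sqh by (auto simp: \<Phi>_def dest: inj_onD)
  thus "U = V" using sq_inj \<open>U : S\<close> \<open>V : S\<close> by (auto simp: S_def)
 qed
 have surj: "EX U:S. \<Phi> U = z" if "z:hplus (1/2 - s)" for z
  using zet_surj[OF s that] sq_surj[OF _ s(2)] by (metis \<Phi>_def S_def)
 have img: "\<Phi> ` S = hplus (1/2 - s)" using \<Phi>h surj by blast
 define \<Psi> where "\<Psi> = inv_into S \<Phi>"
 have \<Psi>: "\<Psi> z:S" "\<Phi> (\<Psi> z) = z" if "z:hplus (1/2 - s)" for z
  using that img by (auto simp: \<Psi>_def inv_into_into f_inv_into_f)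
 have ext: "\<Phi> (distr_of (%x. of_real (u x))) = birkhoff u" if u: "u:L2_r0" for u
 proof -
  have "sq (distr_of (%x. of_real (u x))) = pv u"
   using pv_0[OF u] by (auto simp: sq_def fourier_distr_of pv_def[OF u] fcn_def fun_eq_iff)
  thus ?thesis by (simp add: \<Phi>_def birkhoff_zet[OF u])
 qed
 have homeo: "homeomorphic_map (Metric_space.mtopology S (sobolev_dist (- s)))
   (Metric_space.mtopology (hplus (1/2 - s)) (hplus_dist (1/2 - s))) \<Phi>"
  unfolding homeomorphic_map_maps
 proof (rule exI[of _ \<Psi>], unfold homeomorphic_maps_def, intro conjI ballI)
  note mS = sobolev_metric[of "- s", folded S_def] and mH = hplus_metric[of "1/2 - s"]
  show "continuous_map (Metric_space.mtopology S (sobolev_dist (- s))) (Metric_space.mtopology (hplus (1/2 - s)) (hplus_dist (1/2 - s))) \<Phi>"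
  proof (rule continuous_map_sequential[OF mS mH])
   fix x a assume x: "!!j. x j:S" and a: "a:S" and l: "(%j::nat. sobolev_dist (- s) (x j) a) ----> 0"
   hence "(%j. wn (- s) (%n. sq (x j) n - sq a n)) ----> 0" by (simp add: sobolev_dist_tendsto S_def)
   from zet_continuous[OF s, of "%j. sq (x j)" "sq a", OF sqh[OF x] sqh[OF a] this]
   show "(%j. hplus_dist (1/2 - s) (\<Phi> (x j)) (\<Phi> a)) ----> 0" unfolding hplus_dist_tendsto \<Phi>_def .
  qed (use img in simp)
  show "continuous_map (Metric_space.mtopology (hplus (1/2 - s)) (hplus_dist (1/2 - s))) (Metric_space.mtopology S (sobolev_dist (- s))) \<Psi>"
  proof (rule continuous_map_sequential[OF mH mS])
   fix x a assume x: "!!j. x j:hplus (1/2 - s)" and a: "a:hplus (1/2 - s)"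
    and l: "(%j::nat. hplus_dist (1/2 - s) (x j) a) ----> 0"
   have z: "zet (sq (\<Psi> y)) = y" if "y:hplus (1/2 - s)" for y using \<Psi>(2)[OF that] by (simp add: \<Phi>_def)
   have "(%j. wn (1/2 - s) (%n. zet (sq (\<Psi> (x j))) n - zet (sq (\<Psi> a)) n)) ----> 0"
    using l by (simp add: hplus_dist_tendsto z x a)
   from zet_inverse_continuous[OF s, of "%j. sq (\<Psi> (x j))" "sq (\<Psi> a)", OF sqh[OF \<Psi>(1)[OF x]] sqh[OF \<Psi>(1)[OF a]] this]
   show "(%j. sobolev_dist (- s) (\<Psi> (x j)) (\<Psi> a)) ----> 0"
    using \<Psi>(1)[OF a] \<Psi>(1)[OF x] by (simp add: sobolev_dist_tendsto S_def)
  qed (use \<Psi>(1) in blast)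
  show "\<Psi> (\<Phi> x) = x" if "x:topspace (Metric_space.mtopology S (sobolev_dist (- s)))" for x
   using that inv_into_f_f[OF inj] by (simp add: \<Psi>_def Metric_space.topspace_mtopology[OF mS])
  show "\<Phi> (\<Psi> y) = y" if "y:topspace (Metric_space.mtopology (hplus (1/2 - s)) (hplus_dist (1/2 - s)))" for y
   using that \<Psi>(2) by (simp add: Metric_space.topspace_mtopology[OF mH])
 qed
 have norm_bound: "EX C. ALL U:S. hplus_norm (1/2 - s) (\<Phi> U) <= r --> sobolev_norm (- s) U <= C" for r
 proof -
  obtain C where C: "!!v. v:hplus (- s) ==> wn (1/2 - s) (zet v) <= r^2 ==> wn (- s) v <= C" using zet_proper[OF s, of "r^2"] by blast
  have "sobolev_norm (- s) U <= sqrt 2 * sqrt C" if U: "U:S" and r: "hplus_norm (1/2 - s) (\<Phi> U) <= r" for U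
  proof -
   have "(sqrt (wn (1/2 - s) (\<Phi> U)))^2 <= r^2" using r by (intro power_mono) (auto simp: hplus_norm_wn)
   hence "wn (- s) (sq U) <= C" by (intro C sqh U) (simp add: \<Phi>_def)
   thus ?thesis using sobolev_r0_D(2)[of U "- s"] U by (simp add: S_def)
  qed
  thus ?thesis by blast
 qed
 \<comment> \<open>The supremum over a ball is monotone only; the summand \<open>r\<close> makes the
   function strictly increasing.\<close>
 define F where "F r = r + Sup (sobolev_norm (- s) ` {U:S. hplus_norm (1/2 - s) (\<Phi> U) <= r})" for r
 have bdd: "bdd_above (sobolev_norm (- s) ` {U:S. hplus_norm (1/2 - s) (\<Phi> U) <= r})" for r
  using norm_bound[of r] by (auto simp: bdd_above_def)
 \<comment> \<open>The preimage of 0 lies in every ball of nonnegative radius, so the suprema range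
   over nonempty sets.\<close>
 obtain U0 where U0: "U0:S" "\<Phi> U0 = (%n. 0)" using surj[of "%n. 0"] by (auto simp: hplus_def)
 have ne: "U0:{U:S. hplus_norm (1/2 - s) (\<Phi> U) <= r}" if "r >= 0" for r
  using U0 that by (simp add: hplus_norm_def)
 have sn: "sobolev_norm (- s) U >= 0" for U unfolding sobolev_norm_def by (intro real_sqrt_ge_zero infsum_nonneg) auto
 have F0: "F ` {0..} \<subseteq> {0..}"
 proof
  fix y assume "y:F ` {0..}"
  then obtain r where r: "r >= 0" "y = F r" by auto
  have "0 <= Sup (sobolev_norm (- s) ` {U:S. hplus_norm (1/2 - s) (\<Phi> U) <= r})"
   by (rule cSup_upper2[OF imageI[OF ne[OF r(1)]] sn bdd])
  thus "y:{0..}" using r by (simp add: F_def)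
 qed
 have Fm: "strict_mono_on {0..} F"
 proof (rule strict_mono_onI)
  fix r t :: real assume r: "r:{0..}" "r < t"
  have "Sup (sobolev_norm (- s) ` {U:S. hplus_norm (1/2 - s) (\<Phi> U) <= r}) <= Sup (sobolev_norm (- s) ` {U:S. hplus_norm (1/2 - s) (\<Phi> U) <= t})"
   by (rule cSup_subset_mono) (use ne[of r] r bdd in auto)
  thus "F r < F t" using r(2) by (simp add: F_def)
 qed
 have FU: "sobolev_norm (- s) U <= F (hplus_norm (1/2 - s) (\<Phi> U))" if U: "U:S" for U
 proof -
  have "sobolev_norm (- s) U <= Sup (sobolev_norm (- s) ` {V:S. hplus_norm (1/2 - s) (\<Phi> V) <= hplus_norm (1/2 - s) (\<Phi> U)})"
   by (rule cSup_upper[OF _ bdd]) (use U in auto)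
  moreover have "hplus_norm (1/2 - s) (\<Phi> U) >= 0" by (simp add: hplus_norm_wn)
  ultimately show ?thesis by (simp add: F_def)
 qed
 have B1: "Metric_space.mbounded (hplus (1/2 - s)) (hplus_dist (1/2 - s)) (\<Phi> ` B)"
  if B: "Metric_space.mbounded S (sobolev_dist (- s)) B" for B
 proof -
  obtain C where C: "B \<subseteq> S" "!!U. U:B ==> wn (- s) (sq U) <= C"
   using B unfolding S_def mbounded_sobolev by blast
  obtain M where "!!v. v:hplus (- s) ==> wn (- s) v <= C ==> wn (1/2 - s) (zet v) <= M" using zet_bounded[OF s, of C] by blast
  hence "ALL z:\<Phi> ` B. wn (1/2 - s) z <= M" using C sqh by (auto simp: \<Phi>_def)
  thus ?thesis unfolding mbounded_hplus using \<Phi>h C(1) by blast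
 qed
 have B2: "Metric_space.mbounded S (sobolev_dist (- s)) (\<Psi> ` B)"
  if B: "Metric_space.mbounded (hplus (1/2 - s)) (hplus_dist (1/2 - s)) B" for B
 proof -
  obtain C where C: "B \<subseteq> hplus (1/2 - s)" "!!z. z:B ==> wn (1/2 - s) z <= C"
   using B unfolding mbounded_hplus by blast
  obtain M where M: "!!v. v:hplus (- s) ==> wn (1/2 - s) (zet v) <= C ==> wn (- s) v <= M" using zet_proper[OF s, of C] by blast
  have "wn (- s) (sq (\<Psi> z)) <= M" if "z:B" for z
   using \<Psi>[of z] C that by (intro M sqh) (auto simp: \<Phi>_def)
  thus ?thesis unfolding S_def mbounded_sobolev using \<Psi>(1) C(1) unfolding S_def by blast
 qed
 have "F ` {0..} \<subseteq> {0..} \<and> strict_mono_on {0..} F \<and> (ALL U:S. sobolev_norm (- s) U <= F (hplus_norm (1/2 - s) (\<Phi> U)))"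
  using F0 Fm FU by blast
 hence iii: "EX F. F ` {0..} \<subseteq> {0..} \<and> strict_mono_on {0..} F \<and> (ALL U:S. sobolev_norm (- s) U <= F (hplus_norm (1/2 - s) (\<Phi> U)))"
  by (rule exI[of _ F])
 show ?thesis unfolding S_def[symmetric]
  by (rule exI[of _ \<Phi>]) (intro conjI homeo iii ballI allI impI ext B1 B2[unfolded \<Psi>_def])
qed

end
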